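(* Let $(\bar M^{m+n},\bar g)$ be a Riemannian manifold with a rank-$(m+1)$ pre-calibration $\Omega$, and let $\phi:M^m\to\bar M$ be an immersed oriented submanifold with $\Omega$-calibrated extended tangent space on a compact domain $D\subset M$. Let $h_D=\frac1{|D|}\int_D\|H\|\,dM$. The following statements are all equivalent: (1) $\|H\|=h_D$ is constant in $D$. (2) $A_D'(0)=0$ for all $\Omega$-volume preserving variations of $\phi$ on $D$ that fix the boundary $\partial D$. (3) $J_D'(0)=0$ for all variations of $\phi$ on $D$ that fix the boundary $\partial D$. (2') The same as (2), but only for variations that are moreover in $\bar{\mathcal F}_{D,\Omega}$ (or, alternatively, only for those in $\mathcal F_{D,\Omega}$). (3') The same as (3), but only for variations that are in $\bar{\mathcal F}_{D,\Omega}$ (or, alternatively, only for those in $\mathcal F_{D,\Omega}$).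
   Context: A rank-$(m+1)$ pre-calibration on $\bar M$ is a smooth $(m+1)$-form $\Omega$ with $|\Omega(u_1,\dots,u_{m+1})|\le 1$ for every orthonormal system $u_i$ of $T_x\bar M$, with equality for some orthonormal system at each $x\in\bar M$. $\phi:M\to\bar M$ is an immersion of an oriented $m$-manifold with induced metric $g=\phi^*\bar g$ and volume element $dM$; $NM$ is the normal bundle, $B$ the second fundamental form, $H=\frac1m\mathrm{trace}_gB$ the mean curvature vector. $D\subset M$ is a compact (connected) domain with smooth boundary; if $M$ is closed, $D=M$ is allowed. $|D|$ is the $g$-volume of $D$. $\phi$ has $\Omega$-calibrated extended tangent space on $D$ if there is a smooth unit section $\nu$ of $NM_{/D}$ with $\bar g(H,\nu)=\|H\|$ (with $H=\|H\|\nu$) and $\Omega(\nu_p,d\phi(e_1),\dots,d\phi(e_m))=1$ for every $p\in D$ and direct (positively oriented) orthonormal frame $e_i$ of $T_pM$. A variation of $\phi$ on $D$ is a smooth map $\bar\phi:(-\epsilon,\epsilon)\times D\to\bar M$, $\bar\phi(t,p)=\phi_t(p)$, with $\phi_0=\phi$; it fixes the boundary if $\phi_t=\phi$ on $\partial D$ for all $t$. Its vector variation is $W=\frac{\partial\bar\phi}{\partial t}|_{t=0}$. Let $dM_t$ be the volume element of $g_t=\phi_t^*\bar g$, and $$A_D(t)=\int_D dM_t,\qquad V_D(t)=\int_{[0,t]\times D}\bar\phi^*\Omega,\qquad J_D(t)=A_D(t)+m\,h_D\,V_D(t).$$ The variation is $\Omega$-volume preserving if $V_D(t)=V_D(0)=0$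 for all $t$. $\mathcal F_D$ is the set of smooth $f:D\to\mathbb R$ with $f_{/\partial D}=0$ and $\int_Df\,dM=0$. $\bar{\mathcal F}_{D,\Omega}$ is the set of vector fields along $\phi:D\to\bar M$ of the form $W=f(\nu+N)$ with $f\in\mathcal F_D$, $N$ a smooth section of $\phi^{-1}T\bar M$ over $D$ with $N\perp\nu$; $\mathcal F_{D,\Omega}$ is the subset of those $W$ that are sections of $NM_{/D}$. A variation is said to be in $\bar{\mathcal F}_{D,\Omega}$ (resp. $\mathcal F_{D,\Omega}$) if its vector variation $W$ at $t=0$ lies in $\bar{\mathcal F}_{D,\Omega}$ (resp. $\mathcal F_{D,\Omega}$). *)

theory Defs
  imports "HOL-Analysis.Analysis"
begin

section \<open>Smoothness in Euclidean spaces\<close>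

primrec C_k_on :: "nat \<Rightarrow> ('a::euclidean_space \<Rightarrow> 'b::real_normed_vector) \<Rightarrow> 'a set \<Rightarrow> bool" where
  "C_k_on 0 = (\<lambda>f U. continuous_on U f)"
| "C_k_on (Suc k) = (\<lambda>f U. (\<forall>x\<in>U. f differentiable (at x)) \<and>
     (\<forall>v. C_k_on k (\<lambda>x. frechet_derivative f (at x) v) U))"

text \<open>Smoothness on an arbitrary set: local existence of \<open>C\<^sup>\<infinity>\<close> extensions.  On open sets this is the
  usual notion; it is also the usual notion on domains with smooth boundary.\<close>

definition smooth_on :: "('a::euclidean_space \<Rightarrow> 'b::real_normed_vector) \<Rightarrow> 'a set \<Rightarrow> bool" where
  "smooth_on f S \<longleftrightarrow> (\<forall>x\<in>S. \<exists>U F. open U \<and> x \<in> U \<and> (\<forall>k. C_k_on k F U) \<and> (\<forall>y\<in>U \<inter> S. F y = f y))"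

section \<open>Manifolds\<close>

text \<open>A manifold is a (Hausdorff, second countable) topological space given by a type, together with
  an atlas.  The manifold dimension is the dimension of the model space \<open>'e\<close>.\<close>

type_synonym ('a, 'e) chart = "'a set \<times> ('a \<Rightarrow> 'e)"

abbreviation cdom :: "('a, 'e) chart \<Rightarrow> 'a set" where "cdom \<equiv> fst"
abbreviation cmap :: "('a, 'e) chart \<Rightarrow> 'a \<Rightarrow> 'e" where "cmap \<equiv> snd"

definition cinv :: "('a, 'e) chart \<Rightarrow> 'e \<Rightarrow> 'a" where
  "cinv \<kappa> = inv_into (cdom \<kappa>) (cmap \<kappa>)"

definition is_chart :: "('a::topological_space, 'e::euclidean_space) chart \<Rightarrow> bool" where
  "is_chart \<kappa> \<longleftrightarrow> open (cdom \<kappa>) \<and> open (cmap \<kappa> ` cdom \<kappa>) \<and>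
     homeomorphism (cdom \<kappa>) (cmap \<kappa> ` cdom \<kappa>) (cmap \<kappa>) (cinv \<kappa>)"

definition smooth_transition ::
  "('a::topological_space, 'e::euclidean_space) chart \<Rightarrow> ('a, 'e) chart \<Rightarrow> bool" where
  "smooth_transition \<kappa> \<kappa>' \<longleftrightarrow> smooth_on (cmap \<kappa>' \<circ> cinv \<kappa>) (cmap \<kappa> ` (cdom \<kappa> \<inter> cdom \<kappa>'))"

definition smooth_atlas :: "('a::topological_space, 'e::euclidean_space) chart set \<Rightarrow> bool" where
  "smooth_atlas A \<longleftrightarrow> (\<forall>\<kappa>\<in>A. is_chart \<kappa>) \<and> (\<Union>\<kappa>\<in>A. cdom \<kappa>) = UNIV \<and>
     (\<forall>\<kappa>\<in>A. \<forall>\<kappa>'\<in>A. smooth_transition \<kappa> \<kappa>')"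

text \<open>Charts of the maximal smooth atlas generated by \<open>A\<close> (not necessarily oriented ones).\<close>

definition compatible_chart ::
  "('a::topological_space, 'e::euclidean_space) chart set \<Rightarrow> ('a, 'e) chart \<Rightarrow> bool" where
  "compatible_chart A \<kappa> \<longleftrightarrow> is_chart \<kappa> \<and> (\<forall>\<kappa>'\<in>A. smooth_transition \<kappa> \<kappa>' \<and> smooth_transition \<kappa>' \<kappa>)"

definition transition_deriv ::
  "('a, 'e::euclidean_space) chart \<Rightarrow> ('a, 'e) chart \<Rightarrow> 'a \<Rightarrow> 'e \<Rightarrow> 'e" where
  "transition_deriv \<kappa> \<kappa>' p = frechet_derivative (cmap \<kappa>' \<circ> cinv \<kappa>) (at (cmap \<kappa> p))"

text \<open>An oriented manifold is one given by an oriented atlas.\<close>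

definition oriented_atlas :: "('a::topological_space, real^'m) chart set \<Rightarrow> bool" where
  "oriented_atlas A \<longleftrightarrow> smooth_atlas A \<and>
     (\<forall>\<kappa>\<in>A. \<forall>\<kappa>'\<in>A. \<forall>p\<in>cdom \<kappa> \<inter> cdom \<kappa>'. det (matrix (transition_deriv \<kappa> \<kappa>' p)) > 0)"

text \<open>The tangent space at \<open>p\<close> is represented by the model space \<open>'e\<close>, a vector of \<open>'e\<close> being read in the
  coordinates of a chart \<open>chart_at A p\<close> chosen once and for all for each point.  A tensor field is a
  function that assigns to \<open>p\<close> a tensor on this copy of \<open>'e\<close>.  The choice of charts varies arbitrarily
  with \<open>p\<close>, so smoothness is only meaningful after passing to a fixed chart by \<open>to_chart\<close> and
  \<open>from_chart\<close>.\<close>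

definition chart_at :: "('a, 'e) chart set \<Rightarrow> 'a \<Rightarrow> ('a, 'e) chart" where
  "chart_at A p = (SOME \<kappa>. \<kappa> \<in> A \<and> p \<in> cdom \<kappa>)"

definition to_chart :: "('a, 'e::euclidean_space) chart set \<Rightarrow> ('a, 'e) chart \<Rightarrow> 'a \<Rightarrow> 'e \<Rightarrow> 'e" where
  "to_chart A \<kappa> p = transition_deriv (chart_at A p) \<kappa> p"

definition from_chart :: "('a, 'e::euclidean_space) chart set \<Rightarrow> ('a, 'e) chart \<Rightarrow> 'a \<Rightarrow> 'e \<Rightarrow> 'e" where
  "from_chart A \<kappa> p = transition_deriv \<kappa> (chart_at A p) p"

text \<open>The product manifold \<open>\<real> \<times> M\<close>, with \<open>\<real>\<close> as first factor: the index \<open>None\<close> is the coordinate of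
  \<open>\<real>\<close>.  For an oriented atlas this gives the product orientation \<open>dt \<and> dM\<close>.\<close>

definition prod_atlas :: "('a, real^'m) chart set \<Rightarrow> (real \<times> 'a, real^('m option)) chart set" where
  "prod_atlas A = (\<lambda>\<kappa>. (UNIV \<times> cdom \<kappa>,
     \<lambda>(t, p). \<chi> i. case i of None \<Rightarrow> t | Some j \<Rightarrow> cmap \<kappa> p $ j)) ` A"

text \<open>Compact connected domain with smooth boundary; the boundary is \<open>frontier D\<close> (empty if \<open>D = M\<close>).\<close>

definition smooth_compact_domain :: "('a::topological_space, real^'m) chart set \<Rightarrow> 'a set \<Rightarrow> bool" where
  "smooth_compact_domain A D \<longleftrightarrow> compact D \<and> connected D \<and> D \<noteq> {} \<and>
     (\<forall>p\<in>frontier D. \<exists>\<kappa> i. compatible_chart A \<kappa> \<and> p \<in> cdom \<kappa> \<and> cmap \<kappa> p $ i = 0 \<and>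
        cmap \<kappa> ` (D \<inter> cdom \<kappa>) = {y \<in> cmap \<kappa> ` cdom \<kappa>. 0 \<le> y $ i})"

section \<open>Smooth maps, functions and fields\<close>

definition smooth_map_on ::
  "('a::topological_space, 'e::euclidean_space) chart set \<Rightarrow>
   ('b::topological_space, 'v::euclidean_space) chart set \<Rightarrow> 'a set \<Rightarrow> ('a \<Rightarrow> 'b) \<Rightarrow> bool" where
  "smooth_map_on A B S \<phi> \<longleftrightarrow> continuous_on S \<phi> \<and>
     (\<forall>\<kappa>\<in>A. \<forall>\<kappa>'\<in>B. smooth_on (cmap \<kappa>' \<circ> \<phi> \<circ> cinv \<kappa>) (cmap \<kappa> ` (S \<inter> cdom \<kappa> \<inter> \<phi> -` cdom \<kappa>')))"

definition smooth_fun_on ::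
  "('a::topological_space, 'e::euclidean_space) chart set \<Rightarrow> 'a set \<Rightarrow> ('a \<Rightarrow> real) \<Rightarrow> bool" where
  "smooth_fun_on A S f \<longleftrightarrow> (\<forall>\<kappa>\<in>A. smooth_on (f \<circ> cinv \<kappa>) (cmap \<kappa> ` (S \<inter> cdom \<kappa>)))"

text \<open>The differential at \<open>p \<in> S\<close> of a map defined on \<open>S\<close> (only used where \<open>S\<close> is, up to a smooth
  boundary, open, so that the derivative within \<open>S\<close> is unique).\<close>

definition mdiff ::
  "('a, 'e::euclidean_space) chart set \<Rightarrow> ('b, 'v::euclidean_space) chart set \<Rightarrow>
   'a set \<Rightarrow> ('a \<Rightarrow> 'b) \<Rightarrow> 'a \<Rightarrow> 'e \<Rightarrow> 'v" where
  "mdiff A B S \<phi> p =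
     frechet_derivative (cmap (chart_at B (\<phi> p)) \<circ> \<phi> \<circ> cinv (chart_at A p))
       (at (cmap (chart_at A p) p) within cmap (chart_at A p) ` (S \<inter> cdom (chart_at A p)))"

definition immersion ::
  "('a::topological_space, 'e::euclidean_space) chart set \<Rightarrow>
   ('b::topological_space, 'v::euclidean_space) chart set \<Rightarrow> ('a \<Rightarrow> 'b) \<Rightarrow> bool" where
  "immersion A B \<phi> \<longleftrightarrow> smooth_map_on A B UNIV \<phi> \<and> (\<forall>p. inj (mdiff A B UNIV \<phi> p))"

text \<open>Smooth sections of the pull-back of the tangent bundle; \<open>X p\<close> is a tangent vector at \<open>\<phi> p\<close>.\<close>

definition smooth_field_along ::
  "('a::topological_space, 'e::euclidean_space) chart set \<Rightarrow>
   ('b::topological_space, 'v::euclidean_space) chart set \<Rightarrow> 'a set \<Rightarrow> ('a \<Rightarrow> 'b) \<Rightarrow> ('a \<Rightarrow> 'v) \<Rightarrow> bool" where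
  "smooth_field_along A B S \<phi> X \<longleftrightarrow> (\<forall>\<kappa>\<in>A. \<forall>\<kappa>'\<in>B.
     smooth_on (\<lambda>y. to_chart B \<kappa>' (\<phi> (cinv \<kappa> y)) (X (cinv \<kappa> y)))
       (cmap \<kappa> ` (S \<inter> cdom \<kappa> \<inter> \<phi> -` cdom \<kappa>')))"

type_synonym ('a, 'e) metric = "'a \<Rightarrow> 'e \<Rightarrow> 'e \<Rightarrow> real"

definition metric_in_chart ::
  "('a, 'e::euclidean_space) chart set \<Rightarrow> ('a, 'e) metric \<Rightarrow> ('a, 'e) chart \<Rightarrow> 'e \<Rightarrow> 'e \<Rightarrow> 'e \<Rightarrow> real" where
  "metric_in_chart A g \<kappa> y u v =
     g (cinv \<kappa> y) (from_chart A \<kappa> (cinv \<kappa> y) u) (from_chart A \<kappa> (cinv \<kappa> y) v)"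

definition riemannian_metric ::
  "('a::topological_space, 'e::euclidean_space) chart set \<Rightarrow> ('a, 'e) metric \<Rightarrow> bool" where
  "riemannian_metric A g \<longleftrightarrow>
     (\<forall>p. bilinear (g p) \<and> (\<forall>u v. g p u v = g p v u) \<and> (\<forall>u. u \<noteq> 0 \<longrightarrow> g p u u > 0)) \<and>
     (\<forall>\<kappa>\<in>A. \<forall>u v. smooth_on (\<lambda>y. metric_in_chart A g \<kappa> y u v) (cmap \<kappa> ` cdom \<kappa>))"

text \<open>Differential forms of degree \<open>CARD('k)\<close>, with arguments indexed by the finite type \<open>'k\<close>.  Forms of
  degree \<open>m + 1\<close> are indexed by \<open>'m option\<close> with \<open>CARD('m) = m\<close>, the first argument having the index
  \<open>None\<close>.\<close>

type_synonym ('a, 'e, 'k) form = "'a \<Rightarrow> ('k \<Rightarrow> 'e) \<Rightarrow> real"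

definition alternating_multilinear :: "(('k::finite \<Rightarrow> 'e::real_vector) \<Rightarrow> real) \<Rightarrow> bool" where
  "alternating_multilinear \<omega> \<longleftrightarrow> (\<forall>u i. linear (\<lambda>v. \<omega> (u(i := v)))) \<and>
     (\<forall>u i j. i \<noteq> j \<and> u i = u j \<longrightarrow> \<omega> u = 0)"

definition smooth_form ::
  "('a::topological_space, 'e::euclidean_space) chart set \<Rightarrow> ('a, 'e, 'k::finite) form \<Rightarrow> bool" where
  "smooth_form A \<omega> \<longleftrightarrow> (\<forall>p. alternating_multilinear (\<omega> p)) \<and>
     (\<forall>\<kappa>\<in>A. \<forall>u. smooth_on (\<lambda>y. \<omega> (cinv \<kappa> y) (\<lambda>i. from_chart A \<kappa> (cinv \<kappa> y) (u i))) (cmap \<kappa> ` cdom \<kappa>))"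

definition orthonormal_system :: "('e \<Rightarrow> 'e \<Rightarrow> real) \<Rightarrow> ('k \<Rightarrow> 'e) \<Rightarrow> bool" where
  "orthonormal_system b u \<longleftrightarrow> (\<forall>i j. b (u i) (u j) = (if i = j then 1 else 0))"

definition pre_calibration ::
  "('b::topological_space, 'v::euclidean_space) chart set \<Rightarrow> ('b, 'v) metric \<Rightarrow>
   ('b, 'v, 'k::finite) form \<Rightarrow> bool" where
  "pre_calibration B gb \<Omega> \<longleftrightarrow> smooth_form B \<Omega> \<and>
     (\<forall>x. \<forall>u. orthonormal_system (gb x) u \<longrightarrow> \<bar>\<Omega> x u\<bar> \<le> 1) \<and>
     (\<forall>x. \<exists>u. orthonormal_system (gb x) u \<and> \<bar>\<Omega> x u\<bar> = 1)"

definition pullback_metric ::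
  "('a, 'e::euclidean_space) chart set \<Rightarrow> ('b, 'v::euclidean_space) chart set \<Rightarrow> 'a set \<Rightarrow>
   ('a \<Rightarrow> 'b) \<Rightarrow> ('b, 'v) metric \<Rightarrow> ('a, 'e) metric" where
  "pullback_metric A B S \<phi> gb p u v = gb (\<phi> p) (mdiff A B S \<phi> p u) (mdiff A B S \<phi> p v)"

definition pullback_form ::
  "('a, 'e::euclidean_space) chart set \<Rightarrow> ('b, 'v::euclidean_space) chart set \<Rightarrow> 'a set \<Rightarrow>
   ('a \<Rightarrow> 'b) \<Rightarrow> ('b, 'v, 'k) form \<Rightarrow> ('a, 'e, 'k) form" where
  "pullback_form A B S \<phi> \<omega> p u = \<omega> (\<phi> p) (\<lambda>i. mdiff A B S \<phi> p (u i))"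

section \<open>Integration\<close>

text \<open>The Borel measure concentrated on \<open>S\<close> that is given in each chart \<open>\<kappa>\<close> by \<open>\<rho> \<kappa> y dy\<close>.\<close>

definition density_measure ::
  "('a::topological_space, 'e::euclidean_space) chart set \<Rightarrow> 'a set \<Rightarrow> (('a, 'e) chart \<Rightarrow> 'e \<Rightarrow> real) \<Rightarrow>
   'a measure" where
  "density_measure A S \<rho> = (THE \<mu>. sets \<mu> = sets borel \<and>
     (\<forall>\<kappa>\<in>A. \<forall>E\<in>sets borel. E \<subseteq> cdom \<kappa> \<longrightarrow>
        emeasure \<mu> E = (\<integral>\<^sup>+y\<in>cmap \<kappa> ` (E \<inter> S). ennreal (\<rho> \<kappa> y) \<partial>lborel)))"

text \<open>Volume measure of a (possibly degenerate) metric \<open>g\<close> on \<open>S\<close>.\<close>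

definition volume_measure ::
  "('a::topological_space, real^'m) chart set \<Rightarrow> ('a, real^'m) metric \<Rightarrow> 'a set \<Rightarrow> 'a measure" where
  "volume_measure A g S = density_measure A S
     (\<lambda>\<kappa> y. sqrt (det (\<chi> i j. metric_in_chart A g \<kappa> y (axis i 1) (axis j 1))))"

definition form_coeff ::
  "('a::topological_space, real^'k) chart set \<Rightarrow> ('a, real^'k, 'k) form \<Rightarrow>
   ('a, real^'k) chart \<Rightarrow> real^'k \<Rightarrow> real" where
  "form_coeff A \<omega> \<kappa> y = \<omega> (cinv \<kappa> y) (\<lambda>i. from_chart A \<kappa> (cinv \<kappa> y) (axis i 1))"

text \<open>Integral over \<open>S\<close> of a form of top degree on an oriented manifold.  The positive and the negative
  part of the coefficient transform as densities because the transition maps of an oriented atlas have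
  positive Jacobian determinant.\<close>

definition form_integral ::
  "('a::topological_space, real^'k) chart set \<Rightarrow> 'a set \<Rightarrow> ('a, real^'k, 'k) form \<Rightarrow> real" where
  "form_integral A S \<omega> =
     measure (density_measure A S (\<lambda>\<kappa> y. max 0 (form_coeff A \<omega> \<kappa> y))) S -
     measure (density_measure A S (\<lambda>\<kappa> y. max 0 (- form_coeff A \<omega> \<kappa> y))) S"

section \<open>Extrinsic geometry\<close>

text \<open>Levi-Civita connection in a chart, \<open>christoffel u v = \<Sum> \<Gamma>\<^sup>k\<^sub>i\<^sub>j u\<^sup>i v\<^sup>j e\<^sub>k\<close>, from the Koszul formula for
  constant vector fields.\<close>

definition christoffel ::
  "('b, 'v::euclidean_space) chart set \<Rightarrow> ('b, 'v) metric \<Rightarrow> ('b, 'v) chart \<Rightarrow> 'v \<Rightarrow> 'v \<Rightarrow> 'v \<Rightarrow> 'v" where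
  "christoffel B gb \<kappa> y u v = (let G = metric_in_chart B gb \<kappa>;
       dG = (\<lambda>a b c. frechet_derivative (\<lambda>x. G x b c) (at y) a)
     in THE w. \<forall>z. 2 * G y w z = dG u v z + dG v u z - dG z u v)"

text \<open>Pull-back to \<open>M\<close> of the Levi-Civita connection: covariant derivative at \<open>p\<close>, in the direction \<open>u\<close>,
  of a vector field \<open>X\<close> along \<open>\<phi>\<close>.\<close>

definition cov_deriv_along ::
  "('a, 'e::euclidean_space) chart set \<Rightarrow> ('b, 'v::euclidean_space) chart set \<Rightarrow> ('b, 'v) metric \<Rightarrow>
   ('a \<Rightarrow> 'b) \<Rightarrow> ('a \<Rightarrow> 'v) \<Rightarrow> 'a \<Rightarrow> 'e \<Rightarrow> 'v" where
  "cov_deriv_along A B gb \<phi> X p u = (let \<kappa> = chart_at A p; \<kappa>' = chart_at B (\<phi> p) in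
     frechet_derivative (\<lambda>y. to_chart B \<kappa>' (\<phi> (cinv \<kappa> y)) (X (cinv \<kappa> y))) (at (cmap \<kappa> p)) u +
     christoffel B gb \<kappa>' (cmap \<kappa>' (\<phi> p)) (mdiff A B UNIV \<phi> p u) (X p))"

definition normal_at ::
  "('a, 'e::euclidean_space) chart set \<Rightarrow> ('b, 'v::euclidean_space) chart set \<Rightarrow> ('b, 'v) metric \<Rightarrow>
   ('a \<Rightarrow> 'b) \<Rightarrow> 'a \<Rightarrow> 'v \<Rightarrow> bool" where
  "normal_at A B gb \<phi> p w \<longleftrightarrow> (\<forall>u. gb (\<phi> p) w (mdiff A B UNIV \<phi> p u) = 0)"

definition normal_part ::
  "('a, 'e::euclidean_space) chart set \<Rightarrow> ('b, 'v::euclidean_space) chart set \<Rightarrow> ('b, 'v) metric \<Rightarrow>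
   ('a \<Rightarrow> 'b) \<Rightarrow> 'a \<Rightarrow> 'v \<Rightarrow> 'v" where
  "normal_part A B gb \<phi> p w =
     (THE n. normal_at A B gb \<phi> p n \<and> w - n \<in> range (mdiff A B UNIV \<phi> p))"

text \<open>\<open>B(u, v)\<close> is the normal part of the covariant derivative in the direction \<open>u\<close> of \<open>d\<phi>(V)\<close>, where \<open>V\<close> is
  the extension of \<open>v\<close> with constant coordinates in \<open>chart_at A p\<close>.\<close>

definition second_fundamental_form ::
  "('a, 'e::euclidean_space) chart set \<Rightarrow> ('b, 'v::euclidean_space) chart set \<Rightarrow> ('b, 'v) metric \<Rightarrow>
   ('a \<Rightarrow> 'b) \<Rightarrow> 'a \<Rightarrow> 'e \<Rightarrow> 'e \<Rightarrow> 'v" where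
  "second_fundamental_form A B gb \<phi> p u v =
     normal_part A B gb \<phi> p (cov_deriv_along A B gb \<phi>
       (\<lambda>q. mdiff A B UNIV \<phi> q (from_chart A (chart_at A p) q v)) p u)"

definition metric_trace :: "(real^'m \<Rightarrow> real^'m \<Rightarrow> real) \<Rightarrow> (real^'m \<Rightarrow> real^'m \<Rightarrow> 'v::real_vector) \<Rightarrow> 'v" where
  "metric_trace b T =
     (\<Sum>i\<in>UNIV. \<Sum>j\<in>UNIV. matrix_inv (\<chi> k l. b (axis k 1) (axis l 1)) $ i $ j *\<^sub>R T (axis i 1) (axis j 1))"

definition mean_curvature ::
  "('a, real^'m) chart set \<Rightarrow> ('b, 'v::euclidean_space) chart set \<Rightarrow> ('b, 'v) metric \<Rightarrow>
   ('a \<Rightarrow> 'b) \<Rightarrow> 'a \<Rightarrow> 'v" where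
  "mean_curvature A B gb \<phi> p = (1 / real CARD('m)) *\<^sub>R
     metric_trace (pullback_metric A B UNIV \<phi> gb p) (second_fundamental_form A B gb \<phi> p)"

definition mean_curvature_norm ::
  "('a, real^'m) chart set \<Rightarrow> ('b, 'v::euclidean_space) chart set \<Rightarrow> ('b, 'v) metric \<Rightarrow>
   ('a \<Rightarrow> 'b) \<Rightarrow> 'a \<Rightarrow> real" where
  "mean_curvature_norm A B gb \<phi> p =
     sqrt (gb (\<phi> p) (mean_curvature A B gb \<phi> p) (mean_curvature A B gb \<phi> p))"

section \<open>Calibrated extended tangent space\<close>

text \<open>\<open>\<nu>\<close> realises the calibrated extended tangent space on \<open>D\<close>.  The frame vectors are expressed in
  \<open>chart_at A p\<close>, which is a chart of the oriented atlas, so a frame is positively oriented iff its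
  matrix has positive determinant.\<close>

definition calibrated_extended_tangent_space ::
  "('a::topological_space, real^'m) chart set \<Rightarrow> ('b::topological_space, 'v::euclidean_space) chart set \<Rightarrow>
   ('b, 'v) metric \<Rightarrow> ('b, 'v, 'm option) form \<Rightarrow> ('a \<Rightarrow> 'b) \<Rightarrow> 'a set \<Rightarrow> ('a \<Rightarrow> 'v) \<Rightarrow> bool" where
  "calibrated_extended_tangent_space A B gb \<Omega> \<phi> D \<nu> \<longleftrightarrow>
     smooth_field_along A B D \<phi> \<nu> \<and>
     (\<forall>p\<in>D. normal_at A B gb \<phi> p (\<nu> p) \<and> gb (\<phi> p) (\<nu> p) (\<nu> p) = 1 \<and>
        gb (\<phi> p) (mean_curvature A B gb \<phi> p) (\<nu> p) = mean_curvature_norm A B gb \<phi> p \<and>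
        mean_curvature A B gb \<phi> p = mean_curvature_norm A B gb \<phi> p *\<^sub>R \<nu> p \<and>
        (\<forall>e :: 'm \<Rightarrow> real^'m.
           orthonormal_system (pullback_metric A B UNIV \<phi> gb p) e \<and> det (\<chi> i. e i) > 0 \<longrightarrow>
           \<Omega> (\<phi> p) (case_option (\<nu> p) (\<lambda>i. mdiff A B UNIV \<phi> p (e i))) = 1))"

section \<open>Variations\<close>

text \<open>The induced volume measure \<open>dM\<close> on \<open>D\<close>, and the mean value \<open>h\<^sub>D\<close> of the mean curvature.\<close>

definition dM ::
  "('a::topological_space, real^'m) chart set \<Rightarrow> ('b, 'v::euclidean_space) chart set \<Rightarrow> ('b, 'v) metric \<Rightarrow>
   ('a \<Rightarrow> 'b) \<Rightarrow> 'a set \<Rightarrow> 'a measure" where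
  "dM A B gb \<phi> D = volume_measure A (pullback_metric A B UNIV \<phi> gb) D"

definition h_mean ::
  "('a::topological_space, real^'m) chart set \<Rightarrow> ('b, 'v::euclidean_space) chart set \<Rightarrow> ('b, 'v) metric \<Rightarrow>
   ('a \<Rightarrow> 'b) \<Rightarrow> 'a set \<Rightarrow> real" where
  "h_mean A B gb \<phi> D =
     (1 / measure (dM A B gb \<phi> D) D) * (LINT p:D|dM A B gb \<phi> D. mean_curvature_norm A B gb \<phi> p)"

definition variation ::
  "('a::topological_space, real^'m) chart set \<Rightarrow> ('b::topological_space, 'v::euclidean_space) chart set \<Rightarrow>
   ('a \<Rightarrow> 'b) \<Rightarrow> 'a set \<Rightarrow> real \<Rightarrow> (real \<times> 'a \<Rightarrow> 'b) \<Rightarrow> bool" where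
  "variation A B \<phi> D \<epsilon> \<Phi> \<longleftrightarrow> \<epsilon> > 0 \<and>
     smooth_map_on (prod_atlas A) B ({-\<epsilon><..<\<epsilon>} \<times> D) \<Phi> \<and> (\<forall>p\<in>D. \<Phi> (0, p) = \<phi> p)"

definition fixes_boundary ::
  "('a::topological_space \<Rightarrow> 'b) \<Rightarrow> 'a set \<Rightarrow> real \<Rightarrow> (real \<times> 'a \<Rightarrow> 'b) \<Rightarrow> bool" where
  "fixes_boundary \<phi> D \<epsilon> \<Phi> \<longleftrightarrow> (\<forall>t\<in>{-\<epsilon><..<\<epsilon>}. \<forall>p\<in>frontier D. \<Phi> (t, p) = \<phi> p)"

definition vector_variation ::
  "('b, 'v::euclidean_space) chart set \<Rightarrow> (real \<times> 'a \<Rightarrow> 'b) \<Rightarrow> 'a \<Rightarrow> 'v" where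
  "vector_variation B \<Phi> p =
     vector_derivative (\<lambda>t. cmap (chart_at B (\<Phi> (0, p))) (\<Phi> (t, p))) (at 0)"

definition area_D ::
  "('a::topological_space, real^'m) chart set \<Rightarrow> ('b, 'v::euclidean_space) chart set \<Rightarrow> ('b, 'v) metric \<Rightarrow>
   'a set \<Rightarrow> (real \<times> 'a \<Rightarrow> 'b) \<Rightarrow> real \<Rightarrow> real" where
  "area_D A B gb D \<Phi> t = measure (volume_measure A (pullback_metric A B D (\<lambda>p. \<Phi> (t, p)) gb) D) D"

text \<open>For \<open>t < 0\<close>, the integral over \<open>[0,t] \<times> D\<close> is minus the one over \<open>[t,0] \<times> D\<close>.\<close>

definition volume_D ::
  "('a::topological_space, real^'m) chart set \<Rightarrow> ('b, 'v::euclidean_space) chart set \<Rightarrow>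
   ('b, 'v, 'm option) form \<Rightarrow> 'a set \<Rightarrow> real \<Rightarrow> (real \<times> 'a \<Rightarrow> 'b) \<Rightarrow> real \<Rightarrow> real" where
  "volume_D A B \<Omega> D \<epsilon> \<Phi> t =
     (let \<omega> = pullback_form (prod_atlas A) B ({-\<epsilon><..<\<epsilon>} \<times> D) \<Phi> \<Omega> in
      if 0 \<le> t then form_integral (prod_atlas A) ({0..t} \<times> D) \<omega>
      else - form_integral (prod_atlas A) ({t..0} \<times> D) \<omega>)"

definition J_D ::
  "('a::topological_space, real^'m) chart set \<Rightarrow> ('b, 'v::euclidean_space) chart set \<Rightarrow> ('b, 'v) metric \<Rightarrow>
   ('b, 'v, 'm option) form \<Rightarrow> ('a \<Rightarrow> 'b) \<Rightarrow> 'a set \<Rightarrow> real \<Rightarrow> (real \<times> 'a \<Rightarrow> 'b) \<Rightarrow> real \<Rightarrow> real" where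
  "J_D A B gb \<Omega> \<phi> D \<epsilon> \<Phi> t =
     area_D A B gb D \<Phi> t + real CARD('m) * h_mean A B gb \<phi> D * volume_D A B \<Omega> D \<epsilon> \<Phi> t"

definition volume_preserving ::
  "('a::topological_space, real^'m) chart set \<Rightarrow> ('b, 'v::euclidean_space) chart set \<Rightarrow>
   ('b, 'v, 'm option) form \<Rightarrow> 'a set \<Rightarrow> real \<Rightarrow> (real \<times> 'a \<Rightarrow> 'b) \<Rightarrow> bool" where
  "volume_preserving A B \<Omega> D \<epsilon> \<Phi> \<longleftrightarrow> (\<forall>t\<in>{-\<epsilon><..<\<epsilon>}. volume_D A B \<Omega> D \<epsilon> \<Phi> t = 0)"

definition F_D ::
  "('a::topological_space, real^'m) chart set \<Rightarrow> ('b, 'v::euclidean_space) chart set \<Rightarrow> ('b, 'v) metric \<Rightarrow>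
   ('a \<Rightarrow> 'b) \<Rightarrow> 'a set \<Rightarrow> ('a \<Rightarrow> real) set" where
  "F_D A B gb \<phi> D = {f. smooth_fun_on A D f \<and> (\<forall>p\<in>frontier D. f p = 0) \<and>
     (LINT p:D|dM A B gb \<phi> D. f p) = 0}"

text \<open>Vector fields along \<open>\<phi>\<close> on \<open>D\<close> (values outside \<open>D\<close> are irrelevant): \<open>\<F>\<close>-bar and its subset of
  normal fields.\<close>

definition F_bar ::
  "('a::topological_space, real^'m) chart set \<Rightarrow> ('b::topological_space, 'v::euclidean_space) chart set \<Rightarrow>
   ('b, 'v) metric \<Rightarrow> ('a \<Rightarrow> 'b) \<Rightarrow> 'a set \<Rightarrow> ('a \<Rightarrow> 'v) \<Rightarrow> ('a \<Rightarrow> 'v) set" where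
  "F_bar A B gb \<phi> D \<nu> = {W. \<exists>f\<in>F_D A B gb \<phi> D. \<exists>N. smooth_field_along A B D \<phi> N \<and>
     (\<forall>p\<in>D. gb (\<phi> p) (N p) (\<nu> p) = 0 \<and> W p = f p *\<^sub>R (\<nu> p + N p))}"

definition F_normal ::
  "('a::topological_space, real^'m) chart set \<Rightarrow> ('b::topological_space, 'v::euclidean_space) chart set \<Rightarrow>
   ('b, 'v) metric \<Rightarrow> ('a \<Rightarrow> 'b) \<Rightarrow> 'a set \<Rightarrow> ('a \<Rightarrow> 'v) \<Rightarrow> ('a \<Rightarrow> 'v) set" where
  "F_normal A B gb \<phi> D \<nu> =
     {W \<in> F_bar A B gb \<phi> D \<nu>. \<forall>p\<in>D. normal_at A B gb \<phi> p (W p)}"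

end

theory Submission
  imports Defs
begin

text \<open>In charts, and with a partition of unity, the divergence theorem for vector fields that vanish on
 \<open>\<partial>D\<close> gives the first variation \<open>A'(0) = - m \<integral> g(H, W) dM\<close>. A calibration attains its maximum on the
 frame extended by \<open>\<nu>\<close>, so the form \<open>\<Omega>(w, e\<^sub>1, ..., e\<^sub>m)\<close> in \<open>w\<close> equals \<open>g(w, \<nu>)\<close>; hence \<open>V'(0) = \<integral> g(W, \<nu>) dM\<close>
 and \<open>J'(0) = m \<integral> (h\<^sub>D - \<parallel>H\<parallel>) g(W, \<nu>) dM\<close>, which vanishes if \<open>\<parallel>H\<parallel> = h\<^sub>D\<close>.
 If \<open>\<parallel>H\<parallel>\<close> is not constant, push \<open>\<phi>\<close> along \<open>\<nu>\<close> inwards and outwards on two small disjoint sets that are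
 separated by a value of \<open>\<parallel>H\<parallel>\<close>. Let \<open>q\<^sub>i(s)\<close> be the rate at which push \<open>i\<close> sweeps \<open>\<Omega>\<close>-volume at displacement
 \<open>s\<close>; driving the two displacements by \<open>r\<^sub>i' = \<plusminus>1 / q\<^sub>i(r\<^sub>i)\<close> makes the swept volumes cancel for all \<open>t\<close>, while
 \<open>A'(0) \<noteq> 0\<close>.\<close>

section \<open>Smooth maps between Euclidean spaces\<close>

text \<open>Smoothness on \<open>D\<close> means local smooth extensions, so integrals run over the
  interior, the boundary being null in every chart, while bounds are taken on compact chart
  neighbourhoods that may reach across it. The divergence theorem is then used without flattening
  the boundary: a cut-off field vanishing on the boundary stays Lipschitz when set to 0 outside
  \<open>D\<close>, and the directional derivatives of a compactly supported Lipschitz function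
  integrate to 0. All measures are definite descriptions; area and swept volume are rewritten as
  integrals against the one volume measure of the original metric, where derivatives in
  \<open>t\<close> pass under the integral. Volume has to be preserved for all \<open>t\<close>, not
  just to first order. Correcting a variation with a prescribed mean-zero speed would ask for an
  implicit function; two pushes whose swept volumes grow at the exact rates \<open>1\<close> and
  \<open>-1\<close> ask only for inverses of functions of one real variable. Separating the pushes
  by a value \<open>c\<close> of \<open>||H||\<close> gives \<open>(||H|| - c) f >= 0\<close> for
  the normal speed \<open>f\<close>, and since \<open>f\<close> has mean zero this fixes the sign of
  \<open>A'(0)\<close>.\<close>

abbreviation (input) FD :: "('e::real_normed_vector => 'v::real_normed_vector) => 'e => 'e => 'v" where
 "FD f x == frechet_derivative f (at x)"

abbreviation (input) ind :: "'a set => 'a => 'b::zero_neq_one" where "ind == indicator"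

abbreviation (input) bm :: "('a::topological_space => 'b::topological_space) set" where "bm == borel_measurable borel"

abbreviation (input) ax :: "'n => real^'n" where "ax i == axis i 1"

abbreviation (input) Iv :: "real => real set" where "Iv r == {-r<..<r}"

abbreviation (input) HD :: "('e::real_normed_vector => 'v::real_normed_vector) => ('e => 'v) => 'e => bool" where
 "HD f f' x == (f has_derivative f') (at x)"

abbreviation (input) HR :: "(real => real) => real => real => bool" where "HR f d x == (f has_real_derivative d) (at x)"

abbreviation (input) nnI :: "'a measure => ('a => ennreal) => ennreal" where "nnI == nn_integral"

abbreviation (input) cran :: "('a, 'e) chart => 'e set" where "cran K == cmap K ` cdom K"

abbreviation (input) bx :: "real => real => ('a, 'e::metric_space) chart => 'a => (real \<times> 'e) set" where
 "bx t r K p == ball t r \<times> ball (cmap K p) r"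

lemmas has_derivative_cong_open = has_derivative_transform_within_open

lemma linear_basis_expansion:
 fixes f :: "'a::euclidean_space => 'b::real_vector"
 assumes "linear f"
 shows "f w = (SUM b:Basis. (w \<bullet> b) *\<^sub>R f b)"
proof -
 have "f w = f (SUM b:Basis. (w \<bullet> b) *\<^sub>R b)" by (simp add: euclidean_representation)
 also have "... = (SUM b:Basis. (w \<bullet> b) *\<^sub>R f b)"
  by (simp only: linear_sum[OF assms] linear_scale[OF assms])
 finally show ?thesis .
qed

lemma C_k_on_cong:
 assumes "C_k_on k f U" "open U" "!!x. x : U ==> f x = g x"
 shows "C_k_on k g U"
 using assms(1,3)
proof (induction k arbitrary: f g)
 case 0
 thus ?case using continuous_on_cong by (metis C_k_on.simps(1))
next
 case (Suc k)
 have fd: "HD f (FD f x) x" if "x : U" for x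
  using Suc.prems(1) that by (auto simp: frechet_derivative_works)
 have gd: "HD g (FD f x) x" if "x : U" for x
  using has_derivative_cong_open[OF fd[OF that] assms(2) that] Suc.prems(2) by auto
 have eq: "FD g x = FD f x" if "x : U" for x
  using frechet_derivative_at[OF gd[OF that]] by simp
 have "C_k_on k (%x. FD g x v) U" for v
  by (rule Suc.IH[of "%x. FD f x v"]) (use Suc.prems eq in auto)
 thus ?case using gd by (auto simp: differentiable_def)
qed

lemma C_k_on_SucI:
 assumes "open U" "!!x. x : U ==> HD f (f' x) x"
  "!!v. C_k_on k (%x. f' x v) U"
 shows "C_k_on (Suc k) f U"
proof -
 have "FD f x = f' x" if "x : U" for x
  using frechet_derivative_at[OF assms(2)[OF that]] by simp
 hence "C_k_on k (%x. FD f x v) U" for v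
  by (intro C_k_on_cong[OF assms(3) assms(1)]) auto
 thus ?thesis using assms(2) by (auto simp: differentiable_def)
qed

lemma C_k_on_SucD:
 assumes "C_k_on (Suc k) f U" "x : U"
 shows "HD f (FD f x) x"
 using assms by (auto simp: frechet_derivative_works)

lemma C_k_on_Suc_imp:
 assumes "C_k_on (Suc k) f U"
 shows "C_k_on k f U"
 using assms
proof (induction k arbitrary: f)
 case 0
 hence "f differentiable_on U"
  by (auto simp: differentiable_on_def intro: differentiable_at_withinI)
 thus ?case by (simp add: differentiable_imp_continuous_on)
next
 case (Suc k)
 have *: "ALL x:U. f differentiable (at x)" "!!v. C_k_on (Suc k) (%x. FD f x v) U"
  using Suc.prems unfolding C_k_on.simps(2)[of "Suc k"] by blast+
 thus ?case using Suc.IH[OF *(2)] by simp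
qed

lemma C_k_on_subset:
 assumes "C_k_on k f U" "V <= U"
 shows "C_k_on k f V"
 using assms
proof (induction k arbitrary: f)
 case 0
 thus ?case by (auto intro: continuous_on_subset)
next
 case (Suc k)
 thus ?case by auto
qed

lemma C_k_on_local:
 assumes "!!x. x : U ==> EX V. open V & x : V & C_k_on k f V"
 shows "C_k_on k f U"
 using assms
proof (induction k arbitrary: f)
 case 0
 have "continuous (at x) f" if "x : U" for x
  using 0[OF that] by (auto simp: continuous_on_eq_continuous_at)
 thus ?case by (auto simp: continuous_at_imp_continuous_on)
next
 case (Suc k)
 have "f differentiable at x" if x: "x : U" for x
 proof -
  obtain V where "x : V" "C_k_on (Suc k) f V" using Suc.prems[OF x] by blast
  thus ?thesis by simp
 qed
 moreover have "C_k_on k (%x. FD f x v) U" for v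
 proof (rule Suc.IH)
  fix x assume "x : U"
  then obtain V where "open V" "x : V" "C_k_on (Suc k) f V" using Suc.prems by blast
  thus "EX V. open V & x : V & C_k_on k (%x. FD f x v) V" by auto
 qed
 ultimately show ?case by simp
qed

lemma C_k_on_const: "open U ==> C_k_on k (%x. c) U"
proof (induction k arbitrary: c)
 case (Suc k)
 thus ?case by (intro C_k_on_SucI[where f'="%x v. 0"]) auto
qed auto

lemma C_k_on_linear:
 assumes "bounded_linear f" "open U"
 shows "C_k_on k f U"
proof (cases k)
 case 0
 thus ?thesis using assms by (auto intro: linear_continuous_on)
next
 case (Suc j)
 thus ?thesis
  using assms by (simp only:) (blast intro: C_k_on_SucI[where f'="%x. f"] C_k_on_const bounded_linear_imp_has_derivative)
qed

lemma C_k_on_add: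
 assumes "C_k_on k f U" "C_k_on k g U" "open U"
 shows "C_k_on k (%x. f x + g x) U"
 using assms(1,2)
proof (induction k arbitrary: f g)
 case 0
 thus ?case by (auto intro: continuous_intros)
next
 case (Suc k)
 show ?case
  by (rule C_k_on_SucI[OF assms(3) has_derivative_add[OF C_k_on_SucD[OF Suc.prems(1)] C_k_on_SucD[OF Suc.prems(2)]]])
   (use Suc in auto)
qed

lemma C_k_on_bilinear:
 assumes "bounded_bilinear h" "C_k_on k f U" "C_k_on k g U" "open U"
 shows "C_k_on k (%x. h (f x) (g x)) U"
 using assms(2,3)
proof (induction k arbitrary: f g)
 case 0
 thus ?case using bounded_bilinear.continuous_on[OF assms(1)] by auto
next
 case (Suc k)
 interpret bounded_bilinear h by fact
 have "C_k_on k f U" "C_k_on k g U" using Suc.prems by (blast intro: C_k_on_Suc_imp)+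
 with Suc show ?case
  by (intro C_k_on_SucI[OF assms(4) FDERIV[OF C_k_on_SucD[OF Suc.prems(1)] C_k_on_SucD[OF Suc.prems(2)]]]
    C_k_on_add[OF _ _ assms(4)]) auto
qed

lemma C_k_on_sum:
 assumes "!!i. i : I ==> C_k_on k (f i) U" "open U"
 shows "C_k_on k (%x. SUM i:I. f i x) U"
 using assms(1)
 by (induction I rule: infinite_finite_induct) (auto simp: C_k_on_const C_k_on_add assms(2))

text \<open>The derivative \<open>f'(g x)(g' x v)\<close> is not a composition covered by the
  induction hypothesis, since base point and direction both vary. Expanding the direction in the
  basis leaves maps \<open>x |-> f'(g x) b\<close> with fixed \<open>b\<close>, to which the
  hypothesis applies.\<close>

lemma C_k_on_compose:
 fixes f :: "'b::euclidean_space => 'c::real_normed_vector" and g :: "'a::euclidean_space => 'b"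
 assumes "C_k_on k f V" "C_k_on k g U" "open U" "open V" "g ` U <= V"
 shows "C_k_on k (%x. f (g x)) U"
 using assms(1,2)
proof (induction k arbitrary: f)
 case 0
 thus ?case using assms(5) by (auto intro: continuous_on_compose2)
next
 case (Suc k)
 have gV: "g x : V" if "x : U" for x using that assms(5) by auto
 let ?f' = "%y. FD f y" and ?g' = "%y. FD g y"
 have d: "HD (%x. f (g x)) (%v. ?f' (g x) (?g' x v)) x" if "x : U" for x
  using has_derivative_compose[OF C_k_on_SucD[OF Suc.prems(2) that] C_k_on_SucD[OF Suc.prems(1) gV[OF that]]] .
 have "C_k_on k (%x. ?f' (g x) (?g' x v)) U" for v
 proof -
  have "C_k_on k (%x. SUM b:Basis. (?g' x v \<bullet> b) *\<^sub>R ?f' (g x) b) U"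
  proof (intro C_k_on_sum assms C_k_on_bilinear[OF bounded_bilinear_scaleR] C_k_on_bilinear[OF bounded_bilinear_inner] C_k_on_const)
   show "C_k_on k (%x. ?g' x v) U" using Suc.prems(2) by simp
   show "C_k_on k (%x. ?f' (g x) b) U" for b
    by (rule Suc.IH) (use Suc.prems C_k_on_Suc_imp[OF Suc.prems(2)] in simp_all)
  qed
  thus ?thesis
  proof (rule C_k_on_cong[OF _ assms(3)])
   fix x assume "x : U"
   hence "linear (?f' (g x))"
    by (intro has_derivative_linear[OF C_k_on_SucD[OF Suc.prems(1) gV]])
   thus "(SUM b:Basis. (?g' x v \<bullet> b) *\<^sub>R ?f' (g x) b) = ?f' (g x) (?g' x v)"
    by (rule linear_basis_expansion[symmetric])
  qed
 qed
 thus ?case by (rule C_k_on_SucI[OF assms(3) d, rotated]) assumption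
qed

text \<open>Openness is part of the predicate because \<open>C_k_on\<close> speaks of derivatives at
  points and not within a set.\<close>

definition Cinf :: "('a::euclidean_space => 'b::real_normed_vector) => 'a set => bool" where
 "Cinf f U \<longleftrightarrow> open U & (ALL k. C_k_on k f U)"

lemma Cinf_open: "Cinf f U ==> open U"
 by (simp add: Cinf_def)

lemma Cinf_D: "Cinf f U ==> C_k_on k f U"
 by (simp add: Cinf_def)

lemma Cinf_cong:
 assumes "Cinf f U" "!!x. x : U ==> f x = g x"
 shows "Cinf g U"
 unfolding Cinf_def
 using C_k_on_cong[OF Cinf_D[OF assms(1)] Cinf_open[OF assms(1)] assms(2)] Cinf_open[OF assms(1)]
 by simp

lemma Cinf_subset: "Cinf f U ==> open V ==> V <= U ==> Cinf f V"
 unfolding Cinf_def using C_k_on_subset[of _ f U V] by simp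

lemma Cinf_local:
 assumes "!!x. x : U ==> EX V. x : V & Cinf f V" "open U"
 shows "Cinf f U"
 unfolding Cinf_def
proof (intro conjI allI assms C_k_on_local)
 fix k x assume "x : U"
 then obtain V where "x : V" "Cinf f V" using assms(1) by blast
 thus "EX V. open V & x : V & C_k_on k f V"
  by (intro exI[of _ V]) (simp add: Cinf_def)
qed

lemma Cinf_deriv:
 assumes "Cinf f U" "x : U"
 shows "HD f (FD f x) x"
 using C_k_on_SucD[OF Cinf_D[OF assms(1)] assms(2)] .

lemma Cinf_continuous: "Cinf f U ==> continuous_on U f"
 using Cinf_D[of f U 0] by simp

lemma Cinf_frechet:
 assumes "Cinf f U"
 shows "Cinf (%x. FD f x v) U"
 unfolding Cinf_def
proof (intro conjI allI)
 show "C_k_on k (%x. FD f x v) U" for k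
  using Cinf_D[OF assms, of "Suc k"] by simp
qed (rule Cinf_open[OF assms])

lemma Cinf_frechet_linear:
 assumes "Cinf f U" "x : U"
 shows "linear (FD f x)"
 using Cinf_deriv[OF assms] by (rule has_derivative_linear)

lemma smooth_onE:
 assumes "smooth_on f S" "x : S"
 obtains U F where "Cinf F U" "x : U" "!!y. y : U Int S ==> F y = f y"
proof -
 have "EX U F. open U & x : U & (ALL k. C_k_on k F U) & (ALL y:U Int S. F y = f y)"
  using assms unfolding smooth_on_def by (rule bspec)
 then obtain U F where "open U & x : U & (ALL k. C_k_on k F U) & (ALL y:U Int S. F y = f y)"
  by (elim exE)
 thus ?thesis by (intro that[of F U]) (auto simp: Cinf_def)
qed

lemma smooth_onI:
 assumes "!!x. x : S ==> EX U F. Cinf F U & x : U & (ALL y:U Int S. F y = f y)"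
 shows "smooth_on f S"
 unfolding smooth_on_def
proof
 fix x assume "x : S"
 from assms[OF this] obtain U F where "Cinf F U" "x : U" "ALL y:U Int S. F y = f y" by auto
 thus "EX U F. open U & x : U & (ALL k. C_k_on k F U) & (ALL y:U Int S. F y = f y)"
  by (intro exI[of _ U] exI[of _ F]) (auto simp: Cinf_def)
qed

text \<open>Near a point of an open set a local extension coincides with the function. This is the
  passage from the extension smoothness of the definitions to the calculus of
  \<open>Cinf\<close>.\<close>

lemma smooth_on_open_iff: "open S ==> smooth_on f S \<longleftrightarrow> Cinf f S"
proof
 assume S: "open S" and f: "smooth_on f S"
 show "Cinf f S"
 proof (rule Cinf_local[OF _ S])
  fix x assume "x : S"
  from f this obtain U F where U: "Cinf F U" "x : U" "!!y. y : U Int S ==> F y = f y"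
   by (rule smooth_onE) (rule that)
  have "Cinf F (U Int S)" using S U Cinf_open by (intro Cinf_subset[OF U(1)]) auto
  hence "Cinf f (U Int S)" using U(3) by (rule Cinf_cong)
  thus "EX V. x : V & Cinf f V" using \<open>x : S\<close> U by (intro exI[of _ "U Int S"]) simp
 qed
next
 assume "open S" "Cinf f S" thus "smooth_on f S"
  unfolding smooth_on_def Cinf_def by (intro ballI exI[of _ S] exI[of _ f]) simp
qed

lemma Cinf_const: "open U ==> Cinf (%x. c) U"
 by (simp add: Cinf_def C_k_on_const)

lemma Cinf_linear: "bounded_linear f ==> open U ==> Cinf f U"
 by (simp add: Cinf_def C_k_on_linear)

lemma Cinf_compose:
 fixes f :: "'b::euclidean_space => 'c::real_normed_vector" and g :: "'a::euclidean_space => 'b"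
 shows "Cinf f V ==> Cinf g U ==> (!!x. x : U ==> g x : V) ==> Cinf (%x. f (g x)) U"
 unfolding Cinf_def by (intro conjI allI C_k_on_compose[where f=f and g=g and V=V]) auto

lemma Cinf_bounded_linear:
 fixes g :: "'a::euclidean_space => 'b::euclidean_space"
 shows "bounded_linear f ==> Cinf g U ==> Cinf (%x. f (g x)) U"
 by (rule Cinf_compose[of f UNIV]) (auto intro: Cinf_linear)

lemma Cinf_add: "Cinf f U ==> Cinf g U ==> Cinf (%x. f x + g x) U"
 by (simp add: Cinf_def C_k_on_add)

lemma Cinf_bilinear:
 "bounded_bilinear h ==> Cinf f U ==> Cinf g U ==> Cinf (%x. h (f x) (g x)) U"
 by (simp add: Cinf_def C_k_on_bilinear)

lemmas Cinf_scaleR = Cinf_bilinear[OF bounded_bilinear_scaleR]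
lemmas Cinf_mult = Cinf_bilinear[OF bounded_bilinear_mult]
lemmas Cinf_inner = Cinf_bilinear[OF bounded_bilinear_inner]

lemma Cinf_minus: "Cinf f U ==> Cinf (%x. - f x) U"
 using Cinf_scaleR[OF Cinf_const[OF Cinf_open, of f U "-1"], of f] by simp

lemma Cinf_diff: "Cinf f U ==> Cinf g U ==> Cinf (%x. f x - g x) U"
 using Cinf_add[OF _ Cinf_minus, of f U g] by simp

lemma Cinf_sum:
 "open U ==> (!!i. i : I ==> Cinf (f i) U) ==> Cinf (%x. SUM i:I. f i x) U"
 by (simp add: Cinf_def C_k_on_sum)

lemma Cinf_prod:
 fixes f :: "'i => 'a::euclidean_space => real"
 shows "open U ==> (!!i. i : I ==> Cinf (f i) U) ==> Cinf (%x. PROD i:I. f i x) U"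
 by (induction I rule: infinite_finite_induct) (auto simp: Cinf_const Cinf_mult)

lemma Cinf_Pair:
 assumes "Cinf f U" "Cinf g U"
 shows "Cinf (%x. (f x, g x)) U"
proof -
 have "C_k_on k (%x. (f x, g x)) U" if "C_k_on k f U" "C_k_on k g U" for k
  using that
 proof (induction k arbitrary: f g)
  case 0
  thus ?case by (auto intro: continuous_intros)
 next
  case (Suc k)
  show ?case
  proof (rule C_k_on_SucI[OF Cinf_open[OF assms(1)] has_derivative_Pair[OF C_k_on_SucD[OF Suc.prems(1)] C_k_on_SucD[OF Suc.prems(2)]]])
   show "C_k_on k (%x. (FD f x v, FD g x v)) U" for v
    by (rule Suc.IH) (use Suc.prems in simp_all)
  qed
 qed
 thus ?thesis using assms by (simp add: Cinf_def)
qed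

lemma Cinf_det:
 fixes f :: "'a::euclidean_space => real^'n^'n"
 assumes "open U" "!!i j. Cinf (%x. f x $ i $ j) U"
 shows "Cinf (%x. det (f x)) U"
 unfolding det_def
 by (intro Cinf_sum Cinf_mult Cinf_prod Cinf_const assms)

text \<open>The recursion \<open>(1/f)' = - f' (1/f)^2\<close> closes under the induction because only \<open>1/f\<close> itself recurs.\<close>

lemma Cinf_inverse:
 fixes f :: "'a::euclidean_space => real"
 assumes "Cinf f U" "!!x. x : U ==> f x ~= 0"
 shows "Cinf (%x. inverse (f x)) U"
proof -
 have U: "open U" using assms(1) by (rule Cinf_open)
 have fk: "C_k_on k f U" "C_k_on k (%x. FD f x v) U" for k v
  using assms(1) Cinf_frechet[OF assms(1), of v] by (auto simp: Cinf_def)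
 have "C_k_on k (%x. inverse (f x)) U" for k
 proof (induction k)
  case 0
  thus ?case using Cinf_continuous[OF assms(1)] assms(2) by (auto intro: continuous_intros)
 next
  case (Suc k)
  have "((%x. inverse (f x)) has_derivative
   (%v. - ((inverse (f x) * FD f x v) * inverse (f x)))) (at x)" if "x : U" for x
   by (rule has_derivative_compose[OF Cinf_deriv[OF assms(1) that] has_derivative_inverse'[OF assms(2)[OF that]]])
  thus ?case
  proof (rule C_k_on_SucI[OF U])
   fix v
   have "C_k_on k (%x. (- 1) *\<^sub>R ((inverse (f x) * FD f x v) * inverse (f x))) U"
    by (intro C_k_on_bilinear[OF bounded_bilinear_scaleR] C_k_on_bilinear[OF bounded_bilinear_mult] Suc fk U C_k_on_const)
   thus "C_k_on k (%x. - ((inverse (f x) * FD f x v) * inverse (f x))) U"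
    by simp
  qed
 qed
 thus ?thesis using U by (simp add: Cinf_def)
qed

lemma Cinf_divide:
 fixes f g :: "'a::euclidean_space => real"
 assumes "Cinf f U" "Cinf g U" "!!x. x : U ==> g x ~= 0"
 shows "Cinf (%x. f x / g x) U"
 using Cinf_mult[OF assms(1) Cinf_inverse[OF assms(2,3)]] by (simp add: divide_inverse)

text \<open>The derivative is arranged as half of \<open>sqrt f\<close> times \<open>1/f\<close>
  times \<open>f'\<close>. Only \<open>sqrt f\<close> itself recurs in the induction;
  \<open>1/f\<close> is already known to be smooth.\<close>

lemma Cinf_sqrt:
 fixes f :: "'a::euclidean_space => real"
 assumes "Cinf f U" "!!x. x : U ==> f x > 0"
 shows "Cinf (%x. sqrt (f x)) U"
proof -
 have U: "open U" using assms(1) by (rule Cinf_open)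
 have fk: "C_k_on k f U" "C_k_on k (%x. FD f x v) U"
  "C_k_on k (%x. inverse (f x)) U" for k v
  using assms(1) Cinf_frechet[OF assms(1), of v] Cinf_inverse[OF assms(1)] assms(2)
  by (fastforce simp: Cinf_def)+
 have "C_k_on k (%x. sqrt (f x)) U" for k
 proof (induction k)
  case 0
  thus ?case using Cinf_continuous[OF assms(1)] by (auto intro: continuous_intros)
 next
  case (Suc k)
  have "((%x. sqrt (f x)) has_derivative
   (%v. (1/2) * ((sqrt (f x) * inverse (f x)) * FD f x v))) (at x)" if "x : U" for x
  proof -
   have "HD sqrt ((*) (inverse (sqrt (f x)) / 2)) (f x)"
    using DERIV_real_sqrt[OF assms(2)[OF that]] by (simp add: has_field_derivative_def)
   from has_derivative_compose[OF Cinf_deriv[OF assms(1) that] this]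
   have "HD (%x. sqrt (f x)) (%v. inverse (sqrt (f x)) / 2 * FD f x v) x" .
   moreover have "inverse (sqrt (f x)) = sqrt (f x) * inverse (f x)"
    using assms(2)[OF that] by (simp add: field_simps)
   ultimately show ?thesis by (simp add: mult.assoc)
  qed
  thus ?case
  proof (rule C_k_on_SucI[OF U])
   show "C_k_on k (%x. (1/2) * ((sqrt (f x) * inverse (f x)) * FD f x v)) U" for v
    by (intro C_k_on_bilinear[OF bounded_bilinear_mult] Suc fk U C_k_on_const)
  qed
 qed
 thus ?thesis using U by (simp add: Cinf_def)
qed

text \<open>Functions that are linear in a second argument, such as derivatives and metrics in charts, are
 expanded in the standard basis.\<close>

lemma Cinf_apply_linear:
 fixes L :: "'a::euclidean_space => 'b::euclidean_space => 'c::real_normed_vector"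
 assumes "!!x. x : U ==> linear (L x)" "!!v. Cinf (%x. L x v) U" "Cinf w U"
 shows "Cinf (%x. L x (w x)) U"
proof -
 have U: "open U" using assms(3) by (rule Cinf_open)
 have "Cinf (%x. SUM b:Basis. (w x \<bullet> b) *\<^sub>R L x b) U"
  using U by (intro Cinf_sum Cinf_scaleR Cinf_inner Cinf_const assms)
 thus ?thesis
 proof (rule Cinf_cong)
  fix x assume "x : U"
  thus "(SUM b:Basis. (w x \<bullet> b) *\<^sub>R L x b) = L x (w x)"
   using assms(1)[of x] by (intro linear_basis_expansion[symmetric])
 qed
qed

lemma Cinf_apply_bilinear:
 fixes L :: "'a::euclidean_space => 'b::euclidean_space => 'd::euclidean_space => 'c::real_normed_vector"
 assumes "!!x. x : U ==> bilinear (L x)" "!!v w. Cinf (%x. L x v w) U" "Cinf v U" "Cinf w U"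
 shows "Cinf (%x. L x (v x) (w x)) U"
proof (rule Cinf_apply_linear[where L="%x. L x (v x)"])
 show "linear (L x (v x))" if "x : U" for x
  using assms(1)[OF that] by (simp add: bilinear_def)
 show "Cinf (%x. L x (v x) w) U" for w
 proof (rule Cinf_apply_linear[where L="%x u. L x u w"])
  show "linear (%u. L x u w)" if "x : U" for x
   using assms(1)[OF that] by (simp add: bilinear_def)
 qed (rule assms)+
qed (rule assms)

text \<open>Along \<open>h\<close>, the difference \<open>f (h s t) - f (h 0 t)\<close> is the
  integral over \<open>r\<close> from 0 to \<open>s\<close> of the derivative in direction
  \<open>u\<close>. Differentiating in \<open>t\<close> at 0 under the integral sign, and the
  outcome in \<open>s\<close> at 0, produces the mixed derivative in both orders.\<close>

lemma second_derivative_symmetric: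
 fixes f :: "'a::euclidean_space => 'b::euclidean_space"
 assumes f: "Cinf f U" and x: "x : U"
 shows "FD (%z. FD f z u) x v = FD (%z. FD f z v) x u"
proof -
 let ?Du = "%z. FD f z u" and ?Dv = "%z. FD f z v"
 define h where "h s t = x + s *\<^sub>R u + t *\<^sub>R v" for s t
 have "open ((%z. h (fst z) (snd z)) -` U)"
  unfolding h_def by (intro open_vimage Cinf_open[OF f] continuous_intros)
 moreover have "(0, 0) : (%z. h (fst z) (snd z)) -` U" using x by (simp add: h_def)
 ultimately obtain S T where ST: "open S" "open T" "0 : S" "0 : T" "S \<times> T <= (%z. h (fst z) (snd z)) -` U"
  by (rule open_prod_elim) auto
 obtain a b where "a > 0" "cball 0 a <= S" "b > 0" "cball 0 b <= T"
  using ST open_contains_cball by metis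
 then obtain e where e: "e > 0" "!!s t. s : {-e..e} ==> t : {-e..e} ==> h s t : U"
  using ST(5) by (intro that[of "min a b"]) (auto simp: subset_iff abs_le_iff)
 have ds: "((%s. g (h s t)) has_vector_derivative FD g (h s t) u) (at s within X)"
  and dt: "((%t. g (h s t)) has_vector_derivative FD g (h s t) v) (at t within X)"
  if g: "Cinf g U" and st: "s : {-e..e}" "t : {-e..e}" for g :: "'a => 'b" and s t X
 proof -
  note d = Cinf_deriv[OF g e(2)[OF st]] and lin = Cinf_frechet_linear[OF g e(2)[OF st]]
  have "((%s. h s t) has_derivative (%r. r *\<^sub>R u)) (at s within X)" "((%t. h s t) has_derivative (%r. r *\<^sub>R v)) (at t within X)"
   unfolding h_def by (auto intro!: derivative_eq_intros)
  from has_derivative_compose[OF this(1) d] has_derivative_compose[OF this(2) d]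
  show "((%s. g (h s t)) has_vector_derivative FD g (h s t) u) (at s within X)"
   "((%t. g (h s t)) has_vector_derivative FD g (h s t) v) (at t within X)"
   by (simp_all add: has_vector_derivative_def linear_scale[OF lin])
 qed
 note Cu = Cinf_frechet[OF f, of u] and Cv = Cinf_frechet[OF f, of v]
 have c: "continuous_on X (%z. g (h (p z) (q z)))"
  if "Cinf g U" "continuous_on X p" "continuous_on X q" "p ` X <= {-e..e}" "q ` X <= {-e..e}"
  for g :: "'a => 'b" and X :: "'c::topological_space set" and p q
 proof (rule continuous_on_compose2[OF Cinf_continuous[OF that(1)]])
  show "continuous_on X (%z. h (p z) (q z))" unfolding h_def by (intro continuous_intros that)
  show "(%z. h (p z) (q z)) ` X <= U" using that(4,5) by (auto intro!: e(2) simp del: atLeastAtMost_iff)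
 qed
 have int: "integral {0..s} (%r. FD ?Du (h r 0) v) = ?Dv (h s 0) - ?Dv (h 0 0)" if s: "s : {0..e}" for s
 proof -
  have I: "integral {0..s} (%r. ?Du (h r t)) = f (h s t) - f (h 0 t)" if "t : {-e..e}" for t
   by (rule integral_unique, rule fundamental_theorem_of_calculus) (use s that ds[OF f] in auto)
  have "((%t. integral (cbox 0 s) (%r. ?Du (h r t))) has_vector_derivative integral (cbox 0 s) (%r. FD ?Du (h r 0) v)) (at 0 within {-e..e})"
  proof (rule leibniz_rule_vector_derivative)
   show "((%t. ?Du (h r t)) has_vector_derivative FD ?Du (h r t) v) (at t within {-e..e})" if "t : {-e..e}" "r : cbox 0 s" for t r
    by (rule dt[OF Cu]) (use that s in auto)
   show "(%r. ?Du (h r t)) integrable_on cbox 0 s" if "t : {-e..e}" for t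
    by (rule integrable_continuous, rule c[OF Cu]) (insert that s, auto intro!: continuous_intros)
   show "continuous_on ({-e..e} \<times> cbox 0 s) (%(t, r). FD ?Du (h r t) v)"
    unfolding split_beta by (rule c[OF Cinf_frechet[OF Cu]]) (insert s, auto intro!: continuous_intros)
  qed (use e in auto)
  moreover have "((%t. f (h s t) - f (h 0 t)) has_vector_derivative ?Dv (h s 0) - ?Dv (h 0 0)) (at 0 within {-e..e})"
   by (intro derivative_intros dt[OF f]) (use s e in auto)
  hence "((%t. integral (cbox 0 s) (%r. ?Du (h r t))) has_vector_derivative ?Dv (h s 0) - ?Dv (h 0 0)) (at 0 within {-e..e})"
   by (rule has_vector_derivative_transform[rotated 2]) (use e I in auto)
  ultimately show ?thesis
   using vector_derivative_unique_within_closed_interval[of "-e" e 0] e by (simp add: cbox_interval)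
 qed
 have "((%s. integral {0..s} (%r. FD ?Du (h r 0) v)) has_vector_derivative FD ?Du (h 0 0) v) (at 0 within {0..e})"
  by (rule integral_has_vector_derivative, rule c[OF Cinf_frechet[OF Cu]]) (insert e, auto intro!: continuous_intros)
 hence "((%s. ?Dv (h s 0) - ?Dv (h 0 0)) has_vector_derivative FD ?Du (h 0 0) v) (at 0 within {0..e})"
  by (rule has_vector_derivative_transform[rotated 2]) (use e int in auto)
 moreover have "((%s. ?Dv (h s 0) - ?Dv (h 0 0)) has_vector_derivative FD ?Dv (h 0 0) u - 0) (at 0 within {0..e})"
  by (intro derivative_intros ds[OF Cv]) (use e in auto)
 ultimately have "FD ?Du (h 0 0) v = FD ?Dv (h 0 0) u"
  using vector_derivative_unique_within_closed_interval[of 0 e 0] e by (simp add: cbox_interval)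
 thus ?thesis by (simp add: h_def)
qed

section \<open>Alternating forms and determinants\<close>

lemma alternating_swap:
 assumes "alternating_multilinear om" "i ~= j"
 shows "om (u o Transposition.transpose i j) = - om u"
proof -
 have lin: "linear (%v. om (u(i := v)))" for u i using assms(1) by (simp add: alternating_multilinear_def)
 have alt: "om u = 0" if "u i = u j" for u using assms that unfolding alternating_multilinear_def by blast
 let ?f = "%a b. om (u(i := a, j := b))"
 have l1: "?f (a + a') b = ?f a b + ?f a' b" for a a' b
  using linear_add[OF lin[of "u(j := b)" i], of a a'] assms(2) by (simp add: fun_upd_twist)
 have l2: "?f a (b + b') = ?f a b + ?f a b'" for a b b'
  using linear_add[OF lin[of "u(i := a)" j], of b b'] by simp
 have z: "?f a a = 0" for a using alt[of "u(i := a, j := a)"] assms(2) by simp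
 have "?f (u i + u j) (u i + u j) = ?f (u i) (u i) + ?f (u j) (u i) + (?f (u i) (u j) + ?f (u j) (u j))"
  by (simp only: l1 l2)
 hence "?f (u j) (u i) = - ?f (u i) (u j)" unfolding z by simp
 moreover have "u(i := u j, j := u i) = u o Transposition.transpose i j"
  by (auto simp: fun_eq_iff Transposition.transpose_def)
 ultimately show ?thesis by simp
qed

text \<open>Both sides are multiplicative in \<open>M\<close>, so elementary matrices suffice: a
  zero row, diagonal matrices, transpositions, and the addition of a multiple of one row to another.
  The system \<open>u\<close> stays arbitrary in the induction because the product case applies the
  claim for \<open>A\<close> to the system already transformed by \<open>B\<close>.\<close>

lemma alternating_multilinear_det:
 fixes om :: "('k::finite => 'e::real_vector) => real" and M :: "real^'k^'k"
 assumes "alternating_multilinear om"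
 shows "om (%i. SUM j:UNIV. M $ i $ j *\<^sub>R u j) = det M * om u"
proof (induction M arbitrary: u rule: induct_matrix_elementary)
 case (1 A B)
 have "(%i. SUM j:UNIV. (A ** B) $ i $ j *\<^sub>R u j) = (%i. SUM k:UNIV. A $ i $ k *\<^sub>R (SUM j:UNIV. B $ k $ j *\<^sub>R u j))"
  by (auto simp: fun_eq_iff matrix_matrix_mult_def scaleR_sum_right scaleR_sum_left intro: sum.swap)
 thus ?case by (simp add: 1 det_mul)
next
 case (2 A i)
 have "linear (%v. om ((%i. SUM j:UNIV. A $ i $ j *\<^sub>R u j)(i := v)))"
  using assms by (simp add: alternating_multilinear_def)
 hence "om ((%i. SUM j:UNIV. A $ i $ j *\<^sub>R u j)(i := 0)) = 0" by (rule linear_0)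
 moreover have "(SUM j:UNIV. A $ i $ j *\<^sub>R u j) = 0" using 2 by (simp add: row_def vec_eq_iff)
 hence "(%i. SUM j:UNIV. A $ i $ j *\<^sub>R u j)(i := 0) = (%i. SUM j:UNIV. A $ i $ j *\<^sub>R u j)" by auto
 moreover have "det A = 0" using det_zero_row(2)[of i A] 2 by simp
 ultimately show ?case by simp
next
 case (3 A)
 have "(SUM j:UNIV. A $ i $ j *\<^sub>R u j) = A $ i $ i *\<^sub>R u i" for i
  using 3 by (subst sum.remove[of _ i]) (auto intro!: sum.neutral)
 moreover have "om (%i. if i : I then c i *\<^sub>R u i else u i) = (PROD i:I. c i) * om u" if "finite I" for I c
  using that
 proof induction
  case (insert k I)
  let ?w = "%i. if i : I then c i *\<^sub>R u i else u i"
  have "linear (%v. om (?w(k := v)))" using assms by (simp add: alternating_multilinear_def)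
  hence "om (?w(k := c k *\<^sub>R u k)) = c k *\<^sub>R om (?w(k := u k))" by (rule linear_scale)
  moreover have "?w(k := u k) = ?w" using insert by auto
  moreover have "?w(k := c k *\<^sub>R u k) = (%i. if i : insert k I then c i *\<^sub>R u i else u i)" by auto
  ultimately show ?case using insert by simp
 qed simp
 from this[of UNIV "%i. A $ i $ i"] have "om (%i. A $ i $ i *\<^sub>R u i) = (PROD i:UNIV. A $ i $ i) * om u" by simp
 moreover have "det A = (PROD i:UNIV. A $ i $ i)" using 3 by (intro det_diagonal) auto
 ultimately show ?case by simp
next
 case (4 m n)
 let ?T = "\<chi> i j. mat 1 $ i $ Transposition.transpose m n j :: real^'k^'k"
 have "(SUM j:UNIV. ?T $ i $ j *\<^sub>R u j) = (u o Transposition.transpose m n) i" for i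
 proof -
  have "(SUM j:UNIV. ?T $ i $ j *\<^sub>R u j) = (SUM j:UNIV. if j = Transposition.transpose m n i then u j else 0)"
   by (rule sum.cong) (auto simp: mat_def)
  thus ?thesis by simp
 qed
 hence "om (%i. SUM j:UNIV. ?T $ i $ j *\<^sub>R u j) = - om u"
  using alternating_swap[OF assms 4] by presburger
 moreover have "det ?T = - 1"
 proof -
  have "det (\<chi> i. (mat 1 :: real^'k^'k) $ Transposition.transpose m n i) = of_int (sign (Transposition.transpose m n)) * det (mat 1 :: real^'k^'k)"
   by (rule det_permute_rows) (simp add: permutes_swap_id)
  moreover have "?T = (\<chi> i. mat 1 $ Transposition.transpose m n i)"
   by (auto simp: vec_eq_iff mat_def Transposition.transpose_def)
  ultimately show ?thesis using 4 by (simp add: sign_swap_id)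
 qed
 ultimately show ?case by simp
next
 case (5 m n c)
 let ?T = "\<chi> i j. if i = m & j = n then c else of_bool (i = j) :: real^'k^'k"
 have e: "(SUM j:UNIV. ?T $ i $ j *\<^sub>R u j) = (if i = m then u m + c *\<^sub>R u n else u i)" for i
 proof -
  have "(SUM j:UNIV. ?T $ i $ j *\<^sub>R u j) = (SUM j:UNIV. (if j = i then u j else 0) + (if j = n then (if i = m then c *\<^sub>R u j else 0) else 0))"
   using 5 by (intro sum.cong) auto
  thus ?thesis by (simp add: sum.distrib)
 qed
 have lin: "linear (%v. om (u(m := v)))" using assms by (simp add: alternating_multilinear_def)
 have "(%i. SUM j:UNIV. ?T $ i $ j *\<^sub>R u j) = u(m := u m + c *\<^sub>R u n)"
  by (rule ext) (subst e, simp)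
 hence "om (%i. SUM j:UNIV. ?T $ i $ j *\<^sub>R u j) = om u + c * om (u(m := u n))"
  by (simp add: linear_add[OF lin] linear_scale[OF lin])
 moreover have "om (u(m := u n)) = 0"
  using assms 5 unfolding alternating_multilinear_def by (metis fun_upd_other fun_upd_same)
 moreover have "det ?T = 1"
 proof -
  have "?T = (\<chi> k. if k = m then row m (mat 1) + c *s row n (mat 1) else row k (mat 1))"
   using 5 by (auto simp: vec_eq_iff row_def mat_def)
  thus ?thesis using det_row_operation[OF 5, of "mat 1 :: real^'k^'k" c] by simp
 qed
 ultimately show ?case by simp
qed

text \<open>Expand \<open>det\<close> at the identity: a permutation other than the identity moves two indices, so its
 term vanishes to second order.\<close>

lemma has_derivative_det_id:
 fixes N :: "'a::real_normed_vector => real^'n^'n"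
 assumes d: "!!i j. ((%x. N x $ i $ j) has_derivative (%h. N' h $ i $ j)) (at x within S)" and id: "N x = mat 1"
 shows "((%x. det (N x)) has_derivative (%h. trace (N' h))) (at x within S)"
proof -
 let ?X = "%h p. SUM i:UNIV. N' h $ i $ p i * (PROD j:UNIV - {i}. N x $ j $ p j)"
 let ?P = "{p. p permutes (UNIV :: 'n set)}"
 have "((%x. det (N x)) has_derivative
  (%h. SUM p:?P. of_int (sign p) * ?X h p)) (at x within S)"
  unfolding det_def by (auto intro!: derivative_eq_intros d)
 moreover have "(SUM p:?P. of_int (sign p) * ?X h p) = trace (N' h)" for h
 proof -
  have z: "?X h p = 0" if p: "p permutes UNIV" "p ~= id" for p
  proof (rule sum.neutral, rule)
   fix i :: 'n
   have "EX j. j ~= i & p j ~= j"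
   proof (rule ccontr)
    assume "~ (EX j. j ~= i & p j ~= j)"
    hence fx: "p j = j" if "j ~= i" for j using that by blast
    have "p i = i" using permutes_inj[OF p(1)] fx by (metis injD)
    with fx have "p = id" by (metis eq_id_iff)
    with p show False by simp
   qed
   then obtain j where "j ~= i" "p j ~= j" by blast
   hence "(PROD j:UNIV - {i}. N x $ j $ p j) = 0"
    by (intro prod_zero) (auto simp: id mat_def intro!: bexI[of _ j])
   thus "N' h $ i $ p i * (PROD j:UNIV - {i}. N x $ j $ p j) = 0" by simp
  qed
  have "(SUM p:?P. of_int (sign p) * ?X h p)
   = of_int (sign (id :: 'n => 'n)) * (SUM i:UNIV. N' h $ i $ id i * (PROD j:UNIV - {i}. N x $ j $ id j))"
   by (subst sum.remove[of _ id]) (auto simp: permutes_id z intro!: sum.neutral)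
  also have "... = trace (N' h)"
   by (simp add: id mat_def trace_def)
  finally show ?thesis .
 qed
 ultimately show ?thesis by simp
qed

lemma matrix_inv_mult:
 fixes A :: "real^'n^'n"
 assumes "det A ~= 0"
 shows "A ** matrix_inv A = mat 1" "matrix_inv A ** A = mat 1"
proof -
 have "EX A'. A ** A' = mat 1 & A' ** A = mat 1"
  using assms invertible_det_nz invertible_def by blast
 hence "A ** matrix_inv A = mat 1 & matrix_inv A ** A = mat 1"
  unfolding matrix_inv_def by (rule someI_ex)
 thus "A ** matrix_inv A = mat 1" "matrix_inv A ** A = mat 1" by auto
qed

text \<open>Jacobi's formula. Left multiplication by the inverse of \<open>M x\<close> moves the
  base point to the identity matrix, where the derivative of \<open>det\<close> is the trace; the
  factor \<open>det (M x)\<close> undoes this normalisation.\<close>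

lemma has_derivative_det:
 fixes M :: "'a::real_normed_vector => real^'n^'n"
 assumes d: "!!i j. ((%x. M x $ i $ j) has_derivative (%h. M' h $ i $ j)) (at x within S)" and nz: "det (M x) ~= 0"
 shows "((%x. det (M x)) has_derivative
  (%h. det (M x) * (SUM i:UNIV. SUM j:UNIV. matrix_inv (M x) $ i $ j * M' h $ j $ i))) (at x within S)"
proof -
 define A where "A = matrix_inv (M x)"
 have "((%y. (A ** M y) $ i $ j) has_derivative (%h. (A ** M' h) $ i $ j)) (at x within S)" for i j
  unfolding matrix_matrix_mult_def by (auto intro!: derivative_eq_intros d)
 hence "((%y. det (A ** M y)) has_derivative (%h. trace (A ** M' h))) (at x within S)"
  by (rule has_derivative_det_id) (simp add: A_def matrix_inv_mult nz)
 hence "((%y. det (M x) * det (A ** M y)) has_derivative (%h. det (M x) * trace (A ** M' h))) (at x within S)"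
  by (rule has_derivative_mult_right)
 moreover have "det (M x) * det A = 1"
  using arg_cong[OF matrix_inv_mult(1)[OF nz], of det] by (simp add: det_mul A_def)
 hence "det (M x) * det (A ** M y) = det (M y)" for y
  by (simp add: det_mul mult.assoc[symmetric])
 moreover have "trace (A ** M' h) = (SUM i:UNIV. SUM j:UNIV. A $ i $ j * M' h $ j $ i)" for h
  by (simp add: trace_def matrix_matrix_mult_def)
 ultimately show ?thesis by (simp add: A_def)
qed

text \<open>Cramer's rule turns the entries of the inverse into quotients of determinants, from
  which smoothness of the inverse matrix is read off.\<close>

lemma matrix_inv_cramer:
 fixes A :: "real^'n^'n"
 assumes "det A ~= 0"
 shows "matrix_inv A $ k $ l = det (\<chi> i j. if j = k then ax l $ i else A $ i $ j) / det A"
proof -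
 have "A *v (matrix_inv A *v ax l) = ax l"
  by (simp add: matrix_vector_mul_assoc matrix_inv_mult assms)
 hence "matrix_inv A *v ax l = (\<chi> k. det (\<chi> i j. if j = k then ax l $ i else A $ i $ j) / det A)"
  using cramer[OF assms] by blast
 moreover have "(matrix_inv A *v ax l) $ k = matrix_inv A $ k $ l"
  by (simp add: matrix_vector_mult_basis column_def)
 ultimately show ?thesis by simp
qed

lemma Cinf_matrix_inv:
 fixes f :: "'a::euclidean_space => real^'n^'n"
 assumes U: "open U" and f: "!!i j. Cinf (%x. f x $ i $ j) U" and nz: "!!x. x : U ==> det (f x) ~= 0"
 shows "Cinf (%x. matrix_inv (f x) $ k $ l) U"
proof -
 have "Cinf (%x. det (\<chi> i j. if j = k then ax l $ i else f x $ i $ j) / det (f x)) U"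
 proof (intro Cinf_divide Cinf_det U f nz)
  show "Cinf (%x. (\<chi> i j. if j = k then ax l $ i else f x $ i $ j) $ i $ j) U" for i j
   by (cases "j = k") (insert f U, simp_all add: Cinf_const)
 qed
 thus ?thesis by (rule Cinf_cong) (simp add: matrix_inv_cramer nz)
qed

section \<open>Inner products, Gram matrices and metric traces\<close>

definition inner_form :: "('v::real_vector => 'v => real) => bool" where
 "inner_form b \<longleftrightarrow> bilinear b & (ALL u v. b u v = b v u) & (ALL u. u ~= 0 --> b u u > 0)"

lemma inner_formD:
 assumes "inner_form b"
 shows "bilinear b" "b u v = b v u" "u ~= 0 ==> b u u > 0" "b u u >= 0" "b u u = 0 \<longleftrightarrow> u = 0"
proof -
 show b: "bilinear b" "b u v = b v u" and p: "u ~= 0 ==> b u u > 0"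
  using assms by (auto simp: inner_form_def)
 show "b u u >= 0" "b u u = 0 \<longleftrightarrow> u = 0"
  using p bilinear_lzero[OF b(1), of u] by (cases "u = 0"; force)+
qed

text \<open>Gram-Schmidt for \<open>b\<close>: as long as there are fewer vectors than the
  dimension, some \<open>v\<close> lies outside their span, and its component orthogonal to them is
  normalised.\<close>

lemma orthonormal_family_exists:
 fixes b :: "'v::euclidean_space => 'v => real"
 assumes b: "inner_form b" and "finite I" "card I <= DIM('v)"
 shows "EX e. ALL i:I. ALL j:I. b (e i) (e j) = (if i = j then 1 else 0)"
 using assms(2,3)
proof (induction I)
 case (insert k I)
 then obtain e where e: "!!i j. i : I ==> j : I ==> b (e i) (e j) = (if i = j then 1 else 0)" by auto
 have bl: "bilinear b" and sym: "!!u v. b u v = b v u" using inner_formD[OF b] by auto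
 have "dim (span (e ` I)) <= card I"
  using dim_le_card[of "span (e ` I)" "e ` I"] insert card_image_le[of I e] by simp
 hence "span (e ` I) ~= UNIV" using insert by (metis card_insert_disjoint dim_UNIV not_less_eq_eq order_trans)
 then obtain v where v: "v ~: span (e ` I)" by blast
 define w where "w = v - (SUM i:I. b v (e i) *\<^sub>R e i)"
 have "(SUM i:I. b v (e i) *\<^sub>R e i) : span (e ` I)" by (intro span_sum span_scale span_base) auto
 hence "w ~= 0" using v by (auto simp: w_def)
 hence pos: "b w w > 0" by (rule inner_formD(3)[OF b])
 have orth: "b w (e j) = 0" if "j : I" for j
 proof -
  have "b w (e j) = b v (e j) - (SUM i:I. b v (e i) * b (e i) (e j))"
   by (simp add: w_def bilinear_lsub[OF bl] linear_sum[OF bl[unfolded bilinear_def, THEN conjunct2, rule_format]] bilinear_lmul[OF bl])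
  also have "(SUM i:I. b v (e i) * b (e i) (e j)) = (SUM i:I. if i = j then b v (e j) else 0)"
   by (rule sum.cong) (auto simp: e that)
  finally show ?thesis using that insert by simp
 qed
 define e' where "e' = e(k := (1 / sqrt (b w w)) *\<^sub>R w)"
 show ?case
  by (rule exI[of _ e'])
   (insert insert pos orth e sym, auto simp: e'_def bilinear_lmul[OF bl] bilinear_rmul[OF bl])
qed simp

lemma bilinear_sum_sum:
 assumes "bilinear b"
 shows "b (SUM i:I. c i *\<^sub>R x i) (SUM j:J. d j *\<^sub>R y j) = (SUM i:I. SUM j:J. (c i * d j) *\<^sub>R b (x i) (y j))"
proof -
 have l: "linear (b x)" "linear (%x. b x y)" for x y using assms by (auto simp: bilinear_def)
 have "b (SUM i:I. c i *\<^sub>R x i) (SUM j:J. d j *\<^sub>R y j) = (SUM i:I. c i *\<^sub>R b (x i) (SUM j:J. d j *\<^sub>R y j))"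
  by (simp only: linear_sum[OF l(2)] linear_scale[OF l(2)])
 also have "... = (SUM i:I. c i *\<^sub>R (SUM j:J. d j *\<^sub>R b (x i) (y j)))"
  by (simp only: linear_sum[OF l(1)] linear_scale[OF l(1)])
 finally show ?thesis by (simp add: scaleR_sum_right)
qed

abbreviation gram :: "(real^'m => real^'m => real) => real^'m^'m" where
 "gram b \<equiv> \<chi> i j. b (ax i) (ax j)"

lemma vec_axis_expansion: "(v :: real^'m) = (SUM i:UNIV. v $ i *\<^sub>R ax i)"
 by (simp add: vec_eq_iff axis_def if_distrib[of "(*) _"] cong: if_cong)

lemma bilinear_gram:
 fixes b :: "real^'m => real^'m => 'w::real_vector"
 assumes "bilinear b"
 shows "b u v = (SUM i:UNIV. SUM j:UNIV. (u $ i * v $ j) *\<^sub>R b (ax i) (ax j))"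
 by (subst (1) vec_axis_expansion[of u], subst vec_axis_expansion[of v]) (rule bilinear_sum_sum[OF assms])

text \<open>Source of two frame formulas for the frame matrix \<open>E\<close> and the Gram matrix
  \<open>G\<close>: determinants give \<open>(det E)^2 det G = 1\<close>, which evaluates volume
  densities, and inversion gives \<open>G^-1 = E^T E\<close>, which evaluates metric traces.\<close>

lemma gram_orthonormal:
 fixes b :: "real^'m => real^'m => real"
 assumes b: "bilinear b" and e: "orthonormal_system b e"
 shows "(\<chi> i. e i) ** gram b ** transpose (\<chi> i. e i) = mat 1"
proof -
 have "((\<chi> i. e i) ** gram b ** transpose (\<chi> i. e i)) $ k $ l = b (e k) (e l)" for k l
 proof -
  have "((\<chi> i. e i) ** gram b ** transpose (\<chi> i. e i)) $ k $ l = (SUM j:UNIV. SUM i:UNIV. e k $ i * b (ax i) (ax j) * e l $ j)"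
   by (simp add: matrix_matrix_mult_def transpose_def sum_distrib_right)
  also have "... = (SUM i:UNIV. SUM j:UNIV. e k $ i * b (ax i) (ax j) * e l $ j)"
   by (rule sum.swap)
  also have "... = b (e k) (e l)"
   unfolding bilinear_gram[OF b, of "e k" "e l"] by (intro sum.cong refl) simp
  finally show ?thesis .
 qed
 thus ?thesis using e by (simp add: vec_eq_iff mat_def orthonormal_system_def)
qed

lemma orthonormal_frame_exists:
 fixes b :: "real^'m => real^'m => real"
 assumes b: "inner_form b"
 obtains e :: "'m => real^'m" where "orthonormal_system b e" "det (\<chi> i. e i) > 0"
proof -
 have bl: "bilinear b" using inner_formD[OF b] by simp
 obtain e :: "'m => real^'m" where e: "orthonormal_system b e"
  using orthonormal_family_exists[OF b, of "UNIV :: 'm set"] unfolding orthonormal_system_def by auto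
 have "det (\<chi> i. e i) ~= 0"
  using arg_cong[OF gram_orthonormal[OF bl e], of det] by (auto simp: det_mul)
 then consider "det (\<chi> i. e i) > 0" | "det (\<chi> i. e i) < 0" by linarith
 thus ?thesis
 proof cases
  case 2
  \<comment> \<open>Reversing one vector, no matter which, changes the orientation and keeps the
    system orthonormal.\<close>
  fix k :: 'm
  define e' where "e' = e(k := - e k)"
  have "(\<chi> i. e' i) = (\<chi> i. if i = k then (- 1) *s e i else e i)"
   by (auto simp: vec_eq_iff e'_def)
  hence "det (\<chi> i. e' i) = - det (\<chi> i. e i)"
   using det_row_mul[of k "- 1" e e] by (simp del: fun_upd_apply)
  moreover have "orthonormal_system b e'"
   using e by (auto simp: orthonormal_system_def e'_def bilinear_lneg[OF bl] bilinear_rneg[OF bl])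
  ultimately show ?thesis using 2 that by simp
 qed (use e that in blast)
qed

lemma det_gram_orthonormal:
 fixes b :: "real^'m => real^'m => real"
 assumes "bilinear b" "orthonormal_system b e"
 shows "(det (\<chi> i. e i))^2 * det (gram b) = 1"
 using arg_cong[OF gram_orthonormal[OF assms], of det] by (simp add: det_mul power2_eq_square mult_ac)

lemma det_gram_pos:
 fixes b :: "real^'m => real^'m => real"
 assumes b: "inner_form b"
 shows "det (gram b) > 0"
proof -
 obtain e :: "'m => real^'m" where "orthonormal_system b e" using orthonormal_frame_exists[OF b] .
 from det_gram_orthonormal[OF inner_formD(1)[OF b] this] show ?thesis
  by (metis less_eq_real_def linorder_not_le mult_nonneg_nonpos not_one_le_zero zero_le_power2)
qed

lemma sqrt_det_gram_orthonormal:
 fixes b :: "real^'m => real^'m => real"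
 assumes b: "inner_form b" and e: "orthonormal_system b e" "det (\<chi> i. e i) > 0"
 shows "det (\<chi> i. e i) * sqrt (det (gram b)) = 1"
proof -
 have "sqrt ((det (\<chi> i. e i))^2 * det (gram b)) = 1"
  using det_gram_orthonormal[OF inner_formD(1)[OF b] e(1)] by simp
 thus ?thesis using e(2) by (simp add: real_sqrt_mult)
qed

text \<open>The matrix of an oriented orthonormal frame has determinant
  \<open>1 / sqrt (det (gram b))\<close>. A form whose values on such frames are known, as for a
  calibration, thereby becomes known on the coordinate frame.\<close>

lemma alternating_axis_orthonormal:
 fixes b :: "real^'m => real^'m => real" and om :: "('m => real^'m) => real"
 assumes b: "inner_form b" and e: "orthonormal_system b e" "det (\<chi> i. e i) > 0"
  and om: "alternating_multilinear om"
 shows "om (%i. ax i) = sqrt (det (gram b)) * om e"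
proof -
 have "om (%i. SUM j:UNIV. (\<chi> i. e i) $ i $ j *\<^sub>R ax j) = det (\<chi> i. e i) * om (%i. ax i)"
  by (rule alternating_multilinear_det[OF om])
 moreover have "(%i. SUM j:UNIV. (\<chi> i. e i) $ i $ j *\<^sub>R ax j) = e"
  using vec_axis_expansion[of "e _"] by (auto simp: fun_eq_iff)
 ultimately have "sqrt (det (gram b)) * om e = (det (\<chi> i. e i) * sqrt (det (gram b))) * om (%i. ax i)"
  by simp
 thus ?thesis using sqrt_det_gram_orthonormal[OF b e] by simp
qed

lemma metric_trace_orthonormal:
 fixes b :: "real^'m => real^'m => real" and T :: "real^'m => real^'m => 'v::real_vector"
 assumes b: "bilinear b" and e: "orthonormal_system b (e :: 'm => real^'m)" and T: "bilinear T"
 shows "metric_trace b T = (SUM k:UNIV. T (e k) (e k))"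
proof -
 define E where "E = (\<chi> i. e i)"
 have 1: "E ** gram b ** transpose E = mat 1" using gram_orthonormal[OF b e] by (simp add: E_def)
 have "det E * det (gram b) * det E = 1" using arg_cong[OF 1, of det] by (simp add: det_mul)
 hence nz: "det (gram b) ~= 0" by auto
 have "transpose E ** (E ** gram b) = mat 1" using 1 matrix_left_right_inverse by blast
 hence "(transpose E ** E) ** gram b ** matrix_inv (gram b) = matrix_inv (gram b)"
  by (simp add: matrix_mul_assoc)
 hence "matrix_inv (gram b) = transpose E ** E"
  by (simp add: matrix_mul_assoc[symmetric] matrix_inv_mult[OF nz])
 hence inv: "matrix_inv (gram b) $ i $ j = (SUM k:UNIV. e k $ i * e k $ j)" for i j
  by (simp add: matrix_matrix_mult_def transpose_def E_def)
 have "metric_trace b T = (SUM i:UNIV. SUM j:UNIV. SUM k:UNIV. (e k $ i * e k $ j) *\<^sub>R T (ax i) (ax j))"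
  by (simp add: metric_trace_def inv scaleR_sum_left)
 also have "... = (SUM i:UNIV. SUM k:UNIV. SUM j:UNIV. (e k $ i * e k $ j) *\<^sub>R T (ax i) (ax j))"
  by (intro sum.cong refl sum.swap)
 also have "... = (SUM k:UNIV. SUM i:UNIV. SUM j:UNIV. (e k $ i * e k $ j) *\<^sub>R T (ax i) (ax j))"
  by (rule sum.swap)
 also have "... = (SUM k:UNIV. T (e k) (e k))"
  by (intro sum.cong refl bilinear_gram[OF T, symmetric])
 finally show ?thesis .
qed

lemma bilinear_compose:
 assumes "bilinear T" "linear S" "linear S'"
 shows "bilinear (%u v. T (S u) (S' v))"
 unfolding bilinear_def
proof (intro conjI allI)
 show "linear (%v. T (S u) (S' v))" for u
  using linear_compose[OF assms(3), of "T (S u)"] assms(1) by (simp add: bilinear_def o_def)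
 show "linear (%u. T (S u) (S' v))" for v
  using linear_compose[OF assms(2), of "%u. T u (S' v)"] assms(1) by (simp add: bilinear_def o_def)
qed

text \<open>\<open>R\<close> carries an orthonormal frame of \<open>b\<close> to one of
  \<open>b'\<close>, and over these two frames both traces are the same sum. Independence of metric
  traces from charts rests on this.\<close>

lemma metric_trace_transform:
 fixes b b' :: "real^'m => real^'m => real" and T T' :: "real^'m => real^'m => 'v::real_vector"
 assumes b: "inner_form b" and T: "bilinear T" and S: "linear S" "linear R" "!!u. S (R u) = u"
  and b': "!!u v. b' u v = b (S u) (S v)" and T': "!!u v. T' u v = T (S u) (S v)"
 shows "metric_trace b' T' = metric_trace b T"
proof -
 obtain e :: "'m => real^'m" where e: "orthonormal_system b e" using orthonormal_frame_exists[OF b] .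
 have bl: "bilinear b" using inner_formD[OF b] by simp
 have bl': "bilinear b'" "bilinear T'"
  using bilinear_compose[OF bl S(1) S(1)] bilinear_compose[OF T S(1) S(1)]
  by (simp_all add: b'[abs_def] T'[abs_def])
 have "orthonormal_system b' (%i. R (e i))"
  using e by (simp add: orthonormal_system_def b' S(3))
 thus ?thesis
  using metric_trace_orthonormal[OF bl e T] metric_trace_orthonormal[OF bl'(1) _ bl'(2)] by (simp add: T' S(3))
qed

section \<open>Cut-off functions and parameter integrals\<close>

lemma Cinf_ident: "open U ==> Cinf (%x. x) U"
 by (intro Cinf_linear bounded_linear_ident)

text \<open>The functions \<open>exp (-1/x) x^(-n)\<close>, extended by 0. The exponent is carried
  along because differentiation maps the family into linear combinations of its members, so that one
  induction proves all of them smooth.\<close>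

definition flat_exp :: "nat => real => real" where
 "flat_exp n x = (if x > 0 then exp (- inverse x) * inverse x ^ n else 0)"

lemma flat_exp_tendsto_0: "(flat_exp n \<longlongrightarrow> 0) (at 0)"
proof -
 have "((%x. inverse x ^ n / exp (inverse x)) \<longlongrightarrow> (0::real)) (at_right 0)"
  by (rule filterlim_compose[OF tendsto_power_div_exp_0 filterlim_inverse_at_top_right])
 moreover have "eventually (%x. inverse x ^ n / exp (inverse x) = flat_exp n x) (at_right 0)"
  by (auto simp: eventually_at_filter flat_exp_def exp_minus field_simps)
 ultimately have "(flat_exp n \<longlongrightarrow> 0) (at_right 0)"
  by (rule Lim_transform_eventually)
 moreover have "(flat_exp n \<longlongrightarrow> 0) (at_left 0)"
  by (rule tendsto_eventually) (auto simp: eventually_at_filter flat_exp_def)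
 ultimately show ?thesis by (simp add: filterlim_at_split)
qed

lemma flat_exp_deriv:
 "HR (flat_exp n) (flat_exp (n + 2) x - real n * flat_exp (n + 1) x) x"
proof -
 consider "x > 0" | "x < 0" | "x = 0" by linarith
 thus ?thesis
 proof cases
  case 1
  have "((%x. exp (- inverse x) * inverse x ^ n) has_real_derivative
   exp (- inverse x) * inverse x ^ (n + 2) - real n * (exp (- inverse x) * inverse x ^ (n + 1))) (at x)"
  proof -
   have 1: "HR (%x. exp (- inverse x)) (exp (- inverse x) * (inverse x)^2) x"
    using 1 by (auto intro!: derivative_eq_intros simp: power2_eq_square)
   have 2: "HR (%x. inverse x ^ n) (real n * inverse x ^ (n - 1) * (- ((inverse x)^2))) x"
    by (rule DERIV_cong[OF DERIV_power[OF DERIV_inverse]]) (use \<open>x > 0\<close> in \<open>simp_all add: power2_eq_square\<close>)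
   have 3: "real n * inverse x ^ (n - 1) * (- ((inverse x)^2)) = - (real n * inverse x ^ (n + 1))"
    by (cases n) (auto simp: power2_eq_square mult_ac)
   show ?thesis
    by (rule DERIV_cong[OF DERIV_mult[OF 1 2[unfolded 3]]]) (simp add: power_add power2_eq_square algebra_simps)
  qed
  hence "(flat_exp n has_real_derivative
   exp (- inverse x) * inverse x ^ (n + 2) - real n * (exp (- inverse x) * inverse x ^ (n + 1))) (at x)"
   by (rule has_field_derivative_transform_within_open[where S="{0<..}"]) (insert 1, auto simp: flat_exp_def)
  thus ?thesis using 1 by (simp add: flat_exp_def)
 next
  case 2
  have "HR (flat_exp n) 0 x"
   by (rule has_field_derivative_transform_within_open[where f="%_. 0" and S="{..<0}"]) (insert 2, auto simp: flat_exp_def)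
  thus ?thesis using 2 by (simp add: flat_exp_def)
 next
  case 3
  \<comment> \<open>At 0 the difference quotient of \<open>flat_exp n\<close> is
    \<open>flat_exp (Suc n)\<close>, which tends to 0.\<close>
  have "((%h. (flat_exp n (0 + h) - flat_exp n 0) / h) \<longlongrightarrow> 0) (at 0)"
   by (rule Lim_transform_eventually[OF flat_exp_tendsto_0[of "Suc n"]])
     (auto simp: eventually_at_filter flat_exp_def field_simps)
  thus ?thesis using 3 by (simp add: flat_exp_def DERIV_def)
 qed
qed

lemma Cinf_flat_exp: "Cinf (flat_exp n) UNIV"
proof -
 have "C_k_on k (flat_exp n) UNIV" for k n
 proof (induction k arbitrary: n)
  case 0
  show ?case using flat_exp_deriv by (auto intro!: DERIV_continuous_on)
 next
  case (Suc k)
  show ?case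
  proof (rule C_k_on_SucI)
   show "HD (flat_exp n) (%v. (flat_exp (n + 2) x + (- real n) * flat_exp (n + 1) x) * v) x" for x
    using flat_exp_deriv[of n x] by (simp add: has_field_derivative_def)
   show "C_k_on k (%x. (flat_exp (n + 2) x + (- real n) * flat_exp (n + 1) x) * v) UNIV" for v
    by (intro C_k_on_bilinear[OF bounded_bilinear_mult] C_k_on_add C_k_on_const Suc.IH) auto
  qed simp
 qed
 thus ?thesis by (simp add: Cinf_def)
qed

definition smooth_step :: "real => real" where
 "smooth_step x = flat_exp 0 x / (flat_exp 0 x + flat_exp 0 (1 - x))"

lemma smooth_step_denom: "flat_exp 0 x + flat_exp 0 (1 - x) > 0"
 by (cases "x > 0") (auto simp: flat_exp_def add_pos_nonneg)

lemma smooth_step_values: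
 "0 <= smooth_step x" "smooth_step x <= 1" "x <= 0 ==> smooth_step x = 0" "x >= 1 ==> smooth_step x = 1"
proof -
 have "flat_exp 0 y >= 0" for y by (simp add: flat_exp_def)
 thus "0 <= smooth_step x" "smooth_step x <= 1"
  using smooth_step_denom[of x] by (auto simp: smooth_step_def divide_le_eq)
 show "x <= 0 ==> smooth_step x = 0" "x >= 1 ==> smooth_step x = 1"
  by (auto simp: smooth_step_def flat_exp_def)
qed

lemma Cinf_smooth_step: "Cinf smooth_step UNIV"
 unfolding smooth_step_def
proof (intro Cinf_divide Cinf_add Cinf_flat_exp)
 show "Cinf (%x. flat_exp 0 (1 - x)) UNIV"
  by (rule Cinf_compose[OF Cinf_flat_exp]) (intro Cinf_diff Cinf_const Cinf_ident open_UNIV UNIV_I)+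
 show "flat_exp 0 x + flat_exp 0 (1 - x) ~= 0" for x using smooth_step_denom[of x] by simp
qed

lemma smooth_bump_exists:
 fixes y0 :: "'a::euclidean_space"
 assumes "r > 0"
 obtains be :: "'a => real" where "Cinf be UNIV" "!!y. 0 <= be y" "!!y. be y <= 1"
  "!!y. dist y y0 <= r / 2 ==> be y = 1" "!!y. dist y y0 >= r ==> be y = 0"
proof -
 \<comment> \<open>The argument of \<open>smooth_step\<close> is at least 1 exactly when the
   distance is at most \<open>r / 2\<close>, and at most 0 exactly when it is at least
   \<open>r\<close>; this determines the factor \<open>4 / (3 r^2)\<close>. The squared distance is
   used because it is smooth at the centre.\<close>
 define be where "be y = smooth_step ((r^2 - (y - y0) \<bullet> (y - y0)) * (4 / (3 * r^2)))" for y :: 'a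
 have d: "(y - y0) \<bullet> (y - y0) = (dist y y0)^2" for y by (simp add: dist_norm power2_norm_eq_inner)
 show ?thesis
 proof
  show "Cinf be UNIV" unfolding be_def
   by (rule Cinf_compose[OF Cinf_smooth_step])
     (intro Cinf_mult Cinf_diff Cinf_inner Cinf_const Cinf_ident open_UNIV UNIV_I)+
  show "0 <= be y" "be y <= 1" for y by (simp_all add: be_def smooth_step_values)
  show "be y = 1" if "dist y y0 <= r / 2" for y
  proof -
   have "(dist y y0)^2 <= (r / 2)^2" using that by (intro power_mono) auto
   thus ?thesis using assms unfolding be_def d
    by (intro smooth_step_values(4)) (simp add: field_simps power2_eq_square)
  qed
  show "be y = 0" if "dist y y0 >= r" for y
  proof -
   have "(dist y y0)^2 >= r^2" using that assms by (intro power_mono) auto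
   thus ?thesis using assms unfolding be_def d
    by (intro smooth_step_values(3) mult_nonpos_nonneg) auto
  qed
 qed
qed

text \<open>By translation invariance, the integral of \<open>u (x + t e)\<close> over \<open>x\<close> is independent of \<open>t\<close>.\<close>

lemma has_real_derivative_integral:
 fixes f :: "real => 'a => real"
 assumes int: "!!t. abs t < a ==> integrable M (f t)" and a: "a > 0" and w: "integrable M w"
  and lip: "!!t p. abs t < a ==> abs (f t p - f 0 p) <= w p * abs t"
  and d: "AE p in M. HR (%t. f t p) (f' p) 0" and m: "f' : borel_measurable M"
 shows "HR (%t. \<integral>p. f t p \<partial>M) (LINT p|M. f' p) 0"
proof -
 define I where "I t = (LINT p|M. f t p)" for t
 have "((%h. (I (0 + h) - I 0) / h) \<longlongrightarrow> (LINT p|M. f' p)) (at 0)"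
  unfolding tendsto_at_iff_sequentially
 proof (intro allI impI)
  fix X :: "nat => real" assume X: "ALL i. X i : UNIV - {0}" "X \<longlonglongrightarrow> 0"
  have "eventually (%n. abs (X n) < a) sequentially" using tendstoD[OF X(2) a] by simp
  then obtain N where N: "!!n. abs (X (n + N)) < a" unfolding eventually_sequentially by (metis le_add2)
  have X0: "X n ~= 0" for n using X by auto
  let ?q = "%n p. (f (X (n + N)) p - f 0 p) / X (n + N)"
  note i = int[OF N] and i0 = int[of 0]
  have "(%n. \<integral>p. ?q n p \<partial>M) \<longlonglongrightarrow> (LINT p|M. f' p)"
  proof (rule integral_dominated_convergence[where w=w])
   show "?q n : borel_measurable M" for n using borel_measurable_integrable[OF i[of n]] borel_measurable_integrable[OF i0] a by simp
   show "AE p in M. (%n. ?q n p) \<longlonglongrightarrow> f' p"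
    using d
   proof eventually_elim
    case (elim p)
    hence "(%n. (f (X n) p - f 0 p) / X n) \<longlonglongrightarrow> f' p"
     using X by (simp add: DERIV_def tendsto_at_iff_sequentially o_def)
    thus ?case by (rule LIMSEQ_ignore_initial_segment)
   qed
   show "AE p in M. norm (?q n p) <= w p" for n
    by (rule AE_I2) (insert lip[OF N] X0, simp add: divide_le_eq)
  qed (rule m w)+
  moreover have e: "(LINT p|M. ?q n p) = (I (X (n + N)) - I 0) / X (n + N)" for n
   unfolding I_def using i[of n] i0 a by simp
  ultimately have "(%n. (I (X (n + N)) - I 0) / X (n + N)) \<longlonglongrightarrow> (LINT p|M. f' p)" by (simp only: e)
  hence "(%n. (I (X n) - I 0) / X n) \<longlonglongrightarrow> (LINT p|M. f' p)" by (rule LIMSEQ_offset)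
  thus "((%h. (I (0 + h) - I 0) / h) o X) \<longlonglongrightarrow> (LINT p|M. f' p)" by (simp add: o_def)
 qed
 thus ?thesis by (simp add: DERIV_def I_def)
qed

text \<open>Difference quotients are bounded by the Lipschitz constant times \<open>norm e\<close>
  on a fixed ball, enlarged by \<open>norm e\<close> to allow for shifts with
  \<open>|t| < 1\<close>, and vanish outside it; dominated convergence moves the derivative under
  the integral. Differentiability almost everywhere admits functions with a kink along a null
  boundary.\<close>

lemma integral_directional_derivative_zero:
 fixes u d :: "'a::euclidean_space => real"
 assumes lip: "!!x y. abs (u x - u y) <= C * dist x y" and supp: "!!x. norm x > R ==> u x = 0"
  and meas: "d : bm" and d: "AE x in lborel. HR (%t. u (x + t *\<^sub>R e)) (d x) 0"
 shows "integral\<^sup>L lborel d = 0"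
proof -
 have lip': "abs (u x - u y) <= abs C * dist x y" for x y
  by (rule order_trans[OF lip]) (simp add: mult_right_mono)
 have c: "continuous_on UNIV u"
 proof (rule lipschitz_on_continuous_on)
  show "(abs C)-lipschitz_on UNIV u" by (rule lipschitz_onI) (insert lip', auto simp: dist_real_def)
 qed
 hence um: "u : bm" by (rule borel_measurable_continuous_onI)
 have "integrable lborel (%x. ind (cball 0 R) x *\<^sub>R u x)"
  by (rule borel_integrable_compact) (insert c, auto intro: continuous_on_subset)
 moreover have "(%x. ind (cball 0 R) x *\<^sub>R u x) = u"
  using supp by (auto simp: fun_eq_iff indicator_def not_le)
 ultimately have ui: "integrable lborel u" by simp
 have shift: "integrable lborel (%x. u (x + c))" "(LINT x|lborel. u (x + c)) = (LINT x|lborel. u x)" for c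
 proof -
  have eq: "lborel = distr lborel borel ((+) c)" by (rule lborel_distr_plus[symmetric])
  have "integrable (distr lborel borel ((+) c)) u" using ui eq by simp
  thus "integrable lborel (%x. u (x + c))" by (subst (asm) integrable_distr_eq) (insert um, auto simp: add.commute)
  have "(LINT x|lborel. u x) = (LINT x|(distr lborel borel ((+) c)). u x)" using eq by simp
  also have "... = (LINT x|lborel. u (x + c))" by (subst integral_distr) (insert um, auto simp: add.commute)
  finally show "(LINT x|lborel. u (x + c)) = (LINT x|lborel. u x)" ..
 qed
 have "HR (%t. \<integral>x. u (x + t *\<^sub>R e) \<partial>lborel) (integral\<^sup>L lborel d) 0"
 proof (rule has_real_derivative_integral[where a=1 and w="%x. abs C * norm e * ind (cball 0 (R + norm e)) x"])
  show "abs (u (x + t *\<^sub>R e) - u (x + 0 *\<^sub>R e)) <= abs C * norm e * ind (cball 0 (R + norm e)) x * abs t"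
   if t: "abs t < 1" for t x
  proof (cases "norm x <= R + norm e")
   case True
   thus ?thesis using lip'[of "x + t *\<^sub>R e" x] by (simp add: dist_norm mult_ac)
  next
   case False
   have "norm (t *\<^sub>R e) <= norm e" using t by (simp add: mult_left_le_one_le)
   moreover have "norm x <= norm (x + t *\<^sub>R e) + norm (t *\<^sub>R e)"
    using norm_triangle_ineq4[of "x + t *\<^sub>R e" "t *\<^sub>R e"] by simp
   ultimately have "norm (x + t *\<^sub>R e) > R" "norm x > R" using False norm_ge_zero[of e] by linarith+
   thus ?thesis by (simp add: supp)
  qed
  have "emeasure lborel (cball 0 (R + norm e) :: 'a set) < \<infinity>" by (rule emeasure_lborel_cball_finite)
  thus "integrable lborel (%x :: 'a. abs C * norm e * ind (cball 0 (R + norm e)) x)"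
   by (intro integrable_mult_right) (auto intro!: integrable_real_indicator)
 qed (use shift d meas in simp_all)
 hence "HR (%t. \<integral>x. u x \<partial>lborel) (integral\<^sup>L lborel d) 0" unfolding shift(2) .
 thus ?thesis using DERIV_const by (rule DERIV_unique)
qed

text \<open>\<open>r\<close> is the local inverse of the strictly increasing \<open>Q\<close>, hence
  solves \<open>r' = 1 / q(r)\<close>. Smoothness bootstraps from this equation: if \<open>r\<close>
  is of class \<open>k\<close>, so is the right-hand side, and \<open>r\<close> is of class
  \<open>k + 1\<close>.\<close>

lemma smooth_inverse_function:
 fixes Q q :: "real => real"
 assumes dl: "dl > 0" and d: "!!s. abs s < dl ==> HR Q (q s) s"
  and q: "Cinf q (Iv dl)" and pos: "!!s. abs s < dl ==> q s > 0" and "Q 0 = 0"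
 obtains ep r where "ep > 0" "Cinf r (Iv ep)" "r 0 = 0" "!!t. abs t < ep ==> abs (r t) < dl"
  "!!t. abs t < ep ==> HR r (inverse (q (r t))) t"
proof -
 define a where "a = dl / 2"
 have a: "0 < a" "a < dl" using dl by (auto simp: a_def)
 have mono: "Q s < Q t" if "s < t" "-dl < s" "t < dl" for s t
 proof (rule DERIV_pos_imp_increasing[OF that(1)])
  fix x assume "s <= x" "x <= t"
  hence "abs x < dl" using that by auto
  thus "EX y. DERIV Q x :> y & 0 < y" using d pos by blast
 qed
 have cont: "isCont Q s" if "abs s < dl" for s using d[OF that] by (rule DERIV_isCont)
 \<comment> \<open>The interval from \<open>-ep\<close> to \<open>ep\<close> lies in the image of
   \<open>[-a, a]\<close>; being open, it keeps preimages away from the end points.\<close>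
 define ep where "ep = min (Q a) (- Q (- a))"
 have ep: "ep > 0" using mono[of 0 a] mono[of "-a" 0] a assms(5) by (simp add: ep_def)
 have ex: "EX s. abs s < a & Q s = t" if "abs t < ep" for t
 proof -
  have "EX s>=-a. s <= a & Q s = t"
   by (rule IVT) (insert that a cont, auto simp: ep_def)
  then obtain s where s: "-a <= s" "s <= a" "Q s = t" by auto
  hence "s ~= a" "s ~= -a" using that by (auto simp: ep_def)
  thus ?thesis using s by (intro exI[of _ s]) auto
 qed
 define r where "r t = (SOME s. abs s < a & Q s = t)" for t
 have r: "abs (r t) < a" "Q (r t) = t" if "abs t < ep" for t
  using someI_ex[OF ex[OF that]] by (auto simp: r_def)
 have inj: "s = t" if "Q s = Q t" "abs s < dl" "abs t < dl" for s t
  using mono[of s t] mono[of t s] that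
  by (metis abs_less_iff linorder_less_linear minus_less_iff order_less_irrefl)
 have rQ: "r (Q s) = s" if "abs s < a" "abs (Q s) < ep" for s
 proof (rule inj)
  show "Q (r (Q s)) = Q s" by (rule r(2)[OF that(2)])
  show "abs (r (Q s)) < dl" "abs s < dl" using r(1)[OF that(2)] that(1) a by linarith+
 qed
 have rcont: "isCont r t" if t: "abs t < ep" for t
 proof -
  have "isCont Q (r t)" using r[OF t] a by (intro cont) auto
  moreover have "ep - abs t > 0" using t by simp
  ultimately have "EX d>0. ALL s. dist s (r t) < d --> dist (Q s) (Q (r t)) < ep - abs t"
   unfolding continuous_at_eps_delta by blast
  then obtain d where d: "d > 0" "!!s. dist s (r t) < d ==> dist (Q s) (Q (r t)) < ep - abs t"
   by blast
  define e where "e = min d (a - abs (r t))"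
  have e: "abs (Q s) < ep & abs s < a" if "dist s (r t) < e" for s
   using d(2)[of s] r[OF t] that unfolding e_def dist_real_def by auto
  have "e > 0" using d(1) r[OF t] by (simp add: e_def)
  have "isCont r (Q (r t))"
  proof (rule isCont_inverse_function[where f=Q and x="r t" and g=r and d="e / 2"])
   fix z assume "abs (z - r t) <= e / 2"
   hence "dist z (r t) < e" using \<open>e > 0\<close> by (simp add: dist_real_def)
   hence "abs (Q z) < ep" "abs z < a" using e[of z] by auto
   thus "r (Q z) = z" "isCont Q z" using a by (auto intro!: rQ cont)
  qed (use \<open>e > 0\<close> in simp)
  thus ?thesis using r[OF t] by simp
 qed
 have rd: "HR r (inverse (q (r t))) t" if t: "abs t < ep" for t
 proof (rule DERIV_inverse_function[where f=Q and g=r and x=t and a="-ep" and b=ep and D="q (r t)"])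
  show "DERIV Q (r t) :> q (r t)" "q (r t) ~= 0" using r[OF t] a d[of "r t"] pos[of "r t"] by auto
  show "Q (r y) = y" if "- ep < y" "y < ep" for y using that by (intro r) auto
 qed (use t rcont in auto)
 have "C_k_on k r (Iv ep)" for k
 proof (induction k)
  case 0
  thus ?case using rcont by (auto intro!: continuous_at_imp_continuous_on)
 next
  case (Suc k)
  show ?case
  proof (rule C_k_on_SucI)
   show "HD r (%v. inverse (q (r t)) * v) t" if "t : Iv ep" for t
    using rd[of t] that by (auto simp: has_field_derivative_def)
   have "Cinf (%s. inverse (q s)) (Iv dl)"
   proof (intro Cinf_inverse q)
    show "q s ~= 0" if "s : Iv dl" for s using pos[of s] that by (auto simp: abs_less_iff)
   qed
   note iq = Cinf_D[OF this, of k]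
   have "C_k_on k (%t. inverse (q (r t))) (Iv ep)"
   proof (rule C_k_on_compose[OF iq Suc.IH])
    show "r ` Iv ep <= Iv dl"
    proof
     fix z assume "z : r ` Iv ep"
     then obtain t where "z = r t" "abs t < ep" by auto
     thus "z : Iv dl" using r(1)[of t] a by (simp add: abs_less_iff)
    qed
   qed auto
   thus "C_k_on k (%t. inverse (q (r t)) * v) (Iv ep)" for v
    by (intro C_k_on_bilinear[OF bounded_bilinear_mult] C_k_on_const) auto
  qed simp
 qed
 hence "Cinf r (Iv ep)" by (simp add: Cinf_def)
 moreover have "r 0 = 0" using rQ[of 0] a ep assms(5) by simp
 moreover have "abs (r t) < dl" if "abs t < ep" for t using r[OF that] a by simp
 ultimately show ?thesis using rd by (intro that[OF ep, of r])
qed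

text \<open>The derivative in \<open>s\<close> is again the parametric integral of a smooth
  function, so differentiation under the integral sign can be iterated; the induction runs over all
  \<open>q\<close> at once.\<close>

lemma Cinf_parametric_integral:
 fixes q :: "real \<times> 'b::euclidean_space => real"
 assumes q: "Cinf q (Iv dl \<times> V)" and V: "cbox a b <= V"
 shows "Cinf (%s. integral (cbox a b) (%y. q (s, y))) (Iv dl)"
proof -
 let ?I = "%q s. integral (cbox a b) (%y. q (s, y))"
 let ?U = "Iv dl"
 have "C_k_on k (?I q) ?U" if "Cinf q (?U \<times> V)" for k and q :: "real \<times> 'b => real"
  using that
 proof (induction k arbitrary: q)
  let ?q' = "%(q :: real \<times> 'b => real) z. FD q z (1, 0)"
  have der: "((?I q) has_field_derivative integral (cbox a b) (%y. ?q' q (s, y))) (at s)"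
   if q: "Cinf q (?U \<times> V)" and s: "s : ?U" for q s
  proof -
   have c: "continuous_on (?U \<times> cbox a b) q" "continuous_on (?U \<times> cbox a b) (?q' q)"
    using V by (intro continuous_on_subset[OF Cinf_continuous[OF q]]
      continuous_on_subset[OF Cinf_continuous[OF Cinf_frechet[OF q]]]; auto)+
   have "((?I q) has_field_derivative integral (cbox a b) (%y. ?q' q (s, y))) (at s within ?U)"
   proof (rule leibniz_rule_field_derivative[where f="%s y. q (s, y)" and fx="%s y. ?q' q (s, y)"])
    fix x t assume x: "x : ?U" "t : cbox a b"
    hence xt: "(x, t) : ?U \<times> V" using V by auto
    have "HD (%x. q (x, t)) (%d. FD q (x, t) (d, 0)) x"
     by (rule has_derivative_compose[where g=q and f="%x. (x, t)", OF _ Cinf_deriv[OF q xt]])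
       (auto intro!: derivative_eq_intros)
    moreover have "(%d. FD q (x, t) (d, 0)) = (*) (?q' q (x, t))"
    proof
     show "FD q (x, t) (d, 0) = ?q' q (x, t) * d" for d
      using linear_scale[OF Cinf_frechet_linear[OF q xt], of d "(1, 0)"] by simp
    qed
    ultimately have "HD (%x. q (x, t)) ((*) (?q' q (x, t))) x"
     by (simp only:)
    thus "((%x. q (x, t)) has_field_derivative ?q' q (x, t)) (at x within ?U)"
     unfolding has_field_derivative_def by (rule has_derivative_at_withinI)
   next
    fix x assume x: "x : ?U"
    have "continuous_on (cbox a b) (%y. q (x, y))"
     by (rule continuous_on_compose2[OF c(1), of _ "%y. (x, y)"])
       (insert x, auto intro!: continuous_on_Pair continuous_on_const continuous_on_id)
    thus "(%y. q (x, y)) integrable_on cbox a b" by (rule integrable_continuous)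
   next
    show "continuous_on (?U \<times> cbox a b) (%(x, t). ?q' q (x, t))"
     using c(2) by (simp add: case_prod_unfold)
   qed (insert s, simp_all add: convex_real_interval)
   thus ?thesis by (subst (asm) at_within_open) (use s in simp_all)
  qed
  {
   case 0
   have "continuous_on ?U (?I q)"
    by (rule DERIV_continuous_on) (rule has_field_derivative_at_within[OF der[OF 0]])
   thus ?case by simp
  next
   case (Suc k)
   show ?case
   proof (rule C_k_on_SucI)
    show "HD (?I q) (%v. integral (cbox a b) (%y. ?q' q (s, y)) * v) s"
     if "s : ?U" for s
     using der[OF Suc.prems that] by (simp add: has_field_derivative_def)
    show "C_k_on k (%s. integral (cbox a b) (%y. ?q' q (s, y)) * v) ?U" for v
     by (intro C_k_on_bilinear[OF bounded_bilinear_mult] C_k_on_const Suc.IH Cinf_frechet Suc.prems) auto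
   qed simp
  }
 qed
 with q show ?thesis by (simp add: Cinf_def)
qed

section \<open>Charts and atlases\<close>

lemma is_chartD:
 assumes "is_chart K"
 shows "open (cdom K)" "open (cran K)"
  "p : cdom K ==> cinv K (cmap K p) = p"
  "y : cran K ==> cmap K (cinv K y) = y"
  "y : cran K ==> cinv K y : cdom K"
  "continuous_on (cdom K) (cmap K)" "continuous_on (cran K) (cinv K)"
  "inj_on (cmap K) (cdom K)"
proof -
 have h: "homeomorphism (cdom K) (cran K) (cmap K) (cinv K)"
  using assms by (simp add: is_chart_def)
 show "open (cdom K)" "open (cran K)" using assms by (simp_all add: is_chart_def)
 show 1: "cinv K (cmap K p) = p" if "p : cdom K" for p
  using h that by (simp add: homeomorphism_def)
 show "y : cran K ==> cmap K (cinv K y) = y"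
  using 1 by auto
 show "y : cran K ==> cinv K y : cdom K"
  using 1 by auto
 show "continuous_on (cdom K) (cmap K)" "continuous_on (cran K) (cinv K)"
  using h by (simp_all add: homeomorphism_def)
 show "inj_on (cmap K) (cdom K)" using 1 by (rule inj_on_inverseI)
qed

lemma chart_image_eq:
 assumes "is_chart K" "V <= cdom K"
 shows "cmap K ` V = cran K Int cinv K -` V"
proof (intro equalityI subsetI)
 fix y assume "y : cmap K ` V"
 then obtain p where "p : V" "y = cmap K p" by auto
 thus "y : cran K Int cinv K -` V"
  using assms(2) is_chartD(3)[OF assms(1), of p] by auto
next
 fix y assume y: "y : cran K Int cinv K -` V"
 hence "y = cmap K (cinv K y)" using is_chartD(4)[OF assms(1), of y] by simp
 thus "y : cmap K ` V" using y by auto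
qed

lemma chart_open_image:
 assumes "is_chart K" "open V" "V <= cdom K"
 shows "open (cmap K ` V)"
 unfolding chart_image_eq[OF assms(1,3)]
 by (rule continuous_open_preimage[OF is_chartD(7)[OF assms(1)] is_chartD(2)[OF assms(1)] assms(2)])

lemma chart_open_preimage:
 assumes "is_chart K" "open Y"
 shows "open (cdom K Int cmap K -` Y)"
 by (rule continuous_open_preimage[OF is_chartD(6)[OF assms(1)] is_chartD(1)[OF assms(1)] assms(2)])

lemma chart_borel_image:
 assumes "is_chart K" "E : sets borel" "E <= cdom K"
 shows "cmap K ` E : sets borel"
proof -
 have "cinv K : borel_measurable (restrict_space borel (cran K))"
  by (rule borel_measurable_continuous_on_restrict[OF is_chartD(7)[OF assms(1)]])
 from measurable_sets[OF this assms(2)]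
 have "cinv K -` E Int cmap K ` cdom K : sets (restrict_space borel (cran K))"
  by (simp add: space_restrict_space)
 moreover have "cran K Int space borel : sets borel"
  using is_chartD(2)[OF assms(1)] by simp
 ultimately have "cinv K -` E Int cmap K ` cdom K : sets borel"
  by (simp add: sets_restrict_space_iff)
 thus ?thesis unfolding chart_image_eq[OF assms(1,3)] by (simp add: Int_commute)
qed

locale atlas =
 fixes A :: "('a::topological_space, 'e::euclidean_space) chart set"
 assumes smooth_atlas: "smooth_atlas A"
begin

lemma is_chart: "K : A ==> is_chart K"
 using smooth_atlas by (simp add: smooth_atlas_def)

lemmas chartD = is_chartD[OF is_chart]

lemma chart_at: "chart_at A p : A" "p : cdom (chart_at A p)"
proof -
 have "p : (UN K:A. cdom K)" using smooth_atlas by (simp add: smooth_atlas_def)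
 hence "EX K. K : A & p : cdom K" by auto
 hence "chart_at A p : A & p : cdom (chart_at A p)"
  unfolding chart_at_def by (rule someI_ex)
 thus "chart_at A p : A" "p : cdom (chart_at A p)" by auto
qed

lemma transition_smooth:
 assumes "K : A" "K' : A"
 shows "Cinf (cmap K' o cinv K) (cmap K ` (cdom K Int cdom K'))"
proof -
 have "open (cmap K ` (cdom K Int cdom K'))"
  by (intro chart_open_image is_chart open_Int chartD(1) Int_lower1 assms)
 moreover have "smooth_on (cmap K' o cinv K) (cmap K ` (cdom K Int cdom K'))"
  using smooth_atlas assms by (simp add: smooth_atlas_def smooth_transition_def)
 ultimately show ?thesis by (rule smooth_on_open_iff[THEN iffD1])
qed

lemma transition_has_derivative:
 assumes "K : A" "K' : A" "p : cdom K" "p : cdom K'"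
 shows "HD (cmap K' o cinv K) (transition_deriv K K' p) (cmap K p)"
 unfolding transition_deriv_def
 by (rule Cinf_deriv[OF transition_smooth]) (use assms in auto)

lemma transition_linear:
 assumes "K : A" "K' : A" "p : cdom K" "p : cdom K'"
 shows "linear (transition_deriv K K' p)"
 using transition_has_derivative[OF assms] by (rule has_derivative_linear)

lemma transition_compose:
 assumes "K1 : A" "K2 : A" "K3 : A" "p : cdom K1" "p : cdom K2" "p : cdom K3"
 shows "transition_deriv K2 K3 p (transition_deriv K1 K2 p u) = transition_deriv K1 K3 p u"
proof -
 have y: "(cmap K2 o cinv K1) (cmap K1 p) = cmap K2 p" using assms by (simp add: chartD(3))
 have "((cmap K3 o cinv K2) o (cmap K2 o cinv K1) has_derivative
  transition_deriv K2 K3 p o transition_deriv K1 K2 p) (at (cmap K1 p))"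
  by (rule diff_chain_at) (unfold y, (rule transition_has_derivative; fact assms)+)
 moreover have "open (cmap K1 ` (cdom K1 Int cdom K2))"
  by (intro chart_open_image is_chart open_Int chartD(1) Int_lower1 assms)
 ultimately have "(cmap K3 o cinv K1 has_derivative
  transition_deriv K2 K3 p o transition_deriv K1 K2 p) (at (cmap K1 p))"
  by (rule has_derivative_cong_open) (insert assms, auto simp: chartD(3))
 from has_derivative_unique[OF this transition_has_derivative[OF assms(1,3,4,6)]]
 show ?thesis by (simp add: fun_eq_iff)
qed

lemma transition_id:
 assumes "K : A" "p : cdom K"
 shows "transition_deriv K K p u = u"
proof -
 have "HD (%y. y) (%y. y) (cmap K p)" by (rule has_derivative_ident)
 hence "HD (cmap K o cinv K) (%y. y) (cmap K p)"
  by (rule has_derivative_cong_open[OF _ chartD(2)[OF assms(1)]]) (insert assms, auto simp: chartD(3))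
 from has_derivative_unique[OF this transition_has_derivative[OF assms(1,1,2,2)]]
 show ?thesis by (simp add: fun_eq_iff)
qed

lemma to_chart_linear: "K : A ==> p : cdom K ==> linear (to_chart A K p)"
 and from_chart_linear: "K : A ==> p : cdom K ==> linear (from_chart A K p)"
 using chart_at by (auto simp: to_chart_def from_chart_def intro!: transition_linear)

lemma to_from_chart: "K : A ==> p : cdom K ==> to_chart A K p (from_chart A K p u) = u"
 and from_to_chart: "K : A ==> p : cdom K ==> from_chart A K p (to_chart A K p u) = u"
 using chart_at by (auto simp: to_chart_def from_chart_def transition_compose transition_id)

lemma transition_from_chart:
 "K : A ==> K' : A ==> p : cdom K ==> p : cdom K' ==>
  from_chart A K' p (transition_deriv K K' p u) = from_chart A K p u"
 using chart_at by (auto simp: from_chart_def transition_compose)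

end

lemma (in atlas) to_chart_eq_0: "K : A ==> p : cdom K ==> to_chart A K p u = 0 \<longleftrightarrow> u = 0"
 using from_to_chart[of K p u] linear_0[OF to_chart_linear[of K p]] linear_0[OF from_chart_linear[of K p]] by auto

locale two_atlases = A: atlas A + B: atlas B
 for A :: "('a::topological_space, 'e::euclidean_space) chart set"
 and B :: "('b::topological_space, 'v::euclidean_space) chart set"
begin

abbreviation rep :: "('a, 'e) chart => ('b, 'v) chart => ('a => 'b) => 'e => 'v" where
 "rep K K' \<phi> \<equiv> cmap K' o \<phi> o cinv K"

text \<open>\<open>mdiff\<close> is defined through the charts chosen at \<open>p\<close> and at its
  image, and through a derivative within \<open>S\<close>. At an interior point the latter is the
  full derivative, and the chain rule with the transition maps carries it to any pair of
  charts.\<close>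

lemma mdiff_chart:
 assumes ch: "K : A" "K' : B" "p : cdom K" "\<phi> p : cdom K'"
  and p: "p : interior S" and cont: "continuous_on S \<phi>"
  and d: "HD (rep K K' \<phi>) L (cmap K p)"
 shows "to_chart B K' (\<phi> p) (mdiff A B S \<phi> p (from_chart A K p u)) = L u"
  and "mdiff A B S \<phi> p v = from_chart B K' (\<phi> p) (L (to_chart A K p v))"
proof -
 define K0 where "K0 = chart_at A p"
 define K0' where "K0' = chart_at B (\<phi> p)"
 have ch0: "K0 : A" "K0' : B" "p : cdom K0" "\<phi> p : cdom K0'"
  by (simp_all add: K0_def K0'_def A.chart_at B.chart_at)
 define V where "V = interior S Int \<phi> -` (cdom K' Int cdom K0') Int (cdom K Int cdom K0)"
 have "open (interior S Int \<phi> -` (cdom K' Int cdom K0'))"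
  by (intro continuous_open_preimage open_interior open_Int B.chartD(1) ch ch0
    continuous_on_subset[OF cont] interior_subset)
 hence oV: "open V" unfolding V_def by (rule open_Int) (intro open_Int A.chartD(1) ch ch0)
 have pV: "p : V" using p ch ch0 by (simp add: V_def)
 have oV0: "open (cmap K0 ` V)"
  by (rule chart_open_image[OF A.is_chart[OF ch0(1)] oV]) (auto simp: V_def)
 have y: "(cmap K o cinv K0) (cmap K0 p) = cmap K p" using ch0 by (simp add: A.chartD(3))
 have y': "rep K K' \<phi> (cmap K p) = cmap K' (\<phi> p)" using ch by (simp add: A.chartD(3))
 have "HD (rep K K' \<phi> o (cmap K o cinv K0)) (L o transition_deriv K0 K p) (cmap K0 p)"
  by (rule diff_chain_at[OF A.transition_has_derivative[OF ch0(1) ch(1) ch0(3) ch(3)]]) (unfold y, rule d)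
 hence "((cmap K0' o cinv K') o (rep K K' \<phi> o (cmap K o cinv K0)) has_derivative
  transition_deriv K' K0' (\<phi> p) o (L o transition_deriv K0 K p)) (at (cmap K0 p))"
 proof (rule diff_chain_at)
  have "(rep K K' \<phi> o (cmap K o cinv K0)) (cmap K0 p) = cmap K' (\<phi> p)"
   using y y' by (simp add: o_def)
  thus "HD (cmap K0' o cinv K') (transition_deriv K' K0' (\<phi> p)) ((rep K K' \<phi> o (cmap K o cinv K0)) (cmap K0 p))"
   using B.transition_has_derivative[OF ch(2) ch0(2) ch(4) ch0(4)] by simp
 qed
 hence "(rep K0 K0' \<phi> has_derivative
  transition_deriv K' K0' (\<phi> p) o (L o transition_deriv K0 K p)) (at (cmap K0 p))"
 proof (rule has_derivative_cong_open[OF _ oV0])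
  fix z assume "z : cmap K0 ` V"
  then obtain q where q: "q : V" "z = cmap K0 q" by auto
  hence "cinv K0 z = q" "cinv K (cmap K q) = q" "cinv K' (cmap K' (\<phi> q)) = \<phi> q"
   using ch ch0 by (auto simp: V_def A.chartD(3) B.chartD(3))
  thus "((cmap K0' o cinv K') o (rep K K' \<phi> o (cmap K o cinv K0))) z = rep K0 K0' \<phi> z"
   by simp
 qed (use pV in auto)
 moreover have "at (cmap K0 p) within cmap K0 ` (S Int cdom K0) = at (cmap K0 p)"
  by (rule at_within_nhd[OF _ oV0]) (insert pV interior_subset, auto simp: V_def)
 ultimately have *: "mdiff A B S \<phi> p = transition_deriv K' K0' (\<phi> p) o (L o transition_deriv K0 K p)"
  unfolding mdiff_def K0_def[symmetric] K0'_def[symmetric]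
  using frechet_derivative_at[symmetric] by simp
 thus "mdiff A B S \<phi> p v = from_chart B K' (\<phi> p) (L (to_chart A K p v))" for v
  by (simp add: from_chart_def to_chart_def K0_def K0'_def)
 thus "to_chart B K' (\<phi> p) (mdiff A B S \<phi> p (from_chart A K p u)) = L u"
  using ch by (simp add: A.to_from_chart B.to_from_chart)
qed

lemma rep_smooth:
 assumes "K : A" "K' : B" and sm: "smooth_map_on A B S \<phi>" and "open S"
 shows "Cinf (rep K K' \<phi>) (cmap K ` (S Int cdom K Int \<phi> -` cdom K'))"
proof -
 have "continuous_on S \<phi>" using sm by (simp add: smooth_map_on_def)
 hence "open (S Int \<phi> -` cdom K')"
  by (rule continuous_open_preimage[OF _ assms(4) B.chartD(1)[OF assms(2)]])
 hence "open ((S Int \<phi> -` cdom K') Int cdom K)"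
  using A.chartD(1)[OF assms(1)] by (rule open_Int)
 hence "open (S Int cdom K Int \<phi> -` cdom K')"
  by (simp add: Int_ac)
 hence "open (cmap K ` (S Int cdom K Int \<phi> -` cdom K'))"
  by (intro chart_open_image A.is_chart assms) auto
 moreover have "smooth_on (rep K K' \<phi>) (cmap K ` (S Int cdom K Int \<phi> -` cdom K'))"
  using sm assms by (simp add: smooth_map_on_def)
 ultimately show ?thesis by (rule smooth_on_open_iff[THEN iffD1])
qed

end

locale riemannian = atlas A
 for A :: "('a::topological_space, 'e::euclidean_space) chart set" +
 fixes g :: "('a, 'e) metric"
 assumes riemannian_metric: "riemannian_metric A g"
begin

lemma metric_inner_form: "inner_form (g p)"
 using riemannian_metric by (simp add: riemannian_metric_def inner_form_def)

lemma metric_chart: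
 assumes "K : A" "p : cdom K"
 shows "g p u v = metric_in_chart A g K (cmap K p) (to_chart A K p u) (to_chart A K p v)"
 using assms by (simp add: metric_in_chart_def chartD(3) from_to_chart)

lemma metric_in_chart_inner_form:
 assumes "K : A" "y : cran K"
 shows "inner_form (metric_in_chart A g K y)"
proof -
 have y: "cinv K y : cdom K" using assms by (simp add: chartD(5))
 have g: "inner_form (g (cinv K y))" by (rule metric_inner_form)
 have "bilinear (metric_in_chart A g K y)"
  unfolding metric_in_chart_def[abs_def]
  by (rule bilinear_compose[OF inner_formD(1)[OF g] from_chart_linear[OF assms(1) y] from_chart_linear[OF assms(1) y]])
 moreover have "from_chart A K (cinv K y) u ~= 0" if "u ~= 0" for u
 proof
  assume "from_chart A K (cinv K y) u = 0"
  hence "u = 0" using to_from_chart[OF assms(1) y, of u] linear_0[OF to_chart_linear[OF assms(1) y]] by simp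
  thus False using that by simp
 qed
 ultimately show ?thesis
  using inner_formD(2,3)[OF g] by (simp add: inner_form_def metric_in_chart_def)
qed

lemma metric_in_chart_smooth:
 assumes "K : A"
 shows "Cinf (%y. metric_in_chart A g K y u v) (cran K)"
proof -
 have "smooth_on (%y. metric_in_chart A g K y u v) (cran K)"
  using riemannian_metric assms unfolding riemannian_metric_def by simp
 with chartD(2)[OF assms] show ?thesis by (rule smooth_on_open_iff[THEN iffD1])
qed

end

section \<open>The product manifold of the real line with \<open>M\<close>\<close>

definition pack :: "real \<times> (real^'m) => real^('m option)" where
 "pack z = (\<chi> i. case i of None => fst z | Some j => snd z $ j)"

definition unpack :: "real^('m option) => real \<times> (real^'m)" where
 "unpack z = (z $ None, \<chi> j. z $ Some j)"

lemma pack_nth [simp]: "pack z $ None = fst z" "pack z $ Some j = snd z $ j"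
 by (simp_all add: pack_def)

lemma unpack_pack [simp]: "unpack (pack z) = z"
 by (simp add: unpack_def prod_eq_iff vec_eq_iff)

lemma pack_unpack [simp]: "pack (unpack z) = z"
 by (simp add: pack_def unpack_def vec_eq_iff split: option.split)

lemma bounded_linear_pack: "bounded_linear pack"
 by (rule linear_conv_bounded_linear[THEN iffD1], rule linearI)
   (auto simp: pack_def vec_eq_iff split: option.split)

lemma bounded_linear_unpack: "bounded_linear unpack"
 by (rule linear_conv_bounded_linear[THEN iffD1], rule linearI)
   (auto simp: unpack_def vec_eq_iff)

lemma unpack_axis [simp]: "unpack (ax None) = (1, 0)" "unpack (ax (Some j)) = (0, ax j)"
 by (auto simp: unpack_def axis_def vec_eq_iff)

lemma pack_vimage: "unpack -` V = pack ` V"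
 by (auto simp: image_iff) (metis pack_unpack)

lemma open_pack_image: "open V ==> open (pack ` V)"
 unfolding pack_vimage[symmetric]
 by (rule open_vimage) (auto intro: linear_continuous_on[OF bounded_linear_unpack])

lemma open_unpack_image: "open V ==> open (unpack ` V)"
proof -
 assume V: "open V"
 have "unpack ` V = pack -` V" by (auto simp: image_iff) (metis unpack_pack)
 thus ?thesis using V open_vimage[OF V linear_continuous_on[OF bounded_linear_pack]] by simp
qed

text \<open>The charts of \<open>prod_atlas\<close> written with \<open>pack\<close>. Calculus is
  done on the Euclidean product of time and space and carried to the index type with
  \<open>None\<close> by this linear isomorphism.\<close>

definition prod_chart :: "('a, real^'m) chart => (real \<times> 'a, real^('m option)) chart" where
 "prod_chart K = (UNIV \<times> cdom K, %(t, p). pack (t, cmap K p))"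

lemma prod_atlas_eq: "prod_atlas A = prod_chart ` A"
 unfolding prod_atlas_def prod_chart_def pack_def by simp

lemma cdom_prod_chart [simp]: "cdom (prod_chart K) = UNIV \<times> cdom K"
 and cmap_prod_chart [simp]: "cmap (prod_chart K) z = pack (fst z, cmap K (snd z))"
 by (simp_all add: prod_chart_def case_prod_unfold)

lemma cmap_prod_chart_image: "cmap (prod_chart K) ` (S \<times> V) = pack ` (S \<times> cmap K ` V)"
 by (force simp: image_iff)

lemma cinv_prod_chart:
 fixes K :: "('a::topological_space, real^'m) chart"
 assumes "is_chart K" "y : cran K"
 shows "cinv (prod_chart K) (pack (t, y)) = (t, cinv K y)"
proof -
 have "inj_on (cmap (prod_chart K)) (UNIV \<times> cdom K)"
 proof (rule inj_onI)
  fix x z assume xz: "x : UNIV \<times> cdom K" "z : UNIV \<times> cdom K" "cmap (prod_chart K) x = cmap (prod_chart K) z"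
  from arg_cong[OF xz(3), of unpack] have "fst x = fst z" "cmap K (snd x) = cmap K (snd z)" by auto
  with xz is_chartD(8)[OF assms(1)] show "x = z" by (auto simp: prod_eq_iff dest: inj_onD)
 qed
 hence "inv_into (UNIV \<times> cdom K) (cmap (prod_chart K)) (cmap (prod_chart K) (t, cinv K y)) = (t, cinv K y)"
  using is_chartD(5)[OF assms] by (intro inv_into_f_f) auto
 thus ?thesis
  using is_chartD(4)[OF assms] by (simp add: cinv_def)
qed

lemma is_chart_prod:
 fixes K :: "('a::topological_space, real^'m) chart"
 assumes "is_chart K"
 shows "is_chart (prod_chart K)"
proof -
 let ?Y = "cran K"
 have im: "cmap (prod_chart K) ` cdom (prod_chart K) = pack ` (UNIV \<times> ?Y)"
  unfolding cdom_prod_chart by (rule cmap_prod_chart_image)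
 have inv: "cinv (prod_chart K) (pack (t, y)) = (t, cinv K y)" if "y : ?Y" for t y
  by (rule cinv_prod_chart[OF assms that])
 have "continuous_on (pack ` (UNIV \<times> ?Y)) (%z. (fst (unpack z), cinv K (snd (unpack z))))"
  by (intro continuous_intros continuous_on_compose2[OF is_chartD(7)[OF assms]]
    linear_continuous_on[OF bounded_linear_unpack]) auto
 hence c1: "continuous_on (pack ` (UNIV \<times> ?Y)) (cinv (prod_chart K))"
  by (rule continuous_on_eq) (auto simp: inv)
 have c2: "continuous_on (UNIV \<times> cdom K) (cmap (prod_chart K))"
  unfolding cmap_prod_chart[abs_def]
  by (intro continuous_on_compose2[OF linear_continuous_on[OF bounded_linear_pack]] continuous_intros
    continuous_on_compose2[OF is_chartD(6)[OF assms]]) auto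
 show ?thesis
  unfolding is_chart_def im
 proof (intro conjI)
  show "open (cdom (prod_chart K))" using is_chartD(1)[OF assms] by (simp add: open_Times)
  show "open (pack ` (UNIV \<times> ?Y))" using is_chartD(2)[OF assms] by (intro open_pack_image open_Times) auto
  have 1: "cinv (prod_chart K) ` pack ` (UNIV \<times> ?Y) = UNIV \<times> cdom K"
   using is_chartD(5)[OF assms] is_chartD(3)[OF assms] inv by (force simp: image_iff)
  show "homeomorphism (cdom (prod_chart K)) (pack ` (UNIV \<times> ?Y)) (cmap (prod_chart K)) (cinv (prod_chart K))"
   unfolding homeomorphism_def cdom_prod_chart 1
   using c1 c2 inv is_chartD(3)[OF assms] im[unfolded cdom_prod_chart] by auto
 qed
qed

lemma smooth_atlas_prod:
 fixes A :: "('a::topological_space, real^'m) chart set"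
 assumes "smooth_atlas A"
 shows "smooth_atlas (prod_atlas A)"
proof -
 interpret atlas A using assms by unfold_locales
 have trans: "smooth_transition (prod_chart K) (prod_chart K')" if k: "K : A" "K' : A" for K K'
 proof -
  let ?V = "cmap K ` (cdom K Int cdom K')"
  have V: "open ?V" using Cinf_open[OF transition_smooth[OF k]] .
  have im: "cmap (prod_chart K) ` (cdom (prod_chart K) Int cdom (prod_chart K')) = pack ` (UNIV \<times> ?V)"
   by (simp only: cdom_prod_chart Times_Int_Times Int_UNIV_left cmap_prod_chart_image)
  have op: "open (pack ` (UNIV \<times> ?V))" using V by (intro open_pack_image open_Times) auto
  have un: "Cinf (%z. fst (unpack z)) (pack ` (UNIV \<times> ?V))" "Cinf (%z. snd (unpack z)) (pack ` (UNIV \<times> ?V))"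
   by (rule Cinf_linear[OF _ op], rule bounded_linear_compose[OF _ bounded_linear_unpack], rule bounded_linear_fst bounded_linear_snd)+
  have "Cinf (%z. pack (fst (unpack z), (cmap K' o cinv K) (snd (unpack z)))) (pack ` (UNIV \<times> ?V))"
   by (rule Cinf_bounded_linear[OF bounded_linear_pack Cinf_Pair[OF un(1) Cinf_compose[OF transition_smooth[OF k] un(2)]]]) auto
  hence "Cinf (cmap (prod_chart K') o cinv (prod_chart K)) (pack ` (UNIV \<times> ?V))"
  proof (rule Cinf_cong)
   fix z assume "z : pack ` (UNIV \<times> ?V)"
   then obtain t y where "z = pack (t, y)" "y : ?V" by auto
   thus "pack (fst (unpack z), (cmap K' o cinv K) (snd (unpack z))) = (cmap (prod_chart K') o cinv (prod_chart K)) z"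
    using cinv_prod_chart[OF is_chart[OF k(1)], of y t] by auto
  qed
  thus ?thesis
   unfolding smooth_transition_def im using op by (simp only: smooth_on_open_iff)
 qed
 have "(UN K:prod_atlas A. cdom K) = UNIV \<times> (UN K:A. cdom K)"
  unfolding prod_atlas_eq by (auto simp: cdom_prod_chart)
 thus ?thesis
  using trans is_chart_prod[OF is_chart] assms unfolding smooth_atlas_def prod_atlas_eq by auto
qed

section \<open>Measures given by densities in charts: uniqueness\<close>

lemma countable_subatlas:
 fixes A :: "('a::second_countable_topology, 'e::euclidean_space) chart set"
 assumes "smooth_atlas A"
 obtains C where "countable C" "C <= A" "(UN K:C. cdom K) = UNIV"
proof -
 interpret atlas A using assms by unfold_locales
 have "open S" if "S : cdom ` A" for S using that chartD(1) by (elim imageE) simp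
 from Lindelof[OF this] obtain F where F: "F <= cdom ` A" "countable F" "\<Union>F = \<Union>(cdom ` A)" by auto
 from countable_subset_image[of F cdom A] F obtain C where "countable C" "C <= A" "F = cdom ` C" by auto
 thus ?thesis using F assms by (intro that[of C]) (auto simp: smooth_atlas_def)
qed

text \<open>The property inside the definite description of \<open>density_measure\<close>, named so
  that uniqueness and existence can be treated separately.\<close>

definition density_measure_spec ::
 "('a::topological_space, 'e::euclidean_space) chart set => 'a set => (('a, 'e) chart => 'e => real) =>
  'a measure => bool" where
 "density_measure_spec A S rr mu \<longleftrightarrow> sets mu = sets borel &
   (ALL K:A. ALL E:sets borel. E <= cdom K -->
    emeasure mu E = (\<integral>\<^sup>+y\<in>cmap K ` (E Int S). ennreal (rr K y) \<partial>lborel))"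

text \<open>Making a countable chart cover disjoint cuts the manifold into Borel pieces that lie in
  single charts. For measures these pieces do the work of a partition of unity.\<close>

lemma countable_disjoint_pieces:
 fixes A :: "('a::second_countable_topology, 'e::euclidean_space) chart set"
 assumes "smooth_atlas A"
 obtains P :: "nat => 'a set" and c where "disjoint_family P" "(\<Union>n. P n) = UNIV"
  "!!n. P n : sets borel" "!!n. c n : A" "!!n. P n <= cdom (c n)"
proof -
 interpret atlas A using assms by unfold_locales
 obtain C where C: "countable C" "C <= A" "(UN K:C. cdom K) = UNIV" using countable_subatlas[OF assms] .
 have "C ~= {}" using C(3) by auto
 define c where "c = from_nat_into C"
 have cC: "c n : A" for n using from_nat_into[OF \<open>C ~= {}\<close>, of n] C(2) by (auto simp: c_def)
 have rng: "range c = C" unfolding c_def by (rule range_from_nat_into[OF \<open>C ~= {}\<close> C(1)])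
 define P where "P = disjointed (%n. cdom (c n))"
 show ?thesis
 proof
  show "disjoint_family P" unfolding P_def by (rule disjoint_family_disjointed)
  have "(\<Union>n. cdom (c n)) = (UN K:C. cdom K)" using rng by auto
  thus "(\<Union>n. P n) = UNIV" unfolding P_def UN_disjointed_eq using C(3) by simp
  show "P n : sets borel" for n
   unfolding P_def disjointed_def using chartD(1)[OF cC] by auto
  show "P n <= cdom (c n)" for n unfolding P_def by (rule disjointed_subset)
 qed (rule cC)
qed

text \<open>The specification fixes the measure of Borel sets inside charts, and countable
  additivity over the pieces fixes the rest. Exhibiting one measure with the specification therefore
  evaluates the definite description.\<close>

lemma density_measure_eqI:
 fixes A :: "('a::second_countable_topology, 'e::euclidean_space) chart set"
 assumes A: "smooth_atlas A" and spec: "density_measure_spec A S rr mu"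
 shows "density_measure A S rr = mu"
 unfolding density_measure_def density_measure_spec_def[symmetric]
proof (rule the_equality)
 show "density_measure_spec A S rr mu" by (rule spec)
next
 fix mu' assume spec': "density_measure_spec A S rr mu'"
 obtain P :: "nat => 'a set" and c where P: "disjoint_family P" "(\<Union>n. P n) = UNIV"
  "!!n. P n : sets borel" "!!n. c n : A" "!!n. P n <= cdom (c n)"
  using countable_disjoint_pieces[OF A] by metis
 have s: "sets mu' = sets borel" "sets mu = sets borel" using spec spec' by (auto simp: density_measure_spec_def)
 show "mu' = mu"
 proof (rule measure_eqI)
  show "sets mu' = sets mu" using s by simp
  fix E assume "E : sets mu'"
  hence E: "E : sets borel" using s by simp
  have EP: "E Int P n : sets borel" for n using E P(3) by auto
  have eq: "emeasure mu' (E Int P n) = emeasure mu (E Int P n)" for n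
  proof -
   have "E Int P n <= cdom (c n)" using P(5)[of n] by auto
   thus ?thesis using spec spec' EP[of n] P(4)[of n] unfolding density_measure_spec_def by simp
  qed
  have dis: "disjoint_family (%n. E Int P n)" using P(1) by (auto simp: disjoint_family_on_def)
  have U: "(\<Union>n. E Int P n) = E" using P(2) by auto
  have rng: "range (%n. E Int P n) <= sets borel" using EP by (rule image_subsetI)
  have "emeasure mu' (\<Union>n. E Int P n) = (\<Sum>n. emeasure mu' (E Int P n))"
   by (rule suminf_emeasure[symmetric]) (use rng s dis in simp_all)
  also have "... = (\<Sum>n. emeasure mu (E Int P n))" by (simp add: eq)
  also have "... = emeasure mu (\<Union>n. E Int P n)"
   by (rule suminf_emeasure) (use rng s dis in simp_all)
  finally show "emeasure mu' E = emeasure mu E" unfolding U .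
 qed
qed

section \<open>Change of variables and density measures\<close>

text \<open>Bridge between the nonnegative integral over \<open>lborel\<close>, used in the
  measures, and the gauge integral, in which the change of variables theorem is phrased.\<close>

lemma nn_integral_absolutely_integrable:
 fixes f :: "'a::euclidean_space => real"
 assumes nn: "!!x. x : X ==> f x >= 0" and m: "(%x. ind X x * f x) : bm"
 shows "(\<integral>\<^sup>+x\<in>X. ennreal (f x) \<partial>lborel) < \<infinity> ==> f absolutely_integrable_on X"
  and "f absolutely_integrable_on X ==> (\<integral>\<^sup>+x\<in>X. ennreal (f x) \<partial>lborel) = ennreal (integral X f)"
proof -
 let ?J = "\<integral>\<^sup>+x\<in>X. ennreal (f x) \<partial>lborel"
 let ?h = "%x. ind X x * f x"
 have m': "?h : borel_measurable lborel" using m by simp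
 have nn': "0 <= ?h x" for x using nn by (simp add: indicator_def)
 have eq: "?J = (nnI lborel (%x. ennreal (?h x)))"
  by (intro nn_integral_cong) (simp add: indicator_def)
 have ai: "f absolutely_integrable_on X \<longleftrightarrow> integrable lborel ?h"
  unfolding set_integrable_def using integrable_completion[OF m'] by simp
 show "f absolutely_integrable_on X" if "?J < \<infinity>"
  unfolding ai by (rule integrableI_nonneg[OF m']) (insert nn' that, auto simp: eq)
 assume f: "f absolutely_integrable_on X"
 have "(nnI lborel (%x. ennreal (?h x))) = ennreal (LINT x|lborel. ?h x)"
  by (rule nn_integral_eq_integral) (use f ai nn' in auto)
 also have "(LINT x|lborel. ?h x) = (LINT x|lebesgue. ?h x)"
  by (rule integral_completion[OF m', symmetric])
 also have "... = integral X f"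
  using set_lebesgue_integral_eq_integral(2)[OF f] by (simp add: set_lebesgue_integral_def)
 finally show "?J = ennreal (integral X f)" using eq by simp
qed

text \<open>If one side fails to be absolutely integrable, so does the other, and both nonnegative
  integrals are infinite; otherwise the theorem for absolutely integrable functions applies. That
  theorem is about vector valued functions, hence the values in \<open>real^1\<close>.\<close>

lemma nn_integral_change_of_variables_wellorder:
 fixes g :: "real^'m::{finite,wellorder} => real^'m::_" and f h :: "real^'m::_ => real"
 assumes X: "X : sets borel" and g: "!!x. x : X ==> HD g (g' x) x" and inj: "inj_on g X"
  and nn: "!!y. y : g ` X ==> f y >= 0"
  and h: "!!x. x : X ==> h x = f (g x) * abs (det (matrix (g' x)))"
  and mf: "(%y. ind (g ` X) y * f y) : bm"
  and mh: "(%x. ind X x * h x) : bm"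
 shows "(\<integral>\<^sup>+y\<in>g ` X. ennreal (f y) \<partial>lborel) = (\<integral>\<^sup>+x\<in>X. ennreal (h x) \<partial>lborel)"
proof -
 let ?k = "%x. abs (det (matrix (g' x))) * f (g x)"
 have nnh: "h x >= 0" if "x : X" for x using h[OF that] nn that by simp
 have hk: "h x = ?k x" if "x : X" for x using h[OF that] by simp
 have hk1: "h absolutely_integrable_on X \<longleftrightarrow> ?k absolutely_integrable_on X"
  unfolding set_integrable_def by (rule Bochner_Integration.integrable_cong) (auto simp: hk indicator_def)
 have hk2: "integral X h = integral X ?k" by (rule integral_cong) (rule hk)
 have cv: "(?k absolutely_integrable_on X & integral X ?k = b) \<longleftrightarrow> (f absolutely_integrable_on g ` X & integral (g ` X) f = b)" for b
 proof -
  have "(%x. abs (det (matrix (g' x))) *\<^sub>R vec (f(g x)) :: real ^ 1) absolutely_integrable_on X &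
      integral X (%x. abs (det (matrix (g' x))) *\<^sub>R vec (f(g x))) = (vec b :: real ^ 1)
     \<longleftrightarrow> (%x. vec (f x) :: real ^ 1) absolutely_integrable_on (g ` X) &
      integral (g ` X) (%x. vec (f x)) = (vec b :: real ^ 1)"
   by (rule has_absolute_integral_change_of_variables) (use X inj has_derivative_at_withinI[OF g] in auto)
  thus ?thesis by (simp add: absolutely_integrable_on_1_iff integral_on_1_eq)
 qed
 note F = nn_integral_absolutely_integrable[of "g ` X" f, OF nn mf]
 note H = nn_integral_absolutely_integrable[of X h, OF nnh mh]
 show ?thesis
 proof (cases "f absolutely_integrable_on g ` X")
  case True
  hence "?k absolutely_integrable_on X" "integral X ?k = integral (g ` X) f" using cv[of "integral (g ` X) f"] by auto
  thus ?thesis using F(2) H(2) True hk1 hk2 by simp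
 next
  case False
  hence "~ ?k absolutely_integrable_on X" using cv[of "integral X ?k"] by auto
  hence "(\<integral>\<^sup>+y\<in>g ` X. ennreal (f y) \<partial>lborel) = \<infinity>" "(\<integral>\<^sup>+x\<in>X. ennreal (h x) \<partial>lborel) = \<infinity>"
   using F(1) H(1) False hk1 by (auto simp: less_top[symmetric])
  thus ?thesis by simp
 qed
qed

text \<open>The preimage of a coordinate box is a coordinate box with the same side lengths in
  another order, and \<open>lborel\<close> is determined by the volumes of boxes.\<close>

lemma lborel_distr_basis_bij:
 fixes T :: "'a::euclidean_space => 'b::euclidean_space"
 assumes T: "linear T" and bij: "bij_betw T Basis Basis" and inner: "!!x b. b : Basis ==> T x \<bullet> T b = x \<bullet> b"
 shows "distr lborel borel T = lborel"
proof (rule lborel_eqI[symmetric])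
 have Tm: "T : bm"
  using T by (intro borel_measurable_continuous_onI linear_continuous_on) (simp add: linear_conv_bounded_linear)
 fix l u :: 'b assume le: "!!b. b : Basis ==> l \<bullet> b <= u \<bullet> b"
 define S where "S l = (SUM b:Basis. (l \<bullet> T b) *\<^sub>R b)" for l :: 'b
 have S: "S l \<bullet> b = l \<bullet> T b" if "b : Basis" for l b using that by (simp add: S_def inner_sum_left inner_Basis if_distrib cong: if_cong)
 have TB: "T b : Basis" if "b : Basis" for b using bij that by (auto simp: bij_betw_def)
 have img: "T ` Basis = Basis" using bij by (simp add: bij_betw_def)
 have vim: "T -` box l u = box (S l) (S u)"
 proof (intro set_eqI iffI)
  fix x assume "x : T -` box l u"
  hence "l \<bullet> T b < T x \<bullet> T b & T x \<bullet> T b < u \<bullet> T b" if "b : Basis" for b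
   using TB[OF that] by (auto simp: mem_box)
  thus "x : box (S l) (S u)" by (auto simp: mem_box S inner)
 next
  fix x assume x: "x : box (S l) (S u)"
  have "l \<bullet> c < T x \<bullet> c & T x \<bullet> c < u \<bullet> c" if "c : Basis" for c
  proof -
   from that img obtain b where b: "b : Basis" "c = T b" by (metis imageE)
   thus ?thesis using x inner by (auto simp: mem_box S)
  qed
  thus "x : T -` box l u" by (simp add: mem_box)
 qed
 have "emeasure (distr lborel borel T) (box l u) = emeasure lborel (box (S l) (S u))"
  using Tm by (subst emeasure_distr) (auto simp: vim)
 also have "... = (PROD b:Basis. (S u - S l) \<bullet> b)"
  by (subst emeasure_lborel_box) (auto simp: S TB le)
 also have "(PROD b:Basis. (S u - S l) \<bullet> b) = (PROD b:Basis. (u - l) \<bullet> T b)"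
  by (rule prod.cong) (auto simp: S inner_diff_left)
 also have "... = (PROD c:Basis. (u - l) \<bullet> c)"
  by (rule prod.reindex_bij_betw[OF bij])
 finally show "emeasure (distr lborel borel T) (box l u) = (PROD b:Basis. (u - l) \<bullet> b)" .
qed simp

text \<open>The change of variables theorem of the library is stated for well-ordered index types only; it is
 transported to arbitrary finite ones by enumerating the indices.\<close>

typedef (overloaded) 'k enumerated = "{..<CARD('k::finite)}"
 by (rule exI[of _ 0]) simp

instance enumerated :: (finite) finite
proof
 have "inj (Rep_enumerated :: 'a enumerated => nat)" by (simp add: inj_def Rep_enumerated_inject)
 moreover have "range (Rep_enumerated :: 'a enumerated => nat) <= {..<CARD('a)}" using Rep_enumerated by auto
 ultimately show "finite (UNIV :: 'a enumerated set)" using finite_imageD finite_subset by blast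
qed

instantiation enumerated :: (finite) wellorder
begin

definition "x <= y \<longleftrightarrow> Rep_enumerated x <= Rep_enumerated y"
definition "x < y \<longleftrightarrow> Rep_enumerated x < Rep_enumerated y"

instance
proof
 fix P :: "'a enumerated => bool" and a
 assume IH: "!!x. (!!y. y < x ==> P y) ==> P x"
 show "P a"
  by (induction a rule: measure_induct_rule[of Rep_enumerated]) (rule IH, simp add: less_enumerated_def)
qed (auto simp: less_eq_enumerated_def less_enumerated_def Rep_enumerated_inject)

end

lemma enumeration_exists: "EX \<pi> :: 'k::finite enumerated => 'k. bij \<pi>"
proof -
 have "card (UNIV :: 'k enumerated set) = CARD('k)"
  using type_definition.card[OF type_definition_enumerated] by simp
 thus ?thesis using finite_same_card_bij[of "UNIV :: 'k enumerated set" "UNIV :: 'k set"] by simp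
qed

text \<open>The two index types differ, so this is not conjugation by a permutation matrix. The left
  side is an alternating multilinear function of the rows of \<open>M\<close>, hence
  \<open>det M\<close> times its value at the identity.\<close>

lemma det_reindex:
 fixes M :: "real^'k^'k" and \<pi> :: "'l::finite => 'k::finite"
 assumes \<pi>: "bij \<pi>"
 shows "det (\<chi> i j. M $ \<pi> i $ \<pi> j) = det M"
proof -
 define om where "om u = det (\<chi> i j. u (\<pi> i) $ \<pi> j)" for u :: "'k => real^'k"
 have inj: "inj \<pi>" using \<pi> by (rule bij_is_inj)
 have "alternating_multilinear om"
  unfolding alternating_multilinear_def
 proof (intro conjI allI impI)
  fix u :: "'k => real^'k" and i
  obtain l where l: "i = \<pi> l" using bij_is_surj[OF \<pi>] by (metis surj_def)
  have rw: "om (u(i := v)) = det (\<chi> a. if a = l then (\<chi> j. v $ \<pi> j) else (\<chi> j. u (\<pi> a) $ \<pi> j))" for v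
   unfolding om_def by (rule arg_cong[where f=det]) (auto simp: vec_eq_iff l inj_eq[OF inj])
  show "linear (%v. om (u(i := v)))"
  proof (rule linearI)
   fix v w :: "real^'k" and c :: real
   have "(\<chi> j. (v + w) $ \<pi> j) = (\<chi> j. v $ \<pi> j) + (\<chi> j. w $ \<pi> j)" "(\<chi> j. (c *\<^sub>R v) $ \<pi> j) = c *s (\<chi> j. v $ \<pi> j)"
    by (auto simp: vec_eq_iff)
   thus "om (u(i := v + w)) = om (u(i := v)) + om (u(i := w))" "om (u(i := c *\<^sub>R v)) = c *\<^sub>R om (u(i := v))"
    unfolding rw by (simp_all only: det_row_add det_row_mul real_scaleR_def)
  qed
 next
  fix u :: "'k => real^'k" and i j assume "i ~= j & u i = u j"
  moreover obtain l l' where "i = \<pi> l" "j = \<pi> l'" using bij_is_surj[OF \<pi>] by (metis surj_def)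
  ultimately show "om u = 0" unfolding om_def
   by (intro det_identical_rows[of l l']) (auto simp: row_def)
 qed
 from alternating_multilinear_det[OF this, of M "%i. ax i"]
 have "om (%i. M $ i) = det M * om (%i. ax i)"
  unfolding vec_axis_expansion[symmetric] .
 moreover have "om (%i. ax i) = det (mat 1 :: real^'l^'l)"
  unfolding om_def by (rule arg_cong[where f=det]) (auto simp: vec_eq_iff axis_def mat_def inj_eq[OF inj])
 ultimately show ?thesis by (simp add: om_def)
qed

lemma nn_integral_change_of_variables:
 fixes g :: "real^'k => real^'k" and f h :: "real^'k => real"
 assumes X: "X : sets borel" and g: "!!x. x : X ==> HD g (g' x) x" and inj: "inj_on g X"
  and nn: "!!y. y : g ` X ==> f y >= 0"
  and h: "!!x. x : X ==> h x = f (g x) * abs (det (matrix (g' x)))"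
  and mf: "(%y. ind (g ` X) y * f y) : bm"
  and mh: "(%x. ind X x * h x) : bm"
 shows "(\<integral>\<^sup>+y\<in>g ` X. ennreal (f y) \<partial>lborel) = (\<integral>\<^sup>+x\<in>X. ennreal (h x) \<partial>lborel)"
proof -
 obtain \<pi> :: "'k enumerated => 'k" where \<pi>: "bij \<pi>" using enumeration_exists by blast
 \<comment> \<open>\<open>T\<close> relabels coordinates by the enumeration and \<open>R\<close> is
   its inverse. \<open>T\<close> preserves \<open>lborel\<close>, and conjugating a linear map by it
   reindexes the matrix, which leaves the determinant unchanged.\<close>
 define T where "T v = (\<chi> i. v $ \<pi> i)" for v :: "real^'k"
 define R where "R w = (\<chi> i. w $ inv \<pi> i)" for w :: "real^'k enumerated"
 have inv: "inv \<pi> (\<pi> i) = i" "\<pi> (inv \<pi> j) = j" for i j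
  using \<pi> by (simp_all add: bij_is_inj bij_is_surj surj_f_inv_f)
 have RT: "R (T v) = v" "T (R w) = w" for v w by (simp_all add: T_def R_def inv vec_eq_iff)
 have lT: "linear T" "linear R" unfolding T_def R_def by (auto intro!: linearI simp: vec_eq_iff)
 have bl: "bounded_linear T" "bounded_linear R" using lT by (simp_all add: linear_conv_bounded_linear)
 have Tax: "T (axis (\<pi> i) 1) = ax i" for i
  by (auto simp: T_def axis_def vec_eq_iff inj_eq[OF bij_is_inj[OF \<pi>]])
 have Rax: "R (ax i) = axis (\<pi> i) 1" for i using RT(1)[of "axis (\<pi> i) 1"] by (simp add: Tax)
 have dT: "distr lborel borel T = lborel"
 proof (rule lborel_distr_basis_bij[OF lT(1)])
  have "T ` (Basis :: (real^'k) set) = Basis"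
  proof (intro equalityI subsetI)
   fix w assume "w : T ` (Basis :: (real^'k) set)"
   then obtain j where "w = T (ax j)" by (auto simp: Basis_vec_def)
   hence "w = axis (inv \<pi> j) 1" using Tax[of "inv \<pi> j"] by (simp add: inv)
   thus "w : Basis" by (auto simp: Basis_vec_def)
  next
   fix w :: "real^'k enumerated" assume "w : Basis"
   then obtain j where "w = ax j" by (auto simp: Basis_vec_def)
   hence "w = T (axis (\<pi> j) 1)" by (simp add: Tax)
   thus "w : T ` Basis" by (auto simp: Basis_vec_def)
  qed
  moreover have "inj_on T Basis" by (rule inj_on_inverseI[where g=R]) (rule RT(1))
  ultimately show "bij_betw T Basis Basis" by (simp add: bij_betw_def)
  fix x b :: "real^'k" assume "b : Basis"
  then obtain j where b: "b = ax j" by (auto simp: Basis_vec_def)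
  have Tb: "T b = axis (inv \<pi> j) 1" using Tax[of "inv \<pi> j"] by (simp add: inv b)
  have "T x $ inv \<pi> j = x $ j" by (simp add: T_def inv)
  thus "T x \<bullet> T b = x \<bullet> b" by (simp only: Tb) (simp add: b inner_axis)
 qed
 have Rm: "R : bm" "T : bm"
  by (intro borel_measurable_continuous_onI linear_continuous_on bl)+
 have nnT: "(nnI lborel (%w. F (R w))) = (nnI lborel (%v. F v))" if "F : bm" for F :: "real^'k => ennreal"
 proof -
  have "(nnI lborel (%w. F (R w))) = (nnI (distr lborel borel T) (%w. F (R w)))" by (simp add: dT)
  also have "... = (nnI lborel (%v. F (R (T v))))"
   by (subst nn_integral_distr) (use that Rm in auto)
  finally show ?thesis by (simp add: RT)
 qed
 have mat: "matrix (%w. T (L (R w))) = (\<chi> i j. matrix L $ \<pi> i $ \<pi> j)" for L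
  by (simp add: matrix_def Rax vec_eq_iff T_def)
 have TX: "T ` Y = R -` Y" for Y
 proof (intro equalityI subsetI)
  fix w assume "w : R -` Y"
  thus "w : T ` Y" using RT(2)[of w] by (intro image_eqI[of _ _ "R w"]) auto
 qed (auto simp: RT)
 have ind: "ind (T ` Y) w = ind Y (R w)" for Y w by (simp add: TX indicator_def)
 have gX: "(%w. T (g (R w))) ` (T ` X) = T ` (g ` X)" by (simp add: image_image RT)
 have "(\<integral>\<^sup>+y\<in>T ` (g ` X). ennreal (f (R y)) \<partial>lborel) = (\<integral>\<^sup>+x\<in>T ` X. ennreal (h (R x)) \<partial>lborel)"
  unfolding gX[symmetric]
 proof (rule nn_integral_change_of_variables_wellorder[where g'="%w v. T (g' (R w) (R v))"])
  show "T ` X : sets borel" unfolding TX using measurable_sets[OF Rm(1) X] by simp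
  show "HD (%w. T (g (R w))) (%v. T (g' (R w) (R v))) w" if "w : T ` X" for w
  proof -
   have "R w : X" using that by (auto simp: RT)
   have "HD (%w. g (R w)) (%v. g' (R w) (R v)) w"
    by (rule has_derivative_compose[OF bounded_linear_imp_has_derivative[OF bl(2)] g[OF \<open>R w : X\<close>]])
   thus ?thesis by (rule bounded_linear.has_derivative[OF bl(1)])
  qed
  show "inj_on (%w. T (g (R w))) (T ` X)"
  proof (rule inj_onI)
   fix v w assume "v : T ` X" "w : T ` X" and eq: "T (g (R v)) = T (g (R w))"
   hence "R v : X" "R w : X" by (auto simp: RT)
   moreover have "g (R v) = g (R w)" using arg_cong[OF eq, of R] by (simp add: RT)
   ultimately have "R v = R w" using inj_onD[OF inj] by simp
   thus "v = w" using RT(2)[of v] RT(2)[of w] by metis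
  qed
  show "0 <= f (R y)" if "y : (%w. T (g (R w))) ` (T ` X)" for y
   using that nn unfolding gX by (auto simp: RT)
  show "h (R x) = f (R (T (g (R x)))) * abs (det (matrix (%v. T (g' (R x) (R v)))))" if "x : T ` X" for x
   using that h by (auto simp: RT mat det_reindex[OF \<pi>])
  show "(%y. ind ((%w. T (g (R w))) ` (T ` X)) y * f (R y)) : bm"
   unfolding gX ind using measurable_compose[OF Rm(1) mf] by simp
  show "(%x. ind (T ` X) x * h (R x)) : bm"
   unfolding ind using measurable_compose[OF Rm(1) mh] by simp
 qed
 moreover have "(\<integral>\<^sup>+y\<in>T ` Y. ennreal (F (R y)) \<partial>lborel) = (\<integral>\<^sup>+y\<in>Y. ennreal (F y) \<partial>lborel)"
  if "(%y. ind Y y * F y) : bm" for F Y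
 proof -
  have e: "ennreal (F y) * ind Y y = ennreal (ind Y y * F y)" for y by (simp add: indicator_def)
  show ?thesis unfolding ind e using that by (intro nnT[where F="%y. ennreal (ind Y y * F y)"]) simp
 qed
 ultimately show ?thesis using mf mh by simp
qed

text \<open>A total version of the inverse chart with one fixed value off the chart image, so that
  Borel measurability reduces to continuity on the open image.\<close>

definition chart_inv :: "('a::topological_space, 'e::euclidean_space) chart => 'e => 'a" where
 "chart_inv K y = (if y : cran K then cinv K y else undefined)"

lemma chart_inv_measurable:
 assumes "is_chart K"
 shows "chart_inv K : measurable borel borel"
 unfolding chart_inv_def[abs_def]
proof (rule measurable_If_restrict_space_iff[THEN iffD2])
 show "{x : space borel. x : cran K} : sets borel" using is_chartD(2)[OF assms] by simp
 show "cinv K : measurable (restrict_space borel {x. x : cran K}) borel &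
  (%y. undefined) : measurable (restrict_space borel {x. x ~: cran K}) borel"
  using borel_measurable_continuous_on_restrict[OF is_chartD(7)[OF assms]] by simp
qed

lemma chart_inv_image:
 assumes "is_chart K" "E <= cdom K"
 shows "y : cmap K ` E ==> chart_inv K y : E"
  and "y : cmap K ` E ==> chart_inv K y : F \<longleftrightarrow> y : cmap K ` (E Int F)"
proof -
 assume "y : cmap K ` E"
 then obtain p where p: "p : E" "y = cmap K p" by auto
 hence c: "chart_inv K y = p" using assms is_chartD(3)[OF assms(1), of p] by (auto simp: chart_inv_def)
 show "chart_inv K y : E" using c p by simp
 show "chart_inv K y : F \<longleftrightarrow> y : cmap K ` (E Int F)"
 proof
  assume "y : cmap K ` (E Int F)"
  then obtain q where "q : E Int F" "y = cmap K q" by (elim imageE)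
  moreover have "p : cdom K" "q : cdom K" using p(1) \<open>q : E Int F\<close> assms(2) by auto
  ultimately have "q = p" using p(2) is_chartD(3)[OF assms(1), of p] is_chartD(3)[OF assms(1), of q] \<open>y = cmap K q\<close> by metis
  thus "chart_inv K y : F" using c \<open>q : E Int F\<close> by simp
 qed (use c p in auto)
qed

text \<open>The measure is the sum over the pieces of push-forwards of densities, realised as a
  single push-forward from the product of counting measure and \<open>lborel\<close>. The
  transformation rule \<open>trans\<close> makes it agree with every chart of the atlas, not only
  with the charts \<open>c n\<close> used to build it.\<close>

lemma density_measure_exists:
 fixes A :: "('a::second_countable_topology, real^'k) chart set"
 assumes A: "smooth_atlas A" and S: "S : sets borel"
  and nn: "!!K p. K : A ==> p : S ==> p : cdom K ==> rr K (cmap K p) >= 0"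
  and meas: "!!K. K : A ==> (%y. ind (cmap K ` (cdom K Int S)) y * rr K y) : bm"
  and trans: "!!K K' p. K : A ==> K' : A ==> p : S ==> p : cdom K ==> p : cdom K' ==>
   rr K (cmap K p) = rr K' (cmap K' p) * abs (det (matrix (transition_deriv K K' p)))"
 shows "density_measure_spec A S rr (density_measure A S rr)"
proof -
 let ?N = "count_space UNIV \<Otimes>\<^sub>M lborel"
 interpret atlas A using A by unfold_locales
 obtain P :: "nat => 'a set" and c where P: "disjoint_family P" "(\<Union>n. P n) = UNIV"
  "!!n. P n : sets borel" "!!n. c n : A" "!!n. P n <= cdom (c n)"
  using countable_disjoint_pieces[OF A] by metis
 define w where "w n y = ennreal (ind (cmap (c n) ` (P n Int S)) y * rr (c n) y)" for n y
 define M where "M = distr (density ?N (%(n, y). w n y)) borel (%(n, y). chart_inv (c n) y)"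
 have sub: "ind (cmap K ` (E Int S)) y * rr K y = ind (cmap K ` (E Int S)) y * (ind (cmap K ` (cdom K Int S)) y * rr K y)"
  if "E <= cdom K" for E K y
  using that by (auto simp: indicator_def)
 have im: "(%y. ind (cmap K ` (E Int S)) y * rr K y) : bm"
  if "K : A" "E : sets borel" "E <= cdom K" for K E
 proof -
  have "cmap K ` (E Int S) : sets borel"
   by (rule chart_borel_image[OF is_chart[OF that(1)]]) (use that S in auto)
  thus ?thesis unfolding sub[OF that(3)] using meas[OF that(1)] by measurable
 qed
 have wm: "w n : bm" for n
  unfolding w_def[abs_def] by (intro measurable_compose[OF im measurable_ennreal] P)
 have wm': "(%(n, y). w n y) : borel_measurable ?N"
  by (rule measurable_pair_measure_countable1) (use wm in auto)
 have cm: "(%(n, y). chart_inv (c n) y) : measurable ?N borel"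
  by (rule measurable_pair_measure_countable1) (use chart_inv_measurable[OF is_chart[OF P(4)]] in auto)
 have sM: "sets M = sets borel" by (simp add: M_def)
 have ME: "emeasure M E = (\<Sum>n. \<integral>\<^sup>+y\<in>cmap (c n) ` (P n Int E Int S). ennreal (rr (c n) y) \<partial>lborel)" if E: "E : sets borel" for E
 proof -
  have pre: "(%(n, y). chart_inv (c n) y) -` E Int space ?N : sets ?N"
   by (rule measurable_sets[OF cm E])
  have "emeasure M E = emeasure (density ?N (%(n, y). w n y)) ((%(n, y). chart_inv (c n) y) -` E Int space ?N)"
   unfolding M_def using cm E by (subst emeasure_distr) auto
  also have "... = (nnI ?N (%z. (case z of (n, y) => w n y) * ind ((%(n, y). chart_inv (c n) y) -` E Int space ?N) z))"
   by (rule emeasure_density[OF wm' pre])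
  also have "... = (nnI ?N (%z. (case z of (n, y) => w n y * ind E (chart_inv (c n) y))))"
   by (rule nn_integral_cong) (auto simp: indicator_def)
  also have "... = (\<integral>\<^sup>+n. \<integral>\<^sup>+y. w n y * ind E (chart_inv (c n) y) \<partial>lborel \<partial>count_space UNIV)"
  proof (subst lborel.nn_integral_fst[symmetric])
   have wi: "(%y. w n y * ind E (chart_inv (c n) y)) : bm" for n
    by (rule borel_measurable_times_ennreal[OF wm]) (rule measurable_compose[OF chart_inv_measurable[OF is_chart[OF P(4)]] borel_measurable_indicator[OF E]])
   show "(%(n, y). w n y * ind E (chart_inv (c n) y)) : borel_measurable ?N"
    by (rule measurable_pair_measure_countable1)
      (use wi in auto)
  qed simp
  also have "... = (\<Sum>n. \<integral>\<^sup>+y. w n y * ind E (chart_inv (c n) y) \<partial>lborel)"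
   by (rule nn_integral_count_space_nat)
  also have "... = (\<Sum>n. \<integral>\<^sup>+y\<in>cmap (c n) ` (P n Int E Int S). ennreal (rr (c n) y) \<partial>lborel)"
  proof (rule arg_cong[where f=suminf], rule ext, rule nn_integral_cong)
   fix n y
   have PS: "P n Int S <= cdom (c n)" using P(5)[of n] by auto
   have e: "P n Int S Int E = P n Int E Int S" by auto
   show "w n y * ind E (chart_inv (c n) y) = ennreal (rr (c n) y) * ind (cmap (c n) ` (P n Int E Int S)) y"
   proof (cases "y : cmap (c n) ` (P n Int S)")
    case True
    thus ?thesis using chart_inv_image(2)[OF is_chart[OF P(4)] PS True, of E]
     unfolding w_def e by (simp add: indicator_def)
   next
    case False
    hence "y ~: cmap (c n) ` (P n Int E Int S)" by auto
    with False show ?thesis by (simp add: w_def)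
   qed
  qed
  finally show ?thesis .
 qed
 have "density_measure_spec A S rr M"
  unfolding density_measure_spec_def
 proof (intro conjI ballI impI sM)
  fix K E assume k: "K : A" and E: "E : sets borel" "E <= cdom K"
  have EPb: "E Int P n : sets borel" for n using E P(3) by auto
  \<comment> \<open>On a piece inside both chart domains, the change of variables along the
    transition map trades \<open>c n\<close> for \<open>K\<close>.\<close>
  have piece: "(\<integral>\<^sup>+y\<in>cmap (c n) ` (P n Int E Int S). ennreal (rr (c n) y) \<partial>lborel) = (\<integral>\<^sup>+y\<in>cmap K ` (P n Int E Int S). ennreal (rr K y) \<partial>lborel)" for n
  proof -
   define Q where "Q = P n Int E Int S"
   have Q: "Q : sets borel" "Q <= cdom K" "Q <= cdom (c n)" "Q <= S" using E P(3)[of n] P(5)[of n] S by (auto simp: Q_def)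
   have g: "(cmap (c n) o cinv K) ` (cmap K ` Q) = cmap (c n) ` Q"
   proof -
    have "(cmap (c n) o cinv K) (cmap K p) = cmap (c n) p" if "p : Q" for p
     using chartD(3)[OF k subsetD[OF Q(2) that]] by simp
    thus ?thesis unfolding image_image by (intro image_cong) auto
   qed
   have "(\<integral>\<^sup>+y\<in>(cmap (c n) o cinv K) ` (cmap K ` Q). ennreal (rr (c n) y) \<partial>lborel) = (\<integral>\<^sup>+y\<in>cmap K ` Q. ennreal (rr K y) \<partial>lborel)"
   proof (rule nn_integral_change_of_variables[where g'="%y. transition_deriv K (c n) (cinv K y)"])
    show "cmap K ` Q : sets borel" by (rule chart_borel_image[OF is_chart[OF k] Q(1,2)])
    show "HD (cmap (c n) o cinv K) (transition_deriv K (c n) (cinv K y)) y" if yQ: "y : cmap K ` Q" for y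
    proof -
     obtain p where p: "p : Q" "y = cmap K p" using yQ by auto
     have pk: "p : cdom K" "p : cdom (c n)" using p Q by auto
     show ?thesis unfolding p(2) chartD(3)[OF k pk(1)] by (rule transition_has_derivative[OF k P(4) pk])
    qed
    show "inj_on (cmap (c n) o cinv K) (cmap K ` Q)"
    proof (rule inj_onI)
     fix y z assume y: "y : cmap K ` Q" and z: "z : cmap K ` Q"
      and eq: "(cmap (c n) o cinv K) y = (cmap (c n) o cinv K) z"
     obtain p where p: "p : Q" "y = cmap K p" using y by auto
     obtain q where q: "q : Q" "z = cmap K q" using z by auto
     have "cmap (c n) p = cmap (c n) q"
      using eq chartD(3)[OF k subsetD[OF Q(2) p(1)]] chartD(3)[OF k subsetD[OF Q(2) q(1)]] by (simp add: p(2) q(2))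
     thus "y = z" using inj_onD[OF chartD(8)[OF P(4)[of n]], of p q] subsetD[OF Q(3) p(1)] subsetD[OF Q(3) q(1)] p q by auto
    qed
    show "rr (c n) y >= 0" if "y : (cmap (c n) o cinv K) ` (cmap K ` Q)" for y
     using that unfolding g using nn[OF P(4)] Q(3,4) by auto
    show "rr K y = rr (c n) ((cmap (c n) o cinv K) y) * abs (det (matrix (transition_deriv K (c n) (cinv K y))))"
     if yQ: "y : cmap K ` Q" for y
    proof -
     obtain p where p: "p : Q" "y = cmap K p" using yQ by auto
     have pk: "p : S" "p : cdom K" "p : cdom (c n)" using p Q by auto
     show ?thesis unfolding p(2) using trans[OF k P(4) pk] chartD(3)[OF k pk(2)] by simp
    qed
    have QS: "Q = Q Int S" using Q(4) by auto
    show "(%y. ind ((cmap (c n) o cinv K) ` (cmap K ` Q)) y * rr (c n) y) : bm"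
     unfolding g using im[OF P(4) Q(1,3)] QS by simp
    show "(%y. ind (cmap K ` Q) y * rr K y) : bm"
     using im[OF k Q(1,2)] QS by simp
   qed
   thus ?thesis unfolding g by (simp add: Q_def)
  qed
  have "(\<Sum>n. \<integral>\<^sup>+y\<in>cmap K ` (P n Int E Int S). ennreal (rr K y) \<partial>lborel) = (nnI lborel (%y. (\<Sum>n. ennreal (rr K y) * ind (cmap K ` (P n Int E Int S)) y)))"
  proof (rule nn_integral_suminf[symmetric])
   fix n
   have "(%y. ennreal (ind (cmap K ` (E Int P n Int S)) y * rr K y)) : bm"
    by (rule measurable_compose[OF im measurable_ennreal]) (use k EPb E in auto)
   moreover have "ennreal (ind (cmap K ` (E Int P n Int S)) y * rr K y) = ennreal (rr K y) * ind (cmap K ` (P n Int E Int S)) y" for y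
    by (simp add: Int_commute[of E] indicator_def)
   ultimately show "(%y. ennreal (rr K y) * ind (cmap K ` (P n Int E Int S)) y) : borel_measurable lborel" by simp
  qed
  also have "... = (\<integral>\<^sup>+y\<in>cmap K ` (E Int S). ennreal (rr K y) \<partial>lborel)"
  proof (rule nn_integral_cong)
   fix y
   have dis: "disjoint_family (%n. cmap K ` (P n Int E Int S))"
    unfolding disjoint_family_on_def
   proof (intro ballI impI equals0I)
    fix i j :: nat and z assume ij: "i ~= j" and z: "z : cmap K ` (P i Int E Int S) Int cmap K ` (P j Int E Int S)"
    obtain p where p: "p : P i Int E" "z = cmap K p" using z by auto
    obtain q where q: "q : P j Int E" "z = cmap K q" using z by auto
    have "p = q" using inj_onD[OF chartD(8)[OF k], of p q] E(2) p q by auto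
    thus False using p q P(1) ij by (auto simp: disjoint_family_on_def)
   qed
   have U: "(\<Union>n. cmap K ` (P n Int E Int S)) = cmap K ` (E Int S)"
    unfolding image_UN[symmetric] using P(2) by (intro arg_cong[where f="image (cmap K)"]) auto
   show "(\<Sum>n. ennreal (rr K y) * ind (cmap K ` (P n Int E Int S)) y) = ennreal (rr K y) * ind (cmap K ` (E Int S)) y"
    unfolding ennreal_suminf_cmult suminf_indicator[OF dis] U ..
  qed
  finally show "emeasure M E = (\<integral>\<^sup>+y\<in>cmap K ` (E Int S). ennreal (rr K y) \<partial>lborel)"
   unfolding ME[OF E(1)] piece .
 qed
 thus ?thesis using density_measure_eqI[OF A, of S rr M] by simp
qed

text \<open>On a Borel set inside one chart the measure is the push-forward of a density on the
  model space. Integrals over the manifold become Lebesgue integrals in coordinates through this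
  identity.\<close>

lemma density_measure_chart:
 assumes spec: "density_measure_spec A S rr mu" and k: "K : A" "is_chart K"
  and E: "E : sets borel" "E <= cdom K"
  and m: "(%y. ind (cmap K ` (E Int S)) y * rr K y) : bm"
 shows "density mu (%p. ennreal (ind E p)) =
  distr (density lborel (%y. ennreal (ind (cmap K ` (E Int S)) y * rr K y))) borel (chart_inv K)"
proof (rule measure_eqI)
 have s: "sets mu = sets borel" using spec by (simp add: density_measure_spec_def)
 thus "sets (density mu (%p. ennreal (ind E p))) = sets (distr (density lborel (%y. ennreal (ind (cmap K ` (E Int S)) y * rr K y))) borel (chart_inv K))"
  by simp
 fix F assume "F : sets (density mu (%p. ennreal (ind E p)))"
 hence F: "F : sets borel" using s by simp
 have ES: "E Int S <= cdom K" using E by auto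
 have pre: "chart_inv K -` F : sets borel" using measurable_sets[OF chart_inv_measurable[OF k(2)] F] by simp
 have "emeasure (density mu (%p. ennreal (ind E p))) F = (nnI mu (%p. ind (E Int F) p))"
 proof (subst emeasure_density)
  show "(%p. ennreal (ind E p)) : borel_measurable mu" using s E by simp
  show "F : sets mu" using s F by simp
  show "(nnI mu (%p. ennreal (ind E p) * ind F p)) = (nnI mu (%p. ind (E Int F) p))"
   by (rule nn_integral_cong) (simp add: indicator_def)
 qed
 also have "... = emeasure mu (E Int F)" using s E F by (intro nn_integral_indicator) auto
 also have "... = (\<integral>\<^sup>+y\<in>cmap K ` (E Int F Int S). ennreal (rr K y) \<partial>lborel)"
 proof -
  have "E Int F : sets borel" "E Int F <= cdom K" using E F by auto
  thus ?thesis using spec k(1) unfolding density_measure_spec_def by blast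
 qed
 also have "... = (nnI lborel (%y. ennreal (ind (cmap K ` (E Int S)) y * rr K y) * ind (chart_inv K -` F) y))"
 proof (rule nn_integral_cong)
  fix y
  have e: "E Int S Int F = E Int F Int S" by auto
  show "ennreal (rr K y) * ind (cmap K ` (E Int F Int S)) y = ennreal (ind (cmap K ` (E Int S)) y * rr K y) * ind (chart_inv K -` F) y"
  proof (cases "y : cmap K ` (E Int S)")
   case True
   thus ?thesis using chart_inv_image(2)[OF k(2) ES True, of F] unfolding e by (simp add: indicator_def)
  next
   case False
   hence "y ~: cmap K ` (E Int F Int S)" by auto
   with False show ?thesis by simp
  qed
 qed
 also have "... = emeasure (density lborel (%y. ennreal (ind (cmap K ` (E Int S)) y * rr K y))) (chart_inv K -` F)"
  using m pre by (subst emeasure_density) (auto intro: measurable_compose[OF _ measurable_ennreal])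
 also have "... = emeasure (distr (density lborel (%y. ennreal (ind (cmap K ` (E Int S)) y * rr K y))) borel (chart_inv K)) F"
  using chart_inv_measurable[OF k(2)] F by (subst emeasure_distr) auto
 finally show "emeasure (density mu (%p. ennreal (ind E p))) F = emeasure (distr (density lborel (%y. ennreal (ind (cmap K ` (E Int S)) y * rr K y))) borel (chart_inv K)) F" .
qed

section \<open>Levi-Civita connection and second fundamental form in charts\<close>

abbreviation D2 :: "('a::real_normed_vector => 'b::real_normed_vector) => 'a => 'a => 'a => 'b" where
 "D2 f x u v \<equiv> FD (%z. FD f z u) x v"

abbreviation DG :: "('v::real_normed_vector => 'v => 'v => real) => 'v => 'v => 'v => 'v => real" where
 "DG G x a b c \<equiv> FD (%z. G z b c) x a"

text \<open>The pairing of the Christoffel vector of \<open>u\<close> and \<open>v\<close> with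
  \<open>z\<close>. The Christoffel vector is a definite description, whereas this pairing is an
  explicit expression in the metric, for which smoothness and transformation laws can be
  computed.\<close>

definition koszul :: "('v::real_normed_vector => 'v => 'v => real) => 'v => 'v => 'v => 'v => real" where
 "koszul G x u v z = (DG G x u v z + DG G x v u z - DG G x z u v) / 2"

lemma D2_has_derivative:
 assumes "Cinf f U" "x : U"
 shows "HD (%z. FD f z u) (D2 f x u) x"
 by (rule Cinf_deriv[OF Cinf_frechet[OF assms(1)] assms(2)])

lemma D2_linear:
 fixes f :: "'a::euclidean_space => 'b::euclidean_space"
 assumes "Cinf f U" "x : U"
 shows "linear (D2 f x u)" "linear (%u. D2 f x u v)"
proof -
 show 1: "linear (D2 f x u)" for u using D2_has_derivative[OF assms] by (rule has_derivative_linear)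
 show "linear (%u. D2 f x u v)"
  unfolding second_derivative_symmetric[OF assms, of _ v] by (rule 1)
qed

text \<open>Base point and direction both move. Expanding the direction in the basis leaves
  compositions with fixed directions; the motion of the base point yields the second derivative,
  that of the direction the first.\<close>

lemma derivative_of_applied_derivative:
 fixes f :: "'b::euclidean_space => 'c::euclidean_space"
 assumes f: "Cinf f V" and g: "HD g g' y" and w: "HD w w' y"
  and y: "y : U" "open U" "!!z. z : U ==> g z : V"
 shows "((%z. FD f (g z) (w z)) has_derivative
  (%u. D2 f (g y) (w y) (g' u) + FD f (g y) (w' u))) (at y)"
proof -
 have gy: "g y : V" using y by auto
 have d: "HD (%z. FD f (g z) b) (%u. D2 f (g y) b (g' u)) y" for b
  by (rule has_derivative_compose[OF g D2_has_derivative[OF f gy]])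
 have "((%z. SUM b:Basis. (w z \<bullet> b) *\<^sub>R FD f (g z) b) has_derivative
   (%u. SUM b:Basis. (w y \<bullet> b) *\<^sub>R D2 f (g y) b (g' u) + (w' u \<bullet> b) *\<^sub>R FD f (g y) b)) (at y)"
  by (intro has_derivative_sum has_derivative_scaleR has_derivative_inner_left w d)
 moreover have "(SUM b:Basis. (w y \<bullet> b) *\<^sub>R D2 f (g y) b (g' u) + (w' u \<bullet> b) *\<^sub>R FD f (g y) b)
   = D2 f (g y) (w y) (g' u) + FD f (g y) (w' u)" for u
  unfolding sum.distrib
  using linear_basis_expansion[OF D2_linear(2)[OF f gy], of "w y" "g' u"]
   linear_basis_expansion[OF Cinf_frechet_linear[OF f gy], of "w' u"] by simp
 ultimately have "((%z. SUM b:Basis. (w z \<bullet> b) *\<^sub>R FD f (g z) b) has_derivative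
   (%u. D2 f (g y) (w y) (g' u) + FD f (g y) (w' u))) (at y)" by simp
 thus ?thesis
  by (rule has_derivative_cong_open[OF _ y(2,1)])
    (rule linear_basis_expansion[OF Cinf_frechet_linear[OF f y(3)], symmetric])
qed

lemma D2_compose:
 fixes f :: "'b::euclidean_space => 'c::euclidean_space" and g :: "'a::euclidean_space => 'b"
 assumes f: "Cinf f V" and g: "Cinf g U" and gU: "!!z. z : U ==> g z : V" and y: "y : U"
 shows "FD (%z. f (g z)) y u = FD f (g y) (FD g y u)"
  and "D2 (%z. f (g z)) y u v = D2 f (g y) (FD g y u) (FD g y v)
    + FD f (g y) (D2 g y u v)"
proof -
 have 1: "FD (%z. f (g z)) z = (%u. FD f (g z) (FD g z u))"
  if "z : U" for z
  by (rule frechet_derivative_at[OF has_derivative_compose[OF Cinf_deriv[OF g that] Cinf_deriv[OF f gU[OF that]]], symmetric])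
 thus "FD (%z. f (g z)) y u = FD f (g y) (FD g y u)"
  using y by simp
 have "((%z. FD f (g z) (FD g z u)) has_derivative
  (%v. D2 f (g y) (FD g y u) (FD g y v)
    + FD f (g y) (D2 g y u v))) (at y)"
  by (rule derivative_of_applied_derivative[OF f Cinf_deriv[OF g y] D2_has_derivative[OF g y] y Cinf_open[OF g] gU])
 hence "((%z. FD (%z. f (g z)) z u) has_derivative
  (%v. D2 f (g y) (FD g y u) (FD g y v)
    + FD f (g y) (D2 g y u v))) (at y)"
  by (rule has_derivative_cong_open[OF _ Cinf_open[OF g] y]) (simp add: 1)
 from frechet_derivative_at[OF this, symmetric]
 show "D2 (%z. f (g z)) y u v = D2 f (g y) (FD g y u) (FD g y v)
    + FD f (g y) (D2 g y u v)" by simp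
qed

text \<open>A Riemannian metric in coordinates. The tensor calculus is carried out here, away from
  chosen charts, and is instantiated later with the metric read in a chart.\<close>

locale local_metric =
 fixes G :: "'v::euclidean_space => 'v => 'v => real" and W :: "'v set"
 assumes G_inner: "!!x. x : W ==> inner_form (G x)" and G_smooth: "!!u v. Cinf (%x. G x u v) W"
begin

lemma open_W: "open W" by (rule Cinf_open[OF G_smooth])

lemmas G_bilinear = inner_formD(1)[OF G_inner]
lemmas G_sym = inner_formD(2)[OF G_inner]

lemma DG_has_derivative: "x : W ==> HD (%z. G z b c) (%a. DG G x a b c) x"
 by (rule Cinf_deriv[OF G_smooth])

lemma DG_linear: "x : W ==> linear (%a. DG G x a b c)"
 using DG_has_derivative by (rule has_derivative_linear)

lemma DG_eqI:
 assumes "x : W" "!!z. z : W ==> G z b c = f z" "HD f f' x"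
 shows "DG G x a b c = f' a"
proof -
 have "HD (%z. G z b c) f' x"
  by (rule has_derivative_cong_open[OF assms(3) open_W assms(1)]) (rule assms(2)[symmetric])
 from has_derivative_unique[OF DG_has_derivative[OF assms(1)] this] show ?thesis by (simp add: fun_eq_iff)
qed

lemma DG_bilinear:
 assumes x: "x : W"
 shows "bilinear (%b c. DG G x a b c)"
 unfolding bilinear_def
proof (intro conjI allI linearI)
 fix b b1 b2 :: 'v and r :: real
 show "DG G x a b (b1 + b2) = DG G x a b b1 + DG G x a b b2"
  by (rule DG_eqI[OF x _ has_derivative_add[OF DG_has_derivative[OF x] DG_has_derivative[OF x]]])
    (rule bilinear_radd[OF G_bilinear])
 show "DG G x a (b1 + b2) b = DG G x a b1 b + DG G x a b2 b"
  by (rule DG_eqI[OF x _ has_derivative_add[OF DG_has_derivative[OF x] DG_has_derivative[OF x]]])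
    (rule bilinear_ladd[OF G_bilinear])
 show "DG G x a b (r *\<^sub>R b1) = r *\<^sub>R DG G x a b b1"
  by (rule DG_eqI[OF x _ has_derivative_scaleR_right[OF DG_has_derivative[OF x]]])
    (rule bilinear_rmul[OF G_bilinear])
 show "DG G x a (r *\<^sub>R b1) b = r *\<^sub>R DG G x a b1 b"
  by (rule DG_eqI[OF x _ has_derivative_scaleR_right[OF DG_has_derivative[OF x]]])
    (rule bilinear_lmul[OF G_bilinear])
qed

lemma DG_sym: "x : W ==> DG G x a b c = DG G x a c b"
 by (rule DG_eqI[OF _ _ DG_has_derivative]) (auto intro: G_sym)

text \<open>Product rule for the pairing of two fields along \<open>h\<close>, obtained by expanding
  the bilinear form in the basis; the first summand is the derivative of the metric itself.\<close>

lemma G_chain: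
 fixes h a b :: "'u::euclidean_space => 'v"
 assumes y: "y : U" "open U" "!!z. z : U ==> h z : W"
  and d: "HD h h' y" "HD a a' y" "HD b b' y"
 shows "((%z. G (h z) (a z) (b z)) has_derivative
  (%u. DG G (h y) (h' u) (a y) (b y) + G (h y) (a' u) (b y) + G (h y) (a y) (b' u))) (at y)"
proof -
 have hy: "h y : W" using y by auto
 have exp: "B u v = (SUM i:Basis. SUM j:Basis. (u \<bullet> i) * (v \<bullet> j) * B i j)" if "bilinear B" for B :: "'v => 'v => real" and u v
  using bilinear_sum_sum[OF that, where I=Basis and J=Basis and c="%i. u \<bullet> i" and d="%j. v \<bullet> j" and x="%i. i" and y="%j. j"]
  by (simp add: euclidean_representation)
 have "((%z. SUM i:Basis. SUM j:Basis. (a z \<bullet> i) * (b z \<bullet> j) * G (h z) i j) has_derivative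
  (%u. SUM i:Basis. SUM j:Basis. (a y \<bullet> i) * (b y \<bullet> j) * DG G (h y) (h' u) i j + ((a y \<bullet> i) * (b' u \<bullet> j) + (a' u \<bullet> i) * (b y \<bullet> j)) * G (h y) i j)) (at y)"
  by (intro has_derivative_sum has_derivative_mult has_derivative_inner_left d has_derivative_compose[OF d(1) DG_has_derivative[OF hy]])
 also have "(%u. SUM i:Basis. SUM j:Basis. (a y \<bullet> i) * (b y \<bullet> j) * DG G (h y) (h' u) i j + ((a y \<bullet> i) * (b' u \<bullet> j) + (a' u \<bullet> i) * (b y \<bullet> j)) * G (h y) i j)
  = (%u. DG G (h y) (h' u) (a y) (b y) + G (h y) (a' u) (b y) + G (h y) (a y) (b' u))"
 proof
  fix u
  have e1: "DG G (h y) (h' u) (a y) (b y) = (SUM i:Basis. SUM j:Basis. (a y \<bullet> i) * (b y \<bullet> j) * DG G (h y) (h' u) i j)"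
   by (rule exp[OF DG_bilinear[OF hy]])
  show "(SUM i:Basis. SUM j:Basis. (a y \<bullet> i) * (b y \<bullet> j) * DG G (h y) (h' u) i j + ((a y \<bullet> i) * (b' u \<bullet> j) + (a' u \<bullet> i) * (b y \<bullet> j)) * G (h y) i j)
   = DG G (h y) (h' u) (a y) (b y) + G (h y) (a' u) (b y) + G (h y) (a y) (b' u)"
   unfolding e1 exp[OF G_bilinear[OF hy], of "a' u" "b y"] exp[OF G_bilinear[OF hy], of "a y" "b' u"]
   by (simp add: sum.distrib[symmetric] algebra_simps)
 qed
 finally show ?thesis
  by (rule has_derivative_cong_open[OF _ y(2,1)]) (rule exp[OF G_bilinear[OF y(3)], symmetric])
qed

text \<open>Positive definiteness makes the map from vectors to functionals injective, hence
  bijective in finite dimension. This legitimises the definite description of the Christoffel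
  symbols.\<close>

lemma riesz:
 assumes x: "x : W" and f: "linear f"
 shows "EX! w. ALL z. G x w z = f z"
proof -
 have bl: "bilinear (G x)" by (rule G_bilinear[OF x])
 define T where "T w = (SUM b:Basis. G x w b *\<^sub>R b)" for w
 have lT: "linear T"
  unfolding T_def by (intro linearI) (simp_all add: bilinear_ladd[OF bl] bilinear_lmul[OF bl] scaleR_add_left sum.distrib scaleR_sum_right)
 have Tz: "G x w z = T w \<bullet> z" for w z
  using linear_basis_expansion[of "G x w" z] bl
  by (simp add: bilinear_def T_def inner_sum_left inner_commute[of z] mult.commute)
 have "inj T"
  unfolding linear_injective_0[OF lT]
 proof (intro allI impI)
  fix w assume "T w = 0"
  hence "G x w w = 0" using Tz[of w w] by simp
  thus "w = 0" using inner_formD(5)[OF G_inner[OF x]] by simp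
 qed
 hence "surj T" using linear_injective_imp_surjective[OF lT] by simp
 then obtain w where w: "T w = (SUM b:Basis. f b *\<^sub>R b)" by (metis surjD)
 have fw: "G x w z = f z" for z
  unfolding Tz w using linear_basis_expansion[OF f, of z] by (simp add: inner_sum_left inner_commute[of z] mult.commute)
 show ?thesis
 proof (rule ex1I[of _ w])
  show "ALL z. G x w z = f z" using fw by simp
  fix w' assume "ALL z. G x w' z = f z"
  hence "T w' \<bullet> z = T w \<bullet> z" for z using fw Tz by metis
  hence "T w' = T w" using vector_eq_rdot by blast
  thus "w' = w" using \<open>inj T\<close> by (simp add: inj_eq)
 qed
qed

lemma koszul_linear: "x : W ==> linear (%z. koszul G x u v z)"
proof -
 assume x: "x : W"
 show ?thesis
  unfolding koszul_def
  by (intro linearI)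
   (simp_all add: bilinear_radd[OF DG_bilinear[OF x]] bilinear_rmul[OF DG_bilinear[OF x]]
    linear_add[OF DG_linear[OF x]] linear_scale[OF DG_linear[OF x]] field_simps)
qed

definition gamma :: "'v => 'v => 'v => 'v" where
 "gamma x u v = (THE w. ALL z. 2 * G x w z = DG G x u v z + DG G x v u z - DG G x z u v)"

lemma gamma_koszul: "x : W ==> G x (gamma x u v) z = koszul G x u v z"
proof -
 assume x: "x : W"
 have "(2 * G x w z = DG G x u v z + DG G x v u z - DG G x z u v) \<longleftrightarrow> G x w z = koszul G x u v z" for w z
  by (auto simp: koszul_def)
 hence "EX! w. ALL z. 2 * G x w z = DG G x u v z + DG G x v u z - DG G x z u v"
  using riesz[OF x koszul_linear[OF x]] by simp
 from theI'[OF this] have "2 * G x (gamma x u v) z = DG G x u v z + DG G x v u z - DG G x z u v"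
  unfolding gamma_def by blast
 thus ?thesis by (simp add: koszul_def)
qed

text \<open>The non-tensorial term in the transformation law of the Christoffel symbols.\<close>

lemma koszul_transform:
 assumes G0: "local_metric G0 W0" and ta: "Cinf ta W0" "!!x. x : W0 ==> ta x : W"
  and eq: "!!x b c. x : W0 ==> G0 x b c = G (ta x) (FD ta x b) (FD ta x c)"
  and x: "x : W0"
 shows "koszul G0 x u v z = koszul G (ta x) (FD ta x u) (FD ta x v) (FD ta x z)
   + G (ta x) (D2 ta x u v) (FD ta x z)"
proof -
 interpret G0: local_metric G0 W0 by fact
 let ?d = "%b. FD ta x b"
 have d: "DG G0 x a b c = DG G (ta x) (?d a) (?d b) (?d c) + G (ta x) (D2 ta x b a) (?d c) + G (ta x) (?d b) (D2 ta x c a)" for a b c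
  by (rule G0.DG_eqI[OF x eq G_chain[OF x G0.open_W ta(2) Cinf_deriv[OF ta(1) x] D2_has_derivative[OF ta(1) x] D2_has_derivative[OF ta(1) x]]])
 have s: "D2 ta x b a = D2 ta x a b" for a b by (rule second_derivative_symmetric[OF ta(1) x])
 have gs: "G (ta x) b c = G (ta x) c b" for b c by (rule G_sym[OF ta(2)[OF x]])
 show ?thesis
  unfolding koszul_def d using s[of u v] s[of u z] s[of v z] gs by (simp add: field_simps)
qed

end

lemma matrix_inv_sym:
 fixes A :: "real^'n^'n"
 assumes "det A ~= 0" "!!i j. A $ i $ j = A $ j $ i"
 shows "matrix_inv A $ i $ j = matrix_inv A $ j $ i"
proof -
 have A: "transpose A = A" using assms(2) by (simp add: transpose_def vec_eq_iff)
 have "transpose (matrix_inv A) ** A = transpose (A ** matrix_inv A)"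
  by (simp add: matrix_transpose_mul A)
 hence "transpose (matrix_inv A) ** A = mat 1" by (simp add: matrix_inv_mult assms transpose_mat)
 hence "transpose (matrix_inv A) ** (A ** matrix_inv A) = matrix_inv A"
  by (simp add: matrix_mul_assoc)
 hence "transpose (matrix_inv A) = matrix_inv A" by (simp add: matrix_inv_mult assms)
 from arg_cong[OF this, of "%B. B $ j $ i"] show ?thesis by (simp add: transpose_def)
qed

lemma symmetric_weight_sum:
 fixes P f :: "'k::finite => 'k => real"
 assumes "!!k l. P k l = P l k"
 shows "(SUM k:UNIV. SUM l:UNIV. P k l * f k l) = (SUM k:UNIV. SUM l:UNIV. P k l * f l k)"
 by (subst sum.swap, intro sum.cong refl) (simp add: assms)

locale local_immersion = local_metric G W
 for G :: "'v::euclidean_space => 'v => 'v => real" and W :: "'v set" +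
 fixes F :: "real^'m => 'v" and U :: "(real^'m) set"
 assumes F_smooth: "Cinf F U" and F_in: "!!y. y : U ==> F y : W"
  and F_inj: "!!y. y : U ==> inj (FD F y)"
begin

abbreviation dF :: "real^'m => real^'m => 'v" where "dF y \<equiv> FD F y"

abbreviation e :: "'m => real^'m" where "e k \<equiv> ax k"

definition gF :: "real^'m => real^'m => real^'m => real" where
 "gF y u v = G (F y) (dF y u) (dF y v)"

definition vol :: "real^'m => real" where "vol y = sqrt (det (gram (gF y)))"

text \<open>The densitised inverse metric \<open>sqrt (det g) g^kl\<close>. With it, the Riemannian
  divergence times the volume density is a plain sum of coordinate derivatives.\<close>

definition P :: "'m => 'm => real^'m => real" where
 "P k l y = vol y * matrix_inv (gram (gF y)) $ k $ l"

lemma open_U: "open U" by (rule Cinf_open[OF F_smooth])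

lemma dF_linear: "y : U ==> linear (dF y)" by (rule Cinf_frechet_linear[OF F_smooth])

lemma gF_inner:
 assumes y: "y : U"
 shows "inner_form (gF y)"
proof -
 have g: "inner_form (G (F y))" by (rule G_inner[OF F_in[OF y]])
 have "bilinear (gF y)" unfolding gF_def[abs_def]
  by (rule bilinear_compose[OF inner_formD(1)[OF g] dF_linear[OF y] dF_linear[OF y]])
 moreover have "dF y u ~= 0" if "u ~= 0" for u
  using F_inj[OF y] that linear_injective_0[OF dF_linear[OF y]] by auto
 hence "gF y u u > 0" if "u ~= 0" for u
  unfolding gF_def using that by (intro inner_formD(3)[OF g]) simp
 moreover have "gF y u v = gF y v u" for u v unfolding gF_def by (rule inner_formD(2)[OF g])
 ultimately show ?thesis unfolding inner_form_def by simp
qed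

lemma gF_smooth: "Cinf (%y. gF y u v) U"
 unfolding gF_def
proof (rule Cinf_apply_bilinear[where L="%y. G (F y)"])
 show "Cinf (%y. G (F y) v w) U" for v w
  by (rule Cinf_compose[OF G_smooth F_smooth F_in])
qed (rule G_bilinear[OF F_in] Cinf_frechet[OF F_smooth], assumption?)+

lemma det_pos: "y : U ==> det (gram (gF y)) > 0"
 by (rule det_gram_pos[OF gF_inner])

lemma vol_pos: "y : U ==> vol y > 0"
 by (simp add: vol_def det_pos)

lemma vol_smooth: "Cinf vol U"
 unfolding vol_def by (intro Cinf_sqrt Cinf_det open_U det_pos) (simp_all add: gF_smooth)

lemma P_smooth: "Cinf (P k l) U"
 unfolding P_def[abs_def]
proof (intro Cinf_mult vol_smooth Cinf_matrix_inv open_U)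
 show "det (gram (gF y)) ~= 0" if "y : U" for y using det_pos[OF that] by simp
qed (simp add: gF_smooth)

lemma P_sym: "y : U ==> P k l y = P l k y"
proof -
 assume y: "y : U"
 have "det (gram (gF y)) ~= 0" using det_pos[OF y] by simp
 thus ?thesis unfolding P_def
  using matrix_inv_sym[of "gram (gF y)" k l] inner_formD(2)[OF gF_inner[OF y]] by simp
qed

lemma P_contract:
 assumes y: "y : U"
 shows "(SUM l:UNIV. P k l y * gF y (e m) (e l)) = (if k = m then vol y else 0)"
proof -
 have nz: "det (gram (gF y)) ~= 0" using det_pos[OF y] by simp
 have "(SUM l:UNIV. P k l y * gF y (e m) (e l)) = vol y * (matrix_inv (gram (gF y)) ** gram (gF y)) $ k $ m"
  using inner_formD(2)[OF gF_inner[OF y]]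
  by (simp add: P_def matrix_matrix_mult_def sum_distrib_left mult_ac)
 thus ?thesis by (simp add: matrix_inv_mult[OF nz] mat_def)
qed

lemma vol_metric_trace:
 "vol y * metric_trace (gF y) T = (SUM k:UNIV. SUM l:UNIV. P k l y * T (e k) (e l))"
 by (simp add: metric_trace_def P_def sum_distrib_left mult_ac)

lemma gF_has_derivative:
 assumes y: "y : U"
 shows "HD (%z. gF z a b) (%u. DG G (F y) (dF y u) (dF y a) (dF y b)
   + G (F y) (D2 F y a u) (dF y b) + G (F y) (dF y a) (D2 F y b u)) y"
 unfolding gF_def
 by (rule G_chain[OF y open_U F_in Cinf_deriv[OF F_smooth y] D2_has_derivative[OF F_smooth y] D2_has_derivative[OF F_smooth y]])

text \<open>Jacobi's formula for the Gram determinant, halved by the square root; the symmetry of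
  \<open>P\<close> brings the index positions into the order of the metric.\<close>

lemma vol_has_derivative:
 assumes y: "y : U"
 shows "HD vol (%u. (SUM k:UNIV. SUM l:UNIV. P k l y *
   (DG G (F y) (dF y u) (dF y (e k)) (dF y (e l)) + G (F y) (D2 F y (e k) u) (dF y (e l)) + G (F y) (dF y (e k)) (D2 F y (e l) u))) / 2) y"
proof -
 define T where "T u k l = DG G (F y) (dF y u) (dF y (e k)) (dF y (e l)) + G (F y) (D2 F y (e k) u) (dF y (e l)) + G (F y) (dF y (e k)) (D2 F y (e l) u)" for u k l
 define M where "M = (%z. gram (gF z))"
 let ?X = "%u. SUM i:UNIV. SUM j:UNIV. matrix_inv (M y) $ i $ j * T u j i"
 have nz: "det (M y) ~= 0" using det_pos[OF y] by (simp add: M_def)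
 have "HD (%z. M z $ i $ j) (%u. (\<chi> i j. T u i j) $ i $ j) y" for i j
  using gF_has_derivative[OF y, of "e i" "e j"] by (simp add: T_def M_def)
 from has_derivative_det[OF this nz]
 have "HD (%z. det (M z)) (%u. det (M y) * ?X u) y"
  by simp
 moreover have "HD sqrt ((*) (inverse (sqrt (det (M y))) / 2)) (det (M y))"
  using DERIV_real_sqrt[of "det (M y)"] det_pos[OF y] by (simp add: has_field_derivative_def M_def)
 ultimately have "HD (%z. sqrt (det (M z))) (%u. inverse (sqrt (det (M y))) / 2 * (det (M y) * ?X u)) y"
  by (rule has_derivative_compose)
 moreover have "(%u. inverse (sqrt (det (M y))) / 2 * (det (M y) * ?X u))
  = (%u. (SUM k:UNIV. SUM l:UNIV. P k l y * T u k l) / 2)"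
 proof
  fix u
  have 1: "inverse (sqrt (det (M y))) / 2 * (det (M y) * X) = (vol y * X) / 2" for X
   using det_pos[OF y] by (simp add: vol_def M_def field_simps)
  have 2: "vol y * ?X u = (SUM k:UNIV. SUM l:UNIV. P k l y * T u k l)"
   unfolding symmetric_weight_sum[of "%k l. P k l y" "T u", OF P_sym[OF y]]
   by (simp add: P_def M_def sum_distrib_left mult.assoc)
  show "inverse (sqrt (det (M y))) / 2 * (det (M y) * ?X u)
   = (SUM k:UNIV. SUM l:UNIV. P k l y * T u k l) / 2"
   unfolding 1 2 ..
 qed
 ultimately have "HD (%z. sqrt (det (M z))) (%u. (SUM k:UNIV. SUM l:UNIV. P k l y * T u k l) / 2) y"
  by (simp only:)
 thus ?thesis by (simp add: vol_def[abs_def] M_def T_def)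
qed

text \<open>Coordinates of the part of \<open>V\<close> tangent to the submanifold, multiplied by
  the volume density. Their coordinate divergence is the divergence of the tangential part times
  \<open>vol\<close>.\<close>

definition Z :: "(real^'m => 'v) => 'm => real^'m => real" where
 "Z V k y = (SUM l:UNIV. P k l y * G (F y) (V y) (dF y (e l)))"

text \<open>The Laplace-Beltrami operator applied to \<open>F\<close>, corrected by the ambient
  Christoffel symbols (the tension field) and multiplied by \<open>vol\<close>. It turns out to be
  \<open>m vol\<close> times the mean curvature vector.\<close>

definition N :: "real^'m => 'v" where
 "N y = (SUM k:UNIV. SUM l:UNIV. FD (P k l) y (e k) *\<^sub>R dF y (e l)
   + P k l y *\<^sub>R (D2 F y (e k) (e l) + gamma (F y) (dF y (e k)) (dF y (e l))))"

text \<open>Half the metric trace of the derivative of the induced metric when the immersion moves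
  with velocity \<open>V\<close>, where \<open>V'\<close> stands for the derivative of
  \<open>V\<close>. This is the relative rate of change of the volume element.\<close>

definition first_variation :: "(real^'m => 'v) => (real^'m => 'v) => real^'m => real" where
 "first_variation V V' y = metric_trace (gF y) (%a b.
   (DG G (F y) (V y) (dF y a) (dF y b) + G (F y) (V' a) (dF y b) + G (F y) (dF y a) (V' b)) / 2)"

lemma Z_has_derivative:
 assumes y: "y : U" and V: "HD V V' y"
 shows "HD (Z V k) (%u. SUM l:UNIV. P k l y * (DG G (F y) (dF y u) (V y) (dF y (e l))
   + G (F y) (V' u) (dF y (e l)) + G (F y) (V y) (D2 F y (e l) u))
   + FD (P k l) y u * G (F y) (V y) (dF y (e l))) y"
 unfolding Z_def[abs_def]
 by (intro has_derivative_sum has_derivative_mult Cinf_deriv[OF P_smooth y]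
   G_chain[OF y open_U F_in Cinf_deriv[OF F_smooth y] V D2_has_derivative[OF F_smooth y]])

text \<open>The first variation formula before integration. The product rule yields derivatives of
  the metric in tangential directions; the Koszul expression inside \<open>N\<close> supplies
  exactly these, minus half the derivative in direction \<open>V\<close>, and the latter is
  compensated by the metric term of \<open>first_variation\<close>.\<close>

lemma divergence_identity:
 assumes y: "y : U" and V: "HD V V' y"
 shows "(SUM k:UNIV. FD (Z V k) y (e k)) = vol y * first_variation V V' y + G (F y) (N y) (V y)"
proof -
 have Fy: "F y : W" by (rule F_in[OF y])
 note bl = G_bilinear[OF Fy]
 have sw: "(SUM k:UNIV. SUM l:UNIV. P k l y * f k l) = (SUM k:UNIV. SUM l:UNIV. P k l y * f l k)" for f
  by (rule symmetric_weight_sum) (rule P_sym[OF y])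
 let ?S = "%f. SUM k:UNIV. SUM l:UNIV. f k l :: real"
 let ?p = "%k l. P k l y" and ?x = "F y" and ?f = "%k. dF y (e k)" and ?v = "V y"
 have S_add: "?S f + ?S g = ?S (%k l. f k l + g k l)" and S_diff: "?S f - ?S g = ?S (%k l. f k l - g k l)"
  and S_half: "?S f / 2 = ?S (%k l. f k l / 2)" for f g
  by (simp_all only: sum.distrib sum_subtractf sum_divide_distrib)
 define Q where "Q = ?S (%k l. FD (P k l) y (e k) * G ?x ?v (?f l))"
 have lhs: "(SUM k:UNIV. FD (Z V k) y (e k)) =
   ?S (%k l. ?p k l * DG G ?x (?f k) ?v (?f l)) + ?S (%k l. ?p k l * G ?x (V' (e k)) (?f l))
   + ?S (%k l. ?p k l * G ?x ?v (D2 F y (e l) (e k))) + Q"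
  unfolding Q_def S_add frechet_derivative_at[OF Z_has_derivative[OF y V], symmetric]
  by (intro sum.cong refl) (simp add: algebra_simps)
 have fv: "vol y * first_variation V V' y = ?S (%k l. ?p k l * DG G ?x ?v (?f k) (?f l)) / 2
   + ?S (%k l. ?p k l * G ?x (V' (e k)) (?f l))"
 proof -
  have 1: "?S (%k l. ?p k l * G ?x (?f k) (V' (e l))) = ?S (%k l. ?p k l * G ?x (V' (e k)) (?f l))"
   unfolding sw[of "%k l. G ?x (?f k) (V' (e l))"] by (intro sum.cong refl) (simp add: G_sym[OF Fy])
  have "vol y * first_variation V V' y = ?S (%k l. ?p k l * DG G ?x ?v (?f k) (?f l)) / 2
   + ?S (%k l. ?p k l * G ?x (V' (e k)) (?f l)) / 2 + ?S (%k l. ?p k l * G ?x (?f k) (V' (e l))) / 2"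
   unfolding first_variation_def vol_metric_trace S_half S_add
   by (intro sum.cong refl) (simp add: field_simps)
  thus ?thesis unfolding 1 by simp
 qed
 have n: "G ?x (N y) ?v = Q + ?S (%k l. ?p k l * G ?x ?v (D2 F y (e l) (e k)))
   + ?S (%k l. ?p k l * koszul G ?x (?f k) (?f l) ?v)"
 proof -
  have lin: "linear (%w. G ?x w ?v)" using bl by (simp add: bilinear_def)
  have "G ?x (N y) ?v = ?S (%k l. FD (P k l) y (e k) * G ?x (?f l) ?v
    + ?p k l * (G ?x (D2 F y (e k) (e l)) ?v + G ?x (gamma ?x (?f k) (?f l)) ?v))"
   unfolding N_def by (simp only: linear_sum[OF lin] linear_add[OF lin] linear_scale[OF lin] real_scaleR_def)
  also have "... = Q + ?S (%k l. ?p k l * G ?x ?v (D2 F y (e l) (e k)))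
   + ?S (%k l. ?p k l * koszul G ?x (?f k) (?f l) ?v)"
   unfolding Q_def S_add
  proof (intro sum.cong refl)
   fix k l
   show "FD (P k l) y (e k) * G ?x (?f l) ?v
     + ?p k l * (G ?x (D2 F y (e k) (e l)) ?v + G ?x (gamma ?x (?f k) (?f l)) ?v)
    = FD (P k l) y (e k) * G ?x ?v (?f l) + ?p k l * G ?x ?v (D2 F y (e l) (e k))
     + ?p k l * koszul G ?x (?f k) (?f l) ?v"
    unfolding gamma_koszul[OF Fy] second_derivative_symmetric[OF F_smooth y, of "e k" "e l"]
     G_sym[OF Fy, of ?v] by (simp add: algebra_simps)
  qed
  finally show ?thesis .
 qed
 have k: "?S (%k l. ?p k l * koszul G ?x (?f k) (?f l) ?v) = ?S (%k l. ?p k l * DG G ?x (?f k) ?v (?f l))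
   - ?S (%k l. ?p k l * DG G ?x ?v (?f k) (?f l)) / 2"
 proof -
  have 1: "?S (%k l. ?p k l * DG G ?x (?f k) (?f l) ?v) = ?S (%k l. ?p k l * DG G ?x (?f k) ?v (?f l))"
   by (intro sum.cong refl arg_cong[where f="(*) _"] DG_sym[OF Fy])
  have 2: "?S (%k l. ?p k l * DG G ?x (?f l) (?f k) ?v) = ?S (%k l. ?p k l * DG G ?x (?f k) ?v (?f l))"
   unfolding sw[of "%k l. DG G ?x (?f l) (?f k) ?v"] by (rule 1)
  have "?S (%k l. ?p k l * koszul G ?x (?f k) (?f l) ?v) =
    (?S (%k l. ?p k l * DG G ?x (?f k) (?f l) ?v) + ?S (%k l. ?p k l * DG G ?x (?f l) (?f k) ?v) - ?S (%k l. ?p k l * DG G ?x ?v (?f k) (?f l))) / 2"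
   unfolding koszul_def S_add S_diff S_half by (intro sum.cong refl) (simp add: field_simps)
  thus ?thesis unfolding 1 2 by simp
 qed
 show ?thesis unfolding lhs fv n k by simp
qed

text \<open>Apply the divergence identity to the coordinate field \<open>V = dF e_m\<close>. Its
  \<open>Z\<close> is \<open>vol\<close> in slot \<open>m\<close> and 0 elsewhere, so the divergence
  is the derivative of \<open>vol\<close>, and this is already the whole change of the volume
  element; the pairing with \<open>N\<close> must vanish.\<close>

lemma N_normal:
 assumes y: "y : U"
 shows "G (F y) (N y) (dF y w) = 0"
proof -
 have Fy: "F y : W" by (rule F_in[OF y])
 have basis: "G (F y) (N y) (dF y (e m)) = 0" for m
 proof -
  let ?V = "%z. dF z (e m)"
  have V: "HD ?V (D2 F y (e m)) y" by (rule D2_has_derivative[OF F_smooth y])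
  have Zk: "Z ?V k z = (if k = m then vol z else 0)" if "z : U" for k z
   using P_contract[OF that, of k m] by (simp add: Z_def gF_def)
  have "FD (Z ?V k) y (e k) = (if k = m then FD vol y (e m) else 0)" for k
  proof (cases "k = m")
   case True
   have "HD (Z ?V k) (FD vol y) y"
    by (rule has_derivative_cong_open[OF Cinf_deriv[OF vol_smooth y] open_U y]) (simp add: Zk True)
   from frechet_derivative_at[OF this, symmetric] show ?thesis using True by simp
  next
   case False
   have "HD (Z ?V k) (%u. 0) y"
    by (rule has_derivative_cong_open[OF has_derivative_const open_U y]) (simp add: Zk False)
   from frechet_derivative_at[OF this, symmetric] show ?thesis using False by simp
  qed
  hence "(SUM k:UNIV. FD (Z ?V k) y (e k)) = FD vol y (e m)" by simp
  moreover have "vol y * first_variation ?V (D2 F y (e m)) y = FD vol y (e m)"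
   unfolding frechet_derivative_at[OF vol_has_derivative[OF y], symmetric] first_variation_def vol_metric_trace
    second_derivative_symmetric[OF F_smooth y, of "e m"]
   by (simp add: sum_divide_distrib)
  ultimately show ?thesis using divergence_identity[OF y V] by simp
 qed
 have lin: "linear (%w. G (F y) (N y) (dF y w))"
  using linear_compose[OF dF_linear[OF y], of "G (F y) (N y)"] G_bilinear[OF Fy] by (simp add: bilinear_def o_def)
 show ?thesis
  by (subst vec_axis_expansion[of w]) (simp only: linear_sum[OF lin] linear_scale[OF lin] basis, simp)
qed

text \<open>The ambient covariant derivative of a coordinate field of the submanifold, without
  projection to the normal space. Paired with normal vectors it gives the second fundamental
  form.\<close>

definition sff :: "real^'m => real^'m => real^'m => 'v" where
 "sff y u v = D2 F y u v + gamma (F y) (dF y u) (dF y v)"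

lemma N_normal_pairing:
 assumes y: "y : U" and n: "!!u. G (F y) n (dF y u) = 0"
 shows "G (F y) (N y) n = vol y * metric_trace (gF y) (%u v. G (F y) (sff y u v) n)"
proof -
 have Fy: "F y : W" by (rule F_in[OF y])
 have lin: "linear (%w. G (F y) w n)" using G_bilinear[OF Fy] by (simp add: bilinear_def)
 have n': "G (F y) (dF y u) n = 0" for u using n G_sym[OF Fy] by simp
 show ?thesis
  unfolding N_def vol_metric_trace sff_def[symmetric]
  by (simp add: linear_sum[OF lin] linear_add[OF lin] linear_scale[OF lin] n')
qed

lemma DG_smooth:
 assumes V: "V <= U" and a: "Cinf a V" and b: "Cinf b V" and c: "Cinf c V"
 shows "Cinf (%y. DG G (F y) (a y) (b y) (c y)) V"
proof -
 have FV: "F y : W" if "y : V" for y using F_in V that by auto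
 have F: "Cinf F V" by (rule Cinf_subset[OF F_smooth Cinf_open[OF a] V])
 have 1: "Cinf (%y. DG G (F y) u v w) V" for u v w
  by (rule Cinf_compose[where f="%x. DG G x u v w" and g=F, OF Cinf_frechet[OF G_smooth] F FV])
 have 2: "Cinf (%y. DG G (F y) (a y) v w) V" for v w
 proof (rule Cinf_apply_linear[where L="%y u. DG G (F y) u v w"])
  show "linear (%u. DG G (F y) u v w)" if "y : V" for y by (rule DG_linear[OF FV[OF that]])
 qed (rule 1 a)+
 show ?thesis
 proof (rule Cinf_apply_bilinear[where L="%y v w. DG G (F y) (a y) v w"])
  show "bilinear (%v w. DG G (F y) (a y) v w)" if "y : V" for y by (rule DG_bilinear[OF FV[OF that]])
 qed (rule 2 b c)+
qed

text \<open>\<open>N\<close> contains Christoffel vectors. Paired with a smooth field they become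
  Koszul expressions, which are visibly smooth; continuity of the mean curvature is deduced from
  this.\<close>

lemma N_pairing_smooth:
 assumes V: "V <= U" and w: "Cinf w V"
 shows "Cinf (%y. G (F y) (N y) (w y)) V"
proof -
 have oV: "open V" by (rule Cinf_open[OF w])
 have FV: "F y : W" if "y : V" for y using F_in V that by auto
 have F: "Cinf F V" by (rule Cinf_subset[OF F_smooth oV V])
 have dFs: "Cinf (%y. dF y u) V" for u by (rule Cinf_frechet[OF F])
 have Ps: "Cinf (P k l) V" for k l by (rule Cinf_subset[OF P_smooth oV V])
 have Gs: "Cinf (%y. G (F y) (a y) (b y)) V" if "Cinf a V" "Cinf b V" for a b
 proof (rule Cinf_apply_bilinear[where L="%y. G (F y)"])
  show "Cinf (%y. G (F y) u v) V" for u v by (rule Cinf_compose[OF G_smooth F FV])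
  show "bilinear (G (F y))" if "y : V" for y by (rule G_bilinear[OF FV[OF that]])
 qed (rule that)+
 have kz: "Cinf (%y. koszul G (F y) (dF y a) (dF y b) (w y)) V" for a b
  unfolding koszul_def
  by (intro Cinf_divide Cinf_diff Cinf_add DG_smooth V dFs w Cinf_const oV) simp
 have "Cinf (%y. SUM k:UNIV. SUM l:UNIV. FD (P k l) y (e k) * G (F y) (dF y (e l)) (w y)
   + P k l y * (G (F y) (D2 F y (e k) (e l)) (w y) + koszul G (F y) (dF y (e k)) (dF y (e l)) (w y))) V"
  by (intro Cinf_sum Cinf_add Cinf_mult oV Gs kz dFs w Ps Cinf_frechet[OF Ps] Cinf_frechet[OF dFs])
 thus ?thesis
 proof (rule Cinf_cong)
  fix y assume y: "y : V"
  have lin: "linear (%v. G (F y) v (w y))" using G_bilinear[OF FV[OF y]] by (simp add: bilinear_def)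
  show "(SUM k:UNIV. SUM l:UNIV. FD (P k l) y (e k) * G (F y) (dF y (e l)) (w y)
   + P k l y * (G (F y) (D2 F y (e k) (e l)) (w y) + koszul G (F y) (dF y (e k)) (dF y (e l)) (w y))) = G (F y) (N y) (w y)"
   unfolding N_def gamma_koszul[OF FV[OF y], symmetric]
   by (simp only: linear_sum[OF lin] linear_add[OF lin] linear_scale[OF lin] real_scaleR_def)
 qed
qed

end

text \<open>Change of charts: \<open>F = ta o F0 o sg\<close> with metrics related by \<open>ta\<close>.  The second fundamental form, paired
 with a normal vector, is invariant.\<close>

lemma sff_transform:
 fixes F F0 :: "real^'m => 'v::euclidean_space"
 assumes I: "local_immersion G W F U" and I0: "local_immersion G0 W0 F0 U0"
  and ta: "Cinf ta W1" "W1 <= W0" "!!x. x : W1 ==> ta x : W"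
  and eq: "!!x b c. x : W1 ==> G0 x b c = G (ta x) (FD ta x b) (FD ta x c)"
  and sg: "Cinf sg U1" "U1 <= U" "!!y. y : U1 ==> sg y : U0" "!!y. y : U1 ==> F0 (sg y) : W1"
  and F: "!!y. y : U1 ==> F y = ta (F0 (sg y))"
  and y: "y : U1" and n: "!!u. G0 (F0 (sg y)) n (FD F0 (sg y) u) = 0"
 shows "G (F y) (local_immersion.sff G F y u v) (FD ta (F0 (sg y)) n) =
   G0 (F0 (sg y)) (local_immersion.sff G0 F0 (sg y) (FD sg y u) (FD sg y v)) n"
  and "FD F y u = FD ta (F0 (sg y)) (FD F0 (sg y) (FD sg y u))"
proof -
 interpret I: local_immersion G W F U by fact
 interpret I0: local_immersion G0 W0 F0 U0 by fact
 define x where "x = F0 (sg y)"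
 have xW1: "x : W1" and xW0: "x : W0" and xW: "ta x : W" using sg(4)[OF y] ta by (auto simp: x_def)
 have oU1: "open U1" by (rule Cinf_open[OF sg(1)])
 have oW1: "open W1" by (rule Cinf_open[OF ta(1)])
 define H where "H = (%z. F0 (sg z))"
 have Hs: "Cinf H U1" unfolding H_def by (rule Cinf_compose[OF I0.F_smooth sg(1) sg(3)])
 define su where "su u = FD sg y u" for u
 define T where "T b = FD ta x b" for b
 have Hy: "H y = x" by (simp add: H_def x_def)
 have HW: "H z : W1" if "z : U1" for z using sg(4)[OF that] by (simp add: H_def)
 have dH1: "FD H y u = FD F0 (sg y) (su u)" for u
  unfolding H_def su_def by (rule D2_compose(1)[OF I0.F_smooth sg(1) sg(3) y])
 have dH2: "D2 H y u v = D2 F0 (sg y) (su u) (su v) + FD F0 (sg y) (D2 sg y u v)" for u v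
  unfolding H_def su_def by (rule D2_compose(2)[OF I0.F_smooth sg(1) sg(3) y])
 have dT1: "FD (%z. ta (H z)) y u = T (FD H y u)" for u
  unfolding T_def Hy[symmetric] by (rule D2_compose(1)[OF ta(1) Hs HW y])
 have dT2: "D2 (%z. ta (H z)) y u v = D2 ta x (FD H y u) (FD H y v) + T (D2 H y u v)" for u v
  unfolding T_def Hy[symmetric] by (rule D2_compose(2)[OF ta(1) Hs HW y])
 have FH: "F z = ta (H z)" if "z : U1" for z using F[OF that] by (simp add: H_def)
 have "FD F z u = FD (%z. ta (H z)) z u" if "z : U1" for z u
 proof -
  have "HD F (FD F z) z" using Cinf_deriv[OF I.F_smooth] sg(2) that by auto
  hence "HD (%z. ta (H z)) (FD F z) z"
   by (rule has_derivative_cong_open[OF _ oU1 that]) (rule FH)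
  from frechet_derivative_at[OF this] show ?thesis by simp
 qed
 note dF = this
 have D2F: "D2 F y u v = D2 (%z. ta (H z)) y u v" for u v
 proof -
  have "HD (%z. FD F z u) (D2 F y u) y"
   using D2_has_derivative[OF I.F_smooth] sg(2) y by auto
  hence "HD (%z. FD (%z. ta (H z)) z u) (D2 F y u) y"
   by (rule has_derivative_cong_open[OF _ oU1 y]) (rule dF)
  from frechet_derivative_at[OF this] show ?thesis by simp
 qed
 have F1: "FD F y u = T (FD F0 (sg y) (su u))" for u
  unfolding dF[OF y] dT1 dH1 ..
 thus "FD F y u = FD ta (F0 (sg y)) (FD F0 (sg y) (FD sg y u))"
  by (simp add: T_def su_def x_def)
 let ?f = "%u. FD F0 (sg y) (su u)"
 have linT: "linear T" unfolding T_def[abs_def] by (rule Cinf_frechet_linear[OF ta(1) xW1])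
 have F2: "D2 F y u v = D2 ta x (?f u) (?f v) + T (D2 F0 (sg y) (su u) (su v)) + T (FD F0 (sg y) (D2 sg y u v))"
  unfolding D2F dT2 dH1 dH2 linear_add[OF linT] by simp
 have n0: "G0 x (FD F0 (sg y) w) n = 0" for w
  using n I0.G_sym[OF xW0] by (simp add: x_def)
 have geq: "G (ta x) (T b) (T c) = G0 x b c" for b c using eq[OF xW1] by (simp add: T_def)
 have G1: "local_metric G0 W1"
 proof
  show "inner_form (G0 x)" if "x : W1" for x using I0.G_inner[of x] ta(2) that by auto
  show "Cinf (%x. G0 x u v) W1" for u v by (rule Cinf_subset[OF I0.G_smooth oW1 ta(2)])
 qed
 have kz: "koszul G0 x a b n = koszul G (ta x) (T a) (T b) (T n) + G (ta x) (D2 ta x a b) (T n)" for a b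
  unfolding T_def by (rule I.koszul_transform[OF G1 ta(1) ta(3) eq xW1])
 have Fy: "F y = ta x" using FH[OF y] Hy by simp
 have lin: "linear (%w. G (ta x) w (T n))" and lin0: "linear (%w. G0 x w n)"
  using I.G_bilinear[OF xW] I0.G_bilinear[OF xW0] by (auto simp: bilinear_def)
 show "G (F y) (I.sff y u v) (FD ta (F0 (sg y)) n) =
   G0 (F0 (sg y)) (I0.sff (sg y) (FD sg y u) (FD sg y v)) n"
  unfolding I.sff_def I0.sff_def Fy F1 F2 x_def[symmetric] T_def[symmetric] su_def[symmetric]
   linear_add[OF lin] linear_add[OF lin0] I.gamma_koszul[OF xW] I0.gamma_koszul[OF xW0] kz geq n0
  by simp
qed

section \<open>Immersed submanifolds\<close>

lemma det_gram_transform: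
 fixes b :: "real^'m => real^'m => real"
 assumes b: "bilinear b"
 shows "det (gram (%u v. b (S u) (S v))) = (det (matrix S))^2 * det (gram b)"
proof -
 have "gram (%u v. b (S u) (S v)) = transpose (matrix S) ** gram b ** matrix S"
 proof (simp only: vec_eq_iff, intro allI)
  fix i j
  have "(transpose (matrix S) ** gram b ** matrix S) $ i $ j = (SUM l:UNIV. SUM k:UNIV. S (ax i) $ k * b (ax k) (ax l) * S (ax j) $ l)"
   by (simp add: matrix_matrix_mult_def transpose_def matrix_def sum_distrib_right)
  also have "... = (SUM k:UNIV. SUM l:UNIV. S (ax i) $ k * b (ax k) (ax l) * S (ax j) $ l)"
   by (rule sum.swap)
  also have "... = b (S (ax i)) (S (ax j))"
   unfolding bilinear_gram[OF b, of "S (ax i)" "S (ax j)"] by (intro sum.cong refl) simp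
  finally show "gram (%u v. b (S u) (S v)) $ i $ j = (transpose (matrix S) ** gram b ** matrix S) $ i $ j"
   by simp
 qed
 thus ?thesis by (simp add: det_mul power2_eq_square)
qed

lemma (in local_metric) koszul_bilinear:
 assumes x: "x : W"
 shows "bilinear (%u v. koszul G x u v z)"
 unfolding bilinear_def
proof (intro conjI allI)
 show "linear (%v. koszul G x u v z)" for u
  unfolding koszul_def
  by (intro linearI)
   (simp_all add: bilinear_radd[OF DG_bilinear[OF x]] bilinear_rmul[OF DG_bilinear[OF x]]
    bilinear_ladd[OF DG_bilinear[OF x]] bilinear_lmul[OF DG_bilinear[OF x]]
    linear_add[OF DG_linear[OF x]] linear_scale[OF DG_linear[OF x]] field_simps)
 show "linear (%u. koszul G x u v z)" for v
  unfolding koszul_def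
  by (intro linearI)
   (simp_all add: bilinear_radd[OF DG_bilinear[OF x]] bilinear_rmul[OF DG_bilinear[OF x]]
    bilinear_ladd[OF DG_bilinear[OF x]] bilinear_lmul[OF DG_bilinear[OF x]]
    linear_add[OF DG_linear[OF x]] linear_scale[OF DG_linear[OF x]] field_simps)
qed

lemma (in local_immersion) sff_pairing_bilinear:
 assumes y: "y : U"
 shows "bilinear (%u v. G (F y) (sff y u v) n)"
proof -
 have Fy: "F y : W" by (rule F_in[OF y])
 have lin: "linear (%w. G (F y) w n)" using G_bilinear[OF Fy] by (simp add: bilinear_def)
 have 1: "bilinear (%u v. koszul G (F y) (dF y u) (dF y v) n)"
  by (rule bilinear_compose[OF koszul_bilinear[OF Fy] dF_linear[OF y] dF_linear[OF y]])
 have 2: "bilinear (%u v. G (F y) (D2 F y u v) n)"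
  unfolding bilinear_def
 proof (intro conjI allI)
  show "linear (%v. G (F y) (D2 F y u v) n)" for u
   using linear_compose[OF D2_linear(1)[OF F_smooth y] lin] by (simp add: o_def)
  show "linear (%u. G (F y) (D2 F y u v) n)" for v
   using linear_compose[OF D2_linear(2)[OF F_smooth y] lin] by (simp add: o_def)
 qed
 have e: "G (F y) (sff y u v) n = G (F y) (D2 F y u v) n + koszul G (F y) (dF y u) (dF y v) n" for u v
  unfolding sff_def linear_add[OF lin] gamma_koszul[OF Fy] ..
 show ?thesis
  unfolding e using 1 2 by (simp add: bilinear_def linear_compose_add)
qed

locale submanifold = two_atlases A B + RB: riemannian B gb
 for A :: "('a::{t2_space, second_countable_topology}, real^'m) chart set"
  and B :: "('b::{t2_space, second_countable_topology}, 'v::euclidean_space) chart set"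
  and gb :: "('b, 'v) metric" +
 fixes \<phi> :: "'a => 'b"
 assumes oriented: "oriented_atlas A" and immersion: "immersion A B \<phi>"
begin

abbreviation (input) dph :: "'a => real^'m => 'v" where "dph == mdiff A B UNIV \<phi>"

abbreviation g :: "('a, real^'m) metric" where "g \<equiv> pullback_metric A B UNIV \<phi> gb"

abbreviation Gm :: "('b, 'v) chart => 'v => 'v => 'v => real" where "Gm \<equiv> metric_in_chart B gb"

abbreviation F :: "('a, real^'m) chart => ('b, 'v) chart => real^'m => 'v" where "F K K' \<equiv> rep K K' \<phi>"

abbreviation rdom :: "('a, real^'m) chart => ('b, 'v) chart => (real^'m) set" where
 "rdom K K' \<equiv> cmap K ` (cdom K Int \<phi> -` cdom K')"

lemma phi_continuous: "continuous_on UNIV \<phi>"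
 using immersion by (simp add: immersion_def smooth_map_on_def)

lemma F_smooth: "K : A ==> K' : B ==> Cinf (F K K') (rdom K K')"
 using rep_smooth[of K K' UNIV \<phi>] immersion by (simp add: immersion_def)

lemma rdom_iff: "K : A ==> p : cdom K ==> cmap K p : rdom K K' \<longleftrightarrow> \<phi> p : cdom K'"
 using inj_onD[OF A.chartD(8)[of K]] by auto

lemma mdiff_phi:
 assumes "K : A" "K' : B" "p : cdom K" "\<phi> p : cdom K'"
 shows "to_chart B K' (\<phi> p) (dph p (from_chart A K p u)) = FD (F K K') (cmap K p) u"
  and "dph p v = from_chart B K' (\<phi> p) (FD (F K K') (cmap K p) (to_chart A K p v))"
proof -
 have "cmap K p : rdom K K'" using assms by auto
 note d = Cinf_deriv[OF F_smooth[OF assms(1,2)] this]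
 note m = mdiff_chart[where \<phi>=\<phi> and S=UNIV, OF assms _ phi_continuous d]
 show "to_chart B K' (\<phi> p) (dph p (from_chart A K p u)) = FD (F K K') (cmap K p) u"
  and "dph p v = from_chart B K' (\<phi> p) (FD (F K K') (cmap K p) (to_chart A K p v))"
  by (rule m; simp)+
qed

lemma mdiff_phi_linear: "linear (dph p)"
proof -
 let ?k = "chart_at A p" and ?k' = "chart_at B (\<phi> p)"
 have k: "?k : A" "?k' : B" "p : cdom ?k" "\<phi> p : cdom ?k'" by (simp_all add: A.chart_at B.chart_at)
 have y: "cmap ?k p : rdom ?k ?k'" using k by auto
 have "dph p = from_chart B ?k' (\<phi> p) o (FD (F ?k ?k') (cmap ?k p) o to_chart A ?k p)"
  using mdiff_phi(2)[OF k] by (simp add: fun_eq_iff)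
 moreover have "linear (from_chart B ?k' (\<phi> p) o (FD (F ?k ?k') (cmap ?k p) o to_chart A ?k p))"
  by (intro linear_compose A.to_chart_linear B.from_chart_linear k Cinf_frechet_linear[OF F_smooth y])
 ultimately show ?thesis by simp
qed

lemma local_metric_chart: "K' : B ==> local_metric (Gm K') (cran K')"
 by unfold_locales (rule RB.metric_in_chart_inner_form RB.metric_in_chart_smooth, assumption+)+

lemma local_immersion_chart:
 assumes k: "K : A" "K' : B"
 shows "local_immersion (Gm K') (cran K') (F K K') (rdom K K')"
proof -
 interpret local_metric "Gm K'" "cran K'" by (rule local_metric_chart[OF k(2)])
 show ?thesis
 proof
  show "Cinf (F K K') (rdom K K')" by (rule F_smooth[OF k])
  fix y assume "y : rdom K K'"
  then obtain p where p: "y = cmap K p" "p : cdom K" "\<phi> p : cdom K'" by auto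
  thus "F K K' y : cran K'" using A.chartD(3)[OF k(1) p(2)] by simp
  have lin: "linear (FD (F K K') y)"
   by (rule Cinf_frechet_linear[OF F_smooth[OF k] \<open>y : rdom K K'\<close>])
  show "inj (FD (F K K') y)"
   unfolding linear_injective_0[OF lin]
  proof (intro allI impI)
   fix u assume "FD (F K K') y u = 0"
   hence "to_chart B K' (\<phi> p) (dph p (from_chart A K p u)) = 0"
    using mdiff_phi(1)[OF k p(2,3)] p(1) by simp
   hence "dph p (from_chart A K p u) = 0" using B.to_chart_eq_0[OF k(2) p(3)] by simp
   moreover have "inj (dph p)" using immersion by (simp add: immersion_def)
   ultimately have "from_chart A K p u = 0"
    using linear_injective_0[OF mdiff_phi_linear] by blast
   thus "u = 0" using A.to_from_chart[OF k(1) p(2), of u] linear_0[OF A.to_chart_linear[OF k(1) p(2)]] by simp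
  qed
 qed
qed

abbreviation "gF K K' \<equiv> local_immersion.gF (Gm K') (F K K')"
abbreviation "vol K K' \<equiv> local_immersion.vol (Gm K') (F K K')"
abbreviation "sff K K' \<equiv> local_immersion.sff (Gm K') (F K K')"
abbreviation "NN K K' \<equiv> local_immersion.N (Gm K') (F K K')"

lemma g_chart:
 assumes k: "K : A" "K' : B" "p : cdom K" "\<phi> p : cdom K'"
 shows "metric_in_chart A g K (cmap K p) u v = gF K K' (cmap K p) u v"
  and "g p u v = gF K K' (cmap K p) (to_chart A K p u) (to_chart A K p v)"
proof -
 interpret I: local_immersion "Gm K'" "cran K'" "F K K'" "rdom K K'"
  by (rule local_immersion_chart[OF k(1,2)])
 have Fp: "F K K' (cmap K p) = cmap K' (\<phi> p)" using k by (simp add: A.chartD(3))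
 have 1: "g p (from_chart A K p u) (from_chart A K p v) = gF K K' (cmap K p) u v" for u v
  unfolding pullback_metric_def I.gF_def RB.metric_chart[OF k(2,4)] mdiff_phi(1)[OF k] Fp ..
 show "metric_in_chart A g K (cmap K p) u v = gF K K' (cmap K p) u v"
  using 1 by (simp add: metric_in_chart_def[of A] A.chartD(3)[OF k(1,3)])
 show "g p u v = gF K K' (cmap K p) (to_chart A K p u) (to_chart A K p v)"
  unfolding 1[symmetric] A.from_to_chart[OF k(1,3)] ..
qed

lemma g_inner: "inner_form (g p)"
proof -
 have gp: "inner_form (gb (\<phi> p))" by (rule RB.metric_inner_form)
 have "dph p u ~= 0" if "u ~= 0" for u
  using immersion linear_injective_0[OF mdiff_phi_linear] that by (auto simp: immersion_def)
 hence "g p u u > 0" if "u ~= 0" for u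
  unfolding pullback_metric_def using that by (intro inner_formD(3)[OF gp]) simp
 moreover have "bilinear (g p)" unfolding pullback_metric_def[abs_def]
  by (rule bilinear_compose[OF inner_formD(1)[OF gp] mdiff_phi_linear mdiff_phi_linear])
 moreover have "g p u v = g p v u" for u v unfolding pullback_metric_def by (rule inner_formD(2)[OF gp])
 ultimately show ?thesis unfolding inner_form_def by simp
qed

text \<open>The density that \<open>volume_measure\<close> uses for the induced metric, which refers
  to a chart of \<open>A\<close> only. Wherever a chart of \<open>B\<close> is at hand it equals the
  coordinate expression \<open>vol\<close>.\<close>

definition rho :: "('a, real^'m) chart => real^'m => real" where
 "rho K y = sqrt (det (gram (metric_in_chart A g K y)))"

lemma rho_vol:
 assumes k: "K : A" "K' : B" "y : rdom K K'"
 shows "rho K y = vol K K' y"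
proof -
 interpret I: local_immersion "Gm K'" "cran K'" "F K K'" "rdom K K'"
  by (rule local_immersion_chart[OF k(1,2)])
 obtain p where "y = cmap K p" "p : cdom K" "\<phi> p : cdom K'" using k(3) by auto
 thus ?thesis using g_chart(1)[OF k(1,2), of p] by (simp add: rho_def I.vol_def)
qed

lemma rho_smooth:
 assumes k: "K : A"
 shows "Cinf (rho K) (cran K)"
proof (rule Cinf_local[OF _ A.chartD(2)[OF k]])
 fix y assume "y : cran K"
 then obtain p where p: "p : cdom K" "y = cmap K p" by auto
 let ?k' = "chart_at B (\<phi> p)"
 have k': "?k' : B" "\<phi> p : cdom ?k'" by (simp_all add: B.chart_at)
 interpret I: local_immersion "Gm ?k'" "cran ?k'" "F K ?k'" "rdom K ?k'"
  by (rule local_immersion_chart[OF k k'(1)])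
 have "Cinf (rho K) (rdom K ?k')"
  by (rule Cinf_cong[OF I.vol_smooth]) (rule rho_vol[OF k k'(1), symmetric])
 moreover have "y : rdom K ?k'" using p k' by auto
 ultimately show "EX V. y : V & Cinf (rho K) V" by (intro exI[of _ "rdom K ?k'"]) simp
qed

lemma rho_pos:
 assumes k: "K : A" and y: "y : cran K"
 shows "rho K y > 0"
proof -
 obtain p where p: "p : cdom K" "y = cmap K p" using y by auto
 let ?k' = "chart_at B (\<phi> p)"
 have k': "?k' : B" "\<phi> p : cdom ?k'" by (simp_all add: B.chart_at)
 interpret I: local_immersion "Gm ?k'" "cran ?k'" "F K ?k'" "rdom K ?k'"
  by (rule local_immersion_chart[OF k k'(1)])
 have "y : rdom K ?k'" using p k' by auto
 thus ?thesis using I.vol_pos rho_vol[OF k k'(1)] by simp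
qed

lemma rho_measurable:
 assumes k: "K : A" and E: "E : sets borel" "E <= cdom K"
 shows "(%y. ind (cmap K ` E) y * rho K y) : bm"
proof -
 have "continuous_on (cmap K ` E) (rho K)"
  by (rule continuous_on_subset[OF Cinf_continuous[OF rho_smooth[OF k]]]) (use E in auto)
 thus ?thesis
  using borel_measurable_continuous_on_indicator[OF chart_borel_image[OF A.is_chart[OF k] E], of "rho K"] by simp
qed

lemma rho_transition:
 assumes k: "K : A" "K2 : A" "p : cdom K" "p : cdom K2"
 shows "rho K (cmap K p) = rho K2 (cmap K2 p) * abs (det (matrix (transition_deriv K K2 p)))"
proof -
 have e: "metric_in_chart A g K (cmap K p) u v = metric_in_chart A g K2 (cmap K2 p) (transition_deriv K K2 p u) (transition_deriv K K2 p v)" for u v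
  unfolding metric_in_chart_def A.chartD(3)[OF k(1,3)] A.chartD(3)[OF k(2,4)] A.transition_from_chart[OF k] ..
 have bl: "bilinear (metric_in_chart A g K2 (cmap K2 p))"
  unfolding metric_in_chart_def[abs_def] A.chartD(3)[OF k(2,4)]
  by (rule bilinear_compose[OF inner_formD(1)[OF g_inner] A.from_chart_linear[OF k(2,4)] A.from_chart_linear[OF k(2,4)]])
 show ?thesis
  unfolding rho_def e det_gram_transform[OF bl] by (simp add: real_sqrt_mult mult.commute)
qed

lemma dM_spec:
 assumes D: "D : sets borel"
 shows "density_measure_spec A D rho (dM A B gb \<phi> D)"
proof -
 have "dM A B gb \<phi> D = density_measure A D rho"
  unfolding dM_def volume_measure_def rho_def[abs_def] ..
 moreover have "density_measure_spec A D rho (density_measure A D rho)"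
 proof (rule density_measure_exists[OF A.smooth_atlas D])
  show "rho K (cmap K p) >= 0" if "K : A" "p : cdom K" for K p
   using rho_pos[OF that(1), of "cmap K p"] that(2) by simp
  show "(%y. ind (cmap K ` (cdom K Int D)) y * rho K y) : bm" if "K : A" for K
   using A.chartD(1)[OF that] D by (intro rho_measurable[OF that]) auto
 qed (rule rho_transition)
 ultimately show ?thesis by simp
qed

abbreviation mc :: "'a => 'v" where "mc \<equiv> mean_curvature A B gb \<phi>"

lemma christoffel_gamma: "K' : B ==> christoffel B gb K' x u v = local_metric.gamma (Gm K') x u v"
 unfolding christoffel_def Let_def local_metric.gamma_def[OF local_metric_chart] ..

text \<open>An orthonormal frame of the induced metric gives an explicit tangential part
  \<open>dph t\<close>. Two decompositions differ by a vector that is tangential and normal at once,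
  hence 0, so the definite description picks this one.\<close>

lemma normal_part_props:
 shows "normal_at A B gb \<phi> p (normal_part A B gb \<phi> p w)"
  and "normal_at A B gb \<phi> p n ==> gb (\<phi> p) (normal_part A B gb \<phi> p w) n = gb (\<phi> p) w n"
proof -
 let ?b = "gb (\<phi> p)" and ?d = "dph p"
 have gp: "inner_form ?b" by (rule RB.metric_inner_form)
 note bl = inner_formD(1)[OF gp]
 note ld = mdiff_phi_linear[of p]
 obtain e :: "'m => real^'m" where e: "orthonormal_system (g p) e" using orthonormal_frame_exists[OF g_inner] .
 define t where "t = (SUM k:UNIV. ?b w (?d (e k)) *\<^sub>R e k)"
 have linw: "linear (%v. ?b v z)" "linear (?b z)" for z using bl by (auto simp: bilinear_def)
 have tk: "?b (?d t) (?d (e k)) = ?b w (?d (e k))" for k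
 proof -
  have "?b (?d t) (?d (e k)) = (SUM l:UNIV. ?b w (?d (e l)) * g p (e l) (e k))"
   by (simp add: t_def linear_sum[OF ld] linear_scale[OF ld] linear_sum[OF linw(1)] linear_scale[OF linw(1)] pullback_metric_def)
  also have "... = (SUM l:UNIV. if l = k then ?b w (?d (e k)) else 0)"
   using e by (intro sum.cong) (auto simp: orthonormal_system_def)
  finally show ?thesis by simp
 qed
 have span: "u = (SUM k:UNIV. g p u (e k) *\<^sub>R e k)" for u
 proof -
  let ?u' = "u - (SUM k:UNIV. g p u (e k) *\<^sub>R e k)"
  note gbl = inner_formD(1)[OF g_inner[of p]]
  have lg: "linear (%v. g p v z)" "linear (g p z)" for z using gbl by (auto simp: bilinear_def)
  have o: "g p ?u' (e k) = 0" for k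
  proof -
   have "g p (SUM l:UNIV. g p u (e l) *\<^sub>R e l) (e k) = (SUM l:UNIV. g p u (e l) * g p (e l) (e k))"
    by (simp add: linear_sum[OF lg(1)] linear_scale[OF lg(1)])
   also have "... = (SUM l:UNIV. if l = k then g p u (e k) else 0)"
    using e by (intro sum.cong) (auto simp: orthonormal_system_def)
   finally show ?thesis by (simp add: linear_diff[OF lg(1)])
  qed
  have "det (\<chi> k. e k) ~= 0"
   using det_gram_orthonormal[OF gbl e] by auto
  hence "inj (%v. (\<chi> k. e k) ** gram (g p) *v v)"
  proof -
   have "det ((\<chi> k. e k) ** gram (g p)) ~= 0"
    using \<open>det (\<chi> k. e k) ~= 0\<close> det_gram_pos[OF g_inner[of p]] by (simp add: det_mul)
   thus ?thesis using invertible_det_nz inj_matrix_vector_mult by blast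
  qed
  moreover have "((\<chi> k. e k) ** gram (g p) *v v) $ k = g p (e k) v" for k v
  proof -
   have "((\<chi> k. e k) ** gram (g p) *v v) $ k = (SUM j:UNIV. SUM i:UNIV. e k $ i * g p (ax i) (ax j) * v $ j)"
    by (simp add: matrix_vector_mult_def matrix_matrix_mult_def sum_distrib_right)
   also have "... = (SUM i:UNIV. SUM j:UNIV. e k $ i * g p (ax i) (ax j) * v $ j)" by (rule sum.swap)
   also have "... = g p (e k) v"
    unfolding bilinear_gram[OF gbl, of "e k" v] by (intro sum.cong refl) simp
   finally show ?thesis .
  qed
  hence "(\<chi> k. e k) ** gram (g p) *v ?u' = (\<chi> k. e k) ** gram (g p) *v 0"
   using o inner_formD(2)[OF g_inner[of p]] linear_0[OF lg(2)] by (simp add: vec_eq_iff)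
  ultimately have "?u' = 0" by (rule injD)
  thus ?thesis by simp
 qed
 have orth: "?b (w - ?d t) (?d u) = 0" for u
 proof -
  have 0: "?b (w - ?d t) (?d (e k)) = 0" for k by (simp add: linear_diff[OF linw(1)] tk)
  have "?b (w - ?d t) (?d u) = ?b (w - ?d t) (?d (SUM k:UNIV. g p u (e k) *\<^sub>R e k))" using span[of u] by simp
  also have "... = 0" by (simp only: linear_sum[OF ld] linear_scale[OF ld] linear_sum[OF linw(2)] linear_scale[OF linw(2)] 0) simp
  finally show ?thesis .
 qed
 have np: "normal_part A B gb \<phi> p w = w - ?d t"
  unfolding normal_part_def
 proof (rule the_equality)
  show "normal_at A B gb \<phi> p (w - ?d t) & w - (w - ?d t) : range ?d" using orth by (simp add: normal_at_def)
  fix n assume n: "normal_at A B gb \<phi> p n & w - n : range ?d"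
  then obtain s where s: "w - n = ?d s" by auto
  have "n - (w - ?d t) = ?d (t - s)" using s by (simp add: linear_diff[OF ld] algebra_simps)
  moreover have "?b (n - (w - ?d t)) (?d (t - s)) = 0"
   using n orth[of "t - s"] by (simp add: normal_at_def linear_diff[OF linw(1)])
  ultimately have "n - (w - ?d t) = 0" using inner_formD(5)[OF gp] by simp
  thus "n = w - ?d t" by simp
 qed
 show "normal_at A B gb \<phi> p (normal_part A B gb \<phi> p w)" using orth by (simp add: np normal_at_def)
 show "?b (normal_part A B gb \<phi> p w) n = ?b w n" if "normal_at A B gb \<phi> p n"
  using that inner_formD(2)[OF gp, of "?d t" n] by (simp add: np normal_at_def linear_diff[OF linw(1)])
qed

text \<open>At \<open>p\<close> itself the chosen charts make \<open>to_chart\<close> and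
  \<open>from_chart\<close> the identity, so the covariant derivative of the definitions is
  literally the coordinate expression. Nearby points have other chosen charts, which is why the
  field is read in the fixed pair \<open>K\<close>, \<open>K'\<close> before it is
  differentiated.\<close>

lemma sff_chart_at:
 fixes p :: 'a and v u :: "real^'m"
 defines "K \<equiv> chart_at A p" and "K' \<equiv> chart_at B (\<phi> p)"
 shows "cov_deriv_along A B gb \<phi> (%q. dph q (from_chart A (chart_at A p) q v)) p u
  = sff K K' (cmap K p) u v"
proof -
 have k: "K : A" "K' : B" "p : cdom K" "\<phi> p : cdom K'"
  by (simp_all add: K_def K'_def A.chart_at B.chart_at)
 interpret I: local_immersion "Gm K'" "cran K'" "F K K'" "rdom K K'"
  by (rule local_immersion_chart[OF k(1,2)])
 have y: "cmap K p : rdom K K'" using k by auto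
 have idA: "to_chart A K p w = w" "from_chart A K p w = w" for w
  unfolding to_chart_def from_chart_def K_def[symmetric] by (rule A.transition_id[OF k(1,3)])+
 have idB: "to_chart B K' (\<phi> p) w = w" "from_chart B K' (\<phi> p) w = w" for w
  unfolding to_chart_def from_chart_def K'_def[symmetric] by (rule B.transition_id[OF k(2,4)])+
 have md: "dph p w = I.dF (cmap K p) w" for w
  using mdiff_phi(2)[OF k, of w] by (simp add: idA idB)
 have "HD (%z. to_chart B K' (\<phi> (cinv K z)) (dph (cinv K z) (from_chart A K (cinv K z) v))) (D2 (F K K') (cmap K p) v) (cmap K p)"
 proof (rule has_derivative_cong_open[OF D2_has_derivative[OF I.F_smooth y] I.open_U y])
  fix z assume "z : rdom K K'"
  then obtain q where q: "q : cdom K" "\<phi> q : cdom K'" "z = cmap K q" by auto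
  show "I.dF z v = to_chart B K' (\<phi> (cinv K z)) (dph (cinv K z) (from_chart A K (cinv K z) v))"
   unfolding q(3) A.chartD(3)[OF k(1) q(1)] mdiff_phi(1)[OF k(1,2) q(1,2)] ..
 qed
 from frechet_derivative_at[OF this, symmetric]
 have "FD (%z. to_chart B K' (\<phi> (cinv K z)) (dph (cinv K z) (from_chart A K (cinv K z) v))) (cmap K p) u
   = D2 (F K K') (cmap K p) v u" by simp
 moreover have "F K K' (cmap K p) = cmap K' (\<phi> p)" using k by (simp add: A.chartD(3))
 ultimately show ?thesis
  unfolding cov_deriv_along_def Let_def K_def[symmetric] K'_def[symmetric] I.sff_def
   christoffel_gamma[OF k(2)] md idA second_derivative_symmetric[OF I.F_smooth y, of u v]
  by simp
qed

lemma mc_pairing: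
 fixes p :: 'a
 defines "K \<equiv> chart_at A p" and "K' \<equiv> chart_at B (\<phi> p)"
 shows "normal_at A B gb \<phi> p (mc p)"
  and "normal_at A B gb \<phi> p n ==> real CARD('m) * gb (\<phi> p) (mc p) n =
   metric_trace (g p) (%u v. gb (\<phi> p) (sff K K' (cmap K p) u v) n)"
proof -
 let ?b = "gb (\<phi> p)"
 define S where "S u v = sff K K' (cmap K p) u v" for u v
 have lin: "linear (%v. ?b v z)" for z using inner_formD(1)[OF RB.metric_inner_form] by (simp add: bilinear_def)
 have sf: "second_fundamental_form A B gb \<phi> p u v = normal_part A B gb \<phi> p (S u v)" for u v
  unfolding second_fundamental_form_def sff_chart_at S_def K_def K'_def ..
 have mc: "mc p = (1 / real CARD('m)) *\<^sub>R (SUM i:UNIV. SUM j:UNIV. matrix_inv (gram (g p)) $ i $ j *\<^sub>R normal_part A B gb \<phi> p (S (ax i) (ax j)))"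
  unfolding mean_curvature_def metric_trace_def sf ..
 have n0: "?b (normal_part A B gb \<phi> p w) (dph p u) = 0" for w u
  using normal_part_props(1)[of p w] by (simp add: normal_at_def)
 show "normal_at A B gb \<phi> p (mc p)"
  unfolding normal_at_def mc linear_scale[OF lin] linear_sum[OF lin] n0 by simp
 assume n: "normal_at A B gb \<phi> p n"
 show "real CARD('m) * ?b (mc p) n = metric_trace (g p) (%u v. ?b (sff K K' (cmap K p) u v) n)"
  unfolding mc linear_scale[OF lin] linear_sum[OF lin] normal_part_props(2)[OF n] metric_trace_def S_def by simp
qed

text \<open>Both sides are normal, so pairings with normal vectors decide. There \<open>N\<close>
  becomes the metric trace of the second fundamental form, whose normal pairings are independent of
  the charts; positive definiteness applied to the difference of the two sides concludes.\<close>

lemma N_mean_curvature: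
 assumes k: "K : A" "K' : B" "p : cdom K" "\<phi> p : cdom K'"
 shows "NN K K' (cmap K p) = (vol K K' (cmap K p) * real CARD('m)) *\<^sub>R to_chart B K' (\<phi> p) (mc p)"
proof -
 define K0 where "K0 = chart_at A p"
 define K0' where "K0' = chart_at B (\<phi> p)"
 have k0: "K0 : A" "K0' : B" "p : cdom K0" "\<phi> p : cdom K0'"
  by (simp_all add: K0_def K0'_def A.chart_at B.chart_at)
 have IL: "local_immersion (Gm K') (cran K') (F K K') (rdom K K')"
  and I0L: "local_immersion (Gm K0') (cran K0') (F K0 K0') (rdom K0 K0')"
  by (rule local_immersion_chart[OF k(1,2)] local_immersion_chart[OF k0(1,2)])+
 interpret I: local_immersion "Gm K'" "cran K'" "F K K'" "rdom K K'" by (rule IL)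
 interpret I0: local_immersion "Gm K0'" "cran K0'" "F K0 K0'" "rdom K0 K0'" by (rule I0L)
 let ?y = "cmap K p" and ?z = "cmap K0 p" and ?m = "real CARD('m)"
 let ?ta = "cmap K' o cinv K0'" and ?sg = "cmap K0 o cinv K"
 let ?W1 = "cmap K0' ` (cdom K0' Int cdom K')"
 define U1 where "U1 = cmap K ` (cdom K Int cdom K0 Int (\<phi> -` cdom K' Int \<phi> -` cdom K0'))"
 have y: "?y : rdom K K'" "?z : rdom K0 K0'" "?y : U1" using k k0 by (auto simp: U1_def)
 have oU1: "open U1"
  unfolding U1_def
  by (intro chart_open_image A.is_chart k open_Int A.chartD(1) k0 open_vimage[OF B.chartD(1) phi_continuous]) auto
 have sgy: "?sg ?y = ?z" using k by (simp add: A.chartD(3))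
 have Fy0: "F K0 K0' ?z = cmap K0' (\<phi> p)" and Fy: "F K K' ?y = cmap K' (\<phi> p)"
  using k k0 by (simp_all add: A.chartD(3))
 define S where "S = transition_deriv K K0 p"
 define T where "T = transition_deriv K0' K' (\<phi> p)"
 have dS: "FD ?sg ?y = S" by (simp add: S_def transition_deriv_def)
 have dT: "FD ?ta (F K0 K0' (?sg ?y)) = T" by (simp only: sgy Fy0 T_def transition_deriv_def)
 have T_to: "T w = to_chart B K' (\<phi> p) w" for w
  by (simp add: T_def to_chart_def K0'_def)
 note tr = sff_transform[where ta="?ta" and sg="?sg" and y="?y" and ?W1.0="?W1" and ?U1.0=U1, OF IL I0L]
 have h1: "Cinf ?ta ?W1" by (rule B.transition_smooth[OF k0(2) k(2)])
 have h2: "?W1 <= cran K0'" by auto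
 have h3: "?ta x : cran K'" if "x : ?W1" for x
 proof -
  from that obtain q where "q : cdom K0'" "q : cdom K'" "x = cmap K0' q" by auto
  thus ?thesis using B.chartD(3)[OF k0(2), of q] by simp
 qed
 have h4: "Gm K0' x b c = Gm K' (?ta x) (FD ?ta x b) (FD ?ta x c)"
  if xW: "x : ?W1" for x b c
 proof -
  from xW obtain q where q: "q : cdom K0'" "q : cdom K'" "x = cmap K0' q" by auto
  have "FD ?ta x b = transition_deriv K0' K' q b" for b by (simp add: q(3) transition_deriv_def)
  thus ?thesis
   unfolding metric_in_chart_def using B.transition_from_chart[OF k0(2) k(2) q(1,2)]
    B.chartD(3)[OF k0(2) q(1)] B.chartD(3)[OF k(2) q(2)] by (simp add: q(3))
 qed
 have h5: "Cinf ?sg U1"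
  by (rule Cinf_subset[OF A.transition_smooth[OF k(1) k0(1)] oU1]) (auto simp: U1_def)
 have h6: "U1 <= rdom K K'" by (auto simp: U1_def)
 have pt: "?sg z : rdom K0 K0' & F K0 K0' (?sg z) : ?W1 & F K K' z = ?ta (F K0 K0' (?sg z))" if zU: "z : U1" for z
 proof -
  from zU obtain q where q: "q : cdom K" "q : cdom K0" "\<phi> q : cdom K'" "\<phi> q : cdom K0'" "z = cmap K q" by (auto simp: U1_def)
  have e: "?sg z = cmap K0 q" "F K0 K0' (cmap K0 q) = cmap K0' (\<phi> q)" "F K K' z = cmap K' (\<phi> q)"
   "?ta (cmap K0' (\<phi> q)) = cmap K' (\<phi> q)"
   using A.chartD(3)[OF k(1) q(1)] A.chartD(3)[OF k0(1) q(2)] B.chartD(3)[OF k0(2) q(4)] by (simp_all add: q(5))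
  show ?thesis unfolding e(1) e(2) e(3) e(4) using q by auto
 qed
 note tr' = tr[OF h1 h2 h3 h4 h5 h6 conjunct1[OF pt] conjunct1[OF conjunct2[OF pt]] conjunct2[OF conjunct2[OF pt]] y(3)]
 have md: "dph p u = I0.dF ?z u" for u
 proof -
  have "to_chart A K0 p w = w" "from_chart B K0' (\<phi> p) z = z" for w z
   unfolding to_chart_def from_chart_def K0_def[symmetric] K0'_def[symmetric]
   by (rule A.transition_id[OF k0(1,3)] B.transition_id[OF k0(2,4)])+
  thus ?thesis using mdiff_phi(2)[OF k0, of u] by simp
 qed
 have G0: "Gm K0' (F K0 K0' ?z) a b = gb (\<phi> p) a b" for a b
 proof -
  have "from_chart B K0' (\<phi> p) z = z" for z
   unfolding from_chart_def K0'_def[symmetric] by (rule B.transition_id[OF k0(2,4)])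
  thus ?thesis unfolding Fy0 metric_in_chart_def B.chartD(3)[OF k0(2,4)] by simp
 qed
 have G: "Gm K' (F K K' ?y) (T a) (T b) = gb (\<phi> p) a b" for a b
  unfolding Fy T_to by (rule RB.metric_chart[OF k(2,4), symmetric])
 have dF: "I.dF ?y u = T (dph p (S u))" for u
  using mdiff_phi(1)[OF k, of u] A.from_to_chart unfolding T_to
  by (simp add: S_def from_chart_def K0_def)
 have main: "Gm K' (F K K' ?y) (NN K K' ?y) (T n) = vol K K' ?y * (?m * gb (\<phi> p) (mc p) n)"
  if n: "normal_at A B gb \<phi> p n" for n
 proof -
  have n0: "Gm K0' (F K0 K0' (?sg ?y)) n (I0.dF (?sg ?y) u) = 0" for u
   using n unfolding sgy G0 md[symmetric] by (simp add: normal_at_def)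
  have "Gm K' (F K K' ?y) (NN K K' ?y) (T n) = vol K K' ?y * metric_trace (gF K K' ?y) (%u v. Gm K' (F K K' ?y) (sff K K' ?y u v) (T n))"
  proof (rule I.N_normal_pairing[OF y(1)])
   show "Gm K' (F K K' ?y) (T n) (I.dF ?y u) = 0" for u
    unfolding dF G using n by (simp add: normal_at_def)
  qed
  also have "metric_trace (gF K K' ?y) (%u v. Gm K' (F K K' ?y) (sff K K' ?y u v) (T n)) =
   metric_trace (g p) (%u v. gb (\<phi> p) (sff K0 K0' ?z u v) n)"
  proof (rule metric_trace_transform[where S=S and R="transition_deriv K0 K p", OF g_inner])
   show "bilinear (%u v. gb (\<phi> p) (sff K0 K0' ?z u v) n)"
    using I0.sff_pairing_bilinear[OF y(2), of n] unfolding G0 .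
   show "linear S" unfolding S_def by (rule A.transition_linear[OF k(1) k0(1) k(3) k0(3)])
   show "linear (transition_deriv K0 K p)" by (rule A.transition_linear[OF k0(1) k(1) k0(3) k(3)])
   show "S (transition_deriv K0 K p u) = u" for u
    unfolding S_def A.transition_compose[OF k0(1) k(1) k0(1) k0(3) k(3) k0(3)] by (rule A.transition_id[OF k0(1,3)])
   show "gF K K' ?y u v = g p (S u) (S v)" for u v
    unfolding I.gF_def dF G pullback_metric_def ..
   show "Gm K' (F K K' ?y) (sff K K' ?y u v) (T n) = gb (\<phi> p) (sff K0 K0' ?z (S u) (S v)) n" for u v
   proof -
    have "Gm K' (F K K' ?y) (sff K K' ?y u v) (FD ?ta (F K0 K0' (?sg ?y)) n)
     = Gm K0' (F K0 K0' (?sg ?y)) (sff K0 K0' (?sg ?y) (FD ?sg ?y u) (FD ?sg ?y v)) n"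
     by (rule tr'(1)) (assumption | rule n0)+
    thus ?thesis unfolding dT dS unfolding sgy G0 .
   qed
  qed
  also have "... = ?m * gb (\<phi> p) (mc p) n"
   unfolding K0_def K0'_def mc_pairing(2)[OF n] ..
  finally show ?thesis .
 qed
 define R where "R = (vol K K' ?y * ?m) *\<^sub>R T (mc p)"
 \<comment> \<open>The vector whose coordinates in \<open>K'\<close> are the difference of the two
   sides. Being normal, it may be inserted into \<open>main\<close>, which shows that its norm is
   0.\<close>
 define n where "n = from_chart B K' (\<phi> p) (NN K K' ?y - R)"
 have Tn: "T n = NN K K' ?y - R" unfolding T_to n_def by (rule B.to_from_chart[OF k(2,4)])
 have Fin: "F K K' ?y : cran K'" by (rule I.F_in[OF y(1)])
 have lin: "linear (%v. Gm K' (F K K' ?y) v z)" for z using I.G_bilinear[OF Fin] by (simp add: bilinear_def)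
 have RT: "Gm K' (F K K' ?y) R (T b) = vol K K' ?y * (?m * gb (\<phi> p) (mc p) b)" for b
  unfolding R_def linear_scale[OF lin] G by simp
 have "normal_at A B gb \<phi> p n"
  unfolding normal_at_def
 proof
  fix u
  define u' where "u' = to_chart A K p u"
  have Tu: "T (dph p u) = I.dF ?y u'"
   using mdiff_phi(1)[OF k, of u'] A.from_to_chart[OF k(1,3), of u] unfolding T_to u'_def by simp
  have "gb (\<phi> p) n (dph p u) = Gm K' (F K K' ?y) (NN K K' ?y) (I.dF ?y u') - Gm K' (F K K' ?y) R (T (dph p u))"
   unfolding G[symmetric] Tn linear_diff[OF lin] Tu ..
  also have "... = 0" unfolding I.N_normal[OF y(1)] RT using mc_pairing(1)[of p] by (simp add: normal_at_def)
  finally show "gb (\<phi> p) n (dph p u) = 0" .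
 qed
 from main[OF this] have "Gm K' (F K K' ?y) (NN K K' ?y - R) (T n) = 0"
  unfolding linear_diff[OF lin] RT by simp
 hence "NN K K' ?y - R = 0" unfolding Tn using inner_formD(5)[OF I.G_inner[OF Fin]] by simp
 thus ?thesis by (simp add: R_def T_to)
qed

end

section \<open>Domains with smooth boundary\<close>

text \<open>The part of \<open>Kq\<close> in \<open>X\<close> need not be compact. A finite cover
  exists because bounds on \<open>X\<close> are available around every point of \<open>Kq\<close>,
  including points outside \<open>X\<close>, such as boundary points when \<open>X\<close> is an
  interior.\<close>

lemma locally_bounded_imp_bounded:
 fixes f :: "'c::topological_space => real"
 assumes Kq: "compact Kq" and loc: "!!z. z : Kq ==> EX O' C. open O' & z : O' & (ALL w:O' Int X. f w <= C)"
 shows "EX C>=0. ALL w:Kq Int X. f w <= C"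
proof -
 from loc obtain O' C where O: "!!z. z : Kq ==> open (O' z) & z : O' z & (ALL w:O' z Int X. f w <= C z)"
  by metis
 obtain T where T: "T <= Kq" "finite T" "Kq <= (UN z:T. O' z)"
  using compactE_image[OF Kq, of Kq O'] O by (metis UN_I subsetI)
 define M where "M = (SUM z:T. abs (C z))"
 show ?thesis
 proof (intro exI[of _ M] conjI ballI)
  show "0 <= M" by (simp add: M_def sum_nonneg)
  fix w assume w: "w : Kq Int X"
  then obtain z where z: "z : T" "w : O' z" using T by auto
  hence "f w <= C z" using O[of z] T w by auto
  also have "... <= abs (C z)" by simp
  also have "... <= M" unfolding M_def by (rule member_le_sum) (use z T in auto)
  finally show "f w <= M" .
 qed
qed

lemma negligible_borel_null:
 assumes "negligible N" "N : sets borel"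
 shows "N : null_sets lborel"
 using assms null_sets_completion_iff[of N lborel] by (simp add: negligible_iff_null_sets)

locale domain = submanifold A B gb \<phi>
 for A :: "('a::{t2_space, second_countable_topology}, real^'m) chart set"
  and B :: "('b::{t2_space, second_countable_topology}, 'v::euclidean_space) chart set" and gb \<phi> +
 fixes D :: "'a set"
 assumes domain: "smooth_compact_domain A D"
begin

abbreviation (input) frD :: "('a, real^'m) chart => (real^'m) set" where
 "frD K == cmap K ` (frontier D Int cdom K)"

abbreviation (input) iD :: "'a set" where "iD == interior D"

lemma D_compact: "compact D" and D_closed: "closed D" and D_borel: "D : sets borel"
proof -
 show 1: "compact D" using domain by (simp add: smooth_compact_domain_def)
 thus 2: "closed D" by (rule compact_imp_closed)
 thus "D : sets borel" by simp
qed

lemma frontier_subset: "frontier D <= D"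
 using D_closed by (rule frontier_subset_closed)

lemma D_split: "D = iD Un frontier D" "iD Int frontier D = {}"
 using D_closed interior_subset[of D] by (auto simp: frontier_def)

lemma frontier_chart:
 assumes p: "p : frontier D"
 obtains K i where "compatible_chart A K" "p : cdom K" "cmap K p $ i = 0"
  "!!q. q : cdom K ==> q : D \<longleftrightarrow> 0 <= cmap K q $ i"
  "!!q. q : cdom K ==> 0 < cmap K q $ i ==> q : iD"
  "!!q. q : cdom K ==> q : frontier D ==> cmap K q $ i = 0"
proof -
 obtain K i where k: "compatible_chart A K" "p : cdom K" "cmap K p $ i = 0"
  "cmap K ` (D Int cdom K) = {y : cran K. 0 <= y $ i}"
  using domain p unfolding smooth_compact_domain_def by blast
 have c: "is_chart K" using k(1) by (simp add: compatible_chart_def)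
 have D: "q : D \<longleftrightarrow> 0 <= cmap K q $ i" if q: "q : cdom K" for q
 proof
  assume "q : D"
  hence "cmap K q : cmap K ` (D Int cdom K)" using q by simp
  thus "0 <= cmap K q $ i" unfolding k(4) by simp
 next
  assume "0 <= cmap K q $ i"
  hence "cmap K q : cmap K ` (D Int cdom K)" unfolding k(4) using q by simp
  then obtain q' where "q' : D" "q' : cdom K" "cmap K q = cmap K q'" by auto
  thus "q : D" using inj_onD[OF is_chartD(8)[OF c], of q q'] q by simp
 qed
 have I: "q : iD" if q: "q : cdom K" "0 < cmap K q $ i" for q
 proof (rule interiorI)
  show "open (cdom K Int cmap K -` {y. 0 < y $ i})"
   by (rule chart_open_preimage[OF c open_halfspace_component_gt_cart])
  show "cdom K Int cmap K -` {y. 0 < y $ i} <= D" using D by fastforce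
 qed (use q in simp)
 have Z: "cmap K q $ i = 0" if q: "q : cdom K" "q : frontier D" for q
 proof -
  have "q : D" "q ~: iD" using q(2) frontier_subset D_split(2) by auto
  thus ?thesis using D[OF q(1)] I[OF q(1)] by force
 qed
 show ?thesis using that[OF k(1,2,3) D I Z] .
qed

text \<open>A boundary chart shows \<open>D\<close> as a half space; shifting a boundary point
  inwards along the distinguished coordinate gives interior points arbitrarily close to it.\<close>

lemma frontier_closure_interior:
 assumes p: "p : frontier D"
 shows "p : closure iD"
proof -
 obtain K i where k: "compatible_chart A K" "p : cdom K" "cmap K p $ i = 0"
  "!!q. q : cdom K ==> 0 < cmap K q $ i ==> q : iD"
  using frontier_chart[OF p] by metis
 have c: "is_chart K" using k(1) by (simp add: compatible_chart_def)
 have "EX q:iD. q : V" if V: "open V" "p : V" for V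
 proof -
  have "open (cmap K ` (V Int cdom K))"
   by (rule chart_open_image[OF c]) (use V is_chartD(1)[OF c] in auto)
  moreover have "cmap K p : cmap K ` (V Int cdom K)" using V k by auto
  ultimately obtain r where r: "r > 0" "ball (cmap K p) r <= cmap K ` (V Int cdom K)"
   using open_contains_ball by blast
  have "cmap K p + (r / 2) *\<^sub>R ax i : ball (cmap K p) r"
   using r by (simp add: dist_norm norm_axis_1)
  hence "cmap K p + (r / 2) *\<^sub>R ax i : cmap K ` (V Int cdom K)"
   by (rule subsetD[OF r(2)])
  then obtain q where q: "q : V" "q : cdom K" "cmap K q = cmap K p + (r / 2) *\<^sub>R ax i"
   by (elim imageE IntE) simp
  have "cmap K q $ i = r / 2" unfolding q(3) by (simp add: k(3))
  hence "q : iD" using k(4)[OF q(2)] r by simp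
  thus ?thesis using q(1) by blast
 qed
 thus ?thesis unfolding closure_iff_nhds_not_empty by blast
qed

lemma D_closure_interior: "D <= closure iD"
 using frontier_closure_interior D_split(1) closure_subset[of "iD"] by blast

lemma interior_nonempty: "iD ~= {}"
 using D_closure_interior domain by (auto simp: smooth_compact_domain_def)

text \<open>Countably many boundary charts cover the boundary, and each maps its part into a
  coordinate hyperplane. Boundary charts are merely compatible with the atlas, so the conclusion for
  \<open>K\<close> passes through differentiable transition maps, which preserve negligible
  sets.\<close>

lemma frontier_null:
 assumes k: "K : A"
 shows "frD K : null_sets lborel"
proof (rule negligible_borel_null)
 have fb: "frontier D Int cdom K : sets borel" using A.chartD(1)[OF k] by auto
 thus "frD K : sets borel"
  by (rule chart_borel_image[OF A.is_chart[OF k]]) auto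
 define Q where "Q = {K'. compatible_chart A K' & (EX i. ALL q:cdom K' Int frontier D. cmap K' q $ i = 0)}"
 have Qo: "open (cdom K')" if "K' : Q" for K'
 proof -
  have "is_chart K'" using that unfolding Q_def compatible_chart_def by blast
  thus ?thesis by (rule is_chartD(1))
 qed
 have Qo': "open S" if "S : cdom ` Q" for S using that Qo by blast
 obtain \<C> where \<C>: "\<C> <= cdom ` Q" "countable \<C>" "\<Union>\<C> = \<Union>(cdom ` Q)"
  by (rule Lindelof[OF Qo'])
 obtain C where C: "countable C" "C <= Q" "\<C> = cdom ` C"
  using \<C>(1,2) countable_subset_image[of \<C> cdom Q] by metis
 have cov: "frontier D <= (UN K':C. cdom K')"
 proof
  fix p assume p: "p : frontier D"
  obtain K' i where k': "compatible_chart A K'" "p : cdom K'" "!!q. q : cdom K' ==> q : frontier D ==> cmap K' q $ i = 0"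
   using frontier_chart[OF p] by metis
  have "K' : Q" unfolding Q_def using k'(1,3) by blast
  with k'(2) have "p : \<Union>(cdom ` Q)" by auto
  thus "p : (UN K':C. cdom K')" using \<C>(3) C(3) by auto
 qed
 have neg: "negligible (cmap K ` (frontier D Int cdom K Int cdom K'))" if kC: "K' : C" for K'
 proof -
  from kC C(2) have "K' : Q" by auto
  then obtain i where k': "compatible_chart A K'" "!!q. q : cdom K' ==> q : frontier D ==> cmap K' q $ i = 0"
   by (auto simp: Q_def)
  have c: "is_chart K'" using k'(1) by (simp add: compatible_chart_def)
  define X where "X = frontier D Int cdom K Int cdom K'"
  have "cmap K' ` X <= {y. y $ i = 0}" using k'(2) by (auto simp: X_def)
  hence n: "negligible (cmap K' ` X)"
   using negligible_subset[OF negligible_standard_hyperplane_cart[of i]] by blast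
  have e: "(cmap K o cinv K') ` (cmap K' ` X) = cmap K ` X"
  proof -
   have "(cmap K o cinv K') (cmap K' p) = cmap K p" if pX: "p : X" for p
   proof -
    have "p : cdom K'" using pX by (simp add: X_def)
    from is_chartD(3)[OF c this] show ?thesis by simp
   qed
   thus ?thesis unfolding image_image by (intro image_cong) auto
  qed
  have "open (cmap K' ` (cdom K' Int cdom K))"
   by (intro chart_open_image c open_Int is_chartD(1) A.is_chart k) auto
  moreover have "smooth_on (cmap K o cinv K') (cmap K' ` (cdom K' Int cdom K))"
   using k'(1) k by (simp add: compatible_chart_def smooth_transition_def)
  ultimately have sm: "Cinf (cmap K o cinv K') (cmap K' ` (cdom K' Int cdom K))"
   by (rule smooth_on_open_iff[THEN iffD1])
  have "(cmap K o cinv K') differentiable_on (cmap K' ` X)"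
   unfolding differentiable_on_def
  proof
   fix y assume "y : cmap K' ` X"
   hence "y : cmap K' ` (cdom K' Int cdom K)" by (auto simp: X_def)
   from differentiable_at_withinI[OF differentiableI[OF Cinf_deriv[OF sm this]]]
   show "(cmap K o cinv K') differentiable at y within cmap K' ` X" .
  qed
  from negligible_differentiable_image_negligible[OF _ n this] show ?thesis
   unfolding e by (simp add: X_def)
 qed
 have "frD K = (UN K':C. cmap K ` (frontier D Int cdom K Int cdom K'))"
  using cov unfolding image_UN[symmetric] by (intro arg_cong[of _ _ "image (cmap K)"]) blast
 moreover have "negligible (UN K':C. cmap K ` (frontier D Int cdom K Int cdom K'))"
  using negligible_countable_Union[of "(%K'. cmap K ` (frontier D Int cdom K Int cdom K')) ` C"] C(1) neg by auto
 ultimately show "negligible (frD K)" by simp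
qed

definition mu :: "'a measure" where "mu = dM A B gb \<phi> D"

lemma mu_spec: "density_measure_spec A D rho mu"
 unfolding mu_def by (rule dM_spec[OF D_borel])

lemma sets_mu [measurable_cong]: "sets mu = sets borel"
 using mu_spec by (simp add: density_measure_spec_def)

lemma space_mu [simp]: "space mu = UNIV"
 using sets_eq_imp_space_eq[OF sets_mu] by simp

lemma mu_emeasure: "K : A ==> E : sets borel ==> E <= cdom K ==>
  emeasure mu E = (\<integral>\<^sup>+y\<in>cmap K ` (E Int D). ennreal (rho K y) \<partial>lborel)"
 using mu_spec unfolding density_measure_spec_def by blast

lemma mu_null_local:
 assumes N: "N : sets borel" and z: "!!K. K : A ==> emeasure mu (N Int cdom K) = 0"
 shows "emeasure mu N = 0"
proof -
 obtain P :: "nat => 'a set" and c where P: "disjoint_family P" "(\<Union>n. P n) = UNIV"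
  "!!n. P n : sets borel" "!!n. c n : A" "!!n. P n <= cdom (c n)"
  using countable_disjoint_pieces[OF A.smooth_atlas] by metis
 have "N <= (\<Union>n. N Int cdom (c n))" using P(2,5) by fastforce
 hence "emeasure mu N <= emeasure mu (\<Union>n. N Int cdom (c n))"
  by (rule emeasure_mono) (use N A.chartD(1)[OF P(4)] sets_mu in auto)
 also have "... = 0"
  by (rule emeasure_UN_eq_0) (use z[OF P(4)] N A.chartD(1)[OF P(4)] sets_mu in auto)
 finally show ?thesis by simp
qed

lemma frontier_mu_null: "emeasure mu (frontier D) = 0" "emeasure mu (- D) = 0"
proof -
 show "emeasure mu (frontier D) = 0"
 proof (rule mu_null_local)
  fix K assume k: "K : A"
  have "frontier D Int cdom K : sets borel" using A.chartD(1)[OF k] by auto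
  hence "emeasure mu (frontier D Int cdom K) = (\<integral>\<^sup>+y\<in>frD K. ennreal (rho K y) \<partial>lborel)"
  proof -
   have e: "(frontier D Int cdom K) Int D = frontier D Int cdom K" using frontier_subset by auto
   show ?thesis if "frontier D Int cdom K : sets borel"
    using mu_emeasure[OF k that Int_lower2] unfolding e .
  qed
  also have "... = 0"
   by (rule nn_integral_null_set[OF frontier_null[OF k]])
  finally show "emeasure mu (frontier D Int cdom K) = 0" .
 qed simp
 show "emeasure mu (- D) = 0"
 proof (rule mu_null_local)
  fix K assume k: "K : A"
  have "- D Int cdom K : sets borel" using A.chartD(1)[OF k] D_borel by auto
  moreover have "(- D Int cdom K) Int D = {}" by auto
  ultimately show "emeasure mu (- D Int cdom K) = 0" using mu_emeasure[OF k _ Int_lower2, of "- D"] by simp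
 qed (use D_borel in auto)
qed

text \<open>Around each point of the compact \<open>D\<close> the density is bounded on a compact
  chart ball. Finitely many of these neighbourhoods cover \<open>D\<close>, and its complement has
  measure 0.\<close>

lemma mu_finite: "emeasure mu UNIV < \<infinity>"
proof -
 have "EX O'. open O' & p : O' & emeasure mu O' < \<infinity>" if "p : D" for p
 proof -
  let ?k = "chart_at A p"
  have k: "?k : A" "p : cdom ?k" by (simp_all add: A.chart_at)
  obtain r where r: "r > 0" "cball (cmap ?k p) r <= cran ?k"
   using open_contains_cball[THEN iffD1, OF A.chartD(2)[OF k(1)], rule_format, of "cmap ?k p"] k(2) by blast
  define O' where "O' = cdom ?k Int cmap ?k -` ball (cmap ?k p) r"
  have O: "open O'" unfolding O'_def by (rule chart_open_preimage[OF A.is_chart[OF k(1)]]) simp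
  have "compact (rho ?k ` cball (cmap ?k p) r)"
   by (rule compact_continuous_image[OF continuous_on_subset[OF Cinf_continuous[OF rho_smooth[OF k(1)]] r(2)]]) simp
  then obtain c where c: "!!y. y : cball (cmap ?k p) r ==> abs (rho ?k y) <= c"
   using compact_imp_bounded[of "rho ?k ` cball (cmap ?k p) r"] by (force simp: bounded_iff)
  have "emeasure mu O' = (\<integral>\<^sup>+y\<in>cmap ?k ` (O' Int D). ennreal (rho ?k y) \<partial>lborel)"
   using O by (intro mu_emeasure k) (auto simp: O'_def)
  also have "... <= (nnI lborel (%y. ennreal c * ind (cball (cmap ?k p) r) y))"
  proof (rule nn_integral_mono)
   fix y
   show "ennreal (rho ?k y) * ind (cmap ?k ` (O' Int D)) y <= ennreal c * ind (cball (cmap ?k p) r) y"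
   proof (cases "y : cmap ?k ` (O' Int D)")
    case True
    hence y: "y : cball (cmap ?k p) r" by (auto simp: O'_def)
    have "rho ?k y <= c" using c[OF y] by simp
    thus ?thesis using y True by (simp add: ennreal_leI)
   qed simp
  qed
  also have "... = ennreal c * emeasure lborel (cball (cmap ?k p) r)"
   by (rule nn_integral_cmult_indicator) simp
  also have "... < \<infinity>" using emeasure_lborel_cball_finite[of "cmap ?k p" r] by (simp add: ennreal_mult_less_top)
  finally show ?thesis using O r k by (intro exI[of _ O']) (auto simp: O'_def)
 qed
 then obtain O' where O: "!!p. p : D ==> open (O' p) & p : O' p & emeasure mu (O' p) < \<infinity>" by metis
 obtain T where T: "T <= D" "finite T" "D <= (UN p:T. O' p)"
  using compactE_image[OF D_compact, of D O'] O by (metis UN_I subsetI)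
 have "emeasure mu UNIV <= emeasure mu ((UN p:T. O' p) Un - D)"
  by (rule emeasure_mono) (insert T O D_borel sets_mu, auto intro!: sets.finite_UN sets.Un)
 also have "... <= emeasure mu (UN p:T. O' p) + emeasure mu (- D)"
  by (rule emeasure_subadditive) (insert T O D_borel sets_mu, auto intro!: sets.finite_UN)
 also have "... = emeasure mu (UN p:T. O' p)" using frontier_mu_null by simp
 also have "... <= (SUM p:T. emeasure mu (O' p))"
  by (rule emeasure_subadditive_finite) (use T O sets_mu in auto)
 also have "... < \<infinity>" using T O by (auto simp: less_top)
 finally show ?thesis .
qed

sublocale mu: finite_measure mu
 by (rule finite_measureI) (use mu_finite in auto)

lemma mu_integral_chart:
 assumes k: "K : A" and f: "f : bm" and E: "E : sets borel" "E <= cdom K" "E <= D"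
  and f0: "!!p. p ~: E ==> f p = 0"
 shows "(LINT p|mu. f p) = (LINT y|lborel. ind (cmap K ` E) y * (rho K y * f (cinv K y)))"
proof -
 have ED: "E Int D = E" using E by auto
 have m: "(%y. ind (cmap K ` (E Int D)) y * rho K y) : bm"
  unfolding ED by (rule rho_measurable[OF k E(1,2)])
 note d = density_measure_chart[OF mu_spec k A.is_chart[OF k] E(1,2) m, unfolded ED]
 have nn: "0 <= ind (cmap K ` E) y * rho K y" for y
  using rho_pos[OF k, of y] E(2) by (auto simp: indicator_def intro: less_imp_le)
 have ci: "chart_inv K : measurable borel borel" by (rule chart_inv_measurable[OF A.is_chart[OF k]])
 have "(LINT p|mu. f p) = (LINT p|mu. ind E p *\<^sub>R f p)"
  by (rule Bochner_Integration.integral_cong) (auto simp: f0 indicator_def)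
 also have "... = (LINT p|(density mu (%p. ennreal (ind E p))). f p)"
  by (rule integral_density[symmetric]) (insert f E sets_mu, auto cong: measurable_cong_sets)
 also have "... = (LINT y|(density lborel (%y. ennreal (ind (cmap K ` E) y * rho K y))). f (chart_inv K y))"
  unfolding d by (rule integral_distr) (use ci f in auto)
 also have "... = (LINT y|lborel. (ind (cmap K ` E) y * rho K y) *\<^sub>R f (chart_inv K y))"
  by (rule integral_density) (insert m nn measurable_compose[OF ci f], auto simp: ED)
 also have "... = (LINT y|lborel. ind (cmap K ` E) y * (rho K y * f (cinv K y)))"
  using E(2) by (intro Bochner_Integration.integral_cong) (auto simp: chart_inv_def indicator_def)
 finally show ?thesis .
qed

end

section \<open>Variations and their densities\<close>

context domain
begin

text \<open>Values are prescribed over the interior of \<open>D\<close> only, but smooth local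
  representatives must exist around all points of \<open>D\<close>, boundary points included.
  Estimates are therefore uniform up to the boundary although \<open>s\<close> is left free on
  it.\<close>

definition smooth_scalar :: "real => (real \<times> 'a => real) => bool" where
 "smooth_scalar ep s \<longleftrightarrow> (ALL t0 p0. abs t0 < ep --> p0 : D --> (EX K:A. EX r>0. EX f. p0 : cdom K &
   Cinf f (bx t0 r K p0) &
   (ALL t:ball t0 r. ALL p:iD Int cdom K. cmap K p : ball (cmap K p0) r --> s (t, p) = f (t, cmap K p))))"

lemma smooth_scalarE:
 assumes "smooth_scalar ep s" "abs t0 < ep" "p0 : D"
 obtains K r f where "K : A" "r > 0" "p0 : cdom K" "Cinf f (bx t0 r K p0)"
  "ALL t:ball t0 r. ALL p:iD Int cdom K. cmap K p : ball (cmap K p0) r --> s (t, p) = f (t, cmap K p)"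
proof -
 have "EX K:A. EX r>0. EX f. p0 : cdom K & Cinf f (bx t0 r K p0) &
   (ALL t:ball t0 r. ALL p:iD Int cdom K. cmap K p : ball (cmap K p0) r --> s (t, p) = f (t, cmap K p))"
  using assms(1)[unfolded smooth_scalar_def, rule_format, OF assms(2,3)] .
 thus ?thesis by (elim bexE exE conjE) (rule that)
qed

lemma smooth_scalar_local:
 assumes s: "smooth_scalar ep s" and t0: "abs t0 < ep" and p0: "p0 : D"
 obtains O' C where "open O'" "(t0, p0) : O'"
  "ALL t p. (t, p) : O' --> p : iD --> isCont s (t, p) & abs (s (t, p)) <= C &
   HR (%t. s (t, p)) (deriv (%t. s (t, p)) t) t & abs (deriv (%t. s (t, p)) t) <= C"
proof -
 obtain K r f where k: "K : A" "r > 0" "p0 : cdom K" and f: "Cinf f (bx t0 r K p0)"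
  and sf: "ALL t:ball t0 r. ALL p:iD Int cdom K. cmap K p : ball (cmap K p0) r --> s (t, p) = f (t, cmap K p)"
  by (rule smooth_scalarE[OF s t0 p0])
 let ?y = "cmap K p0" and ?W = "bx t0 r K p0" and ?Kq = "cball t0 (r/2) \<times> cball (cmap K p0) (r/2)"
 define f' where "f' z = FD f z (1, 0)" for z
 have KW: "?Kq <= ?W" using k(2) by auto
 have cK: "compact ?Kq" by (intro compact_Times) auto
 have "continuous_on ?Kq f" by (rule continuous_on_subset[OF Cinf_continuous[OF f] KW])
 hence "bounded (f ` ?Kq)" by (intro compact_imp_bounded compact_continuous_image cK)
 then obtain C1 where C1: "!!z. z : ?Kq ==> abs (f z) <= C1" unfolding bounded_iff by auto
 have "continuous_on ?Kq f'" unfolding f'_def by (rule continuous_on_subset[OF Cinf_continuous[OF Cinf_frechet[OF f]] KW])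
 hence "bounded (f' ` ?Kq)" by (intro compact_imp_bounded compact_continuous_image cK)
 then obtain C2 where C2: "!!z. z : ?Kq ==> abs (f' z) <= C2" unfolding bounded_iff by auto
 define Q where "Q = cdom K Int cmap K -` ball ?y (r/2)"
 have oQ: "open Q" unfolding Q_def by (rule chart_open_preimage[OF A.is_chart[OF k(1)]]) simp
 define Z where "Z = ball t0 (r/2) \<times> (Q Int iD)"
 have oZ: "open Z" unfolding Z_def by (intro open_Times open_Int oQ) auto
 have sZ: "s z = f (fst z, cmap K (snd z))" if z: "z : Z" for z
 proof -
  have "fst z : ball t0 r" "snd z : iD" "snd z : cdom K" "cmap K (snd z) : ball ?y r"
   using z k(2) by (auto simp: Z_def Q_def)
  thus ?thesis using sf[rule_format, of "fst z" "snd z"] by simp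
 qed
 have "continuous_on Z (%z. f (fst z, cmap K (snd z)))"
 proof (rule continuous_on_compose2[OF Cinf_continuous[OF f]])
  have "continuous_on Z (%z. cmap K (snd z))"
   by (rule continuous_on_compose2[OF A.chartD(6)[OF k(1)]]) (auto simp: Z_def Q_def intro: continuous_intros)
  thus "continuous_on Z (%z. (fst z, cmap K (snd z)))" by (intro continuous_intros)
  show "(%z. (fst z, cmap K (snd z))) ` Z <= ?W" using k(2) by (auto simp: Z_def Q_def)
 qed
 hence cZ: "continuous_on Z s" using sZ by (simp cong: continuous_on_cong)
 show ?thesis
 proof (rule that[of "ball t0 (r/2) \<times> Q" "max C1 C2"])
  show "open (ball t0 (r/2) \<times> Q)" by (intro open_Times oQ) auto
  show "(t0, p0) : ball t0 (r/2) \<times> Q" using k by (simp add: Q_def)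
  show "ALL t p. (t, p) : ball t0 (r/2) \<times> Q --> p : iD --> isCont s (t, p) & abs (s (t, p)) <= max C1 C2 &
   HR (%t. s (t, p)) (deriv (%t. s (t, p)) t) t & abs (deriv (%t. s (t, p)) t) <= max C1 C2"
  proof (intro allI impI)
  fix t p assume tp: "(t, p) : ball t0 (r/2) \<times> Q" and p: "p : iD"
  hence z: "(t, p) : Z" by (simp add: Z_def)
  have yK: "(t, cmap K p) : ?Kq" using tp by (auto simp: Q_def)
  hence yW: "(t, cmap K p) : ?W" using KW by blast
  have c1: "isCont s (t, p)" using cZ z by (simp add: continuous_on_eq_continuous_at[OF oZ])
  have c2: "abs (s (t, p)) <= max C1 C2" using C1[OF yK] sZ[OF z] by simp
  have "HD (%t. (t, cmap K p)) (%h. (h, 0)) t"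
   by (auto intro!: derivative_eq_intros)
  from has_derivative_compose[OF this Cinf_deriv[OF f yW]]
  have "HD (%t. f (t, cmap K p)) (%h. FD f (t, cmap K p) (h, 0)) t" .
  moreover have "FD f (t, cmap K p) (h, 0) = f' (t, cmap K p) * h" for h
   using linear_scale[OF Cinf_frechet_linear[OF f yW], of h "(1, 0)"] by (simp add: f'_def mult.commute)
  ultimately have "HR (%t. f (t, cmap K p)) (f' (t, cmap K p)) t"
   by (simp add: has_field_derivative_def)
  hence d: "HR (%t. s (t, p)) (f' (t, cmap K p)) t"
  proof (rule has_field_derivative_transform_within_open)
   show "f (t', cmap K p) = s (t', p)" if "t' : ball t0 (r/2)" for t'
    using sZ[of "(t', p)"] that tp p by (simp add: Z_def)
  qed (use tp in auto)
  have "deriv (%t. s (t, p)) t = f' (t, cmap K p)" by (rule DERIV_imp_deriv[OF d])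
  thus "isCont s (t, p) & abs (s (t, p)) <= max C1 C2 & HR (%t. s (t, p)) (deriv (%t. s (t, p)) t) t & abs (deriv (%t. s (t, p)) t) <= max C1 C2"
   using c1 c2 d C2[OF yK] by simp
  qed
 qed
qed

lemma smooth_scalar_isCont: "smooth_scalar ep s ==> abs t < ep ==> p : iD ==> isCont s (t, p)"
 by (rule smooth_scalar_local[of ep s t p]) (use interior_subset in blast)+

lemma smooth_scalar_has_deriv:
 "smooth_scalar ep s ==> abs t < ep ==> p : iD ==>
  HR (%t. s (t, p)) (deriv (%t. s (t, p)) t) t"
 by (rule smooth_scalar_local[of ep s t p]) (use interior_subset in blast)+

text \<open>Local bounds on \<open>s\<close> and on its time derivative become uniform by
  compactness of \<open>[-a, a] \<times> D\<close>; the mean value inequality then gives the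
  Lipschitz estimate that dominates difference quotients.\<close>

lemma smooth_scalar_bounds:
 assumes s: "smooth_scalar ep s" and a: "a < ep"
 obtains C where "C >= 0" "!!t p. abs t <= a ==> p : iD ==> abs (s (t, p)) <= C"
  "!!t t' p. abs t <= a ==> abs t' <= a ==> p : iD ==> abs (s (t, p) - s (t', p)) <= C * abs (t - t')"
proof -
 let ?Kq = "{-a..a} \<times> D" and ?X = "UNIV \<times> iD"
 have cK: "compact ?Kq" by (intro compact_Times D_compact) auto
 have loc: "EX O' C. open O' & z : O' & (ALL w:O' Int ?X. abs (s w) <= C) &
  (ALL w:O' Int ?X. abs (deriv (%t. s (t, snd w)) (fst w)) <= C)" if z: "z : ?Kq" for z
 proof -
  have "abs (fst z) < ep" "snd z : D" using z a by auto
  then obtain O' C where O: "open O'" "(fst z, snd z) : O'"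
   "ALL t p. (t, p) : O' --> p : iD --> isCont s (t, p) & abs (s (t, p)) <= C &
    HR (%t. s (t, p)) (deriv (%t. s (t, p)) t) t & abs (deriv (%t. s (t, p)) t) <= C"
   by (rule smooth_scalar_local[OF s])
  show ?thesis by (rule exI[of _ O'], rule exI[of _ C]) (use O in auto)
 qed
 have "EX O' C. open O' & z : O' & (ALL w:O' Int ?X. abs (s w) <= C)" if z: "z : ?Kq" for z
  using loc[OF z] by blast
 from locally_bounded_imp_bounded[OF cK this] obtain C1 where C1: "C1 >= 0" "!!w. w : ?Kq Int ?X ==> abs (s w) <= C1" by auto
 have "EX O' C. open O' & z : O' & (ALL w:O' Int ?X. abs (deriv (%t. s (t, snd w)) (fst w)) <= C)" if z: "z : ?Kq" for z
  using loc[OF z] by blast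
 from locally_bounded_imp_bounded[OF cK this] obtain C2 where C2: "C2 >= 0"
  "!!w. w : ?Kq Int ?X ==> abs (deriv (%t. s (t, snd w)) (fst w)) <= C2" by auto
 show ?thesis
 proof (rule that[of "C1 + C2"])
  fix t p assume t: "abs t <= a" and p: "p : iD"
  have pD: "p : D" using p interior_subset by auto
  show "abs (s (t, p)) <= C1 + C2" using C1(2)[of "(t, p)"] C2(1) t p pD by (auto simp: abs_le_iff)
  fix t' assume t': "abs t' <= a"
  have "norm (s (t, p) - s (t', p)) <= C2 * norm (t - t')"
  proof (rule field_differentiable_bound)
   show "convex {-a..a}" by simp
   fix x assume x: "x : {-a..a}"
   hence x': "abs x < ep" using a by auto
   show "((%t. s (t, p)) has_field_derivative deriv (%t. s (t, p)) x) (at x within {-a..a})"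
    by (rule has_field_derivative_at_within[OF smooth_scalar_has_deriv[OF s x' p]])
   show "norm (deriv (%t. s (t, p)) x) <= C2" using C2(2)[of "(x, p)"] x p pD by auto
  qed (use t t' in auto)
  also have "... <= (C1 + C2) * abs (t - t')" using C1(1) by (simp add: mult_right_mono)
  finally show "abs (s (t, p) - s (t', p)) <= (C1 + C2) * abs (t - t')" by simp
 qed (use C1 C2 in auto)
qed

lemma smooth_scalar_measurable:
 assumes s: "smooth_scalar ep s"
 shows "(%z. ind (Iv ep \<times> iD) z * s z) : bm"
proof -
 let ?S = "Iv ep \<times> iD"
 have o: "open ?S" by (intro open_Times) auto
 have "continuous_on ?S s"
  unfolding continuous_on_eq_continuous_at[OF o] using smooth_scalar_isCont[OF s] by (auto simp: abs_less_iff)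
 thus ?thesis
  using borel_measurable_continuous_on_indicator[of ?S s] o by simp
qed

lemma smooth_scalar_slice:
 assumes s: "smooth_scalar ep s" and t: "abs t < ep"
 shows "(%p. ind iD p * s (t, p)) : bm"
proof -
 have "continuous_on UNIV (%p. (t, p :: 'a))" by (intro continuous_intros)
 hence "(%p. (t, p :: 'a)) : borel \<rightarrow>\<^sub>M borel" by (rule borel_measurable_continuous_onI)
 from measurable_compose[OF this smooth_scalar_measurable[OF s]]
 have "(%p. ind (Iv ep \<times> iD) (t, p) * s (t, p)) : bm" .
 moreover have "t : Iv ep" using t by auto
 hence "ind (Iv ep \<times> iD) (t, p) = (ind iD p :: real)" for p
  by (simp add: indicator_times)
 ultimately show ?thesis by simp
qed

text \<open>The derivative is a pointwise limit of difference quotients of measurable slices; the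
  steps \<open>h n\<close> are scaled so that \<open>t + h n\<close> stays below \<open>ep\<close>
  in absolute value.\<close>

lemma smooth_scalar_slice_deriv:
 assumes s: "smooth_scalar ep s" and t: "abs t < ep"
 shows "(%p. ind iD p * deriv (%t. s (t, p)) t) : bm"
proof (rule borel_measurable_LIMSEQ_real)
 define h where "h n = (ep - abs t) * inverse (real (Suc n)) / 2" for n
 have h: "abs (t + h n) < ep" "h n ~= 0" for n
 proof -
  have "0 < inverse (real (Suc n))" "inverse (real (Suc n)) <= 1" by (auto simp: field_simps)
  hence "(ep - abs t) * inverse (real (Suc n)) <= (ep - abs t) * 1" "(ep - abs t) * inverse (real (Suc n)) > 0"
   using t by (auto intro!: mult_left_mono mult_pos_pos)
  hence "h n > 0" "h n <= (ep - abs t) / 2" by (simp_all add: h_def)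
  thus "abs (t + h n) < ep" "h n ~= 0" using t by (auto simp: abs_if split: if_splits)
 qed
 have h0: "h \<longlonglongrightarrow> 0"
 proof -
  have "(%n. (ep - abs t) / 2 * inverse (real (Suc n))) \<longlonglongrightarrow> (ep - abs t) / 2 * 0"
   by (rule tendsto_mult[OF tendsto_const LIMSEQ_inverse_real_of_nat])
  thus ?thesis by (simp add: h_def[abs_def])
 qed
 show "(%n. (ind iD p * s (t + h n, p) - ind iD p * s (t, p)) / h n)
   \<longlonglongrightarrow> ind iD p * deriv (%t. s (t, p)) t" for p
 proof (cases "p : iD")
  case True
  have "((%x. (s (t + x, p) - s (t, p)) / x) \<longlongrightarrow> deriv (%t. s (t, p)) t) (at 0)"
   using smooth_scalar_has_deriv[OF s t True] by (simp add: DERIV_def)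
  hence "(%n. (s (t + h n, p) - s (t, p)) / h n) \<longlonglongrightarrow> deriv (%t. s (t, p)) t"
   using h0 h(2) unfolding tendsto_at_iff_sequentially o_def by blast
  thus ?thesis using True by simp
 qed simp
 show "(%p. (ind iD p * s (t + h n, p) - ind iD p * s (t, p)) / h n) : bm" for n
  by (intro borel_measurable_divide borel_measurable_diff smooth_scalar_slice[OF s] t h(1)) auto
qed

lemma has_derivative_parameter_integral:
 assumes m: "!!t. abs t < a ==> (%p. ind iD p * s (t, p)) : bm"
  and m': "(%p. ind iD p * s' p) : bm" and a: "a > 0"
  and b: "!!p. p : iD ==> abs (s (0, p)) <= C"
  and lip: "!!t p. abs t < a ==> p : iD ==> abs (s (t, p) - s (0, p)) <= C * abs t"
  and d: "!!p. p : iD ==> HR (%t. s (t, p)) (s' p) 0"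
 shows "HR (%t. \<integral>p. ind iD p * s (t, p) \<partial>mu) (LINT p|mu. ind iD p * s' p) 0"
proof -
 let ?i = "ind iD :: 'a => real"
 obtain p0 where "p0 : iD" using interior_nonempty by auto
 from b[OF this] have C: "C >= 0" by linarith
 have int: "integrable mu (%p. ?i p * s (t, p))" if t: "abs t < a" for t
 proof (rule mu.integrable_const_bound[where B="C + C * a"])
  have "abs (s (t, p)) <= C + C * a" if "p : iD" for p
   using b[OF that] lip[OF t that] t mult_left_mono[of "abs t" a C] C by linarith
  thus "AE p in mu. norm (?i p * s (t, p)) <= C + C * a"
   using C a by (intro AE_I2) (auto simp: indicator_def)
  show "(%p. ?i p * s (t, p)) : borel_measurable mu" using m[OF t] by (simp cong: measurable_cong_sets)
 qed
 show ?thesis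
 proof (rule has_real_derivative_integral[where w="%_. C", OF int a])
  show "abs (?i p * s (t, p) - ?i p * s (0, p)) <= C * abs t" if "abs t < a" for t p
   using lip[OF that, of p] C by (simp add: indicator_def)
  show "AE p in mu. HR (%t. ?i p * s (t, p)) (?i p * s' p) 0"
   by (rule AE_I2) (insert d, auto simp: indicator_def)
  show "(%p. ?i p * s' p) : borel_measurable mu" using m' by (simp cong: measurable_cong_sets)
 qed simp_all
qed

end

section \<open>Multilinear forms with moving arguments\<close>

lemma alternating_multilinear_case_option:
 fixes om :: "('m::finite option => 'v::real_vector) => real"
 assumes "alternating_multilinear om" "linear L"
 shows "alternating_multilinear (%u. om (case_option w (%i. L (u i))))"
 unfolding alternating_multilinear_def
proof (intro conjI allI impI)
 fix u :: "'m => 'a" and i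
 have "case_option w (%j. L ((u(i := v)) j)) = (case_option w (%i. L (u i)))(Some i := L v)" for v
  by (auto split: option.splits)
 moreover have "linear (%v. om ((case_option w (%i. L (u i)))(Some i := v)))"
  using assms(1) unfolding alternating_multilinear_def by blast
 from linear_compose[OF assms(2) this] have "linear (%v. om ((case_option w (%i. L (u i)))(Some i := L v)))"
  by (simp add: o_def)
 ultimately show "linear (%v. om (case_option w (%j. L ((u(i := v)) j))))" by simp
next
 fix u :: "'m => 'a" and i j assume "i ~= j & u i = u j"
 hence "Some i ~= Some j & case_option w (%i. L (u i)) (Some i) = case_option w (%i. L (u i)) (Some j)" by simp
 thus "om (case_option w (%i. L (u i))) = 0"
  using assms(1) unfolding alternating_multilinear_def by blast
qed

lemma alternating_multilinear_linear_axis: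
 fixes om :: "('k::finite => real^'k) => real"
 assumes "alternating_multilinear om"
 shows "om (%i. T (ax i)) = det (matrix T) * om (%i. ax i)"
proof -
 have "(SUM j:UNIV. transpose (matrix T) $ i $ j *\<^sub>R ax j) = T (ax i)" for i
  using vec_axis_expansion[of "T (ax i)", symmetric] by (simp only: transpose_def matrix_def vec_lambda_beta)
 thus ?thesis
  using alternating_multilinear_det[OF assms, of "transpose (matrix T)" "%j. ax j"] by simp
qed

text \<open>Constant arguments are replaced by moving ones slot by slot. Each replacement expands
  the new argument in the basis, so that multilinearity reduces everything to constant
  arguments.\<close>

lemma Cinf_multilinear:
 fixes om :: "'v::euclidean_space => ('k::finite => 'v) => real" and X :: "'k => 'z::euclidean_space => 'v"
 assumes lin: "!!x u i. x : V ==> linear (%v. om x (u(i := v)))"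
  and sm: "!!u. Cinf (%x. om x u) V"
  and H: "Cinf H U" "!!z. z : U ==> H z : V" and X: "!!i. Cinf (X i) U"
 shows "Cinf (%z. om (H z) (%i. X i z)) U"
proof -
 have "Cinf (%z. om (H z) (%i. if i : S then X i z else u i)) U" if "finite S" for S u
  using that
 proof (induction S arbitrary: u)
  case empty
  show ?case using Cinf_compose[where f="%x. om x u", OF sm H] by simp
 next
  case (insert k S)
  let ?Y = "%u z. (%i. if i : S then X i z else u i)"
  have "Cinf (%z. SUM b:Basis. (X k z \<bullet> b) *\<^sub>R om (H z) (?Y (u(k := b)) z)) U"
  proof (rule Cinf_sum[OF Cinf_open[OF H(1)]])
   fix b :: 'v assume "b : Basis"
   show "Cinf (%z. (X k z \<bullet> b) *\<^sub>R om (H z) (?Y (u(k := b)) z)) U"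
    by (rule Cinf_scaleR[OF Cinf_inner[OF X Cinf_const[OF Cinf_open[OF H(1)]]] insert.IH])
  qed
  thus ?case
  proof (rule Cinf_cong)
   fix z assume z: "z : U"
   have e: "(?Y u z)(k := b) = ?Y (u(k := b)) z" for b using insert.hyps(2) by auto
   have "(%i. if i : insert k S then X i z else u i) = (?Y u z)(k := X k z)" by auto
   thus "(SUM b:Basis. (X k z \<bullet> b) *\<^sub>R om (H z) (?Y (u(k := b)) z)) = om (H z) (%i. if i : insert k S then X i z else u i)"
    using linear_basis_expansion[OF lin[OF H(2)[OF z], where u="?Y u z" and i=k], of "X k z"] unfolding e by simp
  qed
 qed
 from this[of UNIV] show ?thesis by simp
qed

section \<open>Variations read in charts\<close>

locale vari = domain A B gb \<phi> D
 for A :: "('a::{t2_space, second_countable_topology}, real^'m) chart set"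
  and B :: "('b::{t2_space, second_countable_topology}, 'v::euclidean_space) chart set" and gb \<phi> D +
 fixes ep :: real and \<Phi> :: "real \<times> 'a => 'b"
 assumes variation: "variation A B \<phi> D ep \<Phi>"
begin

lemma eps_pos: "ep > 0" and Phi_0: "p : D ==> \<Phi> (0, p) = \<phi> p"
 using variation by (auto simp: variation_def)

lemma Phi_smooth: "smooth_map_on (prod_atlas A) B (Iv ep \<times> D) \<Phi>"
 using variation by (simp add: variation_def)

lemma Phi_continuous: "continuous_on (Iv ep \<times> D) \<Phi>"
 using Phi_smooth by (simp add: smooth_map_on_def)

lemma slice_continuous:
 assumes t: "abs t < ep"
 shows "continuous_on D (%p. \<Phi> (t, p))"
 by (rule continuous_on_compose2[OF Phi_continuous, of D "%p. (t, p)"])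
  (insert t, auto intro!: continuous_intros)

text \<open>A representative \<open>f\<close> of the variation on a full box of the model space.
  Near a boundary point of \<open>D\<close> it is a smooth extension, so agreement with the
  variation is asked at points of \<open>D\<close> only; its values stay in the image of
  \<open>K'\<close>, so that ambient tensors can be evaluated along it.\<close>

definition patch :: "real => 'a => ('a, real^'m) chart => ('b, 'v) chart => real => (real \<times> (real^'m) => 'v) => bool" where
 "patch t0 p0 K K' r f \<longleftrightarrow> K : A & K' : B & r > 0 & p0 : cdom K & ball t0 r <= Iv ep &
   ball (cmap K p0) r <= cran K & Cinf f (bx t0 r K p0) &
   (ALL z:bx t0 r K p0. f z : cran K') &
   (ALL t:ball t0 r. ALL p:D Int cdom K. cmap K p : ball (cmap K p0) r -->
    \<Phi> (t, p) : cdom K' & cmap K' (\<Phi> (t, p)) = f (t, cmap K p))"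

lemma patch_exists:
 assumes t0: "abs t0 < ep" and p0: "p0 : D" and k: "K : A" "p0 : cdom K" and k': "K' : B" "\<Phi> (t0, p0) : cdom K'"
 shows "EX r f. patch t0 p0 K K' r f"
proof -
 let ?S = "Iv ep \<times> D" and ?P = "prod_chart K" and ?y = "cmap K p0"
 define X where "X = cmap ?P ` (?S Int cdom ?P Int \<Phi> -` cdom K')"
 have P: "?P : prod_atlas A" using k by (simp add: prod_atlas_eq)
 have sm: "smooth_on (cmap K' o \<Phi> o cinv ?P) X"
  unfolding X_def using Phi_smooth[unfolded smooth_map_on_def] P k'(1) by blast
 have zin: "(t, p) : ?S Int cdom ?P Int \<Phi> -` cdom K' ==> pack (t, cmap K p) : X" for t p
  unfolding X_def by (rule image_eqI[where x="(t, p)"]) (simp_all add: prod_chart_def)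
 have "(t0, p0) : ?S Int cdom ?P Int \<Phi> -` cdom K'" using t0 p0 k k' by auto
 from smooth_onE[OF sm zin[OF this]] obtain U F where F: "Cinf F U" "pack (t0, ?y) : U"
  "ALL y:U Int X. F y = (cmap K' o \<Phi> o cinv ?P) y" by metis
 define V1 where "V1 = unpack ` U"
 have oU: "open U" by (rule Cinf_open[OF F(1)])
 have oV1: "open V1" unfolding V1_def by (rule open_unpack_image[OF oU])
 have V1: "pack z : U" if "z : V1" for z using that by (auto simp: V1_def)
 define f where "f z = F (pack z)" for z
 have f: "Cinf f V1" unfolding f_def
  by (rule Cinf_compose[OF F(1) Cinf_linear[OF bounded_linear_pack oV1] V1])
 have Ff: "f (t, cmap K p) = cmap K' (\<Phi> (t, p))"
  if tp: "(t, p) : ?S Int cdom ?P Int \<Phi> -` cdom K'" "(t, cmap K p) : V1" for t p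
 proof -
  have p: "p : cdom K" using tp by auto
  have "f (t, cmap K p) = (cmap K' o \<Phi> o cinv ?P) (pack (t, cmap K p))"
   unfolding f_def using F(3) zin[OF tp(1)] V1[OF tp(2)] by blast
  moreover have "cinv ?P (pack (t, cmap K p)) = (t, p)"
   using cinv_prod_chart[OF A.is_chart[OF k(1)], of "cmap K p" t] p A.chartD(3)[OF k(1) p] by simp
  ultimately show ?thesis by simp
 qed
 let ?W = "cran K'"
 have tV1: "(t0, ?y) : V1" unfolding V1_def using F(2) by (metis image_eqI unpack_pack)
 have "f (t0, ?y) = cmap K' (\<Phi> (t0, p0))" by (rule Ff) (use t0 p0 k k' tV1 in auto)
 hence fW: "f (t0, ?y) : ?W" using k' by simp
 define V2 where "V2 = V1 Int f -` ?W"
 have oV2: "open V2" unfolding V2_def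
  by (rule continuous_open_preimage[OF Cinf_continuous[OF f] oV1 B.chartD(2)[OF k'(1)]])
 have "(t0, p0) : ?S" using t0 p0 by auto
 with Phi_continuous B.chartD(1)[OF k'(1)] k'(2)
 obtain O' where O: "open O'" "(t0, p0) : O'" "ALL z:?S. z : O' --> \<Phi> z : cdom K'"
  unfolding continuous_on_topological by blast
 obtain Oa Ob where O2: "open Oa" "open Ob" "(t0, p0) : Oa \<times> Ob" "Oa \<times> Ob <= O'"
  using O(1,2) by (rule open_prod_elim)
 \<comment> \<open>All requirements at once: the extension is defined, its values lie in the chart
   image, the time is admissible, and the point is one where the variation maps into the domain of
   \<open>K'\<close>. Any box inside \<open>V3\<close> is a patch.\<close>
 define V3 where "V3 = V2 Int (Oa Int Iv ep) \<times> cmap K ` (Ob Int cdom K)"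
 have oV3: "open V3" unfolding V3_def
  by (intro open_Int oV2 open_Times O2 open_greaterThanLessThan chart_open_image[OF A.is_chart[OF k(1)]] A.chartD(1) k) simp
 have "(t0, ?y) : V3" using O2(3) t0 k tV1 fW by (auto simp: V3_def V2_def)
 then obtain Va Vb where V: "open Va" "open Vb" "(t0, ?y) : Va \<times> Vb" "Va \<times> Vb <= V3"
  using oV3 by (metis open_prod_elim)
 obtain ra where ra: "ra > 0" "ball t0 ra <= Va" using V by (metis mem_Sigma_iff open_contains_ball)
 obtain rb where rb: "rb > 0" "ball ?y rb <= Vb" using V by (metis mem_Sigma_iff open_contains_ball)
 define r where "r = min ra rb"
 have r: "r > 0" "ball t0 r \<times> ball ?y r <= V3"
 proof -
  have "ball t0 r <= Va" "ball ?y r <= Vb" using ra rb by (auto simp: r_def)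
  thus "ball t0 r \<times> ball ?y r <= V3" using V(4) by blast
 qed (insert ra rb, simp add: r_def)
 have tr: "t0 : ball t0 r" "?y : ball ?y r" using r by auto
 have b0: "ball t0 r \<times> ball ?y r <= (Oa Int Iv ep) \<times> cmap K ` (Ob Int cdom K)"
  using r(2) unfolding V3_def by blast
 have b1: "ball t0 r <= Oa Int Iv ep" and b2: "ball ?y r <= cmap K ` (Ob Int cdom K)"
  using b0 tr unfolding times_subset_iff by blast+
 have "patch t0 p0 K K' r f"
  unfolding patch_def
 proof (intro conjI ballI impI)
  show "Cinf f (ball t0 r \<times> ball ?y r)"
   by (rule Cinf_subset[OF f]) (insert r, auto simp: V3_def V2_def intro: open_Times)
  show "f z : ?W" if "z : ball t0 r \<times> ball ?y r" for z using that r(2) by (auto simp: V3_def V2_def)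
  show "ball t0 r <= Iv ep" using b1 by auto
  show "ball ?y r <= cran K" using b2 by auto
  fix t p assume tp: "t : ball t0 r" "p : D Int cdom K" "cmap K p : ball ?y r"
  then obtain q where q: "q : Ob Int cdom K" "cmap K p = cmap K q" using b2 by blast
  have "p = q" using inj_onD[OF A.chartD(8)[OF k(1)] q(2)] q tp by auto
  hence pO: "p : Ob" using q by simp
  have tO: "t : Oa" "t : Iv ep" using b1 tp(1) by auto
  have "(t, p) : O'" using O2(4) pO tO by auto
  thus *: "\<Phi> (t, p) : cdom K'" using O(3) tO tp(2) by auto
  have "(t, cmap K p) : V1" using r(2) tp by (auto simp: V3_def V2_def)
  thus "cmap K' (\<Phi> (t, p)) = f (t, cmap K p)"
   using Ff[of t p] * tO tp by simp
 qed (use k k' r in auto)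
 thus ?thesis by blast
qed

lemma patchD:
 assumes "patch t0 p0 K K' r f"
 shows "K : A" "K' : B" "r > 0" "p0 : cdom K" "ball t0 r <= Iv ep"
  "ball (cmap K p0) r <= cran K" "Cinf f (bx t0 r K p0)"
  "!!z. z : bx t0 r K p0 ==> f z : cran K'"
  "!!t p. t : ball t0 r ==> p : D ==> p : cdom K ==> cmap K p : ball (cmap K p0) r ==> \<Phi> (t, p) : cdom K'"
  "!!t p. t : ball t0 r ==> p : D ==> p : cdom K ==> cmap K p : ball (cmap K p0) r ==> cmap K' (\<Phi> (t, p)) = f (t, cmap K p)"
proof -
 note p = assms[unfolded patch_def]
 show "K : A" "K' : B" "r > 0" "p0 : cdom K" "ball t0 r <= Iv ep"
  "ball (cmap K p0) r <= cran K" "Cinf f (bx t0 r K p0)"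
  using p by - (elim conjE, assumption)+
 show "f z : cran K'" if "z : bx t0 r K p0" for z using p that by blast
 show "\<Phi> (t, p) : cdom K'" "cmap K' (\<Phi> (t, p)) = f (t, cmap K p)"
  if "t : ball t0 r" "p : D" "p : cdom K" "cmap K p : ball (cmap K p0) r" for t p
  using p that by blast+
qed

context
 fixes t0 p0 K K' r f t p
 assumes patch: "patch t0 p0 K K' r f" and t: "t : ball t0 r" and p: "p : iD" "p : cdom K" "cmap K p : ball (cmap K p0) r"
begin

lemma patch_point: "p : D" "abs t < ep" "(t, cmap K p) : bx t0 r K p0"
 "\<Phi> (t, p) : cdom K'" "cmap K' (\<Phi> (t, p)) = f (t, cmap K p)" "cinv K' (f (t, cmap K p)) = \<Phi> (t, p)"
proof -
 show pD: "p : D" using p interior_subset by auto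
 show "abs t < ep" using t patchD(5)[OF patch] by (auto simp: subset_iff abs_less_iff)
 show "(t, cmap K p) : bx t0 r K p0" using t p by simp
 show 1: "\<Phi> (t, p) : cdom K'" by (rule patchD(9)[OF patch t pD p(2,3)])
 show 2: "cmap K' (\<Phi> (t, p)) = f (t, cmap K p)" by (rule patchD(10)[OF patch t pD p(2,3)])
 show "cinv K' (f (t, cmap K p)) = \<Phi> (t, p)"
  using B.chartD(3)[OF patchD(2)[OF patch] 1] unfolding 2 .
qed

abbreviation "df \<equiv> FD f (t, cmap K p)"

lemma f_deriv: "HD f df (t, cmap K p)"
 by (rule Cinf_deriv[OF patchD(7)[OF patch] patch_point(3)])

lemma df_linear: "linear df"
 by (rule Cinf_frechet_linear[OF patchD(7)[OF patch] patch_point(3)])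

lemma patch_open: "open (cmap K ` (interior D Int cdom K) Int ball (cmap K p0) r)"
 by (intro open_Int open_ball chart_open_image[OF A.is_chart[OF patchD(1)[OF patch]]] A.chartD(1) patchD(1)[OF patch] open_interior) simp

lemma mdiff_slice:
 shows "to_chart B K' (\<Phi> (t, p)) (mdiff A B D (%p. \<Phi> (t, p)) p (from_chart A K p u)) = df (0, u)"
  and "mdiff A B D (%p. \<Phi> (t, p)) p v = from_chart B K' (\<Phi> (t, p)) (df (0, to_chart A K p v))"
proof -
 note k = patchD(1,2)[OF patch]
 have "HD (%y. (t, y)) (%h. (0, h)) (cmap K p)" by (auto intro!: derivative_eq_intros)
 from has_derivative_compose[OF this f_deriv]
 have "HD (%y. f (t, y)) (%h. df (0, h)) (cmap K p)" .
 hence "HD (rep K K' (%p. \<Phi> (t, p))) (%h. df (0, h)) (cmap K p)"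
 proof (rule has_derivative_cong_open[OF _ patch_open])
  fix y assume "y : cmap K ` (interior D Int cdom K) Int ball (cmap K p0) r"
  then obtain q where q: "q : iD" "q : cdom K" "y = cmap K q" "cmap K q : ball (cmap K p0) r" by auto
  have "q : D" using q(1) interior_subset by auto
  from patchD(10)[OF patch t this q(2,4)] show "f (t, y) = rep K K' (%p. \<Phi> (t, p)) y"
   using A.chartD(3)[OF k(1) q(2)] q(3) by simp
 qed (use p in auto)
 note m = mdiff_chart[where \<phi>="%p. \<Phi> (t, p)", OF k p(2) patch_point(4) p(1) slice_continuous[OF patch_point(2)] this]
 show "to_chart B K' (\<Phi> (t, p)) (mdiff A B D (%p. \<Phi> (t, p)) p (from_chart A K p u)) = df (0, u)"
  and "mdiff A B D (%p. \<Phi> (t, p)) p v = from_chart B K' (\<Phi> (t, p)) (df (0, to_chart A K p v))"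
  by (rule m)+
qed

lemma mdiff_slice_linear: "linear (mdiff A B D (%p. \<Phi> (t, p)) p)"
proof -
 note k = patchD(1,2)[OF patch]
 have l: "linear (%u. (0::real, u :: real^'m))" by (intro linearI) auto
 have "mdiff A B D (%p. \<Phi> (t, p)) p = from_chart B K' (\<Phi> (t, p)) o (df o ((%u. (0, u)) o to_chart A K p))"
  using mdiff_slice(2) by (simp add: fun_eq_iff)
 moreover have "linear (from_chart B K' (\<Phi> (t, p)) o (df o ((%u. (0, u)) o to_chart A K p)))"
  by (intro linear_compose l df_linear A.to_chart_linear B.from_chart_linear k p(2) patch_point(4))
 ultimately show ?thesis by simp
qed

lemma mdiff_product:
 "mdiff (prod_atlas A) B (Iv ep \<times> D) \<Phi> (t, p) (from_chart (prod_atlas A) (prod_chart K) (t, p) u)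
  = from_chart B K' (\<Phi> (t, p)) (df (unpack u))"
proof -
 note k = patchD(1,2)[OF patch]
 interpret PB: two_atlases "prod_atlas A" B
  by unfold_locales (rule smooth_atlas_prod[OF A.smooth_atlas])
 have P: "prod_chart K : prod_atlas A" using k by (simp add: prod_atlas_eq)
 let ?z = "pack (t, cmap K p)" and ?V = "cmap K ` (interior D Int cdom K) Int ball (cmap K p0) r"
 have cm: "cmap (prod_chart K) (t, p) = ?z" by (simp add: prod_chart_def)
 have tb: "ball t0 r <= Iv ep" by (rule patchD(5)[OF patch])
 have "HD unpack unpack ?z"
  by (rule bounded_linear.has_derivative[OF bounded_linear_unpack, OF has_derivative_ident])
 moreover have "HD f df (unpack ?z)" using f_deriv by simp
 ultimately have "HD (%z. f (unpack z)) (%h. df (unpack h)) ?z"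
  by (rule has_derivative_compose)
 hence "HD (PB.rep (prod_chart K) K' \<Phi>) (%h. df (unpack h)) ?z"
 proof (rule has_derivative_cong_open)
  show "open (pack ` (ball t0 r \<times> ?V))" by (intro open_pack_image open_Times open_ball patch_open)
  show "?z : pack ` (ball t0 r \<times> ?V)" using t p by auto
  fix z assume "z : pack ` (ball t0 r \<times> ?V)"
  then obtain s q where q: "z = pack (s, cmap K q)" "s : ball t0 r" "q : iD" "q : cdom K" "cmap K q : ball (cmap K p0) r" by auto
  have "q : D" using q(3) interior_subset by auto
  moreover have "cinv (prod_chart K) z = (s, q)"
   using cinv_prod_chart[OF A.is_chart[OF k(1)], of "cmap K q" s] q(1,4) A.chartD(3)[OF k(1) q(4)] by simp
  ultimately show "f (unpack z) = PB.rep (prod_chart K) K' \<Phi> z"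
   using patchD(10)[OF patch q(2) _ q(4,5)] q(1) by simp
 qed
 hence d: "HD (PB.rep (prod_chart K) K' \<Phi>) (%h. df (unpack h)) (cmap (prod_chart K) (t, p))"
  unfolding cm .
 have "(t, p) : cdom (prod_chart K)" using p by simp
 moreover have "(t, p) : interior (Iv ep \<times> D)"
  using p(1) patch_point(2) by (auto simp: interior_Times abs_less_iff)
 ultimately have "to_chart B K' (\<Phi> (t, p)) (mdiff (prod_atlas A) B (Iv ep \<times> D) \<Phi> (t, p) (from_chart (prod_atlas A) (prod_chart K) (t, p) u)) = df (unpack u)"
  by (rule PB.mdiff_chart(1)[where \<phi>=\<Phi>, OF P k(2) _ patch_point(4) _ Phi_continuous d])
 thus ?thesis
  using B.from_to_chart[OF k(2) patch_point(4)] by metis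
qed

lemma velocity_patch:
 "((%s. cmap (chart_at B (\<Phi> (t, p))) (\<Phi> (s, p))) has_vector_derivative from_chart B K' (\<Phi> (t, p)) (df (1, 0))) (at t)"
proof -
 note k = patchD(1,2)[OF patch]
 let ?c = "chart_at B (\<Phi> (t, p))"
 have c: "?c : B" "\<Phi> (t, p) : cdom ?c" by (simp_all add: B.chart_at)
 have "HD (%s. (s, cmap K p)) (%h. (h, 0)) t" by (auto intro!: derivative_eq_intros)
 from has_derivative_compose[OF this f_deriv]
 have fd: "HD (%s. f (s, cmap K p)) (%h. df (h, 0)) t" .
 have "HD (cmap ?c o cinv K') (transition_deriv K' ?c (\<Phi> (t, p))) (f (t, cmap K p))"
  using B.transition_has_derivative[OF k(2) c(1) patch_point(4) c(2)] unfolding patch_point(5) .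
 from has_derivative_compose[OF fd this]
 have "HD (%s. (cmap ?c o cinv K') (f (s, cmap K p))) (%h. from_chart B K' (\<Phi> (t, p)) (df (h, 0))) t"
  unfolding from_chart_def .
 hence d: "HD (%s. cmap ?c (\<Phi> (s, p))) (%h. from_chart B K' (\<Phi> (t, p)) (df (h, 0))) t"
 proof (rule has_derivative_cong_open[OF _ open_ball[of t0 r] t])
  fix s assume s: "s : ball t0 r"
  from patchD(9,10)[OF patch s patch_point(1) p(2,3)] show "(cmap ?c o cinv K') (f (s, cmap K p)) = cmap ?c (\<Phi> (s, p))"
   using B.chartD(3)[OF k(2), of "\<Phi> (s, p)"] by simp
 qed
 have "from_chart B K' (\<Phi> (t, p)) (df (h, 0)) = h *\<^sub>R from_chart B K' (\<Phi> (t, p)) (df (1, 0))" for h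
  using linear_scale[OF df_linear, of h "(1, 0)"] linear_scale[OF B.from_chart_linear[OF k(2) patch_point(4)]] by simp
 hence eq: "(%h. from_chart B K' (\<Phi> (t, p)) (df (h, 0))) = (%h. h *\<^sub>R from_chart B K' (\<Phi> (t, p)) (df (1, 0)))"
  by (rule ext)
 show ?thesis unfolding has_vector_derivative_def eq[symmetric] by (rule d)
qed

end

end

section \<open>Densities relative to the volume measure of \<open>D\<close>\<close>

lemma lborel_distr_pack: "distr lborel borel (pack :: real \<times> (real^'m) => real^('m option)) = lborel"
proof (rule lborel_distr_basis_bij)
 let ?p = "pack :: real \<times> (real^'m) => real^('m option)"
 show "linear ?p" by (rule bounded_linear.linear[OF bounded_linear_pack])
 have ax: "?p (1, 0) = ax None" "?p (0, ax j) = ax (Some j)" for j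
  by (auto simp: pack_def axis_def vec_eq_iff split: option.splits)
 have B: "(Basis :: (real \<times> (real^'m)) set) = insert (1, 0) ((%j. (0, ax j)) ` UNIV)"
  by (auto simp: Basis_prod_def Basis_vec_def)
 have B': "(Basis :: (real^('m option)) set) = insert (ax None) ((%j. ax (Some j)) ` UNIV)"
  by (auto simp: Basis_vec_def UNIV_option_conv)
 show "bij_betw ?p Basis Basis"
  unfolding bij_betw_def
 proof
  show "inj_on ?p Basis" by (rule inj_onI) (metis unpack_pack)
  show "?p ` Basis = Basis" unfolding B B' by (simp add: ax image_image)
 qed
 show "?p x \<bullet> ?p b = x \<bullet> b" for x b
  by (simp add: inner_vec_def UNIV_option_conv inner_prod_def sum.reindex)
qed

lemma measure_density_integral:
 assumes f: "f : borel_measurable M" "!!x. f x >= 0" and S: "S : sets M"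
 shows "measure (density M (%x. ennreal (f x))) S = (LINT x|M. f x * ind S x)"
proof -
 have "measure (density M (%x. ennreal (f x))) S = (LINT x|(density M (%x. ennreal (f x))). ind S x)"
  using sets.sets_into_space[OF S] by (simp add: Int_absorb2)
 also have "... = (LINT x|M. f x *\<^sub>R ind S x)"
  by (rule integral_density) (use f S in auto)
 finally show ?thesis by simp
qed

context domain
begin

lemma nn_integral_mu_chart:
 assumes k: "K : A" and F: "Q : bm" and F0: "!!p. p ~: cdom K ==> Q p = 0"
 shows "(nnI mu (%p. Q p)) = (nnI lborel (%y. ennreal (ind (cmap K ` (cdom K Int D)) y * rho K y) * Q (chart_inv K y)))"
proof -
 have E: "cdom K : sets borel" using A.chartD(1)[OF k] by simp
 have m: "(%y. ind (cmap K ` (cdom K Int D)) y * rho K y) : bm"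
  using E D_borel by (intro rho_measurable[OF k]) auto
 note d = density_measure_chart[OF mu_spec k A.is_chart[OF k] E order_refl m]
 have ci: "chart_inv K : measurable borel borel" by (rule chart_inv_measurable[OF A.is_chart[OF k]])
 have "(nnI mu (%p. Q p)) = (nnI mu (%p. ennreal (ind (cdom K) p) * Q p))"
  by (rule nn_integral_cong) (auto simp: F0 indicator_def)
 also have "... = (nnI (density mu (%p. ennreal (ind (cdom K) p))) (%p. Q p))"
  by (rule nn_integral_density[symmetric]) (insert F E sets_mu, auto cong: measurable_cong_sets)
 also have "... = (nnI (density lborel (%y. ennreal (ind (cmap K ` (cdom K Int D)) y * rho K y))) (%y. Q (chart_inv K y)))"
  unfolding d by (rule nn_integral_distr) (use ci F in auto)
 also have "... = (nnI lborel (%y. ennreal (ind (cmap K ` (cdom K Int D)) y * rho K y) * Q (chart_inv K y)))"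
  by (rule nn_integral_density) (use m measurable_compose[OF ci F] in auto)
 finally show ?thesis .
qed

lemma frontier_null_set: "K : A ==> AE y in lborel. y ~: frD K"
 using frontier_null AE_not_in by blast

text \<open>By uniqueness it suffices that the measure with density \<open>h\<close> relative to
  \<open>mu\<close> has the specification for \<open>rr\<close>. The relation between
  \<open>rr\<close> and \<open>rho\<close> enters in the interior only, because the boundary is null
  in each chart.\<close>

lemma density_mu_eq:
 assumes h: "(%p. ind iD p * h p) : bm" and nn: "!!p. p : iD ==> h p >= 0"
  and rr: "!!K p. K : A ==> p : iD ==> p : cdom K ==> rr K (cmap K p) = h p * rho K (cmap K p)"
 shows "measure (density_measure A D rr) D = (LINT p|mu. ind iD p * h p)"
proof -
 let ?h = "%p. ind iD p * h p"
 have "density_measure A D rr = density mu (%p. ennreal (?h p))"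
 proof (rule density_measure_eqI[OF A.smooth_atlas])
  show "density_measure_spec A D rr (density mu (%p. ennreal (?h p)))"
   unfolding density_measure_spec_def
  proof (intro conjI ballI impI)
   fix K E assume k: "K : A" and E: "E : sets borel" "E <= cdom K"
   let ?q = "%p. ennreal (?h p) * ind E p"
   have "emeasure (density mu (%p. ennreal (?h p))) E = (nnI mu (%p. ?q p))"
    by (rule emeasure_density) (insert h E sets_mu, auto cong: measurable_cong_sets)
   also have "... = (nnI lborel (%y. ennreal (ind (cmap K ` (cdom K Int D)) y * rho K y) * ?q (chart_inv K y)))"
    by (rule nn_integral_mu_chart[OF k]) (insert h E, auto simp: indicator_def)
   also have "... = (nnI lborel (%y. ennreal (rr K y) * ind (cmap K ` (E Int D)) y))"
   proof (rule nn_integral_cong_AE, rule AE_mp[OF frontier_null_set[OF k]], intro AE_I2 impI)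
    fix y assume y: "y ~: frD K"
    show "ennreal (ind (cmap K ` (cdom K Int D)) y * rho K y) * ?q (chart_inv K y) = ennreal (rr K y) * ind (cmap K ` (E Int D)) y"
    proof (cases "y : cmap K ` (cdom K Int D)")
     case True
     then obtain p where p: "p : cdom K" "p : D" "y = cmap K p" by auto
     hence pi: "p : iD" using y D_split(1) by auto
     have ci: "chart_inv K y = p" using p A.chartD(3)[OF k p(1)] by (simp add: chart_inv_def)
     have "y : cmap K ` (E Int D) \<longleftrightarrow> p : E"
      using p E(2) inj_onD[OF A.chartD(8)[OF k], of p] by (auto simp: subset_iff)
     moreover have "rho K y > 0" using rho_pos[OF k, of y] p by simp
     ultimately show ?thesis
      using rr[OF k pi p(1)] nn[OF pi] pi p True unfolding ci
      by (auto simp: indicator_def ennreal_mult mult.commute)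
    next
     case False
     moreover have "y ~: cmap K ` (E Int D)" using False E(2) by auto
     ultimately show ?thesis by simp
    qed
   qed
   finally show "emeasure (density mu (%p. ennreal (?h p))) E = (\<integral>\<^sup>+y\<in>cmap K ` (E Int D). ennreal (rr K y) \<partial>lborel)" .
  qed (simp add: sets_mu)
 qed
 moreover have "measure (density mu (%p. ennreal (?h p))) D = (LINT p|mu. ?h p * ind D p)"
  by (rule measure_density_integral) (insert h nn D_borel sets_mu, auto simp: indicator_def cong: measurable_cong_sets)
 moreover have "?h p * ind D p = ?h p" for p using interior_subset[of D] by (auto simp: indicator_def)
 ultimately show ?thesis by simp
qed

lemma sets_pair_mu [measurable_cong]: "sets (lborel \<Otimes>\<^sub>M mu) = sets (borel :: (real \<times> 'a) measure)"
 unfolding sets_pair_measure_cong[OF sets_lborel sets_mu] borel_prod ..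

text \<open>The product analogue: Fubini reduces to time slices, a chart turns \<open>mu\<close>
  into Lebesgue measure with density \<open>rho\<close>, and \<open>pack\<close> preserves
  \<open>lborel\<close>.\<close>

lemma density_prod_eq:
 assumes h: "(%z. ind ({a..b} \<times> iD) z * h z) : bm"
  and nn: "!!t p. t : {a..b} ==> p : iD ==> h (t, p) >= 0"
  and rr: "!!K t p. K : A ==> t : {a..b} ==> p : iD ==> p : cdom K ==>
   rr (prod_chart K) (pack (t, cmap K p)) = h (t, p) * rho K (cmap K p)"
 shows "measure (density_measure (prod_atlas A) ({a..b} \<times> D) rr) ({a..b} \<times> D)
  = (LINT z|(lborel \<Otimes>\<^sub>M mu). ind ({a..b} \<times> iD) z * h z)"
proof -
 let ?M = "lborel \<Otimes>\<^sub>M mu"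
 let ?h = "%z. ind ({a..b} \<times> iD) z * h z" and ?S = "{a..b} \<times> D"
 interpret P: pair_sigma_finite lborel mu by unfold_locales
 have hM: "?h : borel_measurable ?M"
  using h unfolding measurable_cong_sets[OF sets_pair_mu refl] .
 have "density_measure (prod_atlas A) ?S rr = density ?M (%z. ennreal (?h z))"
 proof (rule density_measure_eqI[OF smooth_atlas_prod[OF A.smooth_atlas]])
  show "density_measure_spec (prod_atlas A) ?S rr (density ?M (%z. ennreal (?h z)))"
   unfolding density_measure_spec_def
  proof (intro conjI ballI impI)
   fix K2 E assume k2: "K2 : prod_atlas A" and E: "E : sets borel" "E <= cdom K2"
   obtain K where k: "K : A" "K2 = prod_chart K" using k2 by (auto simp only: prod_atlas_eq)
   have Ek: "p : cdom K" if "(t, p) : E" for t p using that E(2) k(2) by auto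
   let ?q = "%z. ennreal (?h z) * ind E z"
   let ?J = "%y. ennreal (ind (cmap K ` (cdom K Int D)) y * rho K y)"
   let ?Kq = "%w. ?J (snd w) * ?q (fst w, chart_inv K (snd w))"
   have F: "?q : bm" using h E(1) by measurable
   have FM: "?q : borel_measurable ?M"
    using F unfolding measurable_cong_sets[OF sets_pair_mu refl] .
   have ci: "chart_inv K : measurable borel borel" by (rule chart_inv_measurable[OF A.is_chart[OF k(1)]])
   have m: "(%y. ind (cmap K ` (cdom K Int D)) y * rho K y) : bm"
    using A.chartD(1)[OF k(1)] D_borel by (intro rho_measurable[OF k(1)]) auto
   have ub: "unpack : measurable borel (borel :: (real \<times> (real^'m)) measure)"
    and pb: "pack : measurable (borel :: (real \<times> (real^'m)) measure) borel"
    by (intro borel_measurable_continuous_onI linear_continuous_on bounded_linear_unpack bounded_linear_pack)+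
   have pm: "(%w. (fst w, chart_inv K (snd w))) : measurable (borel :: (real \<times> (real^'m)) measure) (borel :: (real \<times> 'a) measure)"
    unfolding borel_prod[symmetric] using ci by measurable
   have Kq: "?Kq : bm"
    by (intro borel_measurable_times_ennreal measurable_compose[OF pm F] measurable_compose[OF _ m, THEN measurable_compose, OF _ measurable_ennreal])
     (simp_all add: borel_measurable_continuous_onI continuous_on_snd continuous_on_id)
   have "emeasure (density ?M (%z. ennreal (?h z))) E = (nnI ?M (%z. ?q z))"
    by (rule emeasure_density) (use hM E sets_pair_mu in auto)
   also have "... = (\<integral>\<^sup>+t. \<integral>\<^sup>+p. ?q (t, p) \<partial>mu \<partial>lborel)"
    by (rule mu.nn_integral_fst[symmetric, OF FM])
   also have "... = (\<integral>\<^sup>+t. \<integral>\<^sup>+y. ?Kq (t, y) \<partial>lborel \<partial>lborel)"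
   proof (rule nn_integral_cong)
    fix t :: real
    have "continuous_on UNIV (%p. (t, p :: 'a))" by (intro continuous_intros)
    hence "(%p. (t, p :: 'a)) : borel \<rightarrow>\<^sub>M borel" by (rule borel_measurable_continuous_onI)
    from measurable_compose[OF this F]
    have m': "(%p. ?q (t, p)) : bm" .
    have q0: "?q (t, p) = 0" if pk: "p ~: cdom K" for p
    proof -
     have "(t, p) ~: E" using Ek pk by blast
     thus ?thesis by simp
    qed
    show "(nnI mu (%p. ?q (t, p))) = (nnI lborel (%y. ?Kq (t, y)))"
     unfolding fst_conv snd_conv by (rule nn_integral_mu_chart[OF k(1) m']) (rule q0)
   qed
   also have "... = (nnI (lborel \<Otimes>\<^sub>M lborel) (%w. ?Kq w))"
    by (rule lborel.nn_integral_fst) (insert Kq, simp add: lborel_prod)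
   also have "... = (nnI lborel (%w. ?Kq w))" by (simp add: lborel_prod)
   also have "... = (nnI (distr lborel borel pack) (%z. ?Kq (unpack z)))"
    using pb measurable_compose[OF ub Kq] by (subst nn_integral_distr) simp_all
   also have "... = (nnI lborel (%z. ?Kq (unpack z)))" unfolding lborel_distr_pack ..
   also have "... = (\<integral>\<^sup>+z\<in>cmap K2 ` (E Int ?S). ennreal (rr K2 z) \<partial>lborel)"
   proof (rule nn_integral_cong_AE)
    have N: "frD K : sets borel" using frontier_null[OF k(1)] by auto
    have N': "{w :: real \<times> (real^'m). snd w ~: frD K} : sets borel"
    proof -
     have "snd : measurable (borel :: (real \<times> (real^'m)) measure) borel"
      by (intro borel_measurable_continuous_onI continuous_intros)
     from measurable_sets[OF this, of "- frD K"] N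
     show ?thesis by (simp add: vimage_def)
    qed
    have "AE w in lborel \<Otimes>\<^sub>M lborel. snd (w :: real \<times> (real^'m)) ~: frD K"
    proof (rule lborel_pair.AE_pair_measure)
     show "{w : space (lborel \<Otimes>\<^sub>M lborel). snd (w :: real \<times> (real^'m)) ~: frD K} : sets (lborel \<Otimes>\<^sub>M lborel)"
      unfolding lborel_prod using N' by simp
    qed (use frontier_null_set[OF k(1)] in simp)
    hence "AE w in lborel. snd (unpack (pack w)) ~: frD K"
     unfolding lborel_prod unpack_pack .
    hence "AE z in distr lborel borel pack. snd (unpack z) ~: frD K"
     using pb measurable_sets[OF ub N'] by (subst AE_distr_iff) (simp_all add: vimage_def)
    hence "AE z in lborel. snd (unpack z) ~: frD K"
     unfolding lborel_distr_pack .
    thus "AE z in lborel. ?Kq (unpack z) = ennreal (rr K2 z) * ind (cmap K2 ` (E Int ?S)) z"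
    proof (rule AE_mp, intro AE_I2 impI)
     fix z :: "real^('m option)" assume y': "snd (unpack z) ~: frD K"
     obtain t y where w: "unpack z = (t, y)" by (cases "unpack z")
     have z: "z = pack (t, y)" unfolding w[symmetric] by simp
     have y: "y ~: frD K" using y' w by simp
     have im: "z : cmap K2 ` (E Int ?S) \<longleftrightarrow> (EX p. (t, p) : E & t : {a..b} & p : D & y = cmap K p)"
     proof
      assume "z : cmap K2 ` (E Int ?S)"
      then obtain t' p where q: "(t', p) : E" "t' : {a..b}" "p : D" "z = pack (t', cmap K p)"
       by (auto simp: k(2) prod_chart_def)
      have "(t', cmap K p) = (t, y)" using w unfolding q(4) by simp
      thus "EX p. (t, p) : E & t : {a..b} & p : D & y = cmap K p" using q by auto
     next
      assume "EX p. (t, p) : E & t : {a..b} & p : D & y = cmap K p"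
      then obtain p where "(t, p) : E" "t : {a..b}" "p : D" "y = cmap K p" by blast
      thus "z : cmap K2 ` (E Int ?S)"
       unfolding z by (intro image_eqI[where x="(t, p)"]) (auto simp: k(2) prod_chart_def)
     qed
     show "?Kq (unpack z) = ennreal (rr K2 z) * ind (cmap K2 ` (E Int ?S)) z"
     proof (cases "y : cmap K ` (cdom K Int D)")
      case True
      then obtain p where p: "p : cdom K" "p : D" "y = cmap K p" by auto
      hence pi: "p : iD" using y D_split(1) by auto
      have ci: "chart_inv K y = p" using p A.chartD(3)[OF k(1) p(1)] by (simp add: chart_inv_def)
      have inj: "q = p" if "q : cdom K" "y = cmap K q" for q
       using inj_onD[OF A.chartD(8)[OF k(1)], of q p] p that by simp
      have im': "z : cmap K2 ` (E Int ?S) \<longleftrightarrow> (t, p) : E & t : {a..b}"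
       unfolding im using p Ek inj by blast
      have r: "rho K y > 0" using rho_pos[OF k(1), of y] p by simp
      show ?thesis
      proof (cases "(t, p) : E & t : {a..b}")
       case tE: True
       hence "rr K2 z = h (t, p) * rho K y" "h (t, p) >= 0"
        using rr[OF k(1) _ pi p(1), of t] nn[OF _ pi, of t] p(3) z k(2) by auto
       thus ?thesis using tE im' True pi r unfolding w fst_conv snd_conv ci
        by (simp add: ennreal_mult mult.commute)
      next
       case False
       hence "ennreal (?h (t, p)) * ind E (t, p) = 0" by (auto simp: indicator_def)
       thus ?thesis using False im' unfolding w fst_conv snd_conv ci by simp
      qed
     next
      case False
      hence "z ~: cmap K2 ` (E Int ?S)" unfolding im using Ek by blast
      thus ?thesis using False w by simp
     qed
    qed
   qed
   finally show "emeasure (density ?M (%z. ennreal (?h z))) E = (\<integral>\<^sup>+z\<in>cmap K2 ` (E Int ?S). ennreal (rr K2 z) \<partial>lborel)" .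
  qed (simp only: sets_density sets_pair_mu)
 qed
 moreover have "measure (density ?M (%z. ennreal (?h z))) ?S = (LINT z|?M. ?h z * ind ?S z)"
 proof (rule measure_density_integral[OF hM])
  show "?h z >= 0" for z using nn by (cases z) (auto simp: indicator_def)
  have "?S : sets (borel \<Otimes>\<^sub>M borel)" using D_borel by (intro pair_measureI) auto
  thus "?S : sets ?M" unfolding sets_pair_mu borel_prod .
 qed
 moreover have "?h z * ind ?S z = ?h z" for z using interior_subset[of D] by (auto simp: indicator_def)
 ultimately show ?thesis by simp
qed

end

context submanifold
begin

text \<open>\<open>chart_at\<close> selects charts of the oriented atlas. Hence the passage from any
  chart to the selected coordinates has positive Jacobian, and no absolute values survive in the
  formulas for densities and forms.\<close>

lemma det_from_chart_pos:
 assumes "K : A" "p : cdom K"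
 shows "det (matrix (from_chart A K p)) > 0"
 using oriented assms A.chart_at(1)[of p] A.chart_at(2)[of p] unfolding oriented_atlas_def from_chart_def by blast

lemma det_gram_chart:
 assumes "bilinear (h p)" "K : A" "p : cdom K"
 shows "det (gram (metric_in_chart A h K (cmap K p))) = (det (matrix (from_chart A K p)))^2 * det (gram (h p))"
 using det_gram_transform[OF assms(1), of "from_chart A K p"]
 by (simp add: metric_in_chart_def A.chartD(3)[OF assms(2,3)])

lemma rho_point:
 assumes "K : A" "p : cdom K"
 shows "rho K (cmap K p) = det (matrix (from_chart A K p)) * sqrt (det (gram (g p)))"
 unfolding rho_def det_gram_chart[where h=g, OF inner_formD(1)[OF g_inner] assms]
 using det_from_chart_pos[OF assms] by (simp add: real_sqrt_mult)

end

section \<open>First derivative of the area\<close>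

context vari
begin

definition gt :: "real => ('a, real^'m) metric" where "gt t = pullback_metric A B D (%p. \<Phi> (t, p)) gb"

text \<open>The squared ratio of the moved and the original volume element, a quotient of
  determinants and thus independent of charts. The square is smooth in \<open>t\<close> even where a
  slice degenerates; its root is differentiated at \<open>t = 0\<close> only, where the ratio is
  1.\<close>

definition G2 :: "real \<times> 'a => real" where "G2 z = det (gram (gt (fst z) (snd z))) / det (gram (g (snd z)))"

definition velocity :: "real => 'a => 'v" where
 "velocity t p = vector_derivative (%s. cmap (chart_at B (\<Phi> (t, p))) (\<Phi> (s, p))) (at t)"

lemma velocity_0: "velocity 0 = vector_variation B \<Phi>"
 by (simp add: velocity_def vector_variation_def fun_eq_iff)

context
 fixes t0 p0 K K' r f t p
 assumes patch: "patch t0 p0 K K' r f" and t: "t : ball t0 r" and p: "p : iD" "p : cdom K" "cmap K p : ball (cmap K p0) r"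
begin

lemma gt_patch:
 "metric_in_chart A (gt t) K (cmap K p) u v = Gm K' (f (t, cmap K p))
   (FD f (t, cmap K p) (0, u)) (FD f (t, cmap K p) (0, v))"
proof -
 note k = patchD(1,2)[OF patch] and pp = patch_point[OF patch t p]
 show ?thesis
  unfolding metric_in_chart_def[of A] A.chartD(3)[OF k(1) p(2)] gt_def pullback_metric_def
   RB.metric_chart[OF k(2) pp(4)] mdiff_slice(1)[OF patch t p] pp(5) ..
qed

lemma gt_bilinear: "bilinear (gt t p)"
 unfolding gt_def pullback_metric_def[abs_def]
 by (rule bilinear_compose[OF inner_formD(1)[OF RB.metric_inner_form] mdiff_slice_linear[OF patch t p] mdiff_slice_linear[OF patch t p]])

lemma G2_patch:
 "G2 (t, p) = det (gram (%u v. Gm K' (f (t, cmap K p))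
   (FD f (t, cmap K p) (0, u)) (FD f (t, cmap K p) (0, v)))) / (rho K (cmap K p))^2"
proof -
 note k = patchD(1,2)[OF patch]
 have d: "det (matrix (from_chart A K p)) > 0" by (rule det_from_chart_pos[OF k(1) p(2)])
 have "det (gram (g p)) >= 0" using det_gram_pos[OF g_inner[of p]] by simp
 hence "(rho K (cmap K p))^2 = (det (matrix (from_chart A K p)))^2 * det (gram (g p))"
  unfolding rho_point[OF k(1) p(2)] by (simp add: power_mult_distrib)
 thus ?thesis
  using det_gram_chart[where h="gt t", OF gt_bilinear k(1) p(2)] d unfolding gt_patch G2_def by simp
qed

lemma G2_nonneg: "G2 (t, p) >= 0"
proof -
 have gp: "inner_form (gb (\<Phi> (t, p)))" by (rule RB.metric_inner_form)
 let ?L = "mdiff A B D (%p. \<Phi> (t, p)) p"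
 have "det (gram (gt t p)) >= 0"
 proof (cases "inj ?L")
  case True
  hence "?L u ~= 0" if "u ~= 0" for u
   using linear_injective_0[OF mdiff_slice_linear[OF patch t p]] that by blast
  hence "inner_form (gt t p)"
   using gt_bilinear inner_formD(2,3)[OF gp] by (simp add: inner_form_def gt_def pullback_metric_def)
  from det_gram_pos[OF this] show ?thesis by simp
 next
  case False
  \<comment> \<open>A slice that is not immersive at \<open>p\<close> has a singular Gram matrix, so
    the ratio vanishes there.\<close>
  then obtain u where u: "u ~= 0" "?L u = 0" using linear_injective_0[OF mdiff_slice_linear[OF patch t p]] by blast
  have "linear (%w. gb (\<Phi> (t, p)) z w)" for z using inner_formD(1)[OF gp] by (simp add: bilinear_def)
  hence "gt t p v u = 0" for v using u(2) by (simp add: gt_def pullback_metric_def linear_0)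
  moreover have "gt t p v u = (SUM j:UNIV. gt t p v (ax j) * u $ j)" for v
  proof -
   have l: "linear (gt t p v)" using gt_bilinear by (simp add: bilinear_def)
   have "gt t p v u = gt t p v (SUM j:UNIV. u $ j *\<^sub>R ax j)" using vec_axis_expansion[of u] by simp
   thus ?thesis by (simp add: linear_sum[OF l] linear_scale[OF l] mult.commute)
  qed
  ultimately have "gram (gt t p) *v u = 0"
   by (simp add: matrix_vector_mult_def vec_eq_iff)
  with u(1) have "det (gram (gt t p)) = 0"
   using invertible_det_nz invertible_left_inverse matrix_left_invertible_ker by blast
  thus ?thesis by simp
 qed
 thus ?thesis using det_gram_pos[OF g_inner[of p]] by (simp add: G2_def)
qed

lemma velocity_patch_eq: "velocity t p = from_chart B K' (\<Phi> (t, p)) (FD f (t, cmap K p) (1, 0))"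
 unfolding velocity_def by (rule vector_derivative_at[OF velocity_patch[OF patch t p]])

end

lemma interior_patch:
 assumes "abs t < ep" "p : iD" "K : A" "p : cdom K"
 obtains r f where "patch t p K (chart_at B (\<Phi> (t, p))) r f" "t : ball t r" "cmap K p : ball (cmap K p) r"
proof -
 have "p : D" using assms(2) interior_subset by auto
 from patch_exists[OF assms(1) this assms(3,4) B.chart_at(1) B.chart_at(2)]
 obtain r f where r: "patch t p K (chart_at B (\<Phi> (t, p))) r f" by blast
 show ?thesis by (rule that[OF r]) (use patchD(3)[OF r] in auto)
qed

text \<open>Patches exist around every point of \<open>D\<close>. A formula in terms of the
  representative \<open>f\<close> that is smooth and valid on each patch therefore gives smoothness
  up to the boundary.\<close>

lemma patch_smooth_scalar:
 assumes "!!t0 p0 K K' r f. patch t0 p0 K K' r f ==>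
  Cinf (h K K' f) (bx t0 r K p0) &
  (ALL t:ball t0 r. ALL p:iD Int cdom K. cmap K p : ball (cmap K p0) r --> s (t, p) = h K K' f (t, cmap K p))"
 shows "smooth_scalar ep s"
 unfolding smooth_scalar_def
proof (intro allI impI)
 fix t0 p0 assume tp: "abs t0 < ep" "p0 : D"
 let ?k = "chart_at A p0" and ?k' = "chart_at B (\<Phi> (t0, p0))"
 obtain r f where pt: "patch t0 p0 ?k ?k' r f"
  using patch_exists[OF tp A.chart_at(1) A.chart_at(2) B.chart_at(1) B.chart_at(2)] by blast
 show "EX K:A. EX r>0. EX f. p0 : cdom K & Cinf f (bx t0 r K p0) &
   (ALL t:ball t0 r. ALL p:iD Int cdom K. cmap K p : ball (cmap K p0) r --> s (t, p) = f (t, cmap K p))"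
  by (rule bexI[of _ ?k], rule exI[of _ r], rule conjI[OF patchD(3)[OF pt]], rule exI[of _ "h ?k ?k' f"],
    rule conjI[OF patchD(4)[OF pt] assms[OF pt]]) (rule patchD(1)[OF pt])
qed

lemma rho_patch_smooth:
 assumes pt: "patch t0 p0 K K' r f"
 shows "Cinf (%z. rho K (snd z)) (bx t0 r K p0)"
  "z : bx t0 r K p0 ==> rho K (snd z) > 0"
proof -
 have im: "z : bx t0 r K p0 ==> snd z : cran K" for z using patchD(6)[OF pt] by auto
 show "Cinf (%z. rho K (snd z)) (bx t0 r K p0)"
  by (rule Cinf_compose[OF rho_smooth[OF patchD(1)[OF pt]] Cinf_linear[OF bounded_linear_snd Cinf_open[OF patchD(7)[OF pt]]] im])
 show "z : bx t0 r K p0 ==> rho K (snd z) > 0" by (rule rho_pos[OF patchD(1)[OF pt] im])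
qed

lemma G2_smooth_scalar: "smooth_scalar ep G2"
proof (rule patch_smooth_scalar[where h="%K K' f z. det (gram (%u v. Gm K' (f z)
   (FD f z (0, u)) (FD f z (0, v)))) / (rho K (snd z))^2"], rule conjI)
 fix t0 p0 K K' r f assume pt: "patch t0 p0 K K' r f"
 let ?W = "bx t0 r K p0"
 have oW: "open ?W" by (intro open_Times) auto
 note k = patchD(1,2)[OF pt] and fs = patchD(7)[OF pt]
 interpret M: local_metric "Gm K'" "cran K'" by (rule local_metric_chart[OF k(2)])
 have "Cinf (%z. Gm K' (f z) (FD f z (0, u)) (FD f z (0, v))) ?W" for u v
 proof (rule Cinf_apply_bilinear[where L="%z. Gm K' (f z)"])
  show "bilinear (Gm K' (f z))" if "z : ?W" for z by (rule M.G_bilinear[OF patchD(8)[OF pt that]])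
  show "Cinf (%z. Gm K' (f z) a b) ?W" for a b
   by (rule Cinf_compose[OF M.G_smooth fs patchD(8)[OF pt]])
 qed (rule Cinf_frechet[OF fs])+
 hence "Cinf (%z. gram (%u v. Gm K' (f z) (FD f z (0, u)) (FD f z (0, v))) $ i $ j) ?W" for i j
  by simp
 from Cinf_det[OF oW this]
 show "Cinf (%z. det (gram (%u v. Gm K' (f z) (FD f z (0, u)) (FD f z (0, v)))) / (rho K (snd z))^2) ?W"
 proof (rule Cinf_divide)
  show "Cinf (%z. (rho K (snd z))^2) ?W"
   unfolding power2_eq_square by (rule Cinf_mult[OF rho_patch_smooth(1)[OF pt] rho_patch_smooth(1)[OF pt]])
  show "(rho K (snd z))^2 ~= 0" if "z : ?W" for z using rho_patch_smooth(2)[OF pt that] by simp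
 qed
 show "ALL t:ball t0 r. ALL p:iD Int cdom K. cmap K p : ball (cmap K p0) r --> G2 (t, p) =
   det (gram (%u v. Gm K' (f (t, cmap K p)) (FD f (t, cmap K p) (0, u)) (FD f (t, cmap K p) (0, v)))) / (rho K (snd (t, cmap K p)))^2"
  using G2_patch[OF pt] by simp
qed

lemma mdiff_slice_0:
 assumes p: "p : iD"
 shows "mdiff A B D (%p. \<Phi> (0, p)) p v = dph p v"
proof -
 let ?k = "chart_at A p" and ?k' = "chart_at B (\<phi> p)"
 have pD: "p : D" using p interior_subset by auto
 have k: "?k : A" "?k' : B" "p : cdom ?k" "\<phi> p : cdom ?k'" by (simp_all add: A.chart_at B.chart_at)
 have y: "cmap ?k p : rdom ?k ?k'" using k by auto
 have o: "open (cmap ?k ` (interior D Int cdom ?k))"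
  by (intro chart_open_image[OF A.is_chart[OF k(1)]] open_Int A.chartD(1) k) auto
 have "HD (rep ?k ?k' (%p. \<Phi> (0, p))) (FD (F ?k ?k') (cmap ?k p)) (cmap ?k p)"
 proof (rule has_derivative_cong_open[OF Cinf_deriv[OF F_smooth[OF k(1,2)] y] o])
  fix z assume "z : cmap ?k ` (interior D Int cdom ?k)"
  then obtain q where q: "q : iD" "q : cdom ?k" "z = cmap ?k q" by auto
  hence "q : D" using interior_subset by auto
  thus "F ?k ?k' z = rep ?k ?k' (%p. \<Phi> (0, p)) z" using A.chartD(3)[OF k(1) q(2)] q(3) Phi_0 by simp
 qed (use p k in auto)
 from mdiff_chart(2)[where \<phi>="%p. \<Phi> (0, p)", OF k(1,2,3) _ p slice_continuous this, of v] k(4)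
 show ?thesis unfolding mdiff_phi(2)[OF k, of v] using eps_pos Phi_0[OF pD] by simp
qed

lemma G2_0: "p : iD ==> G2 (0, p) = 1"
proof -
 assume p: "p : iD"
 have pD: "p : D" using p interior_subset by auto
 have "gt 0 p u v = g p u v" for u v
  unfolding gt_def pullback_metric_def mdiff_slice_0[OF p] Phi_0[OF pD] ..
 thus ?thesis using det_gram_pos[OF g_inner[of p]] by (simp add: G2_def)
qed

lemma area_eq:
 assumes t: "abs t < ep"
 shows "area_D A B gb D \<Phi> t = (LINT p|mu. ind iD p * sqrt (G2 (t, p)))"
 unfolding area_D_def volume_measure_def gt_def[symmetric]
proof (rule density_mu_eq)
 have "(%p. sqrt (ind iD p * G2 (t, p))) : bm"
  by (intro measurable_compose[OF smooth_scalar_slice[OF G2_smooth_scalar t]]) simp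
 moreover have "sqrt (ind iD p * G2 (t, p)) = ind iD p * sqrt (G2 (t, p))" for p
  by (simp add: indicator_def)
 ultimately show "(%p. ind iD p * sqrt (G2 (t, p))) : bm" by simp
next
 fix p assume p: "p : iD"
 obtain r f where "patch t p (chart_at A p) (chart_at B (\<Phi> (t, p))) r f" "t : ball t r" "cmap (chart_at A p) p : ball (cmap (chart_at A p) p) r"
  by (rule interior_patch[OF t p A.chart_at(1) A.chart_at(2)])
 from G2_nonneg[OF this(1,2) p A.chart_at(2) this(3)] show "sqrt (G2 (t, p)) >= 0" by simp
next
 fix K p assume k: "K : A" and p: "p : iD" "p : cdom K"
 obtain r f where pt: "patch t p K (chart_at B (\<Phi> (t, p))) r f" "t : ball t r" "cmap K p : ball (cmap K p) r"
  by (rule interior_patch[OF t p(1) k p(2)])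
 have d: "det (matrix (from_chart A K p)) > 0" by (rule det_from_chart_pos[OF k p(2)])
 have gp: "det (gram (g p)) > 0" by (rule det_gram_pos[OF g_inner])
 show "sqrt (det (\<chi> i j. metric_in_chart A (gt t) K (cmap K p) (ax i) (ax j))) = sqrt (G2 (t, p)) * rho K (cmap K p)"
  unfolding det_gram_chart[where h="gt t", OF gt_bilinear[OF pt(1,2) p pt(3)] k p(2)] rho_point[OF k p(2)] G2_def
  using d gp by (simp add: real_sqrt_mult real_sqrt_divide)
qed

text \<open>The root is not Lipschitz near 0, but only the comparison with the value 1 at
  \<open>t = 0\<close> matters, and \<open>|sqrt x - 1| <= |x - 1|\<close>. The Lipschitz bound for
  \<open>G2\<close> thus dominates the difference quotients of the volume ratio.\<close>

lemma area_has_derivative: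
 "HR (area_D A B gb D \<Phi>) (LINT p|mu. ind iD p * (deriv (%t. G2 (t, p)) 0 / 2)) 0"
proof -
 let ?i = "ind iD :: 'a => real"
 define a where "a = ep / 2"
 have a: "0 < a" "a < ep" using eps_pos by (simp_all add: a_def)
 obtain C where C: "C >= 0" "!!t t' p. abs t <= a ==> abs t' <= a ==> p : iD ==> abs (G2 (t, p) - G2 (t', p)) <= C * abs (t - t')"
  using smooth_scalar_bounds[OF G2_smooth_scalar a(2)] by metis
 have nn: "G2 (t, p) >= 0" if t: "abs t < ep" and p: "p : iD" for t p
 proof -
  obtain r f where "patch t p (chart_at A p) (chart_at B (\<Phi> (t, p))) r f" "t : ball t r" "cmap (chart_at A p) p : ball (cmap (chart_at A p) p) r"
   by (rule interior_patch[OF t p A.chart_at(1) A.chart_at(2)])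
  from G2_nonneg[OF this(1,2) p A.chart_at(2) this(3)] show ?thesis .
 qed
 have s0: "(%t. sqrt (G2 (t, p))) 0 = 1" if "p : iD" for p using G2_0[OF that] by simp
 have sq: "abs (sqrt x - 1) <= abs (x - 1)" if "x >= 0" for x :: real
 proof -
  have "abs (x - 1) = abs (sqrt x - 1) * (sqrt x + 1)"
  proof -
   have "x - 1 = (sqrt x - 1) * (sqrt x + 1)" using that by (simp add: algebra_simps)
   thus ?thesis using that by (simp add: abs_mult)
  qed
  moreover have "abs (sqrt x - 1) * 1 <= abs (sqrt x - 1) * (sqrt x + 1)" using that by (intro mult_left_mono) auto
  ultimately show ?thesis by simp
 qed
 have "HR (%t. \<integral>p. ?i p * (%z. sqrt (G2 z)) (t, p) \<partial>mu) (LINT p|mu. ?i p * (deriv (%t. G2 (t, p)) 0 / 2)) 0"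
 proof (rule has_derivative_parameter_integral[where C="C + 1", OF _ _ a(1)])
  fix t :: real assume t: "abs t < a"
  have "(%p. sqrt (?i p * G2 (t, p))) : bm"
   by (intro measurable_compose[OF smooth_scalar_slice[OF G2_smooth_scalar]]) (use t a in auto)
  moreover have "sqrt (?i p * G2 (t, p)) = ?i p * sqrt (G2 (t, p))" for p
   by (simp add: indicator_def)
  ultimately show "(%p. ?i p * sqrt (G2 (t, p))) : bm" by simp
 next
  show "(%p. ?i p * (deriv (%t. G2 (t, p)) 0 / 2)) : bm"
   using borel_measurable_divide[OF smooth_scalar_slice_deriv[OF G2_smooth_scalar, of 0] borel_measurable_const[of 2]] eps_pos by simp
 next
  show "abs (sqrt (G2 (0, p))) <= C + 1" if "p : iD" for p using G2_0[OF that] C(1) by simp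
 next
  fix t p assume t: "abs t < a" and p: "p : iD"
  have "abs (sqrt (G2 (t, p)) - sqrt (G2 (0, p))) <= abs (G2 (t, p) - 1)"
   using sq[OF nn[OF _ p, of t]] G2_0[OF p] t a by simp
  also have "... <= C * abs t" using C(2)[of t 0 p] t a p G2_0[OF p] by simp
  also have "... <= (C + 1) * abs t" by (intro mult_right_mono) auto
  finally show "abs (sqrt (G2 (t, p)) - sqrt (G2 (0, p))) <= (C + 1) * abs t" .
 next
  fix p assume p: "p : iD"
  have "HR (%t. G2 (t, p)) (deriv (%t. G2 (t, p)) 0) 0"
   using smooth_scalar_has_deriv[OF G2_smooth_scalar _ p, of 0] eps_pos by simp
  from DERIV_chain2[OF DERIV_real_sqrt this] G2_0[OF p]
  show "HR (%t. sqrt (G2 (t, p))) (deriv (%t. G2 (t, p)) 0 / 2) 0" by simp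
 qed
 thus ?thesis
 proof (rule has_field_derivative_transform_within_open[where S="Iv ep"])
  show "(LINT p|mu. ?i p * sqrt (G2 (t, p))) = area_D A B gb D \<Phi> t" if "t : Iv ep" for t
   using area_eq[of t] that by (auto simp: abs_less_iff)
 qed (use eps_pos in auto)
qed

end

section \<open>Swept volume of a variation\<close>

definition form_in_chart ::
 "('b, 'v::euclidean_space) chart set => ('b, 'v, 'k) form => ('b, 'v) chart => 'v => ('k => 'v) => real" where
 "form_in_chart B \<Omega> K x u = \<Omega> (cinv K x) (%i. from_chart B K (cinv K x) (u i))"

lemma (in atlas) form_in_chart_linear:
 assumes "smooth_form A \<Omega>" "K : A" "x : cran K"
 shows "linear (%v. form_in_chart A \<Omega> K x (u(i := v)))"
proof -
 have c: "cinv K x : cdom K" by (rule chartD(5)[OF assms(2,3)])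
 have e: "(%j. from_chart A K (cinv K x) ((u(i := v)) j)) = (%j. from_chart A K (cinv K x) (u j))(i := from_chart A K (cinv K x) v)" for v
  by auto
 have "linear (%v. \<Omega> (cinv K x) ((%j. from_chart A K (cinv K x) (u j))(i := v)))"
  using assms(1) unfolding smooth_form_def alternating_multilinear_def by blast
 from linear_compose[OF from_chart_linear[OF assms(2) c] this]
 show ?thesis unfolding form_in_chart_def e by (simp add: o_def)
qed

lemma (in atlas) form_in_chart_smooth:
 assumes "smooth_form A \<Omega>" "K : A"
 shows "Cinf (%x. form_in_chart A \<Omega> K x u) (cran K)"
proof -
 have "smooth_on (%x. form_in_chart A \<Omega> K x u) (cran K)"
  using assms unfolding smooth_form_def form_in_chart_def by blast
 with chartD(2)[OF assms(2)] show ?thesis by (rule smooth_on_open_iff[THEN iffD1])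
qed

lemma (in atlas) pullback_coefficient_smooth:
 assumes \<Omega>: "smooth_form A \<Omega>" and k: "K : A" and f: "Cinf f U" "!!z. z : U ==> f z : cran K"
  and X: "Cinf X U" "!!i. Cinf (Y i) U"
 shows "Cinf (%z. form_in_chart A \<Omega> K (f z) (case_option (X z) (%i. Y i z))) U"
proof -
 have "Cinf (%z. form_in_chart A \<Omega> K (f z) (%i. (case i of None => X | Some i => Y i) z)) U"
 proof (rule Cinf_multilinear[OF form_in_chart_linear[OF \<Omega> k] form_in_chart_smooth[OF \<Omega> k] f])
  show "Cinf (case i of None => X | Some i => Y i) U" for i using X by (cases i) simp_all
 qed
 moreover have "(%i. (case i of None => X | Some i => Y i) z) = case_option (X z) (%i. Y i z)" for z
  by (intro ext) (simp split: option.split)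
 ultimately show ?thesis by simp
qed

locale form_vari = vari A B gb \<phi> D ep \<Phi>
 for A :: "('a::{t2_space, second_countable_topology}, real^'m) chart set"
  and B :: "('b::{t2_space, second_countable_topology}, 'v::euclidean_space) chart set" and gb \<phi> D ep \<Phi> +
 fixes \<Omega> :: "('b, 'v, 'm option) form"
 assumes form: "smooth_form B \<Omega>"
begin

lemma alternating: "alternating_multilinear (\<Omega> x)"
 using form by (simp add: smooth_form_def)

text \<open>Coefficient of the pulled-back form relative to \<open>dt\<close> times the original
  volume element. The velocity fills the slot \<open>None\<close>; dividing by the root of the Gram
  determinant makes the quotient a function on the product, independent of charts.\<close>

definition th :: "real \<times> 'a => real" where
 "th z = \<Omega> (\<Phi> z) (case_option (velocity (fst z) (snd z)) (%i. mdiff A B D (%p. \<Phi> (fst z, p)) (snd z) (ax i)))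
   / sqrt (det (gram (g (snd z))))"

abbreviation om :: "(real \<times> 'a, real^('m option), 'm option) form" where
 "om \<equiv> pullback_form (prod_atlas A) B (Iv ep \<times> D) \<Phi> \<Omega>"

abbreviation \<Omega>c :: "('b, 'v) chart => 'v => ('m option => 'v) => real" where
 "\<Omega>c \<equiv> form_in_chart B \<Omega>"

context
 fixes t0 p0 K K' r f t p
 assumes patch: "patch t0 p0 K K' r f" and t: "t : ball t0 r" and p: "p : iD" "p : cdom K" "cmap K p : ball (cmap K p0) r"
begin

lemma form_patch:
 "th (t, p) * rho K (cmap K p) = \<Omega>c K' (f (t, cmap K p)) (case_option (FD f (t, cmap K p) (1, 0))
   (%i. FD f (t, cmap K p) (0, ax i)))" (is "_ = ?R")
proof -
 note k = patchD(1,2)[OF patch] and pp = patch_point[OF patch t p]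
 let ?w = "velocity t p" and ?L = "mdiff A B D (%p. \<Phi> (t, p)) p"
 define et where "et u = \<Omega> (\<Phi> (t, p)) (case_option ?w (%i. ?L (u i)))" for u :: "'m => real^'m"
 have et: "alternating_multilinear et" unfolding et_def[abs_def]
  by (rule alternating_multilinear_case_option[OF alternating mdiff_slice_linear[OF patch t p]])
 have gp: "sqrt (det (gram (g p))) > 0" using det_gram_pos[OF g_inner[of p]] by simp
 have "th (t, p) * rho K (cmap K p) = det (matrix (from_chart A K p)) * et (%i. ax i)"
  unfolding rho_point[OF k(1) p(2)] th_def fst_conv snd_conv et_def using gp by simp
 also have "... = et (%i. from_chart A K p (ax i))"
  by (rule alternating_multilinear_linear_axis[OF et, symmetric])
 also have "... = ?R"
 proof -
  have "?L (from_chart A K p (ax i)) = from_chart B K' (\<Phi> (t, p)) (FD f (t, cmap K p) (0, ax i))" for i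
   unfolding mdiff_slice(2)[OF patch t p] A.to_from_chart[OF k(1) p(2)] ..
  hence "case_option ?w (%i. ?L (from_chart A K p (ax i))) =
   (%i. from_chart B K' (\<Phi> (t, p)) (case i of None => FD f (t, cmap K p) (1, 0)
     | Some i => FD f (t, cmap K p) (0, ax i)))"
   by (intro ext) (simp add: velocity_patch_eq[OF patch t p] split: option.split)
  thus ?thesis unfolding et_def form_in_chart_def pp(6) by simp
 qed
 finally show ?thesis .
qed

lemma form_coeff_patch:
 "form_coeff (prod_atlas A) om (prod_chart K) (pack (t, cmap K p)) = th (t, p) * rho K (cmap K p)"
proof -
 note k = patchD(1,2)[OF patch] and pp = patch_point[OF patch t p]
 have ci: "cinv (prod_chart K) (pack (t, cmap K p)) = (t, p)"
  using cinv_prod_chart[OF A.is_chart[OF k(1)], of "cmap K p" t] p(2) A.chartD(3)[OF k(1) p(2)] by simp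
 have "case_option (FD f (t, cmap K p) (1, 0)) (%i. FD f (t, cmap K p) (0, ax i))
  = (%i. FD f (t, cmap K p) (unpack (ax i)))"
  by (intro ext) (simp split: option.split)
 thus ?thesis
  unfolding form_patch form_coeff_def ci pullback_form_def mdiff_product[OF patch t p] form_in_chart_def pp(6) by simp
qed

end

lemma theta_smooth_scalar: "smooth_scalar ep th"
proof (rule patch_smooth_scalar[where h="%K K' f z. \<Omega>c K' (f z) (case_option (FD f z (1, 0))
   (%i. FD f z (0, ax i))) / rho K (snd z)"], rule conjI)
 fix t0 p0 K K' r f assume pt: "patch t0 p0 K K' r f"
 let ?W = "bx t0 r K p0"
 note k = patchD(1,2)[OF pt] and fs = patchD(7)[OF pt]
 have *: "Cinf (%z. \<Omega>c K' (f z) (case_option (FD f z (1, 0))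
   (%i. FD f z (0, ax i)))) ?W"
  by (rule B.pullback_coefficient_smooth[OF form k(2) fs patchD(8)[OF pt]]) (assumption | rule Cinf_frechet[OF fs])+
 show "Cinf (%z. \<Omega>c K' (f z) (case_option (FD f z (1, 0))
   (%i. FD f z (0, ax i))) / rho K (snd z)) ?W"
 proof (rule Cinf_divide[OF * rho_patch_smooth(1)[OF pt]])
  show "rho K (snd z) ~= 0" if "z : ?W" for z using rho_patch_smooth(2)[OF pt that] by simp
 qed
 show "ALL t:ball t0 r. ALL p:iD Int cdom K. cmap K p : ball (cmap K p0) r --> th (t, p) =
  \<Omega>c K' (f (t, cmap K p)) (case_option (FD f (t, cmap K p) (1, 0))
   (%i. FD f (t, cmap K p) (0, ax i))) / rho K (snd (t, cmap K p))"
 proof (intro ballI impI)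
  fix t p assume t: "t : ball t0 r" and p: "p : iD Int cdom K" "cmap K p : ball (cmap K p0) r"
  hence p': "p : iD" "p : cdom K" by auto
  have "rho K (cmap K p) > 0" using rho_pos[OF k(1), of "cmap K p"] p'(2) by simp
  thus "th (t, p) = \<Omega>c K' (f (t, cmap K p)) (case_option (FD f (t, cmap K p) (1, 0))
   (%i. FD f (t, cmap K p) (0, ax i))) / rho K (snd (t, cmap K p))"
   using form_patch[OF pt t p' p(2)] by (simp add: field_simps)
 qed
qed

definition Ith :: "real => real" where "Ith t = (LINT p|mu. ind iD p * th (t, p))"

lemma theta_integrable:
 assumes t: "abs t < ep"
 shows "integrable mu (%p. ind iD p * th (t, p))"
proof -
 obtain C where C: "C >= 0" "!!s p. abs s <= abs t ==> p : iD ==> abs (th (s, p)) <= C"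
  using smooth_scalar_bounds[OF theta_smooth_scalar t] by metis
 show ?thesis
 proof (rule mu.integrable_const_bound[where B=C])
  show "AE p in mu. norm (ind iD p * th (t, p)) <= C"
   using C by (intro AE_I2) (auto simp: indicator_def)
  show "(%p. ind iD p * th (t, p)) : borel_measurable mu"
   using smooth_scalar_slice[OF theta_smooth_scalar t] by (simp cong: measurable_cong_sets)
 qed
qed

lemma I_theta_continuous:
 assumes a: "a < ep"
 shows "continuous_on {-a..a} Ith"
proof -
 obtain C where C: "C >= 0" "!!t t' p. abs t <= a ==> abs t' <= a ==> p : iD ==> abs (th (t, p) - th (t', p)) <= C * abs (t - t')"
  using smooth_scalar_bounds[OF theta_smooth_scalar a] by metis
 let ?M = "C * measure mu UNIV"
 have "dist (Ith t) (Ith t') <= ?M * dist t t'" if t: "t : {-a..a}" and t': "t' : {-a..a}" for t t'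
 proof -
  have b: "abs t < ep" "abs t' < ep" using t t' a by auto
  let ?d = "%p. ind iD p * th (t, p) - ind iD p * th (t', p)"
  have i: "integrable mu ?d" by (intro Bochner_Integration.integrable_diff theta_integrable b)
  have "Ith t - Ith t' = (LINT p|mu. ?d p)"
   unfolding Ith_def by (rule Bochner_Integration.integral_diff[symmetric]) (rule theta_integrable b)+
  hence "norm (Ith t - Ith t') <= (LINT p|mu. norm (?d p))" using integral_norm_bound[of mu ?d] by simp
  also have "... <= (LINT p|mu. C * abs (t - t'))"
  proof (rule integral_mono)
   show "norm (?d p) <= C * abs (t - t')" for p
    using C(2)[of t t' p] C(1) t t' by (auto simp: indicator_def)
  qed (use i in auto)
  finally have "norm (Ith t - Ith t') <= (LINT p|mu. C * abs (t - t'))" .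
  thus ?thesis by (simp add: dist_real_def mult_ac)
 qed
 thus ?thesis
  by (intro lipschitz_on_continuous_on[of ?M]) (auto simp: lipschitz_on_def C(1) intro!: mult_nonneg_nonneg)
qed

text \<open>The positive and the negative part of the coefficient are handled together as densities
  \<open>max 0 (s * th)\<close> with \<open>s = 1\<close> and \<open>s = -1\<close> relative to the
  product of \<open>lborel\<close> and \<open>mu\<close>. Their difference is integrated by Fubini,
  which leaves the time integral of the flux \<open>Ith\<close>.\<close>

lemma form_integral_eq:
 assumes ab: "-ep < a" "b < ep"
 shows "form_integral (prod_atlas A) ({a..b} \<times> D) om = integral {a..b} Ith"
proof (cases "a <= b")
 case False
 hence 0: "{a..b} \<times> D = {}" by auto
 show ?thesis using False by (simp only: form_integral_def 0) simp
next
 case le: True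
 let ?i = "ind ({a..b} \<times> iD) :: real \<times> 'a => real"
 define c where "c = max (abs a) (abs b)"
 have c: "c < ep" "{a..b} <= {-c..c}" using ab le by (auto simp: c_def)
 obtain C where C: "C >= 0" "!!t p. abs t <= c ==> p : iD ==> abs (th (t, p)) <= C"
  using smooth_scalar_bounds[OF theta_smooth_scalar c(1)] by metis
 have m: "(%z. ?i z * th z) : bm"
 proof -
  have "{a..b} \<times> iD : sets (borel \<Otimes>\<^sub>M borel)" by (intro pair_measureI) auto
  hence "?i : bm" unfolding borel_prod by (rule borel_measurable_indicator)
  from borel_measurable_times[OF this smooth_scalar_measurable[OF theta_smooth_scalar]]
  have "(%z. ?i z * (ind (Iv ep \<times> iD) z * th z)) : bm" .
  moreover have "?i z * (ind (Iv ep \<times> iD) z * th z) = ?i z * th z" for z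
   using ab by (cases z) (auto simp: indicator_def)
  ultimately show ?thesis by simp
 qed
 interpret P: pair_sigma_finite lborel mu by unfold_locales
 let ?M = "lborel \<Otimes>\<^sub>M mu"
 have int: "integrable ?M (%z. ?i z * (h (th z)))" if h: "h : bm" "h 0 = 0" "!!x. abs (h x) <= abs x" for h :: "real => real"
 proof (rule integrableI_bounded_set[where A="{a..b} \<times> UNIV" and B=C])
  have "{a..b} \<times> UNIV : sets (lborel \<Otimes>\<^sub>M mu)" by (intro pair_measureI) auto
  thus "{a..b} \<times> UNIV : sets ?M" .
  have "(%z. h (?i z * th z)) : borel_measurable ?M"
   using measurable_compose[OF m h(1)] unfolding measurable_cong_sets[OF sets_pair_mu refl] .
  moreover have "h (?i z * th z) = ?i z * h (th z)" for z using h(2) by (simp add: indicator_def)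
  ultimately show "(%z. ?i z * h (th z)) : borel_measurable ?M" by simp
  have "emeasure ?M ({a..b} \<times> UNIV) = emeasure lborel {a..b} * emeasure mu UNIV"
   by (rule mu.emeasure_pair_measure_Times) auto
  also have "... < \<infinity>" using mu_finite by (simp add: ennreal_mult_less_top le)
  finally show "emeasure ?M ({a..b} \<times> UNIV) < \<infinity>" .
  show "AE z in ?M. z : {a..b} \<times> UNIV --> norm (?i z * h (th z)) <= C"
  proof (intro AE_I2 impI)
   fix z
   have "abs (h (th z)) <= C" if "z : {a..b} \<times> iD"
    using order_trans[OF h(3) C(2)[of "fst z" "snd z", simplified]] that c(2) by (auto simp: subset_iff abs_le_iff)
   thus "norm (?i z * h (th z)) <= C" using C(1) by (auto simp: indicator_def)
  qed
  show "AE z in ?M. z ~: {a..b} \<times> UNIV --> ?i z * h (th z) = 0" by (intro AE_I2) (auto simp: indicator_def)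
 qed
 have part: "measure (density_measure (prod_atlas A) ({a..b} \<times> D) (%K y. max 0 (s * form_coeff (prod_atlas A) om K y))) ({a..b} \<times> D)
  = (LINT z|?M. ?i z * max 0 (s * th z))" for s :: real
 proof (rule density_prod_eq)
  have "(%z. max 0 (s * (?i z * th z))) : bm" using m by measurable
  moreover have "max 0 (s * (?i z * th z)) = ?i z * max 0 (s * th z)" for z by (simp add: indicator_def)
  ultimately show "(%z. ?i z * max 0 (s * th z)) : bm" by simp
 next
  fix K t p assume k: "K : A" and t: "t : {a..b}" and p: "p : iD" "p : cdom K"
  have t': "abs t < ep" using t ab by auto
  obtain r f where pt: "patch t p K (chart_at B (\<Phi> (t, p))) r f" "t : ball t r" "cmap K p : ball (cmap K p) r"
   by (rule interior_patch[OF t' p(1) k p(2)])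
  have r: "rho K (cmap K p) > 0" using rho_pos[OF k, of "cmap K p"] p(2) by simp
  show "max 0 (s * form_coeff (prod_atlas A) om (prod_chart K) (pack (t, cmap K p))) = max 0 (s * th (t, p)) * rho K (cmap K p)"
   unfolding form_coeff_patch[OF pt(1,2) p pt(3)] using r
   by (auto simp: max_def mult_le_0_iff zero_le_mult_iff mult.assoc[symmetric])
 qed simp
 have "form_integral (prod_atlas A) ({a..b} \<times> D) om = (LINT z|?M. ?i z * max 0 (th z)) - (LINT z|?M. ?i z * max 0 (- th z))"
  unfolding form_integral_def using part[of 1] part[of "-1"] by simp
 also have "... = (LINT z|?M. ?i z * max 0 (th z) - ?i z * max 0 (- th z))"
  by (rule Bochner_Integration.integral_diff[symmetric]) (rule int; auto)+
 also have "... = (LINT z|?M. (%(t, p). ?i (t, p) * th (t, p)) z)"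
  by (intro Bochner_Integration.integral_cong) (auto simp: max_def indicator_def)
 also have "... = (\<integral>t. \<integral>p. ?i (t, p) * th (t, p) \<partial>mu \<partial>lborel)"
  by (rule P.integral_fst[symmetric]) (insert int[of "%x. x"], simp add: case_prod_unfold)
 also have "... = (LINT t|lborel. ind {a..b} t *\<^sub>R Ith t)"
  by (intro Bochner_Integration.integral_cong) (auto simp: Ith_def indicator_def)
 also have "... = integral {a..b} Ith"
 proof -
  have "continuous_on {a..b} Ith" by (rule continuous_on_subset[OF I_theta_continuous[OF c(1)] c(2)])
  from set_borel_integral_eq_integral(2)[OF borel_integrable_atLeastAtMost'[OF this]]
  show ?thesis by (simp add: set_lebesgue_integral_def)
 qed
 finally show ?thesis .
qed

lemma volume_eq:
 assumes t: "abs t < ep"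
 shows "volume_D A B \<Omega> D ep \<Phi> t = (if 0 <= t then integral {0..t} Ith else - integral {t..0} Ith)"
 unfolding volume_D_def Let_def using form_integral_eq[of 0 t] form_integral_eq[of t 0] t eps_pos by (auto simp: abs_less_iff)

lemma volume_has_derivative: "HR (volume_D A B \<Omega> D ep \<Phi>) (Ith 0) 0"
proof -
 define a where "a = ep / 2"
 have a: "0 < a" "a < ep" using eps_pos by (simp_all add: a_def)
 let ?J = "%t. integral {-a..t} Ith"
 have "(?J has_real_derivative Ith 0) (at 0 within {-a..a})"
  by (rule integral_has_real_derivative[OF I_theta_continuous[OF a(2)]]) (use a in simp)
 moreover have "at 0 within {-a..a} = at 0" by (rule at_within_interior) (use a in simp)
 ultimately have "HR ?J (Ith 0) 0" by simp
 hence "HR (%t. ?J t - ?J 0) (Ith 0) 0" by (auto intro!: derivative_eq_intros)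
 thus ?thesis
 proof (rule has_field_derivative_transform_within_open[where S="{-a<..<a}"])
  fix t assume t: "t : {-a<..<a}"
  have int: "Ith integrable_on {c..d}" if "-a <= c" "d <= a" for c d
   by (intro integrable_continuous_real continuous_on_subset[OF I_theta_continuous[OF a(2)]]) (use that in auto)
  show "?J t - ?J 0 = volume_D A B \<Omega> D ep \<Phi> t"
  proof (cases "0 <= t")
   case True
   have "?J 0 + integral {0..t} Ith = ?J t"
    by (rule Henstock_Kurzweil_Integration.integral_combine) (use True t a int in auto)
   thus ?thesis using volume_eq[of t] True t a by simp
  next
   case False
   have "?J t + integral {t..0} Ith = ?J 0"
    by (rule Henstock_Kurzweil_Integration.integral_combine) (use False t a int in auto)
   thus ?thesis using volume_eq[of t] False t a by simp
  qed
 qed (use a in auto)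
qed

lemma volume_eq_0:
 assumes "!!s. abs s < ep ==> Ith s = 0" "abs t < ep"
 shows "volume_D A B \<Omega> D ep \<Phi> t = 0"
proof -
 have "integral {0..t} Ith = integral {0..t} (%_. 0)" "integral {t..0} Ith = integral {t..0} (%_. 0)"
  by (intro Henstock_Kurzweil_Integration.integral_cong assms(1); use assms(2) in auto)+
 thus ?thesis using volume_eq[OF assms(2)] by simp
qed

end

text \<open>A unit vector \<open>n\<close> orthogonal to the frame can be rotated into the calibrated slot; the
 comass bound along this rotation, \<open>\<bar>cos a + om(n, ...) sin a\<bar> <= 1\<close>, forces \<open>om(n, ...) = 0\<close>.\<close>

lemma calibrated_slot:
 fixes b :: "'v::euclidean_space => 'v => real" and om :: "('m::finite option => 'v) => real"
 assumes b: "inner_form b" and om: "alternating_multilinear om"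
  and on: "orthonormal_system b (case_option \<nu> u)" and 1: "om (case_option \<nu> u) = 1"
  and bound: "!!u. orthonormal_system b u ==> abs (om u) <= 1"
 shows "om (case_option w u) = b w \<nu>"
proof -
 have lin2: "linear (b x)" and lin1: "linear (%x. b x z)" for x z using inner_formD(1)[OF b] by (auto simp: bilinear_def)
 note sym = inner_formD(2)[OF b]
 define L where "L w = om (case_option w u)" for w
 have Le: "case_option w u = (case_option 0 u)(None := w)" for w by (auto split: option.split)
 have "linear (%w. om ((case_option 0 u)(None := w)))"
  using om unfolding alternating_multilinear_def by blast
 moreover have "L = (%w. om ((case_option 0 u)(None := w)))"
  by (rule ext) (simp only: L_def Le[symmetric])
 ultimately have L: "linear L" by simp
 have on': "b (case_option \<nu> u i) (case_option \<nu> u j) = (if i = j then 1 else 0)" for i j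
  using on by (simp add: orthonormal_system_def)
 have nn: "b \<nu> \<nu> = 1" and nu: "b \<nu> (u i) = 0" and un: "b (u i) \<nu> = 0" and uu: "b (u i) (u j) = (if i = j then 1 else 0)" for i j
  using on'[of None None] on'[of None "Some i"] on'[of "Some i" None] on'[of "Some i" "Some j"] by auto
 have Lu: "L (u i) = 0" for i
 proof -
  have "None ~= Some i & case_option (u i) u None = case_option (u i) u (Some i)" by simp
  thus ?thesis using om unfolding L_def alternating_multilinear_def by blast
 qed
 define z where "z = w - b w \<nu> *\<^sub>R \<nu> - (SUM i:UNIV. b w (u i) *\<^sub>R u i)"
 have zn: "b z \<nu> = 0"
  by (simp add: z_def linear_diff[OF lin1] linear_scale[OF lin1] linear_sum[OF lin1] nn un)
 have zu: "b z (u j) = 0" for j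
 proof -
  have "b (SUM i:UNIV. b w (u i) *\<^sub>R u i) (u j) = (SUM i:UNIV. if i = j then b w (u j) else 0)"
   unfolding linear_sum[OF lin1] linear_scale[OF lin1] uu by (intro sum.cong) auto
  thus ?thesis by (simp add: z_def linear_diff[OF lin1] linear_scale[OF lin1] nu)
 qed
 have Lz: "L z = 0"
 proof (cases "z = 0")
  case True thus ?thesis using linear_0[OF L] by simp
 next
  case False
  define c where "c = sqrt (b z z)"
  have c: "c > 0" "c * c = b z z" using inner_formD(3)[OF b False] by (simp_all add: c_def)
  define n where "n = (1 / c) *\<^sub>R z"
  have n: "b n n = 1" "b n \<nu> = 0" "b \<nu> n = 0" "b n (u i) = 0" "b (u i) n = 0" for i
   using c(1) c(2)[symmetric] zn zu sym[of \<nu> z] sym[of "u i" z]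
   by (simp_all add: n_def linear_scale[OF lin1] linear_scale[OF lin2] field_simps)
  define l where "l = L n"
  \<comment> \<open>\<open>s\<close> normalises \<open>\<nu> + l n\<close>, the direction in the
    plane of \<open>\<nu>\<close> and \<open>n\<close> in which the linear form is largest. Its
    value on the unit vector is \<open>sqrt (1 + l^2)\<close>, so the comass bound 1 forces
    \<open>l = 0\<close>.\<close>
  define s where "s = 1 / sqrt (1 + l^2)"
  have l1: "1 + l^2 > 0" by (simp add: add_pos_nonneg)
  hence s: "s > 0" "s * s * (1 + l^2) = 1" by (simp_all add: s_def)
  let ?m = "s *\<^sub>R \<nu> + (s * l) *\<^sub>R n"
  have "b ?m ?m = s * s * (1 + l^2)"
   by (simp add: linear_add[OF lin1] linear_add[OF lin2] linear_scale[OF lin1] linear_scale[OF lin2] nn n power2_eq_square algebra_simps)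
  hence mm: "b ?m ?m = 1" using s(2) by simp
  have mu: "b ?m (u i) = 0" "b (u i) ?m = 0" for i
   by (simp_all add: linear_add[OF lin1] linear_add[OF lin2] linear_scale[OF lin1] linear_scale[OF lin2] nu un n)
  have "orthonormal_system b (case_option ?m u)"
   unfolding orthonormal_system_def
  proof (intro allI)
   fix i j show "b (case_option ?m u i) (case_option ?m u j) = (if i = j then 1 else 0)"
    by (cases i; cases j) (simp_all only: option.case mm mu uu option.inject option.distinct if_True if_False refl simp_thms)
  qed
  from bound[OF this] have "abs (L ?m) <= 1" by (simp add: L_def)
  moreover have "L ?m = s * (1 + l^2)"
   using 1 by (simp add: linear_add[OF L] linear_scale[OF L] l_def L_def[of \<nu>] power2_eq_square algebra_simps)
  ultimately have "s * (1 + l^2) <= 1" by simp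
  hence "s * s * (1 + l^2) <= s" using s(1) mult_left_mono[of "s * (1 + l^2)" 1 s] by (simp add: mult.assoc)
  hence "1 <= s" using s(2) by simp
  hence "1 * (1 + l^2) <= s * s * (1 + l^2)" using mult_mono[of 1 s 1 s] by (intro mult_right_mono) auto
  hence "1 + l^2 <= 1" using s(2) by simp
  hence "l = 0" by simp
  moreover have "z = c *\<^sub>R n" using c by (simp add: n_def)
  ultimately show ?thesis using linear_scale[OF L, of c n] by (simp add: l_def)
 qed
 have "w = z + b w \<nu> *\<^sub>R \<nu> + (SUM i:UNIV. b w (u i) *\<^sub>R u i)" by (simp add: z_def)
 hence "L w = L (z + b w \<nu> *\<^sub>R \<nu> + (SUM i:UNIV. b w (u i) *\<^sub>R u i))" by (rule arg_cong)
 hence "L w = L z + b w \<nu> * L \<nu> + (SUM i:UNIV. b w (u i) * L (u i))"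
  by (simp only: linear_add[OF L] linear_scale[OF L] linear_sum[OF L] real_scaleR_def)
 moreover have "L \<nu> = 1" using 1 by (simp add: L_def)
 ultimately have "L w = b w \<nu>" by (simp add: Lz Lu)
 thus ?thesis by (simp add: L_def)
qed

text \<open>A segment from a point of \<open>S\<close> to a point outside crosses the frontier,
  where \<open>w\<close> vanishes; cutting \<open>w\<close> off along \<open>S\<close> therefore
  keeps its Lipschitz constant. This is what keeps boundary terms out of the divergence
  theorem.\<close>

lemma lipschitz_indicator:
 fixes w :: "'a::euclidean_space => real"
 assumes lip: "!!x y. abs (w x - w y) <= C * dist x y" and fr: "!!z. z : frontier S ==> w z = 0"
 shows "abs (ind S x * w x - ind S y * w y) <= C * dist x y"
proof -
 have C: "C >= 0"
 proof -
  obtain b :: 'a where "b : Basis" by (meson nonempty_Basis ex_in_conv)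
  thus ?thesis using lip[of b 0] by (auto simp: norm_Basis intro: order_trans[OF abs_ge_zero])
 qed
 have *: "abs (w x) <= C * dist x y" if x: "x : S" "y ~: S" for x y
 proof -
  have "closed_segment x y Int frontier S ~= {}"
   by (rule connected_Int_frontier) (use x in auto)
  then obtain z where z: "z : closed_segment x y" "z : frontier S" by auto
  have "abs (w x) <= C * dist x z" using lip[of x z] fr[OF z(2)] by simp
  also have "... <= C * dist x y"
   using dist_in_closed_segment[OF z(1)] C by (intro mult_left_mono) (auto simp: dist_commute)
  finally show ?thesis .
 qed
 have "abs (w y) <= C * dist x y" if "y : S" "x ~: S" using *[OF that] by (simp add: dist_commute)
 thus ?thesis using *[of x y] lip[of x y] C by (auto simp: indicator_def)
qed

lemma compact_support_lipschitz:
 fixes w :: "'a::euclidean_space => real"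
 assumes w: "Cinf w UNIV" and supp: "!!y. y ~: cball y0 r ==> w y = 0"
 obtains C where "!!x y. abs (w x - w y) <= C * dist x y"
proof -
 define h where "h x = (SUM b:Basis. abs (FD w x b))" for x
 have "continuous_on (cball y0 r) h" unfolding h_def
  by (intro continuous_intros continuous_on_subset[OF Cinf_continuous[OF Cinf_frechet[OF w]]]) auto
 hence "bounded (h ` cball y0 r)" by (intro compact_imp_bounded compact_continuous_image) auto
 then obtain C where C: "!!x. x : cball y0 r ==> abs (h x) <= C" unfolding bounded_iff by force
 have h: "h x <= max C 0" for x
 proof (cases "x : cball y0 r")
  case False
  have o: "open (- cball y0 r)" by (simp add: closed_def[symmetric])
  have "HD w (%_. 0) x"
   by (rule has_derivative_cong_open[OF has_derivative_const[of 0] o]) (use False supp in auto)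
  hence "FD w x = (%_. 0)" by (rule frechet_derivative_at[symmetric])
  thus ?thesis by (simp add: h_def)
 qed (use C in force)
 have "abs (w x - w y) <= max C 0 * dist x y" for x y
 proof -
  have "norm (w x - w y) <= max C 0 * norm (x - y)"
  proof (rule differentiable_bound[of UNIV w "%x. FD w x"])
   fix x :: 'a
   note d = Cinf_deriv[OF w, of x]
   show "(w has_derivative FD w x) (at x within UNIV)" using d by simp
   show "onorm (FD w x) <= max C 0"
   proof (rule onorm_bound)
    fix v
    have "FD w x v = (SUM b:Basis. (v \<bullet> b) *\<^sub>R FD w x b)"
     by (rule linear_basis_expansion[OF has_derivative_linear[OF d]]) simp
    hence "norm (FD w x v) <= (SUM b:Basis. abs ((v \<bullet> b) * FD w x b))"
     using sum_abs[of "%b. (v \<bullet> b) * FD w x b" Basis] by simp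
    also have "... <= (SUM b:Basis. norm v * abs (FD w x b))"
     by (intro sum_mono) (simp add: abs_mult mult_right_mono Basis_le_norm)
    also have "... = h x * norm v" by (simp add: h_def sum_distrib_left mult.commute)
    also have "... <= max C 0 * norm v" by (intro mult_right_mono h) simp
    finally show "norm (FD w x v) <= max C 0 * norm v" .
   qed simp
  qed auto
  thus ?thesis by (simp add: dist_norm)
 qed
 thus ?thesis by (rule that)
qed

lemma has_derivative_along:
 fixes u :: "'a::real_normed_vector => real"
 assumes d: "HD u u' x"
 shows "HR (%t. u (x + t *\<^sub>R e)) (u' e) 0"
proof -
 have "HD (%s. x + s *\<^sub>R e) (%s. s *\<^sub>R e) 0" by (auto intro!: derivative_eq_intros)
 hence "HD (%s. u (x + s *\<^sub>R e)) (%s. u' (s *\<^sub>R e)) 0"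
  using d has_derivative_compose[of "%s. x + s *\<^sub>R e" "%s. s *\<^sub>R e" 0 UNIV u u'] by simp
 moreover have "u' (s *\<^sub>R e) = u' e * s" for s using linear_scale[OF has_derivative_linear[OF d], of s e] by simp
 ultimately show ?thesis by (simp add: has_field_derivative_def)
qed

section \<open>Smooth functions and bumps on a manifold\<close>

context atlas
begin

definition sfun :: "('a => real) => bool" where
 "sfun \<psi> \<longleftrightarrow> (ALL K:A. Cinf (\<psi> o cinv K) (cran K))"

lemma sfunD: "sfun \<psi> ==> K : A ==> Cinf (%y. \<psi> (cinv K y)) (cran K)"
 unfolding sfun_def o_def by blast

lemma sfunI: "(!!K. K : A ==> Cinf (%y. \<psi> (cinv K y)) (cran K)) ==> sfun \<psi>"
 unfolding sfun_def o_def by blast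

lemma sfun_mult: "sfun \<psi> ==> sfun et ==> sfun (%p. \<psi> p * et p)"
 by (rule sfunI, rule Cinf_mult; rule sfunD)

lemma sfun_one_minus: "sfun \<psi> ==> sfun (%p. 1 - \<psi> p)"
 by (rule sfunI, rule Cinf_diff[OF Cinf_const sfunD]) (rule chartD(2))

lemma sfun_prod: "(!!i. i : I ==> sfun (\<psi> i)) ==> sfun (%p. PROD i:I. \<psi> i p)"
 by (rule sfunI, rule Cinf_prod[OF chartD(2)]) (auto intro: sfunD)

end

lemma (in atlas) chart_cball_closed:
 assumes k: "K : A" and r: "cball y0 r <= cran K" and t2: "!!S :: 'a set. compact S ==> closed S"
 shows "closed (cinv K ` cball y0 r)" "cinv K ` cball y0 r <= cdom K"
proof -
 show "closed (cinv K ` cball y0 r)"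
  by (intro t2 compact_continuous_image continuous_on_subset[OF chartD(7)[OF k] r]) simp
 show "cinv K ` cball y0 r <= cdom K" using chartD(5)[OF k] r by auto
qed

text \<open>A Euclidean bump is pulled back and extended by 0. The extension is smooth because the
  image of the closed ball is closed in the manifold; the locale carries no Hausdorff axiom, so
  closedness of compact sets appears as the hypothesis \<open>t2\<close>.\<close>

lemma (in atlas) sfun_bump:
 assumes k: "K : A" and r: "r > 0" "cball y0 r <= cran K" and t2: "!!S :: 'a set. compact S ==> closed S"
 obtains b where "sfun b" "!!q. 0 <= b q" "!!q. b q <= 1"
  "!!q. q : cdom K ==> dist (cmap K q) y0 <= r / 2 ==> b q = 1"
  "!!q. q ~: cinv K ` cball y0 r ==> b q = 0"
proof -
 obtain be :: "'e => real" where be: "Cinf be UNIV" "!!y. 0 <= be y" "!!y. be y <= 1"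
  "!!y. dist y y0 <= r / 2 ==> be y = 1" "!!y. dist y y0 >= r ==> be y = 0"
  using smooth_bump_exists[OF r(1), of y0] by metis
 define b where "b q = (if q : cdom K then be (cmap K q) else 0)" for q
 let ?Kq = "cinv K ` cball y0 r"
 note Kq = chart_cball_closed[OF k r(2) t2]
 have b0: "b q = 0" if q: "q ~: ?Kq" for q
 proof (cases "q : cdom K")
  case True
  have "cmap K q ~: cball y0 r"
  proof
   assume "cmap K q : cball y0 r"
   hence "cinv K (cmap K q) : ?Kq" by (rule imageI)
   thus False using q chartD(3)[OF k True] by simp
  qed
  thus ?thesis using be(5)[of "cmap K q"] True by (simp add: b_def dist_commute)
 qed (simp add: b_def)
 have "sfun b"
 proof (rule sfunI, rule Cinf_local[OF _ chartD(2)])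
  fix K2 y assume k2: "K2 : A" and "y : cran K2"
  then obtain q where q: "q : cdom K2" "y = cmap K2 q" by auto
  show "EX V. y : V & Cinf (%y. b (cinv K2 y)) V"
  proof (cases "q : cdom K")
   case True
   have "Cinf (%y. be ((cmap K o cinv K2) y)) (cmap K2 ` (cdom K2 Int cdom K))"
    by (rule Cinf_compose[OF be(1) transition_smooth[OF k2 k]]) simp
   hence "Cinf (%y. b (cinv K2 y)) (cmap K2 ` (cdom K2 Int cdom K))"
    by (rule Cinf_cong) (auto simp: b_def chartD(3)[OF k2])
   thus ?thesis using q True by (intro exI[of _ "cmap K2 ` (cdom K2 Int cdom K)"]) auto
  next
   case False
   have o: "open (cmap K2 ` (cdom K2 Int - ?Kq))"
    using Kq(1) by (intro chart_open_image[OF is_chart[OF k2]] open_Int chartD(1)[OF k2]) (auto simp: open_Compl)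
   have "Cinf (%y. b (cinv K2 y)) (cmap K2 ` (cdom K2 Int - ?Kq))"
    by (rule Cinf_cong[OF Cinf_const[OF o, of 0]]) (auto simp: chartD(3)[OF k2] b0)
   moreover have "q ~: ?Kq" using False Kq(2) by auto
   ultimately show ?thesis using q by (intro exI[of _ "cmap K2 ` (cdom K2 Int - ?Kq)"]) auto
  qed
 qed
 moreover have "b q = 1" if "q : cdom K" "dist (cmap K q) y0 <= r / 2" for q using that be(4) by (simp add: b_def)
 ultimately show ?thesis using that[of b] be(2,3) b0 by (simp add: b_def)
qed

section \<open>First variation of area\<close>

lemma bounded_support_integrable:
 fixes d :: "'a::euclidean_space => real"
 assumes "d : bm" "!!y. abs (d y) <= C" "!!y. y ~: cball y0 r ==> d y = 0"
 shows "integrable lborel d"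
proof (rule integrableI_bounded_set[where A="cball y0 r" and B=C])
 show "emeasure lborel (cball y0 r) < \<infinity>" using emeasure_lborel_cball_finite[of y0 r] by simp
qed (use assms in auto)

lemma (in atlas) sfun_has_derivative:
 assumes "sfun et" "K : A" "p : cdom K"
 shows "HD (%y. et (cinv K y)) (FD (%y. et (cinv K y)) (cmap K p)) (cmap K p)"
 by (rule Cinf_deriv[OF sfunD[OF assms(1,2)]]) (use assms(3) in simp)

definition (in atlas) dfun :: "('a => real) => 'a => 'e => real" where
 "dfun et p = FD (%y. et (cinv (chart_at A p) y)) (cmap (chart_at A p) p)"

lemma (in atlas) dfun_linear: "sfun et ==> linear (dfun et p)"
 unfolding dfun_def using sfun_has_derivative[OF _ chart_at(1) chart_at(2)] by (rule has_derivative_linear)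

lemma (in atlas) dfun_chart:
 assumes et: "sfun et" and k: "K : A" "p : cdom K"
 shows "FD (%y. et (cinv K y)) (cmap K p) u = dfun et p (from_chart A K p u)"
proof -
 let ?c = "chart_at A p"
 have c: "?c : A" "p : cdom ?c" by (simp_all add: chart_at)
 have y: "(cmap ?c o cinv K) (cmap K p) = cmap ?c p" using chartD(3)[OF k] by simp
 have d: "HD (%y. et (cinv ?c y)) (dfun et p) ((cmap ?c o cinv K) (cmap K p))"
  unfolding y dfun_def by (rule sfun_has_derivative[OF et c])
 have "HD (%y. et (cinv ?c ((cmap ?c o cinv K) y))) (%u. dfun et p (from_chart A K p u)) (cmap K p)"
  unfolding from_chart_def by (rule has_derivative_compose[OF transition_has_derivative[OF k(1) c(1) k(2) c(2)] d])
 moreover have "open (cmap K ` (cdom K Int cdom ?c))"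
  by (intro chart_open_image[OF is_chart[OF k(1)]] open_Int chartD(1) k(1) c(1)) simp
 ultimately have "HD (%y. et (cinv K y)) (%u. dfun et p (from_chart A K p u)) (cmap K p)"
  by (rule has_derivative_cong_open) (insert k c, auto simp: chartD(3))
 from frechet_derivative_at[OF this, symmetric] show ?thesis by simp
qed

lemma (in atlas) dfun_local_const:
 assumes O: "open O'" "p : O'" "!!q. q : O' ==> et q = c"
 shows "dfun et p u = 0"
proof -
 let ?c = "chart_at A p"
 have c: "?c : A" "p : cdom ?c" by (simp_all add: chart_at)
 have "open (cmap ?c ` (cdom ?c Int O'))"
  by (intro chart_open_image[OF is_chart[OF c(1)]] open_Int chartD(1) c(1) O(1)) simp
 hence "HD (%y. et (cinv ?c y)) (%_. 0) (cmap ?c p)"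
  by (rule has_derivative_cong_open[OF has_derivative_const[of c]])
   (insert c O(2,3), auto simp: chartD(3))
 from frechet_derivative_at[OF this, symmetric] show ?thesis by (simp add: dfun_def)
qed

section \<open>The variation field in a patch at time 0\<close>

locale bvari = vari A B gb \<phi> D ep \<Phi>
 for A :: "('a::{t2_space, second_countable_topology}, real^'m) chart set"
  and B :: "('b::{t2_space, second_countable_topology}, 'v::euclidean_space) chart set" and gb \<phi> D ep \<Phi> +
 assumes boundary: "fixes_boundary \<phi> D ep \<Phi>"
begin

abbreviation W :: "'a => 'v" where "W \<equiv> vector_variation B \<Phi>"

definition area_var :: "'a => real" where "area_var p = deriv (%t. G2 (t, p)) 0 / 2"

text \<open>Pairing of the gradient of \<open>et\<close> with the tangential part of the variation
  field, the extra term of the product rule when the field is cut off by \<open>et\<close>. It is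
  additive in \<open>et\<close>, so over a partition of unity it sums to the term of a constant,
  which is 0.\<close>

definition trace_var :: "('a => real) => 'a => real" where
 "trace_var et p = metric_trace (g p) (%u v. A.dfun et p u * gb (\<phi> p) (W p) (dph p v))"

definition patch0 :: "'a => ('a, real^'m) chart => ('b, 'v) chart => real => (real \<times> (real^'m) => 'v) => bool" where
 "patch0 p0 K K' r f \<longleftrightarrow> patch 0 p0 K K' r f & ball (cmap K p0) r <= rdom K K'"

lemma patch_shrink:
 assumes "patch t0 p0 K K' r f" "0 < r'" "r' <= r"
 shows "patch t0 p0 K K' r' f"
proof -
 have b: "ball x r' <= ball x r" for x :: "'z::metric_space" using assms(3) by auto
 have "Cinf f (ball t0 r' \<times> ball (cmap K p0) r')"
  by (rule Cinf_subset[OF patchD(7)[OF assms(1)]]) (insert b[of t0] b[of "cmap K p0"], auto intro: open_Times)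
 thus ?thesis
  using assms(1,2) b[of t0] b[of "cmap K p0"] unfolding patch_def by (auto simp del: mem_ball simp: subset_iff)
qed

lemma patch0_exists:
 assumes p0: "p0 : D"
 obtains K K' r f where "patch0 p0 K K' r f"
proof -
 let ?k = "chart_at A p0" and ?k' = "chart_at B (\<phi> p0)"
 have k: "?k : A" "?k' : B" "p0 : cdom ?k" "\<phi> p0 : cdom ?k'" by (simp_all add: A.chart_at B.chart_at)
 obtain r f where pt: "patch 0 p0 ?k ?k' r f"
  using patch_exists[OF _ p0 k(1,3,2), of 0] eps_pos Phi_0[OF p0] k(4) by auto
 have "open (rdom ?k ?k')" by (rule Cinf_open[OF F_smooth[OF k(1,2)]])
 moreover have "cmap ?k p0 : rdom ?k ?k'" using k by auto
 ultimately obtain s where s: "s > 0" "ball (cmap ?k p0) s <= rdom ?k ?k'" using open_contains_ball by blast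
 have "patch 0 p0 ?k ?k' (min r s) f" by (rule patch_shrink[OF pt]) (use s patchD(3)[OF pt] in auto)
 moreover have "ball (cmap ?k p0) (min r s) <= rdom ?k ?k'" using s(2) by auto
 ultimately show ?thesis by (intro that[of ?k ?k' "min r s" f]) (simp add: patch0_def)
qed

context
 fixes p0 K K' r f
 assumes patch0: "patch0 p0 K K' r f"
begin

lemma pt: "patch 0 p0 K K' r f" and ball_rdom: "ball (cmap K p0) r <= rdom K K'"
 using patch0 by (auto simp: patch0_def)

lemmas k = patchD(1,2)[OF pt]

definition V :: "real^'m => 'v" where "V y = FD f (0, y) (1, 0)"

lemma box: "y : ball (cmap K p0) r ==> (0, y) : ball 0 r \<times> ball (cmap K p0) r"
 using patchD(3)[OF pt] by simp

lemma V_smooth: "Cinf V (ball (cmap K p0) r)"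
 unfolding V_def
 by (rule Cinf_compose[OF Cinf_frechet[OF patchD(7)[OF pt]] Cinf_linear box])
  (auto intro!: bounded_linear_intros)

text \<open>Over a fixed boundary point the representative is constant in time. The boundary
  condition enters the divergence theorem in this form.\<close>

lemma V_frontier:
 assumes q: "q : frontier D" "q : cdom K" "cmap K q : ball (cmap K p0) r"
 shows "V (cmap K q) = 0"
proof -
 let ?y = "cmap K q"
 have qD: "q : D" using q(1) frontier_subset by auto
 have "HD (%s. (s, ?y)) (%h. (h, 0)) 0" by (auto intro!: derivative_eq_intros)
 from has_derivative_compose[OF this Cinf_deriv[OF patchD(7)[OF pt] box[OF q(3)]]]
 have "HD (%s. f (s, ?y)) (%h. FD f (0, ?y) (h, 0)) 0" .
 hence "HD (%s. cmap K' (\<phi> q)) (%h. FD f (0, ?y) (h, 0)) 0"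
 proof (rule has_derivative_cong_open[OF _ open_ball[of 0 r]])
  fix s :: real assume s: "s : ball 0 r"
  hence "s : Iv ep" using patchD(5)[OF pt] by blast
  hence "\<Phi> (s, q) = \<phi> q" using boundary q(1) unfolding fixes_boundary_def by blast
  thus "f (s, ?y) = cmap K' (\<phi> q)" using patchD(10)[OF pt s qD q(2,3)] by simp
 qed (use patchD(3)[OF pt] in simp)
 from has_derivative_unique[OF this has_derivative_const] show ?thesis by (simp add: V_def fun_eq_iff)
qed

interpretation I: local_immersion "Gm K'" "cran K'" "F K K'" "rdom K K'"
 by (rule local_immersion_chart[OF k])

context
 fixes p
 assumes p: "p : iD" "p : cdom K" "cmap K p : ball (cmap K p0) r"
begin

lemma zero_ball: "(0::real) : ball 0 r" using patchD(3)[OF pt] by simp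

lemma p_facts: "p : D" "\<phi> p : cdom K'" "cmap K p : rdom K K'" "f (0, cmap K p) = F K K' (cmap K p)"
 "F K K' (cmap K p) = cmap K' (\<phi> p)"
proof -
 note pp = patch_point[OF pt zero_ball p]
 show pD: "p : D" by (rule pp(1))
 show 1: "\<phi> p : cdom K'" using pp(4) Phi_0[OF pD] by simp
 show "cmap K p : rdom K K'" using p ball_rdom by blast
 show 2: "F K K' (cmap K p) = cmap K' (\<phi> p)" using A.chartD(3)[OF k(1) p(2)] by simp
 show "f (0, cmap K p) = F K K' (cmap K p)" using pp(5) Phi_0[OF pD] 2 by simp
qed

lemma f_spatial: "FD f (0, cmap K p) (0, u) = I.dF (cmap K p) u"
proof -
 have "HD (%y. (0::real, y)) (%h. (0, h)) (cmap K p)" by (auto intro!: derivative_eq_intros)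
 from has_derivative_compose[OF this Cinf_deriv[OF patchD(7)[OF pt] box[OF p(3)]]]
 have "HD (%y. f (0, y)) (%h. FD f (0, cmap K p) (0, h)) (cmap K p)" .
 hence "HD (F K K') (%h. FD f (0, cmap K p) (0, h)) (cmap K p)"
 proof (rule has_derivative_cong_open[OF _ patch_open[OF pt zero_ball p]])
  fix y assume "y : cmap K ` (interior D Int cdom K) Int ball (cmap K p0) r"
  then obtain q where q: "q : iD" "q : cdom K" "y = cmap K q" "cmap K q : ball (cmap K p0) r" by auto
  have qD: "q : D" using q(1) interior_subset by auto
  from patchD(10)[OF pt zero_ball qD q(2,4)] show "f (0, y) = F K K' y"
   using A.chartD(3)[OF k(1) q(2)] q(3) Phi_0[OF qD] by simp
 qed (use p in auto)
 from frechet_derivative_at[OF this] show ?thesis by (simp add: fun_eq_iff)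
qed

lemma W_chart: "W p = from_chart B K' (\<phi> p) (V (cmap K p))" "to_chart B K' (\<phi> p) (W p) = V (cmap K p)"
proof -
 show 1: "W p = from_chart B K' (\<phi> p) (V (cmap K p))"
  using velocity_patch_eq[OF pt zero_ball p] Phi_0[OF p_facts(1)] by (simp add: velocity_0 V_def)
 show "to_chart B K' (\<phi> p) (W p) = V (cmap K p)"
  unfolding 1 by (rule B.to_from_chart[OF k(2) p_facts(2)])
qed

lemma V_deriv: "FD V (cmap K p) u = D2 f (0, cmap K p) (0, u) (1, 0)"
proof -
 note fs = patchD(7)[OF pt] and b = box[OF p(3)]
 have "HD (%y. (0::real, y)) (%h. (0, h)) (cmap K p)" by (auto intro!: derivative_eq_intros)
 from has_derivative_compose[OF this D2_has_derivative[OF fs b, of "(1, 0)"]]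
 have "HD V (%h. D2 f (0, cmap K p) (1, 0) (0, h)) (cmap K p)" unfolding V_def .
 from frechet_derivative_at[OF this, symmetric]
 show ?thesis using second_derivative_symmetric[OF fs b, of "(1, 0)" "(0, u)"] by simp
qed

text \<open>Jacobi's formula for the Gram determinant as a function of \<open>t\<close>. Exchanging
  time and space derivatives of \<open>f\<close> identifies the time derivative of the coordinate
  frame with the derivative of the velocity \<open>V\<close>.\<close>

lemma area_var_patch:
 "area_var p = I.first_variation V (FD V (cmap K p)) (cmap K p)"
proof -
 let ?y = "cmap K p"
 define y where "y = ?y"
 note fs = patchD(7)[OF pt] and b = box[OF p(3)] and Wf = patchD(8)[OF pt]
 let ?G = "Gm K'"
 define a where "a i t = FD f (t, ?y) (0, ax i)" for i t
 define M where "M t = gram (%u v. ?G (f (t, ?y)) (FD f (t, ?y) (0, u)) (FD f (t, ?y) (0, v)))" for t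
 have tl: "HD (%s. (s, ?y)) (%h. (h, 0)) 0" by (auto intro!: derivative_eq_intros)
 have hd: "HD (%t. f (t, ?y)) (%h. FD f (0, ?y) (h, 0)) 0"
  by (rule has_derivative_compose[OF tl Cinf_deriv[OF fs b]])
 have ad: "HD (a i) (%h. D2 f (0, ?y) (0, ax i) (h, 0)) 0" for i
  unfolding a_def by (rule has_derivative_compose[OF tl D2_has_derivative[OF fs b]])
 have tin: "f (t, ?y) : cran K'" if "t : ball 0 r" for t using Wf[of "(t, ?y)"] that p(3) by simp
 define T where "T i j h = DG ?G (f (0, ?y)) (FD f (0, ?y) (h, 0)) (a i 0) (a j 0)
   + ?G (f (0, ?y)) (D2 f (0, ?y) (0, ax i) (h, 0)) (a j 0) + ?G (f (0, ?y)) (a i 0) (D2 f (0, ?y) (0, ax j) (h, 0))" for i j h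
 have "HD (%t. M t $ i $ j) (%h. (\<chi> i j. T i j h) $ i $ j) 0" for i j
  unfolding M_def T_def vec_lambda_beta a_def[symmetric]
  by (rule I.G_chain[OF zero_ball open_ball tin hd ad ad])
 moreover have M0: "M 0 = gram (I.gF ?y)"
  unfolding M_def p_facts(4) f_spatial I.gF_def ..
 have yU: "?y : rdom K K'" by (rule p_facts(3))
 have dpos: "det (M 0) > 0" unfolding M0 by (rule I.det_pos[OF yU])
 ultimately have "HD (%t. det (M t)) (%h. det (M 0) * (SUM i:UNIV. SUM j:UNIV. matrix_inv (M 0) $ i $ j * (\<chi> i j. T i j h) $ j $ i)) 0"
  by (intro has_derivative_det) auto
 hence "HD (%t. det (M t)) (%h. det (M 0) * (SUM i:UNIV. SUM j:UNIV. matrix_inv (M 0) $ i $ j * T j i h)) 0"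
  by simp
 from has_derivative_compose[OF this, of "%x. x / (rho K ?y)^2" "%x. x / (rho K ?y)^2"]
 have "HD (%t. det (M t) / (rho K ?y)^2) (%h. det (M 0) * (SUM i:UNIV. SUM j:UNIV. matrix_inv (M 0) $ i $ j * T j i h) / (rho K ?y)^2) 0"
  by (simp add: bounded_linear_imp_has_derivative bounded_linear_divide)
 moreover have "det (M 0) / (rho K ?y)^2 = 1"
 proof -
  have "(rho K ?y)^2 = det (M 0)" unfolding rho_vol[OF k yU] I.vol_def M0 using I.det_pos[OF yU] by simp
  thus ?thesis using dpos by simp
 qed
 hence "det (M 0) * X / (rho K ?y)^2 = X" for X by (metis mult.commute mult_1 times_divide_eq_left)
 ultimately have "HD (%t. det (M t) / (rho K ?y)^2) (%h. SUM i:UNIV. SUM j:UNIV. matrix_inv (M 0) $ i $ j * T j i h) 0"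
  by simp
 hence "HD (%t. G2 (t, p)) (%h. SUM i:UNIV. SUM j:UNIV. matrix_inv (M 0) $ i $ j * T j i h) 0"
  by (rule has_derivative_cong_open[OF _ open_ball[of 0 r] zero_ball])
   (insert G2_patch[OF pt _ p], simp add: M_def)
 moreover have "HD (%t. G2 (t, p)) (%h. deriv (%t. G2 (t, p)) 0 * h) 0"
  using smooth_scalar_has_deriv[OF G2_smooth_scalar _ p(1), of 0] eps_pos by (simp add: has_field_derivative_def)
 ultimately have "(%h. SUM i:UNIV. SUM j:UNIV. matrix_inv (M 0) $ i $ j * T j i h) = (%h. deriv (%t. G2 (t, p)) 0 * h)"
  by (rule has_derivative_unique)
 from fun_cong[OF this, of 1] have "deriv (%t. G2 (t, p)) 0 = (SUM i:UNIV. SUM j:UNIV. matrix_inv (M 0) $ i $ j * T j i 1)" by simp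
 moreover have "T j i 1 = DG ?G (F K K' ?y) (V ?y) (I.dF ?y (ax i)) (I.dF ?y (ax j))
   + ?G (F K K' ?y) (FD V ?y (ax i)) (I.dF ?y (ax j)) + ?G (F K K' ?y) (I.dF ?y (ax i)) (FD V ?y (ax j))" for i j
  unfolding T_def a_def V_deriv[symmetric] V_def[symmetric] f_spatial p_facts(4)
  using I.DG_sym[OF I.F_in[OF yU], where b="I.dF ?y (ax j)" and c="I.dF ?y (ax i)"] I.G_sym[OF I.F_in[OF yU]]
  by (simp add: add.commute add.left_commute)
 ultimately show ?thesis
  unfolding area_var_def I.first_variation_def metric_trace_def M0
  by (simp add: sum_divide_distrib)
qed

lemma trace_var_patch:
 assumes et: "A.sfun et"
 shows "metric_trace (I.gF (cmap K p)) (%u v. FD (%y. et (cinv K y)) (cmap K p) u *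
  Gm K' (F K K' (cmap K p)) (V (cmap K p)) (I.dF (cmap K p) v)) = trace_var et p"
 unfolding trace_var_def
proof (rule metric_trace_transform[where S="from_chart A K p" and R="to_chart A K p"])
 have kp: "K : A" "K' : B" "p : cdom K" "\<phi> p : cdom K'" using k p p_facts by auto
 show "inner_form (g p)" by (rule g_inner)
 have l: "linear (gb (\<phi> p) (W p))" using inner_formD(1)[OF RB.metric_inner_form] by (simp add: bilinear_def)
 have l2: "linear (%v. gb (\<phi> p) (W p) (dph p v))"
  using linear_compose[OF mdiff_phi_linear l] by (simp add: o_def)
 show "bilinear (%u v. A.dfun et p u * gb (\<phi> p) (W p) (dph p v))"
  using bilinear_compose[OF _ A.dfun_linear[OF et] l2, of "(*)"] by (simp add: bilinear_def linear_iff algebra_simps)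
 show "linear (from_chart A K p)" "linear (to_chart A K p)" "from_chart A K p (to_chart A K p u) = u" for u
  by (rule A.from_chart_linear[OF kp(1,3)], rule A.to_chart_linear[OF kp(1,3)], rule A.from_to_chart[OF kp(1,3)])
 show "I.gF (cmap K p) u v = g p (from_chart A K p u) (from_chart A K p v)" for u v
  unfolding g_chart(2)[OF kp] A.to_from_chart[OF kp(1,3)] ..
 show "FD (%y. et (cinv K y)) (cmap K p) u * Gm K' (F K K' (cmap K p)) (V (cmap K p)) (I.dF (cmap K p) v) =
  A.dfun et p (from_chart A K p u) * gb (\<phi> p) (W p) (dph p (from_chart A K p v))" for u v
  unfolding A.dfun_chart[OF et kp(1,3)] RB.metric_chart[OF kp(2,4)] W_chart(2) mdiff_phi(1)[OF kp] p_facts(5) ..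
qed

end

end

end

section \<open>Divergence theorem in a patch\<close>

context bvari
begin

definition variation_density :: "'a => real" where
 "variation_density p = area_var p + real CARD('m) * gb (\<phi> p) (mc p) (W p)"

context
 fixes p0 K K' r f r' et
 assumes patch0: "patch0 p0 K K' r f" and r': "0 < r'" "r' < r"
  and et: "A.sfun et" "!!p. p ~: cinv K ` cball (cmap K p0) r' ==> et p = 0"
begin

abbreviation "y0 \<equiv> cmap K p0"
abbreviation "Vf \<equiv> V f"

lemma kk: "K : A" "K' : B" by (rule k[OF patch0])+

interpretation I: local_immersion "Gm K'" "cran K'" "F K K'" "rdom K K'"
 by (rule local_immersion_chart[OF kk])

lemma ball_image: "ball y0 r <= cran K" "cball y0 r' <= cran K" "cball y0 r' <= ball y0 r"
proof -
 show 1: "ball y0 r <= cran K" by (rule patchD(6)[OF pt[OF patch0]])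
 show 2: "cball y0 r' <= ball y0 r" using r' by auto
 show "cball y0 r' <= cran K" using 1 2 by blast
qed

lemma eta_0:
 assumes y: "y : ball y0 r" "y ~: cball y0 r'"
 shows "et (cinv K y) = 0"
proof (rule et(2), rule notI)
 assume "cinv K y : cinv K ` cball y0 r'"
 then obtain z where z: "z : cball y0 r'" "cinv K y = cinv K z" by blast
 have "y : cran K" "z : cran K" using y z ball_image by blast+
 hence "y = z" using arg_cong[OF z(2), of "cmap K"] A.chartD(4)[OF kk(1)] by metis
 thus False using z y by simp
qed

text \<open>The densitised tangential part of the velocity, cut off by \<open>et\<close>, as a field
  on the whole model space. It is supported in the smaller ball of radius \<open>r'\<close>, so the
  value 0 outside the larger ball joins smoothly.\<close>

definition w :: "'m => real^'m => real" where
 "w i y = (if y : ball y0 r then et (cinv K y) * I.Z Vf i y else 0)"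

lemma w_0: "y ~: cball y0 r' ==> w i y = 0"
 using eta_0 by (simp add: w_def)

lemma Z_smooth: "Cinf (I.Z Vf i) (ball y0 r)"
proof -
 note br = ball_rdom[OF patch0]
 have sub: "Cinf h (rdom K K') ==> Cinf h (ball y0 r)" for h :: "real^'m => 'w::real_normed_vector"
  by (rule Cinf_subset[OF _ open_ball br])
 have "Cinf (%y. Gm K' (F K K' y) (Vf y) (I.dF y (ax l))) (ball y0 r)" for l
 proof (rule Cinf_apply_bilinear[where L="%y. Gm K' (F K K' y)"])
  show "bilinear (Gm K' (F K K' y))" if "y : ball y0 r" for y
   by (rule I.G_bilinear[OF I.F_in]) (use br that in blast)
  show "Cinf (%y. Gm K' (F K K' y) a b) (ball y0 r)" for a b
   by (rule sub, rule Cinf_compose[OF I.G_smooth I.F_smooth I.F_in])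
  show "Cinf (%y. I.dF y (ax l)) (ball y0 r)" by (rule sub, rule Cinf_frechet[OF I.F_smooth])
 qed (rule V_smooth[OF patch0])
 thus ?thesis unfolding I.Z_def
  by (intro Cinf_sum Cinf_mult sub[OF I.P_smooth] open_ball)
qed

lemma w_smooth: "Cinf (w i) UNIV"
proof (rule Cinf_local)
 fix y
 have "Cinf (%y. et (cinv K y)) (ball y0 r)"
  by (rule Cinf_subset[OF A.sfunD[OF et(1) kk(1)] open_ball ball_image(1)])
 from Cinf_mult[OF this Z_smooth[where i=i]]
 have 1: "Cinf (w i) (ball y0 r)" by (rule Cinf_cong) (simp add: w_def)
 have "open (- cball y0 r')" by (simp add: closed_def[symmetric])
 hence 2: "Cinf (w i) (- cball y0 r')"
  by (rule Cinf_cong[OF Cinf_const[of _ 0]]) (simp add: w_0)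
 show "EX V. y : V & Cinf (w i) V"
 proof (cases "y : ball y0 r")
  case True thus ?thesis using 1 by (intro exI[of _ "ball y0 r"] conjI)
 next
  case False hence "y : - cball y0 r'" using ball_image(3) by blast
  thus ?thesis using 2 by (intro exI[of _ "- cball y0 r'"] conjI)
 qed
qed simp

definition S :: "(real^'m) set" where "S = cmap K ` (interior D Int cdom K) Int ball y0 r"

lemma S_open: "open S"
 unfolding S_def by (intro open_Int open_ball chart_open_image[OF A.is_chart[OF kk(1)]] A.chartD(1) kk open_interior) simp

lemma frontier_S: "frontier S Int ball y0 r <= frD K"
proof
 fix z assume z: "z : frontier S Int ball y0 r"
 then obtain q where q: "q : cdom K" "z = cmap K q" using ball_image(1) by blast
 have zS: "z ~: S" "z : closure S" using z S_open by (auto simp: frontier_def interior_open)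
 have "q ~: iD" using zS(1) z q by (auto simp: S_def)
 moreover have "q : D"
 proof (rule ccontr)
  assume qD: "q ~: D"
  let ?N = "cmap K ` (- D Int cdom K)"
  have "open ?N"
   by (intro chart_open_image[OF A.is_chart[OF kk(1)]] open_Int A.chartD(1) kk open_Compl D_closed) simp
  moreover have "z : ?N" using q qD by auto
  ultimately obtain y where y: "y : S" "y : ?N"
   using zS(2) unfolding closure_iff_nhds_not_empty by blast
  then obtain a b where ab: "a : iD" "a : cdom K" "y = cmap K a" "b ~: D" "b : cdom K" "y = cmap K b"
   unfolding S_def by blast
  have "a = b" using inj_onD[OF A.chartD(8)[OF kk(1)] _ ab(2,5)] ab(3,6) by simp
  thus False using ab(1,4) interior_subset by auto
 qed
 ultimately have "q : frontier D" using D_split(1) by auto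
 thus "z : frD K" using q by auto
qed

lemma w_frontier: assumes z: "z : frontier S" shows "w i z = 0"
proof (cases "z : ball y0 r")
 case True
 hence "z : frD K" using frontier_S z by blast
 then obtain q where q: "q : frontier D" "q : cdom K" "z = cmap K q" by blast
 have "Vf z = 0" using V_frontier[OF patch0 q(1,2)] True q(3) by simp
 moreover have "Gm K' (F K K' z) 0 u = 0" for u
  by (rule bilinear_lzero[OF I.G_bilinear[OF I.F_in]]) (use ball_rdom[OF patch0] True in blast)
 ultimately show ?thesis by (simp add: w_def I.Z_def)
qed (simp add: w_def)

definition H :: "real^'m => real" where "H y = (SUM i:UNIV. FD (w i) y (ax i))"

lemma dw_continuous: "continuous_on UNIV (%y. FD (w i) y u)"
 by (rule Cinf_continuous[OF Cinf_frechet[OF w_smooth]])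

lemma dw_0: "y ~: cball y0 r' ==> FD (w i) y u = 0"
proof -
 assume y: "y ~: cball y0 r'"
 have o: "open (- cball y0 r')" by (simp add: closed_def[symmetric])
 have "HD (w i) (%_. 0) y"
  by (rule has_derivative_cong_open[OF has_derivative_const[of 0] o]) (insert y, simp_all add: w_0)
 from frechet_derivative_at[OF this, symmetric] show ?thesis by simp
qed

text \<open>\<open>w\<close> vanishes on the frontier of \<open>S\<close>: on the image of the
  boundary of \<open>D\<close> because the velocity does, elsewhere by the cut-off. Its restriction
  to \<open>S\<close> is thus Lipschitz with compact support, and off a null set its derivative is
  that of \<open>w\<close> on \<open>S\<close> and 0 otherwise.\<close>

lemma divergence_integral: "integrable lborel (%y. ind S y * FD (w i) y (ax i))"
 "(LINT y|lborel. ind S y * FD (w i) y (ax i)) = 0"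
proof -
 let ?d = "%y. ind S y * FD (w i) y (ax i) :: real"
 have mS: "S : sets borel" using S_open by simp
 have meas: "?d : bm"
  by (intro borel_measurable_times borel_measurable_continuous_onI[OF dw_continuous] borel_measurable_indicator mS)
 have "bounded ((%y. FD (w i) y (ax i)) ` cball y0 r')"
  by (intro compact_imp_bounded compact_continuous_image continuous_on_subset[OF dw_continuous]) auto
 then obtain C where C: "ALL y:cball y0 r'. abs (FD (w i) y (ax i)) <= C" unfolding bounded_iff by auto
 show "integrable lborel ?d"
 proof (rule bounded_support_integrable[OF meas, where C="abs C" and ?y0.0=y0 and r=r'])
  show "abs (?d y) <= abs C" for y using C dw_0[of y i] by (cases "y : cball y0 r'") (force simp: indicator_def)+
 qed (simp add: dw_0)
 obtain L where L: "!!x y. abs (w i x - w i y) <= L * dist x y"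
  using compact_support_lipschitz[OF w_smooth w_0] by metis
 show "integral\<^sup>L lborel ?d = 0"
 proof (rule integral_directional_derivative_zero[where u="%y. ind S y * w i y" and R="norm y0 + r'"])
  show "abs (ind S x * w i x - ind S y * w i y) <= L * dist x y" for x y
   by (rule lipschitz_indicator[OF L w_frontier])
  show "ind S x * w i x = 0" if "norm x > norm y0 + r'" for x
  proof -
   have "x ~: cball y0 r'" using that norm_triangle_sub[of x y0] by (auto simp: dist_norm norm_minus_commute)
   thus ?thesis using w_0 by simp
  qed
  have "AE x in lborel. x ~: frD K" by (rule frontier_null_set[OF kk(1)])
  thus "AE x in lborel. HR (%t. ind S (x + t *\<^sub>R ax i) * w i (x + t *\<^sub>R ax i)) (?d x) 0"
  proof (rule AE_mp, intro AE_I2 impI)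
   fix x assume x: "x ~: frD K"
   have "x : S \<or> x ~: closure S \<or> x ~: cball y0 r'"
   proof (rule ccontr)
    assume n: "~ ?thesis"
    hence "x : frontier S" using S_open by (simp add: frontier_def interior_open)
    moreover have "x : ball y0 r" using n ball_image(3) by blast
    ultimately show False using x frontier_S by blast
   qed
   then consider "x : S" | "x ~: closure S" | "x ~: cball y0 r'" by blast
   hence "HD (%y. ind S y * w i y) (%h. ind S x * FD (w i) x h) x"
   proof cases
    case 1
    show ?thesis by (rule has_derivative_cong_open[OF _ S_open 1, of "w i"]) (use 1 Cinf_deriv[OF w_smooth, of x] in simp_all)
   next
    case 2
    have o: "open (- closure S)" by (simp add: closed_def[symmetric])
    have n: "y ~: S" if "y ~: closure S" for y using that closure_subset[of S] by auto
    show ?thesis by (rule has_derivative_cong_open[OF _ o, of "%_. 0"]) (use 2 n in simp_all)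
   next
    case 3
    have o: "open (- cball y0 r')" by (simp add: closed_def[symmetric])
    show ?thesis by (rule has_derivative_cong_open[OF _ o, of "%_. 0"]) (use 3 dw_0[OF 3] w_0 in simp_all)
   qed
   from has_derivative_along[OF this]
   show "HR (%t. ind S (x + t *\<^sub>R ax i) * w i (x + t *\<^sub>R ax i)) (?d x) 0" .
  qed
 qed (rule meas)
qed

text \<open>The divergence identity for the cut-off field, with \<open>N\<close> replaced by the
  mean curvature vector; the product rule splits off the derivative of \<open>et\<close>. The common
  factor \<open>rho\<close> is the density of the measure.\<close>

lemma H_formula:
 assumes p: "p : iD" "p : cdom K" "cmap K p : ball y0 r"
 shows "H (cmap K p) = rho K (cmap K p) * (et p * variation_density p + trace_var et p)"
proof -
 let ?y = "cmap K p" and ?et = "%y. et (cinv K y)"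
 let ?d = "FD ?et ?y" and ?V' = "FD Vf ?y"
 note yU = p_facts(3)[OF patch0 p]
 note dV = Cinf_deriv[OF V_smooth[OF patch0] p(3)]
 have ky: "cinv K ?y = p" by (rule A.chartD(3)[OF kk(1) p(2)])
 have rv: "rho K ?y = I.vol ?y" by (rule rho_vol[OF kk yU])
 have dw: "FD (w i) ?y u = et p * FD (I.Z Vf i) ?y u + ?d u * I.Z Vf i ?y" for i u
 proof -
  have "HD (%y. ?et y * I.Z Vf i y) (%u. ?et ?y * FD (I.Z Vf i) ?y u + ?d u * I.Z Vf i ?y) ?y"
   by (rule has_derivative_mult[OF A.sfun_has_derivative[OF et(1) kk(1) p(2)] Cinf_deriv[OF Z_smooth p(3)]])
  hence "HD (w i) (%u. ?et ?y * FD (I.Z Vf i) ?y u + ?d u * I.Z Vf i ?y) ?y"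
   by (rule has_derivative_cong_open[OF _ open_ball p(3)]) (simp add: w_def)
  from frechet_derivative_at[OF this, symmetric] show ?thesis unfolding ky by simp
 qed
 have "H ?y = et p * (SUM i:UNIV. FD (I.Z Vf i) ?y (ax i)) + (SUM i:UNIV. ?d (ax i) * I.Z Vf i ?y)"
  unfolding H_def dw by (simp add: sum.distrib sum_distrib_left)
 also have "(SUM i:UNIV. FD (I.Z Vf i) ?y (ax i)) = I.vol ?y * I.first_variation Vf ?V' ?y + Gm K' (F K K' ?y) (I.N ?y) (Vf ?y)"
  by (rule I.divergence_identity[OF yU dV])
 also have "I.first_variation Vf ?V' ?y = area_var p" by (rule area_var_patch[OF patch0 p, symmetric])
 also have "Gm K' (F K K' ?y) (I.N ?y) (Vf ?y) = I.vol ?y * real CARD('m) * gb (\<phi> p) (mc p) (W p)"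
 proof -
  note f2 = p_facts(2)[OF patch0 p] and f5 = p_facts(5)[OF patch0 p]
  show ?thesis
   unfolding N_mean_curvature[OF kk p(2) f2] bilinear_lmul[OF I.G_bilinear[OF I.F_in[OF yU]], unfolded f5] RB.metric_chart[OF kk(2) f2] W_chart(2)[OF patch0 p] f5 by simp
 qed
 also have "(SUM i:UNIV. ?d (ax i) * I.Z Vf i ?y) = I.vol ?y * trace_var et p"
  unfolding trace_var_patch[OF patch0 p et(1), symmetric] I.vol_metric_trace I.Z_def sum_distrib_left
  by (intro sum.cong refl) simp
 finally show ?thesis unfolding rv variation_density_def by (simp only: algebra_simps)
qed

text \<open>\<open>h\<close> is the divergence of the cut-off field divided by \<open>rho\<close>,
  extended by 0 from the chart ball. Outside that ball the claimed formula is 0 as well: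
  \<open>et\<close> vanishes off a closed set, hence so does its differential.\<close>

lemma local_first_variation:
 obtains h where "h : bm" "EX C. ALL p. abs (h p) <= C" "(LINT p|mu. h p) = 0"
  "ALL p. h p = (if p : iD then et p * variation_density p + trace_var et p else 0)"
proof -
 define E where "E = (interior D Int cdom K) Int cmap K -` ball y0 r"
 have E_eq: "E = iD Int (cdom K Int cmap K -` ball y0 r)" by (auto simp: E_def)
 have Eo: "open E" unfolding E_eq by (intro open_Int open_interior chart_open_preimage[OF A.is_chart[OF kk(1)]] open_ball)
 have Es: "E <= cdom K" "E <= iD" "E <= D" using interior_subset[of D] by (auto simp: E_def)
 have ES: "cmap K ` E = S"
  unfolding S_def E_def by auto
 have Hc: "continuous_on UNIV H" unfolding H_def by (intro continuous_on_sum dw_continuous)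
 define q where "q y = H y / rho K y" for y
 have qc: "continuous_on (cran K) q" unfolding q_def
  by (intro continuous_on_divide continuous_on_subset[OF Hc] Cinf_continuous[OF rho_smooth[OF kk(1)]])
   (use rho_pos[OF kk(1)] in force)+
 define h where "h p = ind E p * q (cmap K p)" for p
 have "continuous_on E (%p. q (cmap K p))"
  by (rule continuous_on_compose2[OF qc continuous_on_subset[OF A.chartD(6)[OF kk(1)] Es(1)]]) (use Es in auto)
 hence hm: "h : bm"
  using borel_measurable_continuous_on_indicator[of E "%p. q (cmap K p)"] Eo by (simp add: h_def[abs_def])
 have "bounded (q ` cball y0 r')"
  by (intro compact_imp_bounded compact_continuous_image continuous_on_subset[OF qc ball_image(2)]) auto
 then obtain C where C: "ALL y:cball y0 r'. abs (q y) <= C" unfolding bounded_iff by auto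
 have q0: "q y = 0" if "y ~: cball y0 r'" for y using dw_0[OF that] by (simp add: q_def H_def)
 have hb: "EX C. ALL p. abs (h p) <= C"
 proof (intro exI allI)
  fix p show "abs (h p) <= abs C"
   using C q0[of "cmap K p"] by (cases "cmap K p : cball y0 r'") (force simp: h_def indicator_def)+
 qed
 have "(LINT p|mu. h p) = (LINT y|lborel. ind (cmap K ` E) y * (rho K y * h (cinv K y)))"
  by (rule mu_integral_chart[OF kk(1) hm _ Es(1,3)]) (insert Eo, auto simp: h_def)
 also have "... = (LINT y|lborel. (SUM i:UNIV. ind S y * FD (w i) y (ax i)))"
 proof (rule Bochner_Integration.integral_cong[OF refl])
  fix y
  show "ind (cmap K ` E) y * (rho K y * h (cinv K y)) = (SUM i:UNIV. ind S y * FD (w i) y (ax i))"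
  proof (cases "y : S")
   case True
   then obtain p where p: "p : E" "y = cmap K p" using ES by blast
   have "p : cdom K" using p Es by auto
   hence "cinv K y = p" "rho K y > 0" using p(2) A.chartD(3)[OF kk(1)] rho_pos[OF kk(1), of y] by auto
   thus ?thesis using True p by (simp add: ES h_def q_def H_def)
  qed (simp add: ES)
 qed
 also have "... = 0" by (subst Bochner_Integration.integral_sum) (simp_all add: divergence_integral)
 finally have hi: "(LINT p|mu. h p) = 0" .
 have "h p = (if p : iD then et p * variation_density p + trace_var et p else 0)" for p
 proof (cases "p : E")
  case True
  hence p: "p : iD" "p : cdom K" "cmap K p : ball y0 r" by (auto simp: E_def)
  have "rho K (cmap K p) > 0" using rho_pos[OF kk(1), of "cmap K p"] p by simp
  thus ?thesis using True p H_formula[OF p] by (simp add: h_def q_def)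
 next
  case False
  show ?thesis
  proof (cases "p : iD")
   case True
   let ?Kq = "cinv K ` cball y0 r'"
   have cl: "closed ?Kq" by (rule A.chart_cball_closed(1)[OF kk(1) ball_image(2) compact_imp_closed])
   have "p ~: ?Kq"
   proof
    assume "p : ?Kq"
    then obtain y where y: "y : cball y0 r'" "p = cinv K y" by blast
    hence "p : cdom K" "cmap K p = y" using A.chartD(4,5)[OF kk(1), of y] ball_image(2) by blast+
    thus False using False True y ball_image(3) by (auto simp: E_def)
   qed
   hence d: "A.dfun et p u = 0" for u
    using A.dfun_local_const[of "- ?Kq" p et 0] et(2) cl by (simp add: open_Compl)
   have "trace_var et p = 0" unfolding trace_var_def metric_trace_def d by simp
   thus ?thesis using False et(2)[OF \<open>p ~: ?Kq\<close>] by (simp add: h_def)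
  qed (insert False, simp add: h_def)
 qed
 thus ?thesis using that[OF hm hb hi] by blast
qed

end

end

section \<open>From patches to the whole domain by a partition of unity\<close>

lemma (in atlas) sfun_add: "sfun et ==> sfun ks ==> sfun (%p. et p + ks p)"
 by (rule sfunI, rule Cinf_add; rule sfunD)

lemma (in atlas) dfun_add:
 assumes "sfun et" "sfun ks"
 shows "dfun (%p. et p + ks p) p u = dfun et p u + dfun ks p u"
proof -
 note d = sfun_has_derivative[OF _ chart_at(1) chart_at(2)]
 from frechet_derivative_at[OF has_derivative_add[OF d[OF assms(1)] d[OF assms(2)]], symmetric]
 show ?thesis by (simp add: dfun_def)
qed

context bvari
begin

text \<open>The first variation formula localised by \<open>et\<close>. A bounded Borel integrand is
  part of the property so that it is closed under addition, by which local cut-offs are assembled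
  into one that is 1 on \<open>D\<close>.\<close>

definition variation_balanced :: "('a => real) => bool" where
 "variation_balanced et \<longleftrightarrow> A.sfun et & (EX h. h : bm & (EX C. ALL p. abs (h p) <= C) & (LINT p|mu. h p) = 0 &
   (ALL p. h p = (if p : iD then et p * variation_density p + trace_var et p else 0)))"

lemma bounded_integrable:
 fixes h :: "'a => real"
 assumes "h : bm" "ALL p. abs (h p) <= C"
 shows "integrable mu h"
proof (rule mu.integrable_const_bound[where B=C])
 show "h : borel_measurable mu" using assms(1) by (simp cong: measurable_cong_sets)
qed (use assms in simp)

lemma trace_var_add:
 assumes "A.sfun et" "A.sfun ks"
 shows "trace_var (%p. et p + ks p) p = trace_var et p + trace_var ks p"
 unfolding trace_var_def metric_trace_def A.dfun_add[OF assms]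
 by (simp add: sum.distrib[symmetric] algebra_simps)

lemma variation_balanced_add:
 assumes "variation_balanced et" "variation_balanced ks"
 shows "variation_balanced (%p. et p + ks p)"
proof -
 obtain h C where h: "A.sfun et" "h : bm" "ALL p. abs (h p) <= C" "(LINT p|mu. h p) = 0"
  "ALL p. h p = (if p : iD then et p * variation_density p + trace_var et p else 0)"
  using assms(1) unfolding variation_balanced_def by blast
 obtain k C' where k: "A.sfun ks" "k : bm" "ALL p. abs (k p) <= C'" "(LINT p|mu. k p) = 0"
  "ALL p. k p = (if p : iD then ks p * variation_density p + trace_var ks p else 0)"
  using assms(2) unfolding variation_balanced_def by blast
 show ?thesis
  unfolding variation_balanced_def
 proof (intro conjI exI[of _ "%p. h p + k p"])
  show "A.sfun (%p. et p + ks p)" by (rule A.sfun_add[OF h(1) k(1)])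
  show "(%p. h p + k p) : bm" by (rule borel_measurable_add[OF h(2) k(2)])
  have "abs (h p + k p) <= C + C'" for p using h(3)[rule_format, of p] k(3)[rule_format, of p] by linarith
  thus "EX C. ALL p. abs (h p + k p) <= C" by blast
  show "(LINT p|mu. h p + k p) = 0"
   using Bochner_Integration.integral_add[OF bounded_integrable[OF h(2,3)] bounded_integrable[OF k(2,3)]] h(4) k(4) by simp
  show "ALL p. h p + k p = (if p : iD then (et p + ks p) * variation_density p + trace_var (%p. et p + ks p) p else 0)"
   using h(5) k(5) by (simp add: trace_var_add[OF h(1) k(1)] algebra_simps)
 qed
qed

lemma variation_balanced_patch:
 assumes pt: "patch0 p0 K K' r f" and r': "0 < r'" "r' < r" and et: "A.sfun et"
  and et0: "!!p. p ~: cinv K ` cball (cmap K p0) r' ==> et p = 0"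
 shows "variation_balanced et"
proof -
 obtain h where "h : bm" "EX C. ALL p. abs (h p) <= C" "(LINT p|mu. h p) = 0"
  "ALL p. h p = (if p : iD then et p * variation_density p + trace_var et p else 0)"
  by (rule local_first_variation[OF pt r' et et0])
 thus ?thesis unfolding variation_balanced_def using et by blast
qed

text \<open>The bumps are combined into \<open>1 - PROD (1 - b p)\<close>, which equals 1 as soon as
  one \<open>b p\<close> does. Enlarging the product by a point adds \<open>b p\<close> times the
  old product, a function supported where \<open>b p\<close> is; this avoids dividing by a sum of
  bumps.\<close>

lemma variation_balanced_const:
 obtains et where "variation_balanced et" "!!p. p : D ==> et p = 1"
proof -
 have "EX O' b K r r' f. open O' & p : O' & (EX K'. patch0 p K K' r f) & 0 < r' & r' < r & A.sfun b &
  (ALL q. q ~: cinv K ` cball (cmap K p) r' --> b q = 0) & (ALL q:O'. b q = 1)" if pD: "p : D" for p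
 proof -
  obtain K K' r f where P: "patch0 p K K' r f" by (rule patch0_exists[OF pD])
  note p' = pt[OF P]
  have k: "K : A" and pk: "p : cdom K" by (rule patchD(1)[OF p'], rule patchD(4)[OF p'])
  have r: "r > 0" by (rule patchD(3)[OF p'])
  have c: "cball (cmap K p) (r / 2) <= cran K" using patchD(6)[OF p'] r by (auto simp: subset_iff)
  obtain b where b: "A.sfun b" "!!q. q : cdom K ==> dist (cmap K q) (cmap K p) <= r / 2 / 2 ==> b q = 1"
   "!!q. q ~: cinv K ` cball (cmap K p) (r / 2) ==> b q = 0"
   using A.sfun_bump[OF k _ c compact_imp_closed] r by (metis half_gt_zero)
  have o: "open (cdom K Int cmap K -` ball (cmap K p) (r / 2 / 2))"
   by (rule chart_open_preimage[OF A.is_chart[OF k] open_ball])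
  have 1: "ALL q:cdom K Int cmap K -` ball (cmap K p) (r / 2 / 2). b q = 1"
   using b(2) by (auto simp: dist_commute)
  show ?thesis
   by (rule exI[of _ "cdom K Int cmap K -` ball (cmap K p) (r / 2 / 2)"], rule exI[of _ b], rule exI[of _ K],
     rule exI[of _ r], rule exI[of _ "r / 2"], rule exI[of _ f], intro conjI exI[of _ K'] o P b(1) 1)
    (use pk r b(3) in simp_all)
 qed
 then obtain O' b K r r' f where X: "!!p. p : D ==> open (O' p) & p : O' p & (EX K'. patch0 p (K p) K' (r p) (f p)) & 0 < r' p & r' p < r p & A.sfun (b p) &
  (ALL q. q ~: cinv (K p) ` cball (cmap (K p) p) (r' p) --> b p q = 0) & (ALL q:O' p. b p q = 1)"
  by metis
 have "D <= (UN p:D. O' p)" using X by blast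
 then obtain T where T: "T <= D" "finite T" "D <= (UN p:T. O' p)"
  using compactE_image[OF D_compact, of D O'] X by metis
 have "variation_balanced (%q. 1 - (PROD p:T'. 1 - b p q))" if "finite T'" "T' ~= {}" "T' <= D" for T'
  using that
 proof (induction T' rule: finite_ne_induct)
  case (singleton p)
  hence Xp: "p : D" by simp
  obtain K' where P: "patch0 p (K p) K' (r p) (f p)" using X[OF Xp] by blast
  have "variation_balanced (b p)"
   by (rule variation_balanced_patch[OF P, where r'="r' p"]) (use X[OF Xp] in simp_all)
  thus ?case by simp
 next
  case (insert p T')
  hence Xp: "p : D" by simp
  obtain K' where P: "patch0 p (K p) K' (r p) (f p)" using X[OF Xp] by blast
  have "A.sfun (%q. PROD p:T'. 1 - b p q)"
  proof (rule A.sfun_prod, rule A.sfun_one_minus)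
   fix i assume "i : T'" hence "i : D" using insert.prems by auto
   thus "A.sfun (b i)" using X by simp
  qed
  hence bs: "A.sfun (%q. b p q * (PROD p:T'. 1 - b p q))" using X[OF Xp] by (intro A.sfun_mult) simp
  have "variation_balanced (%q. b p q * (PROD p:T'. 1 - b p q))"
   by (rule variation_balanced_patch[OF P _ _ bs, where r'="r' p"]) (use X[OF Xp] in simp_all)
  moreover have "variation_balanced (%q. 1 - (PROD p:T'. 1 - b p q))" using insert by simp
  ultimately have "variation_balanced (%q. b p q * (PROD p:T'. 1 - b p q) + (1 - (PROD p:T'. 1 - b p q)))"
   by (rule variation_balanced_add)
  moreover have "b p q * (PROD p:T'. 1 - b p q) + (1 - (PROD p:T'. 1 - b p q)) = 1 - (PROD p:insert p T'. 1 - b p q)" for q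
   using insert.hyps by (simp add: algebra_simps)
  ultimately show ?case by simp
 qed
 moreover have "T ~= {}" using T(3) interior_nonempty interior_subset by fastforce
 ultimately have "variation_balanced (%q. 1 - (PROD p:T. 1 - b p q))" using T by simp
 moreover have "1 - (PROD p:T. 1 - b p q) = 1" if q: "q : D" for q
 proof -
  obtain p where p: "p : T" "q : O' p" using T(3) q by blast
  have "p : D" using p(1) T(1) by blast
  hence "b p q = 1" using X p(2) by blast
  hence "(PROD p:T. 1 - b p q) = 0" using p(1) T(2) by (intro prod_zero) auto
  thus ?thesis by simp
 qed
 ultimately show ?thesis by (rule that)
qed

text \<open>A cut-off that is 1 on \<open>D\<close> has zero differential in the interior, so the
  trace term drops out and \<open>variation_density\<close> integrates to 0. Integrability of the
  curvature term is inferred from the boundedness of \<open>h\<close> and of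
  \<open>area_var\<close>, the latter being a limit of difference quotients under a Lipschitz
  bound.\<close>

lemma mean_curvature_variation:
 "integrable mu (%p. ind iD p * gb (\<phi> p) (mc p) (W p))"
 "(LINT p|mu. ind iD p * area_var p) = - real CARD('m) * (LINT p|mu. ind iD p * gb (\<phi> p) (mc p) (W p))"
proof -
 let ?i = "ind iD :: 'a => real"
 obtain et where et: "variation_balanced et" "!!p. p : D ==> et p = 1" using variation_balanced_const by metis
 then obtain h C where h: "h : bm" "ALL p. abs (h p) <= C" "(LINT p|mu. h p) = 0"
  "ALL p. h p = (if p : iD then et p * variation_density p + trace_var et p else 0)"
  unfolding variation_balanced_def by blast
 have he: "h p = ?i p * variation_density p" for p
 proof (cases "p : iD")
  case True
  have "A.dfun et p u = 0" for u
   by (rule A.dfun_local_const[OF open_interior True, of et 1]) (use et(2) interior_subset in blast)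
  hence "trace_var et p = 0" unfolding trace_var_def metric_trace_def by simp
  moreover have "et p = 1" using True interior_subset by (intro et(2)) auto
  ultimately show ?thesis using h(4) True by simp
 qed (use h(4) in simp)
 have hi: "integrable mu h" by (rule bounded_integrable[OF h(1,2)])
 have ai: "integrable mu (%p. ?i p * area_var p)"
 proof -
  have e2: "ep / 2 < ep" using eps_pos by simp
  obtain M where C: "M >= 0" "!!t t' p. abs t <= ep / 2 ==> abs t' <= ep / 2 ==> p : iD ==> abs (G2 (t, p) - G2 (t', p)) <= M * abs (t - t')"
   using smooth_scalar_bounds[OF G2_smooth_scalar e2] by metis
  have b: "abs (deriv (%t. G2 (t, p)) 0) <= M" if p: "p : iD" for p
  proof -
   have "HR (%t. G2 (t, p)) (deriv (%t. G2 (t, p)) 0) 0"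
    using smooth_scalar_has_deriv[OF G2_smooth_scalar _ p, of 0] eps_pos by simp
   hence "((%x. abs ((G2 (x, p) - G2 (0, p)) / x)) \<longlongrightarrow> abs (deriv (%t. G2 (t, p)) 0)) (at 0)"
    by (intro tendsto_rabs) (simp add: DERIV_def)
   thus ?thesis
   proof (rule tendsto_upperbound)
    have "eventually (%x. abs x < ep / 2 & x ~= 0) (at (0::real))"
     unfolding eventually_at using eps_pos by (intro exI[of _ "ep / 2"]) (simp add: dist_real_def)
    thus "eventually (%x. abs ((G2 (x, p) - G2 (0, p)) / x) <= M) (at 0)"
    proof eventually_elim
     case (elim x)
     thus ?case using C(2)[of x 0 p] p eps_pos by (simp add: divide_le_eq)
    qed
   qed simp
  qed
  have "(%p. ?i p * deriv (%t. G2 (t, p)) 0 / 2) : bm"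
   using smooth_scalar_slice_deriv[OF G2_smooth_scalar, of 0] eps_pos by simp
  thus ?thesis
   by (intro bounded_integrable[where C="M / 2"])
    (insert b C(1), auto simp: area_var_def indicator_def)
 qed
 have e: "?i p * gb (\<phi> p) (mc p) (W p) = (h p - ?i p * area_var p) / real CARD('m)" for p
  unfolding he variation_density_def by (simp add: algebra_simps)
 show "integrable mu (%p. ?i p * gb (\<phi> p) (mc p) (W p))" unfolding e using hi ai by simp
 show "(LINT p|mu. ?i p * area_var p) = - real CARD('m) * (LINT p|mu. ?i p * gb (\<phi> p) (mc p) (W p))"
  unfolding e using hi ai h(3) by simp
qed

lemma area_derivative:
 "HR (area_D A B gb D \<Phi>) (- real CARD('m) * (LINT p|mu. ind iD p * gb (\<phi> p) (mc p) (W p))) 0"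
 using area_has_derivative unfolding area_var_def[symmetric] mean_curvature_variation(2) .

end

section \<open>Calibrated extended tangent spaces\<close>

locale calibrated = domain A B gb \<phi> D
 for A :: "('a::{t2_space, second_countable_topology}, real^'m) chart set"
  and B :: "('b::{t2_space, second_countable_topology}, 'v::euclidean_space) chart set" and gb \<phi> D +
 fixes \<Omega> :: "('b, 'v, 'm option) form" and \<nu> :: "'a => 'v"
 assumes pre: "pre_calibration B gb \<Omega>" and cal: "calibrated_extended_tangent_space A B gb \<Omega> \<phi> D \<nu>"
begin

abbreviation mcn :: "'a => real" where "mcn \<equiv> mean_curvature_norm A B gb \<phi>"

lemma form: "smooth_form B \<Omega>" using pre by (simp add: pre_calibration_def)

lemma nu:
 assumes "p : D"
 shows "normal_at A B gb \<phi> p (\<nu> p)" "gb (\<phi> p) (\<nu> p) (\<nu> p) = 1" "mc p = mcn p *\<^sub>R \<nu> p"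
  "orthonormal_system (g p) e ==> det (\<chi> i. e i) > 0 ==> \<Omega> (\<phi> p) (case_option (\<nu> p) (%i. dph p (e i))) = 1"
 using cal assms unfolding calibrated_extended_tangent_space_def by blast+

text \<open>On an oriented orthonormal frame the calibrated form in its first slot is the pairing
  with \<open>\<nu>\<close>, by \<open>calibrated_slot\<close>; passing to the coordinate frame
  contributes the Gram determinant.\<close>

lemma calibration_pairing:
 assumes p: "p : D"
 shows "\<Omega> (\<phi> p) (case_option w (%i. dph p (ax i))) = sqrt (det (gram (g p))) * gb (\<phi> p) w (\<nu> p)"
proof -
 obtain e :: "'m => real^'m" where e: "orthonormal_system (g p) e" "det (\<chi> i. e i) > 0"
  by (rule orthonormal_frame_exists[OF g_inner])
 have alt: "alternating_multilinear (\<Omega> (\<phi> p))" using form by (simp add: smooth_form_def)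
 have "alternating_multilinear (%u. \<Omega> (\<phi> p) (case_option w (%i. dph p (u i))))"
  by (rule alternating_multilinear_case_option[OF alt mdiff_phi_linear])
 from alternating_axis_orthonormal[OF g_inner e this]
 have "\<Omega> (\<phi> p) (case_option w (%i. dph p (ax i))) = sqrt (det (gram (g p))) * \<Omega> (\<phi> p) (case_option w (%i. dph p (e i)))" .
 also have "\<Omega> (\<phi> p) (case_option w (%i. dph p (e i))) = gb (\<phi> p) w (\<nu> p)"
 proof (rule calibrated_slot[OF RB.metric_inner_form alt _ nu(4)[OF p e]])
  show "orthonormal_system (gb (\<phi> p)) (case_option (\<nu> p) (%i. dph p (e i)))"
   unfolding orthonormal_system_def
  proof (intro allI)
   fix i j
   have 1: "gb (\<phi> p) (\<nu> p) (dph p u) = 0" for u using nu(1)[OF p] by (simp add: normal_at_def)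
   have 2: "gb (\<phi> p) (dph p u) (\<nu> p) = 0" for u using 1 inner_formD(2)[OF RB.metric_inner_form] by metis
   have 3: "gb (\<phi> p) (dph p (e i)) (dph p (e j)) = (if i = j then 1 else 0)" for i j
    using e(1) by (simp add: orthonormal_system_def pullback_metric_def)
   show "gb (\<phi> p) (case_option (\<nu> p) (%i. dph p (e i)) i) (case_option (\<nu> p) (%i. dph p (e i)) j) = (if i = j then 1 else 0)"
    by (cases i; cases j) (simp_all add: 1 2 3 nu(2)[OF p])
  qed
  show "abs (\<Omega> (\<phi> p) u) <= 1" if "orthonormal_system (gb (\<phi> p)) u" for u
   using pre that by (simp add: pre_calibration_def)
 qed
 finally show ?thesis .
qed

lemma variation_derivatives:
 assumes var: "variation A B \<phi> D ep \<Phi>" and bd: "fixes_boundary \<phi> D ep \<Phi>"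
 defines "f \<equiv> %p. gb (\<phi> p) (vector_variation B \<Phi> p) (\<nu> p)"
 shows "integrable mu (%p. ind iD p * (mcn p * f p))"
  "HR (area_D A B gb D \<Phi>) (- real CARD('m) * (LINT p|mu. ind iD p * (mcn p * f p))) 0"
  "integrable mu (%p. ind iD p * f p)"
  "HR (volume_D A B \<Omega> D ep \<Phi>) (LINT p|mu. ind iD p * f p) 0"
proof -
 interpret V: bvari A B gb \<phi> D ep \<Phi> by unfold_locales (rule var bd)+
 interpret X: form_vari A B gb \<phi> D ep \<Phi> \<Omega> by unfold_locales (rule form)
 have 1: "ind iD p * gb (\<phi> p) (mc p) (V.W p) = ind iD p * (mcn p * f p)" for p
 proof (cases "p : iD")
  case True
  hence p: "p : D" using interior_subset by auto
  have "gb (\<phi> p) (mc p) (V.W p) = mcn p * gb (\<phi> p) (\<nu> p) (V.W p)"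
   unfolding nu(3)[OF p] using bilinear_lmul[OF inner_formD(1)[OF RB.metric_inner_form]] by simp
  thus ?thesis unfolding f_def using inner_formD(2)[OF RB.metric_inner_form, of "\<phi> p" "\<nu> p"] by simp
 qed simp
 show "integrable mu (%p. ind iD p * (mcn p * f p))"
  using V.mean_curvature_variation(1) unfolding 1 .
 show "HR (area_D A B gb D \<Phi>) (- real CARD('m) * (LINT p|mu. ind iD p * (mcn p * f p))) 0"
  using V.area_derivative unfolding 1 .
 have 2: "ind iD p * X.th (0, p) = ind iD p * f p" for p
 proof (cases "p : iD")
  case True
  hence p: "p : D" using interior_subset by auto
  have "X.th (0, p) = \<Omega> (\<phi> p) (case_option (V.W p) (%i. dph p (ax i))) / sqrt (det (gram (g p)))"
   unfolding X.th_def fst_conv snd_conv V.velocity_0 V.mdiff_slice_0[OF True] V.Phi_0[OF p] ..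
  also have "... = f p"
   unfolding calibration_pairing[OF p] f_def using det_gram_pos[OF g_inner[of p]] by simp
  finally show ?thesis by simp
 qed simp
 show "integrable mu (%p. ind iD p * f p)"
  using X.theta_integrable[of 0] V.eps_pos unfolding 2 by simp
 show "HR (volume_D A B \<Omega> D ep \<Phi>) (LINT p|mu. ind iD p * f p) 0"
  using X.volume_has_derivative unfolding X.Ith_def 2 .
qed

lemma constant_imp_critical:
 assumes c: "ALL p:D. mcn p = h_mean A B gb \<phi> D"
  and var: "variation A B \<phi> D ep \<Phi>" and bd: "fixes_boundary \<phi> D ep \<Phi>"
 shows "HR (J_D A B gb \<Omega> \<phi> D ep \<Phi>) 0 0"
proof -
 let ?h = "h_mean A B gb \<phi> D" and ?f = "%p. gb (\<phi> p) (vector_variation B \<Phi> p) (\<nu> p)"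
 note d = variation_derivatives[OF var bd]
 have e: "ind iD p * (mcn p * ?f p) = ?h * (ind iD p * ?f p)" for p
  using c interior_subset[of D] by (auto simp: indicator_def)
 have "((%t. area_D A B gb D \<Phi> t + real CARD('m) * ?h * volume_D A B \<Omega> D ep \<Phi> t) has_real_derivative
  - real CARD('m) * (LINT p|mu. ind iD p * (mcn p * ?f p)) + real CARD('m) * ?h * (LINT p|mu. ind iD p * ?f p)) (at 0)"
  by (intro DERIV_add DERIV_cmult d)
 thus ?thesis unfolding e J_D_def[abs_def] by simp
qed

text \<open>The volume term vanishes for every admissible \<open>t\<close>, so \<open>J_D\<close>
  and the area are the same function near 0.\<close>

lemma volume_preserving_J:
 assumes var: "variation A B \<phi> D ep \<Phi>" and vp: "volume_preserving A B \<Omega> D ep \<Phi>"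
  and J: "HR (J_D A B gb \<Omega> \<phi> D ep \<Phi>) 0 0"
 shows "HR (area_D A B gb D \<Phi>) 0 0"
proof (rule has_field_derivative_transform_within_open[OF J, where S="Iv ep"])
 show "0 : Iv ep" using var by (simp add: variation_def)
 show "J_D A B gb \<Omega> \<phi> D ep \<Phi> t = area_D A B gb D \<Phi> t" if "t : Iv ep" for t
  using vp that unfolding volume_preserving_def J_D_def by simp
qed simp

text \<open>The density is positive, and a nonempty open set of coordinates is not Lebesgue
  null.\<close>

lemma open_mu_pos:
 assumes U: "open U" "U <= D" "U ~= {}"
 shows "emeasure mu U > 0"
proof -
 obtain p where p: "p : U" using U by auto
 let ?k = "chart_at A p"
 have k: "?k : A" "p : cdom ?k" by (simp_all add: A.chart_at)
 let ?E = "U Int cdom ?k"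
 have Eo: "open ?E" by (intro open_Int U A.chartD(1) k)
 have Ei: "open (cmap ?k ` ?E)" by (rule chart_open_image[OF A.is_chart[OF k(1)] Eo]) simp
 have ED: "?E Int D = ?E" using U by auto
 have m: "(%y. ind (cmap ?k ` ?E) y * rho ?k y) : bm"
  by (rule rho_measurable[OF k(1)]) (use Eo in auto)
 have "emeasure mu ?E = (\<integral>\<^sup>+y\<in>cmap ?k ` ?E. ennreal (rho ?k y) \<partial>lborel)"
  using mu_emeasure[OF k(1), of ?E] Eo unfolding ED by simp
 also have "... = (nnI lborel (%y. ennreal (ind (cmap ?k ` ?E) y * rho ?k y)))"
  by (intro nn_integral_cong) (simp add: indicator_def)
 finally have e: "emeasure mu ?E = (nnI lborel (%y. ennreal (ind (cmap ?k ` ?E) y * rho ?k y)))" .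
 have "emeasure mu ?E ~= 0"
 proof
  assume "emeasure mu ?E = 0"
  hence "(nnI lborel (%y. ennreal (ind (cmap ?k ` ?E) y * rho ?k y))) = 0" using e by simp
  hence "AE y in lborel. ennreal (ind (cmap ?k ` ?E) y * rho ?k y) = 0"
   using m by (subst (asm) nn_integral_0_iff_AE) auto
  hence "AE y in lborel. y ~: cmap ?k ` ?E"
  proof (rule AE_mp, intro AE_I2 impI)
   fix y assume 0: "ennreal (ind (cmap ?k ` ?E) y * rho ?k y) = 0"
   show "y ~: cmap ?k ` ?E"
   proof
    assume y: "y : cmap ?k ` ?E"
    hence "rho ?k y > 0" using rho_pos[OF k(1), of y] by auto
    thus False using 0 y by simp
   qed
  qed
  hence "cmap ?k ` ?E : null_sets lborel" using Ei by (simp add: AE_iff_null_sets[symmetric])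
  hence "negligible (cmap ?k ` ?E)"
   by (simp add: negligible_iff_null_sets null_sets_completionI)
  thus False using open_not_negligible[OF Ei] p k by auto
 qed
 moreover have "emeasure mu ?E <= emeasure mu U" by (rule emeasure_mono) (use U sets_mu in auto)
 ultimately show ?thesis using zero_less_iff_neq_zero by (metis le_zero_eq)
qed

text \<open>The norm is a square root, but \<open>H = ||H|| \<nu>\<close> makes it the pairing of
  \<open>H\<close> with a smooth unit field. In charts this is \<open>N\<close> paired with a smooth
  extension of \<open>\<nu>\<close>, divided by \<open>m vol\<close>, hence continuous up to the
  boundary.\<close>

lemma mcn_local:
 assumes q: "q : D"
 obtains U h where "open U" "q : U" "continuous_on U h" "ALL p:U Int D. mcn p = (h p :: real)"
proof -
 let ?k = "chart_at A q" and ?k' = "chart_at B (\<phi> q)"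
 have k: "?k : A" "?k' : B" "q : cdom ?k" "\<phi> q : cdom ?k'" by (simp_all add: A.chart_at B.chart_at)
 interpret I: local_immersion "Gm ?k'" "cran ?k'" "F ?k ?k'" "rdom ?k ?k'"
  by (rule local_immersion_chart[OF k(1,2)])
 let ?n = "%y. to_chart B ?k' (\<phi> (cinv ?k y)) (\<nu> (cinv ?k y))"
 let ?X = "cmap ?k ` (D Int cdom ?k Int \<phi> -` cdom ?k')"
 have sm: "smooth_on ?n ?X"
  using cal k(1,2) unfolding calibrated_extended_tangent_space_def smooth_field_along_def by blast
 have "cmap ?k q : ?X" using k q by blast
 from smooth_onE[OF sm this] obtain U0 n where n: "Cinf n U0" "cmap ?k q : U0" "ALL y:U0 Int ?X. n y = ?n y"
  by metis
 define U1 where "U1 = U0 Int rdom ?k ?k'"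
 have U1: "open U1" unfolding U1_def by (intro open_Int Cinf_open[OF n(1)] I.open_U)
 have n1: "Cinf n U1" by (rule Cinf_subset[OF n(1) U1]) (simp add: U1_def)
 define h where "h p = Gm ?k' (F ?k ?k' (cmap ?k p)) (I.N (cmap ?k p)) (n (cmap ?k p)) / (I.vol (cmap ?k p) * real CARD('m))" for p
 define U where "U = cdom ?k Int cmap ?k -` U1"
 have oU: "open U" unfolding U_def by (rule chart_open_preimage[OF A.is_chart[OF k(1)] U1])
 have c1: "continuous_on U1 (%y. Gm ?k' (F ?k ?k' y) (I.N y) (n y) / (I.vol y * real CARD('m)))"
 proof (intro continuous_on_divide continuous_on_mult continuous_on_const)
  show "continuous_on U1 (%y. Gm ?k' (F ?k ?k' y) (I.N y) (n y))"
   by (rule Cinf_continuous[OF I.N_pairing_smooth[OF _ n1]]) (simp add: U1_def)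
  show "continuous_on U1 I.vol"
   by (rule continuous_on_subset[OF Cinf_continuous[OF I.vol_smooth]]) (simp add: U1_def)
  show "ALL y:U1. I.vol y * real CARD('m) ~= 0"
  proof
   fix y assume "y : U1"
   hence "I.vol y > 0" by (intro I.vol_pos) (simp add: U1_def)
   thus "I.vol y * real CARD('m) ~= 0" by simp
  qed
 qed
 have ch: "continuous_on U h" unfolding h_def
  by (rule continuous_on_compose2[OF c1 continuous_on_subset[OF A.chartD(6)[OF k(1)]]]) (auto simp: U_def)
 have "mcn p = h p" if p: "p : U Int D" for p
 proof -
  let ?y = "cmap ?k p"
  have pk: "p : cdom ?k" and y: "?y : U0" "?y : rdom ?k ?k'" and pD: "p : D" using p by (auto simp: U_def U1_def)
  have pk': "\<phi> p : cdom ?k'" using y(2) rdom_iff[OF k(1) pk] by blast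
  have ny: "n ?y = to_chart B ?k' (\<phi> p) (\<nu> p)"
  proof -
   have "?y : U0 Int ?X" using y pk pk' pD by blast
   thus ?thesis using n(3) A.chartD(3)[OF k(1) pk] by simp
  qed
  have Fy: "F ?k ?k' ?y = cmap ?k' (\<phi> p)" using A.chartD(3)[OF k(1) pk] by simp
  have v: "I.vol ?y * real CARD('m) > 0" using I.vol_pos[OF y(2)] by simp
  have "Gm ?k' (cmap ?k' (\<phi> p)) (I.N ?y) (n ?y) = (I.vol ?y * real CARD('m)) * gb (\<phi> p) (mc p) (\<nu> p)"
   unfolding N_mean_curvature[OF k(1,2) pk pk'] ny bilinear_lmul[OF I.G_bilinear[OF I.F_in[OF y(2)], unfolded Fy]]
    RB.metric_chart[OF k(2) pk'] by simp
  also have "gb (\<phi> p) (mc p) (\<nu> p) = mcn p"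
   unfolding nu(3)[OF pD] bilinear_lmul[OF inner_formD(1)[OF RB.metric_inner_form]] nu(2)[OF pD] by simp
  finally have "Gm ?k' (F ?k ?k' ?y) (I.N ?y) (n ?y) = (I.vol ?y * real CARD('m)) * mcn p" unfolding Fy .
  thus ?thesis unfolding h_def by (simp only: nonzero_mult_div_cancel_left[OF less_imp_neq[OF v, THEN not_sym]])
 qed
 moreover have "q : U" using k n(2) by (auto simp: U_def U1_def)
 ultimately show ?thesis using that[OF oU _ ch] by blast
qed

lemma mcn_continuous: "continuous_on D mcn"
 unfolding continuous_on_eq_continuous_within
proof
 fix q assume q: "q : D"
 obtain U h where U: "open U" "q : U" "continuous_on U h" "ALL p:U Int D. mcn p = h p"
  by (rule mcn_local[OF q])
 have "continuous (at q within D) h"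
  using U(1,2,3) by (simp add: continuous_on_eq_continuous_at continuous_at_imp_continuous_at_within)
 hence "(h \<longlongrightarrow> mcn q) (at q within D)" using U(2,4) q by (simp add: continuous_within)
 moreover have "eventually (%p. h p = mcn p) (at q within D)"
  unfolding eventually_at_topological using U(1,2,4) by (intro exI[of _ U]) simp
 ultimately have "(mcn \<longlongrightarrow> mcn q) (at q within D)" by (rule Lim_transform_eventually)
 thus "continuous (at q within D) mcn" by (simp add: continuous_within)
qed

text \<open>If the norm took one value in the interior, then by continuity and density of the
  interior it would be constant on \<open>D\<close>, and so equal to its mean value.\<close>

lemma mean_curvature_separation:
 assumes "~ (ALL p:D. mcn p = h_mean A B gb \<phi> D)"
 obtains p1 p2 where "p1 : iD" "p2 : iD" "mcn p2 < mcn p1"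
proof -
 have "EX p1:iD. EX p2:iD. mcn p2 ~= mcn p1"
 proof (rule ccontr)
  assume n: "~ ?thesis"
  obtain p0 where p0: "p0 : iD" using interior_nonempty by auto
  let ?c = "mcn p0"
  have "closedin (top_of_set D) {p : D. mcn p = ?c}"
   by (rule continuous_closedin_preimage_constant[OF mcn_continuous])
  hence "closed {p : D. mcn p = ?c}" using D_closed by (rule closedin_closed_trans)
  moreover have "iD <= {p : D. mcn p = ?c}" using n p0 interior_subset by blast
  ultimately have "closure iD <= {p : D. mcn p = ?c}" by (rule closure_minimal[rotated])
  hence c: "mcn p = ?c" if "p : D" for p using D_closure_interior that by blast
  have "emeasure mu iD <= emeasure mu D" by (rule emeasure_mono) (use interior_subset D_borel sets_mu in auto)
  hence "emeasure mu D > 0" using open_mu_pos[OF open_interior interior_subset interior_nonempty] by order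
  hence pos: "measure mu D > 0" by (simp add: mu.emeasure_eq_measure)
  have "(LINT p:D|mu. mcn p) = (LINT p|mu. ind D p * ?c)"
   unfolding set_lebesgue_integral_def by (intro Bochner_Integration.integral_cong) (auto simp: c indicator_def)
  also have "... = measure mu D * ?c" using D_borel sets_mu by simp
  finally have "h_mean A B gb \<phi> D = ?c" using pos by (simp add: h_mean_def mu_def[symmetric])
  thus False using assms c by simp
 qed
 thus ?thesis using that by (metis linorder_neqE_linordered_idom)
qed

end

section \<open>Volume preserving variations with non-constant mean curvature\<close>

lemma smooth_on_subset: "smooth_on f S ==> T <= S ==> smooth_on f T"
 unfolding smooth_on_def by (meson IntD1 IntD2 IntI subsetD)

context calibrated
begin

definition coef :: "('b, 'v) chart => (real \<times> (real^'m) => 'v) => real \<times> (real^'m) => real" where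
 "coef K' X z = form_in_chart B \<Omega> K' (X z)
   (case_option (FD X z (1, 0)) (%i. FD X z (0, ax i)))"

text \<open>\<open>X (s, y)\<close> pushes the immersion, read in charts, by \<open>s b \<nu>\<close> inside \<open>U\<close>; \<open>b\<close> is a bump function
 supported in \<open>Kq <= U\<close>, and \<open>q s\<close> is the rate at which \<open>\<Omega>\<close>-volume is swept when \<open>s\<close> has unit speed.\<close>

definition push ::
 "('a, real^'m) chart => ('b, 'v) chart => 'a set => 'a set => ('a => real) => real => (real \<times> (real^'m) => 'v) =>
  (real => real) => bool" where
 "push K K' U Kq b dl X q \<longleftrightarrow> K : A & K' : B & open U & U <= iD & U <= cdom K & \<phi> ` U <= cdom K' &
   closed Kq & Kq <= U & A.sfun b & (ALL p. 0 <= b p) & (ALL p. p ~: Kq --> b p = 0) & dl > 0 &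
   Cinf X (Iv dl \<times> cmap K ` U) & (ALL z:Iv dl \<times> cmap K ` U. X z : cran K') &
   (ALL s p. p : U --> s = 0 \<or> p ~: Kq --> X (s, cmap K p) = F K K' (cmap K p)) &
   (ALL s p. abs s < dl --> p : U --> FD X (s, cmap K p) (1, 0) = b p *\<^sub>R to_chart B K' (\<phi> p) (\<nu> p)) &
   Cinf q (Iv dl) & (ALL s. abs s < dl --> 0 < q s) &
   (ALL s. abs s < dl --> q s = (LINT y|lborel. ind (cmap K ` U) y * coef K' X (s, y)))"

lemma form_in_chart_scale:
 assumes "K' : B" "x : cran K'"
 shows "form_in_chart B \<Omega> K' x (case_option (c *\<^sub>R n) u) = c * form_in_chart B \<Omega> K' x (case_option n u)"
proof -
 have e: "case_option n u = (case_option 0 u)(None := n)" for n :: 'v by (auto split: option.split)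
 have "form_in_chart B \<Omega> K' x ((case_option 0 u)(None := c *\<^sub>R n)) = c *\<^sub>R form_in_chart B \<Omega> K' x ((case_option 0 u)(None := n))"
  by (rule linear_scale[OF B.form_in_chart_linear[OF form assms]])
 thus ?thesis unfolding e[symmetric] by simp
qed

text \<open>With \<open>\<nu>\<close> in the first slot the coordinate coefficient of the
  calibration is the volume density. At displacement 0 the swept rate is therefore the integral of
  the bump against the volume element.\<close>

lemma normal_coefficient:
 assumes k: "K : A" "K' : B" "p : cdom K" "\<phi> p : cdom K'" and p: "p : D"
 shows "form_in_chart B \<Omega> K' (cmap K' (\<phi> p)) (case_option (to_chart B K' (\<phi> p) (\<nu> p))
   (%i. FD (F K K') (cmap K p) (ax i))) = rho K (cmap K p)"
proof -
 let ?et = "%u. \<Omega> (\<phi> p) (case_option (\<nu> p) (%i. dph p (u i)))"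
 have alt: "alternating_multilinear (\<Omega> (\<phi> p))" using form by (simp add: smooth_form_def)
 have "dph p (from_chart A K p (ax i)) = from_chart B K' (\<phi> p) (FD (F K K') (cmap K p) (ax i))" for i
  unfolding mdiff_phi(2)[OF k] A.to_from_chart[OF k(1,3)] ..
 hence "form_in_chart B \<Omega> K' (cmap K' (\<phi> p)) (case_option (to_chart B K' (\<phi> p) (\<nu> p)) (%i. FD (F K K') (cmap K p) (ax i)))
  = ?et (%i. from_chart A K p (ax i))"
  unfolding form_in_chart_def B.chartD(3)[OF k(2,4)]
  by (intro arg_cong[where f="\<Omega> (\<phi> p)"] ext) (simp add: B.from_to_chart[OF k(2,4)] split: option.split)
 also have "... = det (matrix (from_chart A K p)) * ?et (%i. ax i)"
  by (rule alternating_multilinear_linear_axis[OF alternating_multilinear_case_option[OF alt mdiff_phi_linear]])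
 also have "... = rho K (cmap K p)"
  unfolding calibration_pairing[OF p] nu(2)[OF p] rho_point[OF k(1,3)] by simp
 finally show ?thesis .
qed

text \<open>The displacement is affine in the ambient chart instead of geodesic, so its velocity is
  the same vector, the bump times \<open>\<nu>\<close> in coordinates, at every displacement. A
  small \<open>dl\<close> keeps the image inside the chart and, by continuity from displacement 0,
  the rate \<open>q\<close> positive.\<close>

lemma push_exists:
 assumes p0: "p0 : iD" and U0: "open U0" "p0 : U0"
 obtains K K' U Kq b dl X q N where "push K K' U Kq b dl X q" "U <= U0" "open N" "p0 : N" "N <= U" "ALL p:N. b p = 1"
proof -
 define K where "K = chart_at A p0"
 define K' where "K' = chart_at B (\<phi> p0)"
 have k: "K : A" "K' : B" "p0 : cdom K" "\<phi> p0 : cdom K'"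
  by (simp_all add: K_def K'_def A.chart_at B.chart_at)
 interpret I: local_immersion "Gm K'" "cran K'" "F K K'" "rdom K K'"
  by (rule local_immersion_chart[OF k(1,2)])
 define U where "U = U0 Int iD Int cdom K Int \<phi> -` cdom K'"
 have "open (\<phi> -` cdom K')" by (rule open_vimage[OF B.chartD(1)[OF k(2)] phi_continuous])
 hence Uo: "open U" unfolding U_def by (intro open_Int U0 open_interior A.chartD(1) k(1))
 have Us: "U <= U0" "U <= iD" "U <= cdom K" "\<phi> ` U <= cdom K'" "p0 : U" "U <= D"
  using p0 U0 k interior_subset[of D] by (auto simp: U_def)
 define Y where "Y = cmap K ` U"
 have Yo: "open Y" unfolding Y_def by (rule chart_open_image[OF A.is_chart[OF k(1)] Uo Us(3)])
 have "U <= cdom K Int \<phi> -` cdom K'" by (auto simp: U_def)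
 hence YU: "Y <= rdom K K'" "Y <= cran K" unfolding Y_def by blast+
 define y0 where "y0 = cmap K p0"
 have y0: "y0 : Y" using Us(5) by (simp add: y0_def Y_def)
 \<comment> \<open>The closed box is the domain of integration for \<open>q\<close>, since smooth
   dependence on a parameter was established over boxes; the bump will be supported in a ball inside
   it.\<close>
 obtain a c where ac: "cbox a c <= Y" "y0 : box a c" "ALL i:Basis. a \<bullet> i < c \<bullet> i"
  by (rule open_contains_cbox[OF Yo y0])
 obtain rr where rr: "rr > 0" "cball y0 rr <= box a c"
  using open_contains_cball[of "box a c"] ac(2) open_box by blast
 have cb: "cball y0 rr <= cbox a c" "cball y0 rr <= Y" "cball y0 rr <= cran K"
  using rr(2) box_subset_cbox[of a c] ac(1) YU by blast+
 define Kq where "Kq = cinv K ` cball y0 rr"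
 have Kc: "closed Kq" unfolding Kq_def by (rule A.chart_cball_closed(1)[OF k(1) cb(3) compact_imp_closed])
 have K_iff: "p : Kq \<longleftrightarrow> cmap K p : cball y0 rr" if p: "p : cdom K" for p
 proof
  assume "p : Kq"
  then obtain y where y: "y : cball y0 rr" "p = cinv K y" unfolding Kq_def by blast
  thus "cmap K p : cball y0 rr" using A.chartD(4)[OF k(1), of y] cb(3) by (metis subsetD)
 next
  assume "cmap K p : cball y0 rr"
  thus "p : Kq" unfolding Kq_def using A.chartD(3)[OF k(1) p] by (metis imageI)
 qed
 have KU: "Kq <= U"
 proof
  fix p assume "p : Kq"
  then obtain y where y: "y : cball y0 rr" "p = cinv K y" unfolding Kq_def by blast
  then obtain q where "q : U" "y = cmap K q" using cb(2) unfolding Y_def by blast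
  thus "p : U" using y(2) A.chartD(3)[OF k(1), of q] Us(3) by auto
 qed
 obtain b where b: "A.sfun b" "!!q. 0 <= b q" "!!q. b q <= 1"
  "!!q. q : cdom K ==> dist (cmap K q) y0 <= rr / 2 ==> b q = 1" "!!q. q ~: cinv K ` cball y0 rr ==> b q = 0"
  by (rule A.sfun_bump[OF k(1) rr(1) cb(3) compact_imp_closed]) (assumption, metis)
 have b0: "b p = 0" if "p ~: Kq" for p using b(5) that unfolding Kq_def .
 define n where "n y = to_chart B K' (\<phi> (cinv K y)) (\<nu> (cinv K y))" for y
 have ns: "Cinf n Y"
 proof -
  have "smooth_on (%y. to_chart B K' (\<phi> (cinv K y)) (\<nu> (cinv K y))) (cmap K ` (D Int cdom K Int \<phi> -` cdom K'))"
   using cal k(1,2) unfolding calibrated_extended_tangent_space_def smooth_field_along_def by blast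
  hence "smooth_on n Y" unfolding n_def[abs_def] Y_def by (rule smooth_on_subset) (rule image_mono, use Us in blast)
  with Yo show ?thesis by (rule smooth_on_open_iff[THEN iffD1])
 qed
 have Fs: "Cinf (F K K') Y" by (rule Cinf_subset[OF I.F_smooth Yo YU(1)])
 have bs: "Cinf (%y. b (cinv K y)) Y" by (rule Cinf_subset[OF A.sfunD[OF b(1) k(1)] Yo YU(2)])
 define be where "be y = b (cinv K y)" for y
 define X where "X z = F K K' (snd z) + (fst z * be (snd z)) *\<^sub>R n (snd z)" for z :: "real \<times> (real^'m)"
 have oUY: "open (UNIV \<times> Y)" by (intro open_Times Yo) simp
 have sn: "Cinf snd ((UNIV :: real set) \<times> Y)" and fs: "Cinf fst ((UNIV :: real set) \<times> Y)"
  by (rule Cinf_linear[OF bounded_linear_snd oUY], rule Cinf_linear[OF bounded_linear_fst oUY])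
 have sY: "snd z : Y" if "z : UNIV \<times> Y" for z :: "real \<times> (real^'m)" using that by auto
 have Xs: "Cinf X (UNIV \<times> Y)"
  unfolding X_def be_def
  by (intro Cinf_add Cinf_scaleR Cinf_mult fs Cinf_compose[OF Fs sn sY] Cinf_compose[OF bs sn sY] Cinf_compose[OF ns sn sY])
 define Z where "Z = (UNIV \<times> Y) Int X -` (cran K')"
 have Zo: "open Z" unfolding Z_def
  by (rule continuous_open_preimage[OF Cinf_continuous[OF Xs] oUY B.chartD(2)[OF k(2)]])
 have X0: "X (s, y) = F K K' y" if "s = 0 \<or> be y = 0" for s y using that by (auto simp: X_def)
 have FY: "F K K' y : cran K'" if "y : Y" for y by (rule I.F_in) (use that YU in blast)
 have "{0} \<times> cball y0 rr <= Z"
 proof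
  fix z assume "z : {0::real} \<times> cball y0 rr"
  then obtain y where y: "z = (0, y)" "y : Y" using cb(2) by blast
  thus "z : Z" using FY[OF y(2)] X0[of 0 y] by (simp add: Z_def)
 qed
 moreover have "compact ({0::real} \<times> cball y0 rr)" by (intro compact_Times) auto
 \<comment> \<open>Over the ball compactness provides a uniform displacement; off the ball the bump
   is 0 and nothing moves, so the same \<open>dl1\<close> serves all of \<open>Y\<close>.\<close>
 ultimately obtain dl1 where dl1: "dl1 > 0" "(UN z:{0} \<times> cball y0 rr. ball z dl1) <= Z"
  using compact_subset_open_imp_ball_epsilon_subset[OF _ Zo] by metis
 have Xin: "X (s, y) : cran K'" if s: "abs s < dl1" and y: "y : Y" for s y
 proof (cases "y : cball y0 rr")
  case True
  have "(s, y) : ball (0, y) dl1" using s by (simp add: dist_prod_def)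
  hence "(s, y) : Z" using dl1(2) True by blast
  thus ?thesis by (simp add: Z_def)
 next
  case False
  obtain p where p: "p : U" "y = cmap K p" using y unfolding Y_def by blast
  hence "p : cdom K" using Us by auto
  hence "be y = 0" using False p(2) K_iff b0 A.chartD(3)[OF k(1)] by (simp add: be_def)
  thus ?thesis using FY[OF y] X0 by simp
 qed
 have bep: "be (cmap K p) = b p" "n (cmap K p) = to_chart B K' (\<phi> p) (\<nu> p)" "cmap K p : Y" if "p : U" for p
  using A.chartD(3)[OF k(1), of p] that Us(3) by (auto simp: be_def n_def Y_def)
 have DX: "FD X (s, y) (1, 0) = be y *\<^sub>R n y" if y: "y : Y" for s y
 proof -
  have "HD (%t. (t, y)) (%h. (h, 0)) s" by (auto intro!: derivative_eq_intros)
  from has_derivative_compose[OF this Cinf_deriv[OF Xs, of "(s, y)"]] y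
  have "HD (%t. X (t, y)) (%h. FD X (s, y) (h, 0)) s" by simp
  moreover have "HD (%t. X (t, y)) (%h. (h * be y) *\<^sub>R n y) s"
   unfolding X_def by (auto intro!: derivative_eq_intros)
  ultimately have "(%h. FD X (s, y) (h, 0)) = (%h. (h * be y) *\<^sub>R n y)" by (rule has_derivative_unique)
  from fun_cong[OF this, of 1] show ?thesis by simp
 qed
 have DX0: "FD X (0, y) (0, u) = I.dF y u" if y: "y : Y" for y u
 proof -
  have "HD (%x. (0::real, x)) (%h. (0, h)) y" by (auto intro!: derivative_eq_intros)
  from has_derivative_compose[OF this Cinf_deriv[OF Xs, of "(0, y)"]] y
  have "HD (%x. X (0, x)) (%h. FD X (0, y) (0, h)) y" by simp
  moreover have "(%x. X (0, x)) = F K K'" using X0 by (intro ext) simp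
  ultimately have "HD (F K K') (%h. FD X (0, y) (0, h)) y" by (simp only:)
  from frechet_derivative_at[OF this] show ?thesis by (simp only: fun_eq_iff)
 qed
 let ?B = "Iv dl1 \<times> Y"
 have oB: "open ?B" by (intro open_Times Yo) simp
 have XB: "Cinf X ?B" by (rule Cinf_subset[OF Xs oB]) auto
 have XinB: "X z : cran K'" if "z : ?B" for z using Xin[of "fst z" "snd z"] that by (cases z) auto
 have cs: "Cinf (coef K' X) ?B"
  unfolding coef_def[abs_def]
  by (rule B.pullback_coefficient_smooth[OF form k(2) XB XinB]) (assumption | rule Cinf_frechet[OF XB])+
 have coef_eq: "coef K' X (s, y) = be y * form_in_chart B \<Omega> K' (X (s, y)) (case_option (n y) (%i. FD X (s, y) (0, ax i)))"
  if "abs s < dl1" "y : Y" for s y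
  unfolding coef_def DX[OF that(2)] by (rule form_in_chart_scale[OF k(2) Xin[OF that]])
 have coef_0: "coef K' X (0, cmap K p) = b p * rho K (cmap K p)" if p: "p : U" for p
 proof -
  have pk: "p : cdom K" "\<phi> p : cdom K'" "p : D" using p Us by auto
  have "coef K' X (0, cmap K p) = b p * form_in_chart B \<Omega> K' (X (0, cmap K p)) (case_option (n (cmap K p)) (%i. I.dF (cmap K p) (ax i)))"
   using coef_eq[of 0 "cmap K p"] dl1(1) bep[OF p] DX0[OF bep(3)[OF p]] by simp
  also have "X (0, cmap K p) = cmap K' (\<phi> p)" using X0[of 0 "cmap K p"] A.chartD(3)[OF k(1) pk(1)] by simp
  finally show ?thesis unfolding bep(2)[OF p] normal_coefficient[OF k(1,2) pk] .
 qed
 define q where "q s = integral (cbox a c) (%y. coef K' X (s, y))" for s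
 have qs: "Cinf q (Iv dl1)" unfolding q_def[abs_def] by (rule Cinf_parametric_integral[OF cs ac(1)])
 have cc: "continuous_on (cbox a c) (%y. coef K' X (s, y))" if s: "abs s < dl1" for s
  by (rule continuous_on_compose2[OF Cinf_continuous[OF cs]])
   (insert s ac(1), auto intro!: continuous_intros)
 have qi: "q s = (LINT y|lborel. ind (cmap K ` U) y * coef K' X (s, y))" if s: "abs s < dl1" for s
 proof -
  have i: "set_integrable lborel (cbox a c) (%y. coef K' X (s, y))"
   unfolding set_integrable_def by (rule borel_integrable_compact[OF compact_cbox cc[OF s]])
  have "q s = (LINT y|lborel. ind (cbox a c) y *\<^sub>R coef K' X (s, y))"
   unfolding q_def set_borel_integral_eq_integral(2)[OF i, symmetric] set_lebesgue_integral_def ..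
  also have "... = (LINT y|lborel. ind (cmap K ` U) y * coef K' X (s, y))"
  proof (rule Bochner_Integration.integral_cong[OF refl])
   fix y
   have "coef K' X (s, y) = 0" if y: "y : Y" "y ~: cbox a c"
   proof -
    obtain p where p: "p : U" "y = cmap K p" using y unfolding Y_def by blast
    hence "p ~: Kq" using K_iff Us cb(1) y(2) by blast
    hence "be y = 0" using bep(1)[OF p(1)] p(2) b0 by simp
    thus ?thesis using coef_eq[OF s y(1)] by simp
   qed
   thus "ind (cbox a c) y *\<^sub>R coef K' X (s, y) = ind (cmap K ` U) y * coef K' X (s, y)"
    using ac(1) unfolding Y_def[symmetric] by (auto simp: indicator_def)
  qed
  finally show ?thesis .
 qed
 have q0: "q 0 > 0"
 proof -
  have nn: "0 <= coef K' X (0, y)" if y: "y : Y" for y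
  proof -
   obtain p where p: "p : U" "y = cmap K p" using y unfolding Y_def by blast
   thus ?thesis using coef_0[OF p(1)] b(2)[of p] rho_pos[OF k(1), of y] y YU by auto
  qed
  have z: "abs (0::real) < dl1" using dl1 by simp
  have hi: "((%y. coef K' X (0, y)) has_integral q 0) (cbox a c)"
   unfolding q_def by (rule integrable_integral[OF integrable_continuous[OF cc[OF z]]])
  have "q 0 >= 0" by (rule has_integral_nonneg[OF hi]) (use nn ac(1) in blast)
  moreover have "q 0 ~= 0"
  proof
   assume "q 0 = 0"
   \<comment> \<open>A continuous nonnegative integrand with integral 0 vanishes on the box, but at
     \<open>y0\<close> it equals the volume density, since the bump is 1 there.\<close>
   hence "coef K' X (0, y0) = 0"
    using has_integral_0_cbox_imp_0[OF cc[OF z], of y0] hi nn ac box_subset_cbox[of a c] by (metis empty_iff subsetD)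
   moreover have "b p0 = 1" using b(4)[OF k(3)] rr(1) by (simp add: y0_def)
   moreover have "rho K y0 > 0" using rho_pos[OF k(1), of y0] k(3) by (simp add: y0_def)
   ultimately show False using coef_0[OF Us(5)] by (simp add: y0_def)
  qed
  ultimately show ?thesis by simp
 qed
 have "isCont q 0" using Cinf_continuous[OF qs] dl1(1) by (simp add: continuous_on_eq_continuous_at)
 hence "eventually (%s. q s > 0) (at 0)" using q0 by (intro order_tendstoD(1)) (simp_all add: isCont_def)
 then obtain d where d: "d > 0" "ALL s. s ~= 0 & dist s 0 < d --> q s > 0" unfolding eventually_at by auto
 define dl where "dl = min d dl1"
 have dl: "dl > 0" "dl <= dl1" "!!s. abs s < dl ==> q s > 0" using d dl1 q0 by (auto simp: dl_def) (metis)
 have sub: "Iv dl \<times> cmap K ` U <= ?B" using dl(2) unfolding Y_def by auto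
 have "push K K' U Kq b dl X q"
  unfolding push_def
 proof (intro conjI allI impI ballI)
  show "Cinf X (Iv dl \<times> cmap K ` U)"
   by (rule Cinf_subset[OF XB _ sub]) (intro open_Times Yo[unfolded Y_def] open_greaterThanLessThan)
  show "X z : cran K'" if "z : Iv dl \<times> cmap K ` U" for z using XinB sub that by blast
  show "Cinf q (Iv dl)" by (rule Cinf_subset[OF qs]) (use dl(2) in auto)
  show "X (s, cmap K p) = F K K' (cmap K p)" if "p : U" "s = 0 \<or> p ~: Kq" for s p
   using X0 bep(1)[OF that(1)] that(2) b0 by metis
  show "FD X (s, cmap K p) (1, 0) = b p *\<^sub>R to_chart B K' (\<phi> p) (\<nu> p)" if "abs s < dl" "p : U" for s p
   using DX[OF bep(3)[OF that(2)]] bep(1,2)[OF that(2)] by simp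
  show "q s = (LINT y|lborel. ind (cmap K ` U) y * coef K' X (s, y))" if "abs s < dl" for s
   using qi that dl(2) by simp
 qed (use k Uo Us Kc KU b(1,2) b0 dl in auto)
 moreover define N where "N = U Int (cdom K Int cmap K -` ball y0 (rr / 2))"
 have "open N" unfolding N_def by (intro open_Int Uo chart_open_preimage[OF A.is_chart[OF k(1)] open_ball])
 moreover have "p0 : N" using Us(5) k(3) rr(1) by (simp add: N_def y0_def)
 moreover have "ALL p:N. b p = 1" using b(4) by (auto simp: N_def dist_commute)
 ultimately show ?thesis using that Us(1) N_def by blast
qed

end

section \<open>A smoothness criterion for maps on the product manifold\<close>

context submanifold
begin

text \<open>One pair of charts near each point suffices: transition maps carry the representative to
  all other charts, and continuity follows from the same representatives. The neighbourhoods are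
  open in the full product even when \<open>(t, p)\<close> lies on the boundary of \<open>S\<close>,
  which suits maps that are defined beyond \<open>D\<close>.\<close>

lemma smooth_map_on_prodI:
 fixes \<Phi> :: "real \<times> 'a => 'b"
 assumes loc: "!!t p. (t, p) : S ==> EX K0:A. EX K0':B. EX N f V. open N & (t, p) : N & N <= UNIV \<times> cdom K0 &
  Cinf f V & f ` V <= cran K0' & (ALL s q. (s, q) : N --> (s, cmap K0 q) : V & \<Phi> (s, q) = cinv K0' (f (s, cmap K0 q)))"
 shows "smooth_map_on (prod_atlas A) B S \<Phi>"
 unfolding smooth_map_on_def
proof (intro conjI ballI)
 have "isCont \<Phi> (t, p)" if tp: "(t, p) : S" for t p
 proof -
  obtain K0 K0' N f V where k: "K0 : A" "K0' : B" and N: "open N" "(t, p) : N" "N <= UNIV \<times> cdom K0"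
   and f: "Cinf f V" "f ` V <= cran K0'"
   and \<Phi>: "ALL s q. (s, q) : N --> (s, cmap K0 q) : V & \<Phi> (s, q) = cinv K0' (f (s, cmap K0 q))"
   using loc[OF tp] by (elim bexE exE conjE) (rule that)
  have "continuous_on N (%z. (fst z, cmap K0 (snd z)))"
   by (intro continuous_intros continuous_on_compose2[OF A.chartD(6)[OF k(1)]]) (use N(3) in auto)
  hence "continuous_on N (%z. f (fst z, cmap K0 (snd z)))"
   by (rule continuous_on_compose2[OF Cinf_continuous[OF f(1)]]) (use \<Phi> in auto)
  hence "continuous_on N (%z. cinv K0' (f (fst z, cmap K0 (snd z))))"
   by (rule continuous_on_compose2[OF B.chartD(7)[OF k(2)]]) (use f(2) \<Phi> in auto)
  hence "continuous_on N \<Phi>" by (rule continuous_on_eq) (use \<Phi> in auto)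
  thus ?thesis using N by (simp add: continuous_on_eq_continuous_at)
 qed
 thus "continuous_on S \<Phi>" by (intro continuous_at_imp_continuous_on) auto
next
 fix KP K' assume kP: "KP : prod_atlas A" and k': "K' : B"
 obtain K where k1: "K : A" "KP = prod_chart K" using kP unfolding prod_atlas_eq by blast
 show "smooth_on (cmap K' o \<Phi> o cinv KP) (cmap KP ` (S Int cdom KP Int \<Phi> -` cdom K'))"
 proof (rule smooth_onI)
  fix z assume "z : cmap KP ` (S Int cdom KP Int \<Phi> -` cdom K')"
  then obtain w where w: "w : S" "w : cdom KP" "\<Phi> w : cdom K'" "z = cmap KP w" by blast
  obtain t p where wt: "w = (t, p)" by (cases w)
  have p: "p : cdom K" using w(2) unfolding k1(2) wt by simp
  have z: "z = pack (t, cmap K p)" unfolding w(4) k1(2) wt prod_chart_def by simp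
  have tp: "(t, p) : S" using w(1) wt by simp
  obtain K0 K0' N f V where k: "K0 : A" "K0' : B" and N: "open N" "(t, p) : N" "N <= UNIV \<times> cdom K0"
   and f: "Cinf f V" "f ` V <= cran K0'"
   and \<Phi>: "ALL s q. (s, q) : N --> (s, cmap K0 q) : V & \<Phi> (s, q) = cinv K0' (f (s, cmap K0 q))"
   using loc[OF tp] by (elim bexE exE conjE) (rule that)
  obtain Oa Ob where O: "open Oa" "open Ob" "(t, p) : Oa \<times> Ob" "Oa \<times> Ob <= N"
   using N(1,2) by (rule open_prod_elim)
  define Y where "Y = cmap K ` ((cdom K Int cdom K0) Int Ob)"
  have Yo: "open Y" unfolding Y_def
   by (intro chart_open_image[OF A.is_chart[OF k1(1)]] open_Int A.chartD(1) k1(1) k(1) O(2)) auto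
  have Yq: "EX q. y = cmap K q & q : cdom K & q : cdom K0 & q : Ob & cinv K y = q" if "y : Y" for y
   using that A.chartD(3)[OF k1(1)] unfolding Y_def by blast
  let ?ta = "%y. (cmap K0 o cinv K) y"
  have ta: "Cinf ?ta Y"
   by (rule Cinf_subset[OF A.transition_smooth[OF k1(1) k(1)] Yo]) (auto simp: Y_def)
  have oOY: "open (Oa \<times> Y)" by (intro open_Times O Yo)
  have sY: "snd x : Y" if "x : Oa \<times> Y" for x using that by auto
  define G where "G x = f (fst x, ?ta (snd x))" for x
  have inN: "(s, cinv K y) : N" if sy: "s : Oa" "y : Y" for s y
  proof -
   obtain q where q: "q : Ob" "cinv K y = q" using Yq[OF sy(2)] by (elim exE conjE)
   have "(s, q) : Oa \<times> Ob" using sy(1) q(1) by (rule SigmaI)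
   thus ?thesis unfolding q(2) by (rule subsetD[OF O(4)])
  qed
  have ta2: "Cinf (%x. ?ta (snd x)) (Oa \<times> Y)"
   by (rule Cinf_compose[OF ta Cinf_linear[OF bounded_linear_snd oOY] sY])
  have G: "Cinf G (Oa \<times> Y)" unfolding G_def
  proof (rule Cinf_compose[OF f(1)])
   show "Cinf (%x. (fst x, ?ta (snd x))) (Oa \<times> Y)"
    by (rule Cinf_Pair[OF Cinf_linear[OF bounded_linear_fst oOY] ta2])
   show "(fst x, ?ta (snd x)) : V" if "x : Oa \<times> Y" for x using inN[of "fst x" "snd x"] that \<Phi> by auto
  qed
  have G\<Phi>: "\<Phi> (s, cinv K y) = cinv K0' (G (s, y))" "G (s, y) : cran K0'" if sy: "s : Oa" "y : Y" for s y
  proof -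
   note 1 = \<Phi>[rule_format, OF inN[OF sy]]
   thus "\<Phi> (s, cinv K y) = cinv K0' (G (s, y))" by (simp add: G_def)
   have "G (s, y) : f ` V" using 1 by (simp add: G_def)
   thus "G (s, y) : cran K0'" using f(2) by blast
  qed
  let ?h = "%x. (cmap K' o cinv K0') x" and ?Wh = "cmap K0' ` (cdom K0' Int cdom K')"
  have h: "Cinf ?h ?Wh" by (rule B.transition_smooth[OF k(2) k'])
  define U2 where "U2 = Oa \<times> Y Int G -` ?Wh"
  have oU2: "open U2" unfolding U2_def
   by (rule continuous_open_preimage[OF Cinf_continuous[OF G] oOY Cinf_open[OF h]])
  have G2: "Cinf G U2" by (rule Cinf_subset[OF G oU2]) (simp add: U2_def)
  have hG: "Cinf (%x. ?h (G x)) U2" by (rule Cinf_compose[OF h G2]) (simp add: U2_def)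
  have ou: "open (pack ` U2)" by (rule open_pack_image[OF oU2])
  have "Cinf (%x. ?h (G (unpack x))) (pack ` U2)"
   by (rule Cinf_compose[OF hG Cinf_linear[OF bounded_linear_unpack ou]]) auto
  moreover have "z : pack ` U2"
  proof -
   have pY: "cmap K p : Y" using p N O(3) unfolding Y_def by auto
   have t: "t : Oa" using O(3) by auto
   have c: "cinv K (cmap K p) = p" by (rule A.chartD(3)[OF k1(1) p])
   have e: "\<Phi> (t, p) = cinv K0' (G (t, cmap K p))" using G\<Phi>(1)[OF t pY] unfolding c .
   have "\<Phi> (t, p) : cdom K'" using w(3) wt by simp
   hence "cinv K0' (G (t, cmap K p)) : cdom K0' Int cdom K'"
    using e B.chartD(5)[OF k(2) G\<Phi>(2)[OF t pY]] by simp
   hence "cmap K0' (cinv K0' (G (t, cmap K p))) : ?Wh" by (rule imageI)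
   hence "G (t, cmap K p) : ?Wh" unfolding B.chartD(4)[OF k(2) G\<Phi>(2)[OF t pY]] .
   hence "(t, cmap K p) : U2" using t pY by (simp add: U2_def)
   thus ?thesis unfolding z by (rule imageI)
  qed
  moreover have "?h (G (unpack x)) = (cmap K' o \<Phi> o cinv KP) x" if x: "x : pack ` U2" for x
  proof -
   obtain s y where sy: "x = pack (s, y)" "s : Oa" "y : Y" using x by (auto simp: U2_def)
   have "y : cran K" using sy(3) by (auto simp: Y_def)
   from cinv_prod_chart[OF A.is_chart[OF k1(1)] this, of s]
   show ?thesis using G\<Phi>(1)[OF sy(2,3)] unfolding sy(1) k1(2) by simp
  qed
  ultimately show "EX U F. Cinf F U & z : U & (ALL y:U Int cmap KP ` (S Int cdom KP Int \<Phi> -` cdom K'). F y = (cmap K' o \<Phi> o cinv KP) y)"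
   by (intro exI[of _ "pack ` U2"] exI[of _ "%x. ?h (G (unpack x))"]) simp
 qed
qed

end

section \<open>Driving a push at constant flux\<close>

context calibrated
begin

lemma pushD:
 assumes "push K K' U Kq b dl X q"
 shows "K : A" "K' : B" "open U" "U <= iD" "U <= cdom K" "\<phi> ` U <= cdom K'"
  "closed Kq" "Kq <= U" "A.sfun b" "!!p. 0 <= b p" "!!p. p ~: Kq ==> b p = 0" "dl > 0"
  "Cinf X (Iv dl \<times> cmap K ` U)" "!!z. z : Iv dl \<times> cmap K ` U ==> X z : cran K'"
  "!!s p. p : U ==> s = 0 \<or> p ~: Kq ==> X (s, cmap K p) = F K K' (cmap K p)"
  "!!s p. abs s < dl ==> p : U ==> FD X (s, cmap K p) (1, 0) = b p *\<^sub>R to_chart B K' (\<phi> p) (\<nu> p)"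
  "Cinf q (Iv dl)" "!!s. abs s < dl ==> 0 < q s"
  "!!s. abs s < dl ==> q s = (LINT y|lborel. ind (cmap K ` U) y * coef K' X (s, y))"
 using assms unfolding push_def by blast+

text \<open>The displacement solves \<open>R' = sg / q(R)\<close> with \<open>R 0 = 0\<close>.
  Dividing by the swept rate makes the flux of the driven push equal to \<open>sg\<close> at every
  time.\<close>

definition drive :: "real => real => real => (real => real) => (real => real) => bool" where
 "drive sg ep dl q R \<longleftrightarrow> Cinf R (Iv ep) & R 0 = 0 &
   (ALL t. abs t < ep --> abs (R t) < dl & HR R (sg / q (R t)) t)"

text \<open>Separation of variables: the solution is the inverse of an antiderivative of
  \<open>q\<close>, run backwards in time when \<open>sg = -1\<close>. Since
  \<open>|sg| = 1\<close>, the time interval is unchanged.\<close>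

lemma drive_exists:
 assumes P: "push K K' U Kq b dl X q" and sg: "abs (sg) = 1"
 obtains ep R where "ep > 0" "drive sg ep dl q R"
proof -
 note dl = pushD(12)[OF P] and q = pushD(17)[OF P] and qp = pushD(18)[OF P]
 define d where "d = dl / 2"
 have d: "d > 0" "d < dl" using dl by (simp_all add: d_def)
 \<comment> \<open>Integrating from \<open>-d\<close> gives one formula on both sides of 0; the
   subtracted constant normalises \<open>Q 0 = 0\<close>.\<close>
 define Q where "Q s = integral {-d..s} q - integral {-d..0} q" for s
 have qc: "continuous_on {-d..d} q" by (rule continuous_on_subset[OF Cinf_continuous[OF q]]) (use d in auto)
 have "HR Q (q s) s" if s: "abs s < d" for s
 proof -
  have "((%s. integral {-d..s} q) has_real_derivative q s) (at s within {-d..d})"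
   by (rule integral_has_real_derivative[OF qc]) (use s in auto)
  moreover have "at s within {-d..d} = at s" by (rule at_within_interior) (use s in auto)
  ultimately show ?thesis unfolding Q_def by (auto intro!: derivative_eq_intros)
 qed
 moreover have "Cinf q {-d<..<d}" by (rule Cinf_subset[OF q]) (use d in auto)
 moreover have "q s > 0" if "abs s < d" for s using qp[of s] that d by simp
 moreover have "Q 0 = 0" by (simp add: Q_def)
 ultimately obtain ep r where r: "ep > 0" "Cinf r (Iv ep)" "r 0 = 0" "!!t. abs t < ep ==> abs (r t) < d"
  "!!t. abs t < ep ==> HR r (inverse (q (r t))) t"
  using smooth_inverse_function[OF d(1), of Q q] by metis
 have "drive sg ep dl q (%t. r (sg * t))"
  unfolding drive_def
 proof (intro conjI allI impI)
  have st: "abs (sg * t) = abs t" for t using sg by (simp add: abs_mult)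
  show "Cinf (%t. r (sg * t)) (Iv ep)"
  proof (rule Cinf_compose[OF r(2) Cinf_linear])
   show "sg * t : Iv ep" if "t : Iv ep" for t using st[of t] that by (auto simp: abs_less_iff abs_if split: if_splits)
  qed (auto intro: bounded_linear_mult_right)
  show "r (sg * 0) = 0" using r(3) by simp
  fix t assume t: "abs t < ep"
  show "abs (r (sg * t)) < dl" using r(4)[of "sg * t"] t d st[of t] by simp
  have "HR r (inverse (q (r (sg * t)))) (sg * t)" using r(5)[of "sg * t"] t st[of t] by simp
  moreover have "HR (%t. sg * t) sg t" by (auto intro!: derivative_eq_intros)
  ultimately show "HR (%t. r (sg * t)) (sg / q (r (sg * t))) t"
   using DERIV_chain2[of r "inverse (q (r (sg * t)))" "%t. sg * t" t sg UNIV] by (simp add: divide_inverse mult.commute)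
 qed
 thus ?thesis using that r(1) by blast
qed

lemma drive_shrink: "drive sg ep dl q R ==> ep' <= ep ==> drive sg ep' dl q R"
 unfolding drive_def by (auto intro: Cinf_subset)

context
 fixes K K' U Kq b dl X q sg ep R
 assumes P: "push K K' U Kq b dl X q" and R: "drive sg ep dl q R"
begin

definition moved :: "real \<times> (real^'m) => 'v" where "moved z = X (R (fst z), snd z)"

lemma RD: "Cinf R (Iv ep)" "R 0 = 0" "abs t < ep ==> abs (R t) < dl"
 "abs t < ep ==> HR R (sg / q (R t)) t"
 using R unfolding drive_def by blast+

lemma Y_open: "open (cmap K ` U)"
 by (rule chart_open_image[OF A.is_chart[OF pushD(1)[OF P]] pushD(3,5)[OF P]])

lemma Rbox: "z : Iv ep \<times> cmap K ` U ==> (R (fst z), snd z) : Iv dl \<times> cmap K ` U"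
 using RD(3)[of "fst z"] by (auto simp: abs_less_iff)

lemma moved_smooth: "Cinf moved (Iv ep \<times> cmap K ` U)"
proof -
 have o: "open (Iv ep \<times> cmap K ` U)" by (intro open_Times Y_open) simp
 have f: "fst z : Iv ep" if "z : Iv ep \<times> cmap K ` U" for z using that by auto
 have "Cinf (%z. R (fst z)) (Iv ep \<times> cmap K ` U)"
  by (rule Cinf_compose[OF RD(1) Cinf_linear[OF bounded_linear_fst o] f])
 from Cinf_compose[OF pushD(13)[OF P] Cinf_Pair[OF this Cinf_linear[OF bounded_linear_snd o]] Rbox]
 show ?thesis unfolding moved_def .
qed

lemma moved_in: "z : Iv ep \<times> cmap K ` U ==> moved z : cran K'"
 unfolding moved_def by (rule pushD(14)[OF P Rbox])

lemma moved_deriv: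
 assumes t: "abs t < ep" and p: "p : U"
 shows "FD moved (t, cmap K p) (h, u) =
  (h * sg / q (R t)) *\<^sub>R FD X (R t, cmap K p) (1, 0) + FD X (R t, cmap K p) (0, u)"
proof -
 let ?y = "cmap K p"
 have z: "(t, ?y) : Iv ep \<times> cmap K ` U" using t p by (auto simp: abs_less_iff)
 have z': "(R t, ?y) : Iv dl \<times> cmap K ` U" using Rbox[OF z] by simp
 have "HD R ((*) (sg / q (R t))) (fst (t, ?y))" using RD(4)[OF t] by (simp add: has_field_derivative_def)
 from has_derivative_compose[OF bounded_linear_imp_has_derivative[OF bounded_linear_fst] this]
 have "HD (%z. (R (fst z), snd z)) (%h. (sg / q (R t) * fst h, snd h)) (t, ?y)"
  by (intro has_derivative_Pair bounded_linear_imp_has_derivative[OF bounded_linear_snd])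
 from has_derivative_compose[OF this, of X "FD X (R t, ?y)"] Cinf_deriv[OF pushD(13)[OF P] z']
 have "HD moved (%h. FD X (R t, ?y) (sg / q (R t) * fst h, snd h)) (t, ?y)"
  unfolding moved_def by simp
 from frechet_derivative_at[OF this, symmetric]
 have "FD moved (t, ?y) (h, u) = FD X (R t, ?y) (sg / q (R t) * h, u)" by simp
 also have "(sg / q (R t) * h, u) = (h * sg / q (R t)) *\<^sub>R (1, 0) + (0, u)" by (simp add: mult.commute)
 also have "FD X (R t, ?y) ... = (h * sg / q (R t)) *\<^sub>R FD X (R t, ?y) (1, 0) + FD X (R t, ?y) (0, u)"
  using Cinf_frechet_linear[OF pushD(13)[OF P] z'] by (simp only: linear_add linear_scale)
 finally show ?thesis .
qed

context
 fixes \<Phi> :: "real \<times> 'a => 'b"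
 assumes \<Phi>: "!!t p. p : U ==> \<Phi> (t, p) = cinv K' (moved (t, cmap K p))"
begin

lemma Phi_U:
 assumes t: "abs t < ep" and p: "p : U"
 shows "\<Phi> (t, p) : cdom K'" "cmap K' (\<Phi> (t, p)) = moved (t, cmap K p)"
proof -
 have z: "(t, cmap K p) : Iv ep \<times> cmap K ` U" using t p by (auto simp: abs_less_iff)
 show "\<Phi> (t, p) : cdom K'" "cmap K' (\<Phi> (t, p)) = moved (t, cmap K p)"
  unfolding \<Phi>[OF p] by (rule B.chartD(5)[OF pushD(2)[OF P] moved_in[OF z]], rule B.chartD(4)[OF pushD(2)[OF P] moved_in[OF z]])
qed

lemma Phi_U_unmoved:
 assumes "p : U" "t = 0 \<or> p ~: Kq"
 shows "\<Phi> (t, p) = \<phi> p"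
proof -
 have p: "p : cdom K" "\<phi> p : cdom K'" using assms(1) pushD(5,6)[OF P] by auto
 have "moved (t, cmap K p) = F K K' (cmap K p)"
  using pushD(15)[OF P assms(1), of "R t"] assms(2) RD(2) by (auto simp: moved_def)
 thus ?thesis unfolding \<Phi>[OF assms(1)] using A.chartD(3)[OF pushD(1)[OF P] p(1)] B.chartD(3)[OF pushD(2)[OF P] p(2)] by simp
qed

lemma Phi_U_local:
 assumes t: "abs t < ep" and p: "p : U"
 shows "EX K0:A. EX K0':B. EX N f V. open N & (t, p) : N & N <= UNIV \<times> cdom K0 &
  Cinf f V & f ` V <= cran K0' & (ALL s q. (s, q) : N --> (s, cmap K0 q) : V & \<Phi> (s, q) = cinv K0' (f (s, cmap K0 q)))"
proof (rule bexI[OF _ pushD(1)[OF P]], rule bexI[OF _ pushD(2)[OF P]], rule exI[of _ "Iv ep \<times> U"], rule exI[of _ moved],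
  rule exI[of _ "Iv ep \<times> cmap K ` U"], intro conjI)
 show "open (Iv ep \<times> U)" by (intro open_Times pushD(3)[OF P]) simp
 show "(t, p) : Iv ep \<times> U" using t p by (auto simp: abs_less_iff)
 show "Iv ep \<times> U <= UNIV \<times> cdom K" using pushD(5)[OF P] by auto
 show "moved ` (Iv ep \<times> cmap K ` U) <= cran K'" using moved_in by blast
qed (use moved_smooth \<Phi> in auto)

context
 assumes var: "variation A B \<phi> D ep \<Phi>"
begin

interpretation V: form_vari A B gb \<phi> D ep \<Phi> \<Omega> by unfold_locales (rule var form)+

lemma move_patch:
 assumes t: "abs t < ep" and p: "p : U"
 obtains r where "V.patch t p K K' r moved"
proof -
 let ?S = "Iv ep \<times> cmap K ` U"
 have o: "open ?S" by (intro open_Times Y_open) simp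
 have "(t, cmap K p) : ?S" using t p by (auto simp: abs_less_iff)
 have t': "t : Iv ep" using t by (auto simp: abs_less_iff)
 obtain a where a: "a > 0" "ball t a <= Iv ep"
  using open_contains_ball[THEN iffD1, OF open_greaterThanLessThan, rule_format, OF t'] by blast
 obtain c where c: "c > 0" "ball (cmap K p) c <= cmap K ` U"
  using open_contains_ball[of "cmap K ` U"] Y_open p by blast
 define r where "r = min a c"
 have r: "r > 0" "ball t r <= Iv ep" "ball (cmap K p) r <= cmap K ` U" using a c by (auto simp: r_def subset_iff)
 hence b: "ball t r \<times> ball (cmap K p) r <= ?S" by auto
 have inj: "s : U" if "s : cdom K" "cmap K s : cmap K ` U" for s
  using that inj_onD[OF A.chartD(8)[OF pushD(1)[OF P]], of s] pushD(5)[OF P] by auto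
 have "V.patch t p K K' r moved"
  unfolding V.patch_def
 proof (intro conjI ballI impI)
  show "Cinf moved (ball t r \<times> ball (cmap K p) r)"
   by (rule Cinf_subset[OF moved_smooth _ b]) (intro open_Times open_ball)
  show "moved z : cran K'" if "z : ball t r \<times> ball (cmap K p) r" for z using moved_in b that by blast
  show "ball (cmap K p) r <= cran K" using r(3) pushD(5)[OF P] by blast
  fix s x assume s: "s : ball t r" and x: "x : D Int cdom K" "cmap K x : ball (cmap K p) r"
  have xU: "x : U" by (rule inj) (use x r(3) in blast)+
  have s': "abs s < ep" using r(2) s by (auto simp: subset_iff abs_less_iff)
  show "\<Phi> (s, x) : cdom K'" "cmap K' (\<Phi> (s, x)) = moved (s, cmap K x)" by (rule Phi_U[OF s' xU])+
 qed (use pushD(1,2,5)[OF P] p r in auto)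
 thus ?thesis by (rule that)
qed

lemma move_theta:
 assumes t: "abs t < ep" and p: "p : U"
 shows "V.th (t, p) * rho K (cmap K p) = sg / q (R t) * coef K' X (R t, cmap K p)"
proof -
 obtain r where pt: "V.patch t p K K' r moved" by (rule move_patch[OF t p])
 have pp: "p : iD" "p : cdom K" using p pushD(4,5)[OF P] by auto
 have r: "r > 0" by (rule V.patchD(3)[OF pt])
 have z: "(t, cmap K p) : Iv ep \<times> cmap K ` U" using t p by (auto simp: abs_less_iff)
 have d: "FD moved (t, cmap K p) (1, 0) = (sg / q (R t)) *\<^sub>R FD X (R t, cmap K p) (1, 0)"
  "FD moved (t, cmap K p) (0, u) = FD X (R t, cmap K p) (0, u)" for u
  using moved_deriv[OF t p, of 1 0] moved_deriv[OF t p, of 0 u]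
   linear_0[OF Cinf_frechet_linear[OF pushD(13)[OF P] Rbox[OF z]]] by (simp_all add: zero_prod_def)
 have "V.th (t, p) * rho K (cmap K p) = form_in_chart B \<Omega> K' (moved (t, cmap K p)) (case_option (FD moved (t, cmap K p) (1, 0))
   (%i. FD moved (t, cmap K p) (0, ax i)))"
  by (rule V.form_patch[OF pt _ pp]) (use r in simp_all)
 also have "... = sg / q (R t) * coef K' X (R t, cmap K p)"
  unfolding d form_in_chart_scale[OF pushD(2)[OF P] moved_in[OF z]] coef_def by (simp add: moved_def)
 finally show ?thesis .
qed

text \<open>The coefficient of the driven push is \<open>sg / q (R t)\<close> times that of the push
  at displacement \<open>R t\<close>, and the latter integrates to \<open>q (R t)\<close>. The rates
  cancel exactly for every \<open>t\<close>, which gives volume preservation beyond first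
  order.\<close>

lemma move_flux:
 assumes t: "abs t < ep"
 shows "(LINT p|mu. ind U p * V.th (t, p)) = sg"
proof -
 have U: "U : sets borel" "U <= cdom K" "U <= D" "U <= iD" using pushD(3,4,5)[OF P] interior_subset by auto
 have "(%p. ind U p * (ind iD p * V.th (t, p))) : bm"
  by (intro borel_measurable_times smooth_scalar_slice[OF V.theta_smooth_scalar t] borel_measurable_indicator U)
 moreover have "ind U p * (ind iD p * V.th (t, p)) = ind U p * V.th (t, p)" for p
  using U(4) by (auto simp: indicator_def)
 ultimately have m: "(%p. ind U p * V.th (t, p)) : bm" by simp
 have "(LINT p|mu. ind U p * V.th (t, p)) = (LINT y|lborel. ind (cmap K ` U) y * (rho K y * (ind U (cinv K y) * V.th (t, cinv K y))))"
  by (rule mu_integral_chart[OF pushD(1)[OF P] m U(1,2,3)]) simp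
 also have "... = (LINT y|lborel. sg / q (R t) * (ind (cmap K ` U) y * coef K' X (R t, y)))"
 proof (rule Bochner_Integration.integral_cong[OF refl])
  fix y
  show "ind (cmap K ` U) y * (rho K y * (ind U (cinv K y) * V.th (t, cinv K y))) = sg / q (R t) * (ind (cmap K ` U) y * coef K' X (R t, y))"
  proof (cases "y : cmap K ` U")
   case True
   then obtain p where p: "p : U" "y = cmap K p" by blast
   have "cinv K y = p" unfolding p(2) using A.chartD(3)[OF pushD(1)[OF P]] p(1) U(2) by blast
   thus ?thesis using True p(1) move_theta[OF t p(1)] unfolding p(2) by (simp add: mult.commute)
  qed simp
 qed
 also have "... = sg / q (R t) * q (R t)"
  unfolding pushD(19)[OF P RD(3)[OF t]] by simp
 also have "... = sg" using pushD(18)[OF P RD(3)[OF t]] by simp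
 finally show ?thesis .
qed

lemma move_velocity:
 assumes p: "p : U"
 shows "vector_variation B \<Phi> p = (sg / q 0 * b p) *\<^sub>R \<nu> p"
proof -
 have e: "abs (0::real) < ep" using V.eps_pos by simp
 obtain r where pt: "V.patch 0 p K K' r moved" by (rule move_patch[OF e p])
 have pp: "p : iD" "p : cdom K" "p : D" "\<phi> p : cdom K'" using p pushD(4,5,6)[OF P] interior_subset[of D] by auto
 have r: "r > 0" by (rule V.patchD(3)[OF pt])
 have z: "(R 0, cmap K p) : Iv dl \<times> cmap K ` U" using pushD(12)[OF P] RD(2) p by auto
 have d: "FD moved (0, cmap K p) (1, 0) = (sg / q 0) *\<^sub>R (b p *\<^sub>R to_chart B K' (\<phi> p) (\<nu> p))"
  using moved_deriv[OF e p, of 1 0] linear_0[OF Cinf_frechet_linear[OF pushD(13)[OF P] z]] RD(2)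
   pushD(16)[OF P _ p, of 0] pushD(12)[OF P] by (simp add: zero_prod_def)
 have "vector_variation B \<Phi> p = from_chart B K' (\<Phi> (0, p)) (FD moved (0, cmap K p) (1, 0))"
  unfolding V.velocity_0[symmetric] by (rule V.velocity_patch_eq[OF pt _ pp(1,2)]) (use r in simp_all)
 also have "... = (sg / q 0 * b p) *\<^sub>R \<nu> p"
  unfolding d V.Phi_0[OF pp(3)] linear_scale[OF B.from_chart_linear[OF pushD(2)[OF P] pp(4)]] B.from_to_chart[OF pushD(2)[OF P] pp(4)] by simp
 finally show ?thesis .
qed

end

end

end

end

section \<open>A volume preserving variation that changes the area to first order\<close>

context calibrated
begin

text \<open>The immersion is pushed along \<open>\<nu>\<close> where \<open>mcn > c\<close> and
  against it where \<open>mcn < c\<close>, with fluxes \<open>1\<close> and \<open>-1\<close>. The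
  normal speed \<open>f\<close> has mean zero, so \<open>A'(0)\<close> is \<open>-m\<close> times
  the integral of \<open>(mcn - c) f\<close>, which is nonnegative everywhere and positive on an
  open set.\<close>

lemma nonconstant_not_critical:
 assumes nc: "~ (ALL p:D. mcn p = h_mean A B gb \<phi> D)"
 obtains ep \<Phi> where "variation A B \<phi> D ep \<Phi>" "fixes_boundary \<phi> D ep \<Phi>" "volume_preserving A B \<Omega> D ep \<Phi>"
  "vector_variation B \<Phi> : F_normal A B gb \<phi> D \<nu>" "~ HR (area_D A B gb D \<Phi>) 0 0"
proof -
 obtain p1 p2 where p: "p1 : iD" "p2 : iD" "mcn p2 < mcn p1"
  by (rule mean_curvature_separation[OF nc])
 define c where "c = (mcn p1 + mcn p2) / 2"
 have c: "mcn p2 < c" "c < mcn p1" using p(3) by (simp_all add: c_def field_simps)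
 have "p1 ~= p2" using p(3) by auto
 from hausdorff[OF this] obtain G1 G2 where G: "open G1" "open G2" "p1 : G1" "p2 : G2" "G1 Int G2 = {}" by blast
 have mc': "continuous_on iD mcn" by (rule continuous_on_subset[OF mcn_continuous interior_subset])
 have o1: "open (G1 Int (interior D Int mcn -` {c<..}))" and o2: "open (G2 Int (interior D Int mcn -` {..<c}))"
  by (intro open_Int G continuous_open_preimage[OF mc' open_interior] open_greaterThan open_lessThan)+
 obtain K1 K1' U1 Kq1 b1 dl1 X1 q1 N1 where P1: "push K1 K1' U1 Kq1 b1 dl1 X1 q1"
  and U1: "U1 <= G1 Int (interior D Int mcn -` {c<..})" and N1: "open N1" "p1 : N1" "N1 <= U1" "ALL p:N1. b1 p = 1"
  by (rule push_exists[OF p(1) o1]) (use G p c in auto)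
 obtain K2 K2' U2 Kq2 b2 dl2 X2 q2 N2 where P2: "push K2 K2' U2 Kq2 b2 dl2 X2 q2"
  and U2: "U2 <= G2 Int (interior D Int mcn -` {..<c})" and N2: "open N2" "p2 : N2" "N2 <= U2" "ALL p:N2. b2 p = 1"
  by (rule push_exists[OF p(2) o2]) (use G p c in auto)
 have disj: "p ~: U2" if "p : U1" for p using that U1 U2 G(5) by blast
 obtain ep1 R1 where R1': "ep1 > 0" "drive 1 ep1 dl1 q1 R1" by (rule drive_exists[OF P1, of 1]) auto
 obtain ep2 R2 where R2': "ep2 > 0" "drive (- 1) ep2 dl2 q2 R2" by (rule drive_exists[OF P2, of "- 1"]) auto
 define ep where "ep = min ep1 ep2"
 have eps: "ep > 0" using R1' R2' by (simp add: ep_def)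
 have R1: "drive 1 ep dl1 q1 R1" by (rule drive_shrink[OF R1'(2)]) (simp add: ep_def)
 have R2: "drive (- 1) ep dl2 q2 R2" by (rule drive_shrink[OF R2'(2)]) (simp add: ep_def)
 define \<Phi> where "\<Phi> z = (if snd z : U1 then cinv K1' (moved X1 R1 (fst z, cmap K1 (snd z)))
  else if snd z : U2 then cinv K2' (moved X2 R2 (fst z, cmap K2 (snd z))) else \<phi> (snd z))" for z
 have \<Phi>1: "\<Phi> (t, p) = cinv K1' (moved X1 R1 (t, cmap K1 p))" if "p : U1" for t p using that by (simp add: \<Phi>_def)
 have \<Phi>2: "\<Phi> (t, p) = cinv K2' (moved X2 R2 (t, cmap K2 p))" if "p : U2" for t p using that disj by (auto simp: \<Phi>_def)
 have unmoved: "\<Phi> (t, p) = \<phi> p" if "t = 0 \<or> p ~: Kq1 & p ~: Kq2" for t p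
 proof -
  consider "p : U1" | "p : U2" | "p ~: U1" "p ~: U2" by blast
  thus ?thesis
  proof cases
   case 1 show ?thesis by (rule Phi_U_unmoved[OF P1 R1 \<Phi>1 1]) (use that in auto)
  next
   case 2 show ?thesis by (rule Phi_U_unmoved[OF P2 R2 \<Phi>2 2]) (use that in auto)
  qed (simp add: \<Phi>_def)
 qed
 have var: "variation A B \<phi> D ep \<Phi>"
  unfolding variation_def
 proof (intro conjI ballI)
  show "smooth_map_on (prod_atlas A) B (Iv ep \<times> D) \<Phi>"
  proof (rule smooth_map_on_prodI)
   fix t p assume "(t, p) : Iv ep \<times> D"
   hence t: "abs t < ep" by auto
   show "EX K0:A. EX K0':B. EX N f V. open N & (t, p) : N & N <= UNIV \<times> cdom K0 &
    Cinf f V & f ` V <= cran K0' & (ALL s q. (s, q) : N --> (s, cmap K0 q) : V & \<Phi> (s, q) = cinv K0' (f (s, cmap K0 q)))"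
   proof (cases "p : U1 \<or> p : U2")
    case True
    thus ?thesis using Phi_U_local[OF P1 R1 \<Phi>1 t] Phi_U_local[OF P2 R2 \<Phi>2 t] by (elim disjE)
   next
    case False
    let ?k = "chart_at A p" and ?k' = "chart_at B (\<phi> p)"
    have k: "?k : A" "?k' : B" "p : cdom ?k" "\<phi> p : cdom ?k'" by (simp_all add: A.chart_at B.chart_at)
    \<comment> \<open>Off the closed supports nothing moves, so here the immersion itself, constant
      in time, is the representative. The neighbourhood may still meet \<open>U1\<close> or
      \<open>U2\<close>, where \<open>unmoved\<close> covers the points outside the
      supports.\<close>
    let ?N = "UNIV \<times> ((cdom ?k Int \<phi> -` cdom ?k') Int (- Kq1 Int - Kq2))"
    have oN: "open ?N"
     by (intro open_Times open_Int open_UNIV A.chartD(1) k open_vimage[OF B.chartD(1) phi_continuous] open_Compl pushD(7)[OF P1] pushD(7)[OF P2])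
    have oV: "open (UNIV \<times> rdom ?k ?k')" by (intro open_Times open_UNIV Cinf_open[OF F_smooth[OF k(1,2)]])
    have sV: "snd z : rdom ?k ?k'" if "z : UNIV \<times> rdom ?k ?k'" for z :: "real \<times> (real^'m)"
     using that by (simp only: mem_Times_iff)
    have f: "Cinf (%z. F ?k ?k' (snd z)) ((UNIV :: real set) \<times> rdom ?k ?k')"
     by (rule Cinf_compose[OF F_smooth[OF k(1,2)] Cinf_linear[OF bounded_linear_snd oV] sV])
    have Fq: "F ?k ?k' (cmap ?k q) = cmap ?k' (\<phi> q)" if "q : cdom ?k" for q using A.chartD(3)[OF k(1) that] by simp
    show ?thesis
    proof (rule bexI[OF _ k(1)], rule bexI[OF _ k(2)], rule exI[of _ ?N], rule exI[of _ "%z. F ?k ?k' (snd z)"],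
      rule exI[of _ "UNIV \<times> rdom ?k ?k'"], intro conjI oN f)
     show "(t, p) : ?N" using k False pushD(8)[OF P1] pushD(8)[OF P2] by auto
     show "?N <= UNIV \<times> cdom ?k" by auto
     show "(%z. F ?k ?k' (snd z)) ` ((UNIV :: real set) \<times> rdom ?k ?k') <= cran ?k'"
     proof
      fix y assume "y : (%z. F ?k ?k' (snd z)) ` ((UNIV :: real set) \<times> rdom ?k ?k')"
      then obtain q where "q : cdom ?k" "\<phi> q : cdom ?k'" "y = F ?k ?k' (cmap ?k q)" by auto
      thus "y : cran ?k'" using Fq by simp
     qed
     show "ALL s q. (s, q) : ?N --> (s, cmap ?k q) : UNIV \<times> rdom ?k ?k' & \<Phi> (s, q) = cinv ?k' (F ?k ?k' (snd (s, cmap ?k q)))"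
     proof (intro allI impI conjI)
      fix s :: real and q assume "(s, q) : ?N"
      hence q: "q : cdom ?k" "\<phi> q : cdom ?k'" "q ~: Kq1" "q ~: Kq2" by auto
      show "(s, cmap ?k q) : UNIV \<times> rdom ?k ?k'" using q by blast
      show "\<Phi> (s, q) = cinv ?k' (F ?k ?k' (snd (s, cmap ?k q)))"
       unfolding snd_conv Fq[OF q(1)] B.chartD(3)[OF k(2) q(2)] using unmoved[of s q] q by simp
     qed
    qed
   qed
  qed
 qed (use eps unmoved in auto)
 have Kq: "Kq1 <= iD" "Kq2 <= iD" using pushD(4,8)[OF P1] pushD(4,8)[OF P2] by auto
 have bd: "fixes_boundary \<phi> D ep \<Phi>"
  unfolding fixes_boundary_def
 proof (intro ballI)
  fix t p assume "p : frontier D"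
  hence "p ~: Kq1" "p ~: Kq2" using Kq D_split(2) by auto
  thus "\<Phi> (t, p) = \<phi> p" using unmoved by simp
 qed
 interpret V: form_vari A B gb \<phi> D ep \<Phi> \<Omega> by unfold_locales (rule var form)+
 have still: "((%s. cmap (chart_at B (\<Phi> (t, p))) (\<Phi> (s, p))) has_vector_derivative 0) (at t)" if "p ~: U1" "p ~: U2" for t p
 proof -
  have "\<Phi> (s, p) = \<phi> p" for s using unmoved that pushD(8)[OF P1] pushD(8)[OF P2] by blast
  thus ?thesis by simp
 qed
 have th0: "V.th (t, p) = 0" if "p ~: U1" "p ~: U2" for t p
 proof -
  have v: "V.velocity t p = 0" unfolding V.velocity_def by (rule vector_derivative_at[OF still[OF that]])
  have e: "case_option (0::'v) u = (case_option 0 u)(None := 0)" for u by (auto split: option.split)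
  have "linear (%w. \<Omega> (\<Phi> (t, p)) ((case_option 0 u)(None := w)))" for u
   using V.alternating unfolding alternating_multilinear_def by blast
  from linear_0[OF this] have "\<Omega> (\<Phi> (t, p)) (case_option 0 u) = 0" for u unfolding e[symmetric] .
  thus ?thesis unfolding V.th_def fst_conv snd_conv v by simp
 qed
 have U: "U1 : sets borel" "U2 : sets borel" "U1 <= iD" "U2 <= iD"
  using pushD(3,4)[OF P1] pushD(3,4)[OF P2] by auto
 have flux: "V.Ith t = 0" if t: "abs t < ep" for t
 proof -
  let ?h = "%p. ind iD p * V.th (t, p)"
  have i: "integrable mu (%p. ind S p * V.th (t, p))" if S: "S : sets borel" "S <= iD" for S
  proof -
   have "integrable mu (%p. ind S p *\<^sub>R ?h p)"
    by (rule integrable_mult_indicator[OF _ V.theta_integrable[OF t]]) (use S sets_mu in auto)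
   moreover have e: "ind S p *\<^sub>R ?h p = ind S p * V.th (t, p)" for p using S(2) by (auto simp: indicator_def)
   ultimately show ?thesis unfolding e by blast
  qed
  have "?h p = ind U1 p * V.th (t, p) + ind U2 p * V.th (t, p)" for p
   using th0[of p t] disj[of p] U(3,4) by (auto simp: indicator_def)
  hence "V.Ith t = (LINT p|mu. ind U1 p * V.th (t, p) + ind U2 p * V.th (t, p))" unfolding V.Ith_def by simp
  also have "... = (LINT p|mu. ind U1 p * V.th (t, p)) + (LINT p|mu. ind U2 p * V.th (t, p))"
   by (rule Bochner_Integration.integral_add[OF i i]) (rule U)+
  also have "... = 0" using move_flux[OF P1 R1 \<Phi>1 var t] move_flux[OF P2 R2 \<Phi>2 var t] by simp
  finally show ?thesis .
 qed
 have vp: "volume_preserving A B \<Omega> D ep \<Phi>"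
  unfolding volume_preserving_def using V.volume_eq_0[OF flux] by (auto simp: abs_less_iff)
 define a1 where "a1 = 1 / q1 0"
 define a2 where "a2 = 1 / q2 0"
 have a: "a1 > 0" "a2 > 0" using pushD(18)[OF P1, of 0] pushD(18)[OF P2, of 0] pushD(12)[OF P1] pushD(12)[OF P2] by (simp_all add: a1_def a2_def)
 define f where "f p = a1 * b1 p + - a2 * b2 p" for p
 let ?W = "vector_variation B \<Phi>"
 have b0: "b1 p = 0" if "p ~: U1" for p using pushD(8,11)[OF P1] that by blast
 have b0': "b2 p = 0" if "p ~: U2" for p using pushD(8,11)[OF P2] that by blast
 have Wf: "?W p = f p *\<^sub>R \<nu> p" for p
 proof -
  consider "p : U1" | "p : U2" | "p ~: U1" "p ~: U2" by blast
  thus ?thesis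
  proof cases
   case 1
   thus ?thesis using move_velocity[OF P1 R1 \<Phi>1 var 1] b0' disj by (simp add: f_def a1_def)
  next
   case 2
   hence "b1 p = 0" using b0 disj by blast
   thus ?thesis using move_velocity[OF P2 R2 \<Phi>2 var 2] by (simp add: f_def a2_def)
  next
   case 3
   have "?W p = 0" unfolding vector_variation_def by (rule vector_derivative_at[OF still[OF 3]])
   thus ?thesis using b0[OF 3(1)] b0'[OF 3(2)] by (simp add: f_def)
  qed
 qed
 have f_off: "f p = 0" if "p ~: iD" for p
 proof -
  have "p ~: U1" "p ~: U2" using U(3,4) that by auto
  thus ?thesis using b0 b0' by (simp add: f_def)
 qed
 note d = variation_derivatives[OF var bd]
 have gf: "gb (\<phi> p) (?W p) (\<nu> p) = f p" if "p : iD" for p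
 proof -
  have "p : D" using that interior_subset by auto
  thus ?thesis unfolding Wf bilinear_lmul[OF inner_formD(1)[OF RB.metric_inner_form]] nu(2)[OF \<open>p : D\<close>] by simp
 qed
 have e1: "ind iD p * gb (\<phi> p) (?W p) (\<nu> p) = f p" for p
  using gf f_off by (auto simp: indicator_def)
 have e2: "ind iD p * (mcn p * gb (\<phi> p) (?W p) (\<nu> p)) = mcn p * f p" for p
  using gf f_off by (auto simp: indicator_def)
 have fi: "integrable mu f" "integrable mu (%p. mcn p * f p)" using d(1,3) unfolding e1 e2 by auto
 \<comment> \<open>The mean of \<open>f\<close> is the derivative at 0 of the swept volume, which
   vanishes identically.\<close>
 have int0: "(LINT p|mu. f p) = 0"
 proof -
  have "HR (volume_D A B \<Omega> D ep \<Phi>) 0 0"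
  proof (rule has_field_derivative_transform_within_open[OF DERIV_const[of 0], where S="Iv ep"])
   show "0 = volume_D A B \<Omega> D ep \<Phi> t" if "t : Iv ep" for t
    using vp that unfolding volume_preserving_def by simp
  qed (use eps in auto)
  with d(4) show ?thesis unfolding e1 by (rule DERIV_unique)
 qed
 have sf: "A.sfun f" unfolding f_def
 proof (rule A.sfun_add)
  have const: "A.sfun (%p. r)" for r by (rule A.sfunI, rule Cinf_const, rule A.chartD(2))
  show "A.sfun (%p. a1 * b1 p)" "A.sfun (%p. - a2 * b2 p)"
   by (rule A.sfun_mult[OF const pushD(9)[OF P1]], rule A.sfun_mult[OF const pushD(9)[OF P2]])
 qed
 have "f : F_D A B gb \<phi> D"
  unfolding F_D_def mem_Collect_eq
 proof (intro conjI ballI)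
  show "smooth_fun_on A D f"
   unfolding smooth_fun_on_def
  proof
   fix K assume k: "K : A"
   have "Cinf (f o cinv K) (cran K)" using A.sfunD[OF sf k] by (simp add: o_def)
   with A.chartD(2)[OF k] have "smooth_on (f o cinv K) (cran K)" by (rule smooth_on_open_iff[THEN iffD2])
   thus "smooth_on (f o cinv K) (cmap K ` (D Int cdom K))" by (rule smooth_on_subset) auto
  qed
  show "f p = 0" if "p : frontier D" for p using f_off D_split(2) that by blast
  have e: "ind D p *\<^sub>R f p = f p" for p using f_off[of p] interior_subset[of D] by (auto simp: indicator_def)
  show "(LINT p:D|dM A B gb \<phi> D. f p) = 0" unfolding set_lebesgue_integral_def mu_def[symmetric] e by (rule int0)
 qed
 moreover have "smooth_field_along A B D \<phi> (%_. 0)"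
  unfolding smooth_field_along_def
 proof (intro ballI)
  fix K K' assume k: "K : A" "K' : B"
  show "smooth_on (%y. to_chart B K' (\<phi> (cinv K y)) 0) (cmap K ` (D Int cdom K Int \<phi> -` cdom K'))"
  proof (rule smooth_onI)
   fix y
   have "to_chart B K' (\<phi> (cinv K z)) 0 = 0" if "z : cmap K ` (D Int cdom K Int \<phi> -` cdom K')" for z
    using that A.chartD(3)[OF k(1)] linear_0[OF B.to_chart_linear[OF k(2)]] by auto
   thus "EX U F. Cinf F U & y : U & (ALL z:U Int cmap K ` (D Int cdom K Int \<phi> -` cdom K'). F z = to_chart B K' (\<phi> (cinv K z)) 0)"
    by (intro exI[of _ UNIV] exI[of _ "%_. 0"]) (simp add: Cinf_const)
  qed
 qed
 moreover have "gb (\<phi> p) 0 (\<nu> p) = 0" for p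
  by (rule bilinear_lzero[OF inner_formD(1)[OF RB.metric_inner_form]])
 ultimately have "?W : F_bar A B gb \<phi> D \<nu>"
  unfolding F_bar_def mem_Collect_eq using Wf by (intro bexI[of _ f] exI[of _ "%_. 0"]) auto
 moreover have "normal_at A B gb \<phi> p (?W p)" if "p : D" for p
  using nu(1)[OF that] unfolding normal_at_def Wf bilinear_lmul[OF inner_formD(1)[OF RB.metric_inner_form]] by simp
 ultimately have Wn: "?W : F_normal A B gb \<phi> D \<nu>" unfolding F_normal_def by blast
 have "~ HR (area_D A B gb D \<Phi>) 0 0"
 proof
  assume 0: "HR (area_D A B gb D \<Phi>) 0 0"
  have "(LINT p|mu. mcn p * f p) = 0" using DERIV_unique[OF d(2) 0] unfolding e2 by simp
  \<comment> \<open>Subtracting \<open>c f\<close>, whose integral is 0, turns the integrand into a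
    nonnegative one, hence 0 almost everywhere. On the open set \<open>N1\<close>, where the bump is
    1, it is positive, and \<open>N1\<close> has positive measure.\<close>
  hence z: "(LINT p|mu. mcn p * f p - c * f p) = 0" using fi int0 by simp
  have nn: "mcn p * f p - c * f p >= 0" for p
  proof -
   have "(mcn p - c) * f p >= 0"
   proof -
    consider "p : U1" | "p : U2" | "p ~: U1" "p ~: U2" by blast
    thus ?thesis
    proof cases
     case 1
     hence "mcn p - c >= 0" "f p >= 0" using U1 b0' disj a(1) pushD(10)[OF P1, of p] by (auto simp: f_def)
     thus ?thesis by simp
    next
     case 2
     hence "b1 p = 0" using b0 disj by blast
     hence "mcn p - c <= 0" "f p <= 0" using 2 U2 a(2) pushD(10)[OF P2, of p] by (auto simp: f_def)
     thus ?thesis by (rule mult_nonpos_nonpos)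
    next
     case 3
     thus ?thesis using b0 b0' by (simp add: f_def)
    qed
   qed
   thus ?thesis by (simp add: algebra_simps)
  qed
  have "integrable mu (%p. mcn p * f p - c * f p)" using fi by simp
  hence "AE p in mu. mcn p * f p - c * f p = 0"
   using integral_nonneg_eq_0_iff_AE[of mu "%p. mcn p * f p - c * f p"] nn z by simp
  hence "AE p in mu. p ~: N1"
  proof (rule AE_mp, intro AE_I2 impI notI)
   fix p assume e: "mcn p * f p - c * f p = 0" and pN: "p : N1"
   hence "p : U1" using N1(3) by auto
   hence "mcn p > c" "f p = a1" using U1 N1(4) pN b0' disj by (auto simp: f_def)
   thus False using e a(1) by simp
  qed
  hence "emeasure mu N1 = 0" using N1(1) sets_mu AE_iff_null_sets[of N1 mu] by (simp add: null_sets_def)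
  moreover have "emeasure mu N1 > 0"
   by (rule open_mu_pos[OF N1(1)]) (use N1 U interior_subset[of D] in auto)
  ultimately show False by simp
 qed
 thus ?thesis using that[OF var bd vp Wn] by blast
qed

end

theorem theorem2p1:
  fixes A :: "('a::{t2_space, second_countable_topology}, real^'m) chart set"
    and B :: "('b::{t2_space, second_countable_topology}, real^('m + 'n::finite)) chart set"
    and gb :: "('b, real^('m + 'n)) metric"
    and \<Omega> :: "('b, real^('m + 'n), 'm option) form"
    and \<phi> :: "'a \<Rightarrow> 'b"
    and D :: "'a set"
    and \<nu> :: "'a \<Rightarrow> real^('m + 'n)"
  assumes "smooth_atlas B" and "riemannian_metric B gb" and "pre_calibration B gb \<Omega>"
    and "oriented_atlas A" and "immersion A B \<phi>"
    and "smooth_compact_domain A D"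
    and "calibrated_extended_tangent_space A B gb \<Omega> \<phi> D \<nu>"
  defines "S1 \<equiv> (\<forall>p\<in>D. mean_curvature_norm A B gb \<phi> p = h_mean A B gb \<phi> D)"
    and "S2 \<equiv> (\<forall>\<epsilon> \<Phi>. variation A B \<phi> D \<epsilon> \<Phi> \<and> fixes_boundary \<phi> D \<epsilon> \<Phi> \<and>
            volume_preserving A B \<Omega> D \<epsilon> \<Phi> \<longrightarrow>
            (area_D A B gb D \<Phi> has_real_derivative 0) (at 0))"
    and "S3 \<equiv> (\<forall>\<epsilon> \<Phi>. variation A B \<phi> D \<epsilon> \<Phi> \<and> fixes_boundary \<phi> D \<epsilon> \<Phi> \<longrightarrow>
            (J_D A B gb \<Omega> \<phi> D \<epsilon> \<Phi> has_real_derivative 0) (at 0))"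
    and "S2_bar \<equiv> (\<forall>\<epsilon> \<Phi>. variation A B \<phi> D \<epsilon> \<Phi> \<and> fixes_boundary \<phi> D \<epsilon> \<Phi> \<and>
            volume_preserving A B \<Omega> D \<epsilon> \<Phi> \<and> vector_variation B \<Phi> \<in> F_bar A B gb \<phi> D \<nu> \<longrightarrow>
            (area_D A B gb D \<Phi> has_real_derivative 0) (at 0))"
    and "S2_normal \<equiv> (\<forall>\<epsilon> \<Phi>. variation A B \<phi> D \<epsilon> \<Phi> \<and> fixes_boundary \<phi> D \<epsilon> \<Phi> \<and>
            volume_preserving A B \<Omega> D \<epsilon> \<Phi> \<and> vector_variation B \<Phi> \<in> F_normal A B gb \<phi> D \<nu> \<longrightarrow>
            (area_D A B gb D \<Phi> has_real_derivative 0) (at 0))"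
    and "S3_bar \<equiv> (\<forall>\<epsilon> \<Phi>. variation A B \<phi> D \<epsilon> \<Phi> \<and> fixes_boundary \<phi> D \<epsilon> \<Phi> \<and>
            vector_variation B \<Phi> \<in> F_bar A B gb \<phi> D \<nu> \<longrightarrow>
            (J_D A B gb \<Omega> \<phi> D \<epsilon> \<Phi> has_real_derivative 0) (at 0))"
    and "S3_normal \<equiv> (\<forall>\<epsilon> \<Phi>. variation A B \<phi> D \<epsilon> \<Phi> \<and> fixes_boundary \<phi> D \<epsilon> \<Phi> \<and>
            vector_variation B \<Phi> \<in> F_normal A B gb \<phi> D \<nu> \<longrightarrow>
            (J_D A B gb \<Omega> \<phi> D \<epsilon> \<Phi> has_real_derivative 0) (at 0))"
  shows "(S1 \<longleftrightarrow> S2) \<and> (S1 \<longleftrightarrow> S3) \<and> (S1 \<longleftrightarrow> S2_bar) \<and> (S1 \<longleftrightarrow> S2_normal) \<and>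
         (S1 \<longleftrightarrow> S3_bar) \<and> (S1 \<longleftrightarrow> S3_normal)"
proof -
  interpret calibrated A B gb \<phi> D \<Omega> \<nu>
    by unfold_locales (use assms(1-7) in \<open>simp_all add: oriented_atlas_def\<close>)
  have 1: "S1 \<Longrightarrow> S3" unfolding S1_def S3_def using constant_imp_critical by blast
  have 2: "S3 \<Longrightarrow> S3_bar" "S2 \<Longrightarrow> S2_bar" unfolding S3_def S3_bar_def S2_def S2_bar_def by blast+
  have 3: "S3_bar \<Longrightarrow> S3_normal" "S2_bar \<Longrightarrow> S2_normal"
    unfolding S3_bar_def S3_normal_def S2_bar_def S2_normal_def F_normal_def by blast+
  have 4: "S3 \<Longrightarrow> S2" "S3_normal \<Longrightarrow> S2_normal"
    unfolding S3_def S2_def S3_normal_def S2_normal_def using volume_preserving_J by blast+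
  \<comment> \<open>\<open>S2_normal\<close> follows from each of the other statements, so it is the
    one from which \<open>S1\<close> is recovered; this closes all six equivalences.\<close>
  have 5: "S1" if s: "S2_normal"
  proof (rule ccontr)
    assume "\<not> S1"
    then have "\<not> (\<forall>p\<in>D. mcn p = h_mean A B gb \<phi> D)" unfolding S1_def .
    then obtain \<epsilon> \<Phi> where "variation A B \<phi> D \<epsilon> \<Phi>" "fixes_boundary \<phi> D \<epsilon> \<Phi>" "volume_preserving A B \<Omega> D \<epsilon> \<Phi>"
      "vector_variation B \<Phi> \<in> F_normal A B gb \<phi> D \<nu>" "\<not> (area_D A B gb D \<Phi> has_real_derivative 0) (at 0)"
      by (rule nonconstant_not_critical)
    then show False using s unfolding S2_normal_def by blast
  qed
  show ?thesis using 1 2 3 4 5 by blast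
qed

end
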